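(* In the two-stage adaptive experiment described in the context, suppose the moment conditions and the sampling design conditions hold. Let $c_N=\sqrt N(\mathbb E[Y_{uN}(0)]-\mathbb E[Y_{uN}(1)])$ and $c=\lim_{N\to\infty}c_N\in[-\infty,0]$. As $N\to\infty$: (1) Under the constant weighting regime, $\sqrt N(\mathrm{WIPW}(s)-\mathbb E[Y_{uN}(s)])$ converges weakly to $\bar{\mathbb W}_{\mathcal C}(s)$ for each $s\in\{0,1\}$. Moreover, $\sqrt N\,T_N-c_N$ converges weakly to $\mathbb W_{\mathcal U}^{\mathcal C}(c)$ and $W_N-c_N/\hat S_N$ converges weakly to $\mathbb W_{\mathcal N}^{\mathcal C}(c)$. (2) Under the adaptive weighting regime, $\sqrt N(\mathrm{WIPW}(s)-\mathbb E[Y_{uN}(s)])$ converges weakly to $\bar{\mathbb W}_{\mathcal A}(s)$ for each $s\in\{0,1\}$. Moreover, $\sqrt N\,T_N-c_N$ converges weakly to $\mathbb W_{\mathcal U}^{\mathcal A}(c)$ and $W_N-c_N/\hat S_N$ converges weakly to $\mathbb W_{\mathcal N}^{\mathcal A}(c)$.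
   Context: **Experiment.** Stage sample sizes are $N_1,N_2$, $N=N_1+N_2$, with fixed ratios $q_t=N_t/N\in(0,1)$, $t\in\{1,2\}$. Triangular array: distributions may depend on $N$. For each $N$ the pairs of real potential outcomes $(Y_{uN}^{(t)}(0),Y_{uN}^{(t)}(1))$, $t\in\{1,2\}$, $1\le u\le N_t$, are i.i.d. with the law of $(Y_{uN}(0),Y_{uN}(1))$. Treatments are $A_{uN}^{(t)}\in\{0,1\}$ and the observed outcome is $Y_{uN}^{(t)}=A_{uN}^{(t)}Y_{uN}^{(t)}(1)+(1-A_{uN}^{(t)})Y_{uN}^{(t)}(0)$. Let $\mathcal H_0$ be the trivial $\sigma$-algebra and $\mathcal H_1=\sigma((A_{uN}^{(1)},Y_{uN}^{(1)})_{u\le N_1})$. Unconfoundedness: $(Y_{uN}^{(t)}(0),Y_{uN}^{(t)}(1))\perp A_{uN}^{(t)}\mid\mathcal H_{t-1}$. Pilot stage: the $(A_{uN}^{(1)},Y_{uN}^{(1)})$ are i.i.d. with $\mathbb P[A_{uN}^{(1)}=s]=e(s)$, $e(0)+e(1)=1$. Let $S_N^{(1)}(s)=N_1^{-1/2}\sum_{u=1}^{N_1}\mathbf 1(A_{uN}^{(1)}=s)Y_{uN}^{(1)}/e(s)$. Let $\bar{\mathbb R}=\mathbb R\cup\{-\infty\}$, let $e(s,x)\in[0,1]$ ($s\in\{0,1\}$, $x\in\bar{\mathbb R}$) be a sampling function and $l_N\in[0,1/2)$ a clipping rate. Follow-up stage: conditionally on $\mathcal H_1$ the $(A_{uN}^{(2)},Y_{uN}^{(2)})$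 are i.i.d. with $\mathbb P[A_{uN}^{(2)}=0\mid\mathcal H_1]=\min\{1-l_N,\max\{l_N,e(0,S_N^{(1)}(0)-S_N^{(1)}(1))\}\}$. Write $e_N(s,\mathcal H_{t-1})=\mathbb P[A_{uN}^{(t)}=s\mid\mathcal H_{t-1}]$. **Statistics.** For an exponent $m$, $h_N^{(t)}(s)=e_N(s,\mathcal H_{t-1})^m/N^{1/2}$; $\hat\Lambda_{uN}^{(t)}(s)=\mathbf 1(A_{uN}^{(t)}=s)Y_{uN}^{(t)}/e_N(s,\mathcal H_{t-1})$; $\hat\Lambda_N^{(t)}(s)=N_t^{-1}\sum_{u}\hat\Lambda_{uN}^{(t)}(s)$; $\omega_t(s)=N_th_N^{(t)}(s)/\sum_{t'=1}^2N_{t'}h_N^{(t')}(s)$; $\mathrm{WIPW}(s)=\sum_{t=1}^2\omega_t(s)\hat\Lambda_N^{(t)}(s)$; $\hat V_N(s)=\sum_{t=1}^2\omega_t(s)^2N_t^{-2}\sum_{u=1}^{N_t}(\hat\Lambda_{uN}^{(t)}(s)-\mathrm{WIPW}(s))^2$; $\hat S_N=(N\hat V_N(0)+N\hat V_N(1))^{1/2}$; $T_N=\mathrm{WIPW}(0)-\mathrm{WIPW}(1)$; $W_N=\sqrt N\,T_N/\hat S_N$. **Moment conditions.** For $s\in\{0,1\}$: $0<\inf_N(\mathbb E[Y_{uN}^2(s)]-\mathbb E[Y_{uN}(s)]^2)\le\sup_N(\mathbb E[Y_{uN}^4(s)])^{1/2}<\infty$; $\lim_N\mathbb E[Y_{uN}^p(s)]$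 exists for $p=1,2$; and $c_N=\sqrt N(\mathbb E[Y_{uN}(0)]-\mathbb E[Y_{uN}(1)])\to c\in[-\infty,0]$. **Sampling design conditions.** There are $0<c_l<c_u<1$ with $e(s)\in(c_l,c_u)$ for $s\in\{0,1\}$; $e(0,x)+e(1,x)=1$ for all $x\in\bar{\mathbb R}$; and one of the following holds. (Lipschitz) For each $s$, $e(s,\cdot)$ is Lipschitz over $\bar{\mathbb R}$ with a universal constant $L>0$ (Lipschitz on $\mathbb R$ and continuous at $-\infty$), and $e(s,-\infty)\in\{0,1\}$. (Step function) There exist $m_1\in\mathbb R$, $K\in\mathbb N$ and a continuous $g:\bar{\mathbb R}\to\bar{\mathbb R}$ with $g(-\infty)=-\infty$ such that for each $s$, $e(s,x)=\sum_{k=1}^Kc_k(s)\mathbf 1(g(x)\in C_k)$, where $c_k(s)\in[0,1]$, the $C_k$ are disjoint, $C_1=[-\infty,m_1]$, $C_k$ is open for $k\ge2$, and $\bigcup_{k=2}^KC_k=(m_1,\infty)$. **Regimes.** Constant weighting regime: $m=0$ and $l_N=\bar l$ for all $N$, for a constant $\bar l\in(0,1/2)$. Adaptive weighting regime: $m=1/2$, $l_N\in(0,1/2)$ for all $N$, $l_N\to0$ and $Nl_N\to\infty$. **Limit laws.** Let $l_\infty=\lim_Nl_N$, $\mu_s=\lim_N\mathbb E[Y_{uN}(s)]$, $\nu_s=\lim_N\mathbb E[Y_{uN}^2(s)]$. Put $H^{(1)}(s)=e(s)$ and $V^{(t)}(s)=\nu_s-H^{(t)}(s)\mu_s^2$.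 Let $A^{(1)}=(A^{(1)}(0),A^{(1)}(1))\sim N(0,\Sigma^{(1)})$, and given $A^{(1)}$ let $A^{(2)}=(A^{(2)}(0),A^{(2)}(1))\sim N(0,\Sigma^{(2)}(A^{(1)}))$, where $\Sigma^{(t)}$ is the $2\times2$ matrix with unit diagonal and off-diagonal entries $\mathrm{Cov}^{(t)}=-\big(\tfrac{H^{(t)}(0)H^{(t)}(1)}{V^{(t)}(0)V^{(t)}(1)}\big)^{1/2}\mu_0\mu_1$. Here $H^{(2)}(s)=\min\{1-l_\infty,\max\{l_\infty,e(s,\mathcal S^\infty)\}\}$ with $\mathcal S^\infty=A^{(1)}(0)\big(V^{(1)}(0)/e(0)\big)^{1/2}-A^{(1)}(1)\big(V^{(1)}(1)/e(1)\big)^{1/2}+q_1^{1/2}c$ (equal to $-\infty$ if $c=-\infty$). Weights: $\bar w_{\mathcal C}^{(t)}(s)=(q_tV^{(t)}(s)/H^{(t)}(s))^{1/2}$ and $\bar w_{\mathcal A}^{(t)}(s)=(q_tV^{(t)}(s))^{1/2}/\sum_{t'=1}^2q_{t'}(H^{(t')}(s))^{1/2}$. For $\mathcal W\in\{\mathcal A,\mathcal C\}$: $\bar{\mathbb W}_{\mathcal W}(s)=\sum_{t=1}^2A^{(t)}(s)\bar w_{\mathcal W}^{(t)}(s)$; $\mathbb W_{\mathcal U}^{\mathcal W}(c)=\sum_{t=1}^2A^{(t)}(0)\bar w_{\mathcal W}^{(t)}(0)-\sum_{t=1}^2A^{(t)}(1)\bar w_{\mathcal W}^{(t)}(1)$;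 $\mathbb W_{\mathcal N}^{\mathcal W}(c)=\mathbb W_{\mathcal U}^{\mathcal W}(c)/\big(\sum_{s=0}^1\sum_{t=1}^2(\bar w_{\mathcal W}^{(t)}(s))^2\big)^{1/2}$.
   Formalization: Two conditions are added: each follow-up unit's potential outcomes are independent of H_1, and, if c is finite, e(s,x) is continuous at almost every real x (automatic for Lipschitz designs; the claim can fail for step designs where the boundary of {g<=m_1} has positive measure). *)

theory Defs
  imports "HOL-Probability.Probability"
begin

section \<open>Conditional probability given a sub-sigma-algebra\<close>

definition cprob :: "'a measure \<Rightarrow> 'a measure \<Rightarrow> 'a set \<Rightarrow> 'a \<Rightarrow> real" where
  "cprob M F E = real_cond_exp M F (indicator E)"

definition cond_indep_var ::
    "'a measure \<Rightarrow> 'a measure \<Rightarrow> 'b measure \<Rightarrow> ('a \<Rightarrow> 'b) \<Rightarrow> 'c measure \<Rightarrow> ('a \<Rightarrow> 'c) \<Rightarrow> bool" where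
  "cond_indep_var M F S X T Y \<longleftrightarrow>
     X \<in> M \<rightarrow>\<^sub>M S \<and> Y \<in> M \<rightarrow>\<^sub>M T \<and>
     (\<forall>B\<in>sets S. \<forall>C\<in>sets T. AE \<omega> in M.
        cprob M F {\<omega> \<in> space M. X \<omega> \<in> B \<and> Y \<omega> \<in> C} \<omega>
        = cprob M F {\<omega> \<in> space M. X \<omega> \<in> B} \<omega> * cprob M F {\<omega> \<in> space M. Y \<omega> \<in> C} \<omega>)"

definition cond_iid ::
    "'a measure \<Rightarrow> 'a measure \<Rightarrow> 'b measure \<Rightarrow> ('i \<Rightarrow> 'a \<Rightarrow> 'b) \<Rightarrow> 'i set \<Rightarrow> bool" where
  "cond_iid M F S X I \<longleftrightarrow>
     (\<forall>i\<in>I. X i \<in> M \<rightarrow>\<^sub>M S) \<and>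
     (\<forall>B. (\<forall>i\<in>I. B i \<in> sets S) \<longrightarrow> (AE \<omega> in M.
        cprob M F {\<omega> \<in> space M. \<forall>i\<in>I. X i \<omega> \<in> B i} \<omega>
        = (\<Prod>i\<in>I. cprob M F {\<omega> \<in> space M. X i \<omega> \<in> B i} \<omega>))) \<and>
     (\<forall>i\<in>I. \<forall>j\<in>I. \<forall>B\<in>sets S. AE \<omega> in M.
        cprob M F {\<omega> \<in> space M. X i \<omega> \<in> B} \<omega> = cprob M F {\<omega> \<in> space M. X j \<omega> \<in> B} \<omega>)"

section \<open>The two-stage experiment\<close>

text \<open>Stages are numbered 1, 2 and units \<open>1, \<dots>, stage_size X t\<close>; treatment arms are 0, 1.
  Arguments come in the order stage, unit, arm, sample point.\<close>

record 'a trial =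
  prob_sp :: "'a measure"
  stage_size :: "nat \<Rightarrow> nat"
  treatment :: "nat \<Rightarrow> nat \<Rightarrow> 'a \<Rightarrow> nat"
  outcome :: "nat \<Rightarrow> nat \<Rightarrow> nat \<Rightarrow> 'a \<Rightarrow> real"

definition total_size :: "('a, 'z) trial_scheme \<Rightarrow> nat" where
  "total_size X = stage_size X 1 + stage_size X 2"

definition observed :: "('a, 'z) trial_scheme \<Rightarrow> nat \<Rightarrow> nat \<Rightarrow> 'a \<Rightarrow> real" where
  "observed X t u \<omega> = real (treatment X t u \<omega>) * outcome X t u 1 \<omega>
                     + (1 - real (treatment X t u \<omega>)) * outcome X t u 0 \<omega>"

text \<open>\<open>history X 0\<close> is the trivial sigma-algebra and \<open>history X 1\<close> is the one generated by
  the pilot treatments and observed pilot outcomes; no other index is used.\<close>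

definition history :: "('a, 'z) trial_scheme \<Rightarrow> nat \<Rightarrow> 'a measure" where
  "history X t =
    (if t = 0 then sigma (space (prob_sp X)) {}
     else vimage_algebra (space (prob_sp X))
            (\<lambda>\<omega>. \<lambda>u\<in>{1..stage_size X 1}. (treatment X 1 u \<omega>, observed X 1 u \<omega>))
            (\<Pi>\<^sub>M u\<in>{1..stage_size X 1}. count_space UNIV \<Otimes>\<^sub>M borel))"

definition pilot_stat :: "(nat \<Rightarrow> real) \<Rightarrow> ('a, 'z) trial_scheme \<Rightarrow> nat \<Rightarrow> 'a \<Rightarrow> real" where
  "pilot_stat p X s \<omega> =
     (\<Sum>u\<in>{1..stage_size X 1}. of_bool (treatment X 1 u \<omega> = s) * observed X 1 u \<omega> / p s)
       / sqrt (real (stage_size X 1))"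

definition clip :: "real \<Rightarrow> real \<Rightarrow> real" where
  "clip l x = min (1 - l) (max l x)"

text \<open>\<open>Q\<close> is the common law of the pairs of potential outcomes, \<open>p s\<close> the pilot probability
  of arm \<open>s\<close>, \<open>e\<close> the sampling function and \<open>l\<close> the clipping rate. The extended line with
  \<open>-\<infinity>\<close> only is the part \<open>{..<\<infinity>}\<close> of \<^typ>\<open>ereal\<close>; the value of \<open>e\<close> at \<open>\<infinity>\<close> is irrelevant.

  Assumption \<open>fresh_outcomes\<close> says that the follow-up units are sampled independently of the
  pilot data. It is not a consequence of the other assumptions, as these
  do not restrict the joint law of the pilot treatments and the follow-up outcomes.\<close>

locale two_stage_experiment = prob_space "prob_sp X"
  for X :: "'a trial" +
  fixes Q :: "(real \<times> real) measure"
    and p :: "nat \<Rightarrow> real"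
    and e :: "nat \<Rightarrow> ereal \<Rightarrow> real"
    and l :: real
  assumes clipping_rate: "0 \<le> l" "l < 1 / 2"
    and treatment_measurable:
      "\<And>t u. t \<in> {1, 2} \<Longrightarrow> u \<in> {1..stage_size X t} \<Longrightarrow>
         treatment X t u \<in> prob_sp X \<rightarrow>\<^sub>M count_space UNIV"
    and treatment_binary:
      "\<And>t u \<omega>. t \<in> {1, 2} \<Longrightarrow> u \<in> {1..stage_size X t} \<Longrightarrow> \<omega> \<in> space (prob_sp X) \<Longrightarrow>
         treatment X t u \<omega> \<in> {0, 1}"
    and outcomes_indep:
      "indep_vars (\<lambda>_. borel) (\<lambda>(t, u) \<omega>. (outcome X t u 0 \<omega>, outcome X t u 1 \<omega>))
         (SIGMA t:{1, 2}. {1..stage_size X t})"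
    and outcomes_law:
      "\<And>t u. t \<in> {1, 2} \<Longrightarrow> u \<in> {1..stage_size X t} \<Longrightarrow>
         distr (prob_sp X) borel (\<lambda>\<omega>. (outcome X t u 0 \<omega>, outcome X t u 1 \<omega>)) = Q"
    and fresh_outcomes:
      "\<And>u. u \<in> {1..stage_size X 2} \<Longrightarrow>
         indep_set (sets (history X 1))
           {(\<lambda>\<omega>. (outcome X 2 u 0 \<omega>, outcome X 2 u 1 \<omega>)) -` B \<inter> space (prob_sp X) | B. B \<in> sets borel}"
    and unconfounded:
      "\<And>t u. t \<in> {1, 2} \<Longrightarrow> u \<in> {1..stage_size X t} \<Longrightarrow>
         cond_indep_var (prob_sp X) (history X (t - 1))
           borel (\<lambda>\<omega>. (outcome X t u 0 \<omega>, outcome X t u 1 \<omega>))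
           (count_space UNIV) (treatment X t u)"
    and pilot_indep:
      "indep_vars (\<lambda>_. count_space UNIV \<Otimes>\<^sub>M borel)
         (\<lambda>u \<omega>. (treatment X 1 u \<omega>, observed X 1 u \<omega>)) {1..stage_size X 1}"
    and pilot_identical:
      "\<And>u v. u \<in> {1..stage_size X 1} \<Longrightarrow> v \<in> {1..stage_size X 1} \<Longrightarrow>
         distr (prob_sp X) (count_space UNIV \<Otimes>\<^sub>M borel) (\<lambda>\<omega>. (treatment X 1 u \<omega>, observed X 1 u \<omega>))
         = distr (prob_sp X) (count_space UNIV \<Otimes>\<^sub>M borel) (\<lambda>\<omega>. (treatment X 1 v \<omega>, observed X 1 v \<omega>))"
    and pilot_prob:
      "\<And>u s. u \<in> {1..stage_size X 1} \<Longrightarrow> s \<in> {0, 1} \<Longrightarrow>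
         prob {\<omega> \<in> space (prob_sp X). treatment X 1 u \<omega> = s} = p s"
    and followup_iid:
      "cond_iid (prob_sp X) (history X 1) (count_space UNIV \<Otimes>\<^sub>M borel)
         (\<lambda>u \<omega>. (treatment X 2 u \<omega>, observed X 2 u \<omega>)) {1..stage_size X 2}"
    and followup_prob:
      "\<And>u. u \<in> {1..stage_size X 2} \<Longrightarrow> AE \<omega> in prob_sp X.
         cprob (prob_sp X) (history X 1) {\<omega> \<in> space (prob_sp X). treatment X 2 u \<omega> = 0} \<omega>
         = clip l (e 0 (ereal (pilot_stat p X 0 \<omega> - pilot_stat p X 1 \<omega>)))"

section \<open>Statistics\<close>

text \<open>Within a stage the conditional treatment probability does not depend on the unit, so it
  is read off unit 1.\<close>

definition prop_score :: "('a, 'z) trial_scheme \<Rightarrow> nat \<Rightarrow> nat \<Rightarrow> 'a \<Rightarrow> real" where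
  "prop_score X t s =
     cprob (prob_sp X) (history X (t - 1)) {\<omega> \<in> space (prob_sp X). treatment X t 1 \<omega> = s}"

text \<open>In \<^const>\<open>powr\<close>, \<open>0 powr 0 = 0\<close>; this is harmless as the propensity scores are almost
  surely positive whenever the clipping rate is.\<close>

definition raw_weight :: "real \<Rightarrow> ('a, 'z) trial_scheme \<Rightarrow> nat \<Rightarrow> nat \<Rightarrow> 'a \<Rightarrow> real" where
  "raw_weight m X t s \<omega> = prop_score X t s \<omega> powr m / sqrt (real (total_size X))"

definition ipw_unit :: "('a, 'z) trial_scheme \<Rightarrow> nat \<Rightarrow> nat \<Rightarrow> nat \<Rightarrow> 'a \<Rightarrow> real" where
  "ipw_unit X t u s \<omega> = of_bool (treatment X t u \<omega> = s) * observed X t u \<omega> / prop_score X t s \<omega>"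

definition ipw :: "('a, 'z) trial_scheme \<Rightarrow> nat \<Rightarrow> nat \<Rightarrow> 'a \<Rightarrow> real" where
  "ipw X t s \<omega> = (\<Sum>u\<in>{1..stage_size X t}. ipw_unit X t u s \<omega>) / real (stage_size X t)"

definition weight :: "real \<Rightarrow> ('a, 'z) trial_scheme \<Rightarrow> nat \<Rightarrow> nat \<Rightarrow> 'a \<Rightarrow> real" where
  "weight m X t s \<omega> = real (stage_size X t) * raw_weight m X t s \<omega>
     / (\<Sum>t'\<in>{1, 2}. real (stage_size X t') * raw_weight m X t' s \<omega>)"

definition WIPW :: "real \<Rightarrow> ('a, 'z) trial_scheme \<Rightarrow> nat \<Rightarrow> 'a \<Rightarrow> real" where
  "WIPW m X s \<omega> = (\<Sum>t\<in>{1, 2}. weight m X t s \<omega> * ipw X t s \<omega>)"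

definition V_hat :: "real \<Rightarrow> ('a, 'z) trial_scheme \<Rightarrow> nat \<Rightarrow> 'a \<Rightarrow> real" where
  "V_hat m X s \<omega> = (\<Sum>t\<in>{1, 2}. (weight m X t s \<omega>)\<^sup>2 / (real (stage_size X t))\<^sup>2
     * (\<Sum>u\<in>{1..stage_size X t}. (ipw_unit X t u s \<omega> - WIPW m X s \<omega>)\<^sup>2))"

definition S_hat :: "real \<Rightarrow> ('a, 'z) trial_scheme \<Rightarrow> 'a \<Rightarrow> real" where
  "S_hat m X \<omega> = sqrt (real (total_size X) * V_hat m X 0 \<omega> + real (total_size X) * V_hat m X 1 \<omega>)"

definition T_stat :: "real \<Rightarrow> ('a, 'z) trial_scheme \<Rightarrow> 'a \<Rightarrow> real" where
  "T_stat m X \<omega> = WIPW m X 0 \<omega> - WIPW m X 1 \<omega>"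

definition W_stat :: "real \<Rightarrow> ('a, 'z) trial_scheme \<Rightarrow> 'a \<Rightarrow> real" where
  "W_stat m X \<omega> = sqrt (real (total_size X)) * T_stat m X \<omega> / S_hat m X \<omega>"

section \<open>Moment and design conditions\<close>

definition arm :: "nat \<Rightarrow> real \<times> real \<Rightarrow> real" where
  "arm s y = (if s = 0 then fst y else snd y)"

definition moment :: "(real \<times> real) measure \<Rightarrow> nat \<Rightarrow> nat \<Rightarrow> real" where
  "moment Q s r = (\<integral>y. arm s y ^ r \<partial>Q)"

definition scaled_effect :: "(real \<times> real) measure \<Rightarrow> nat \<Rightarrow> real" where
  "scaled_effect Q N = sqrt (real N) * (moment Q 0 1 - moment Q 1 1)"

definition moment_conditions ::
    "(nat \<Rightarrow> nat) \<Rightarrow> (nat \<Rightarrow> (real \<times> real) measure) \<Rightarrow> (nat \<Rightarrow> real) \<Rightarrow> (nat \<Rightarrow> real) \<Rightarrow> ereal \<Rightarrow> bool" where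
  "moment_conditions N Q \<mu> \<nu> c \<longleftrightarrow>
     (\<forall>s\<in>{0, 1}.
        (\<forall>k. integrable (Q k) (\<lambda>y. arm s y ^ 4)) \<and>
        0 < (INF k. ereal (moment (Q k) s 2 - (moment (Q k) s 1)\<^sup>2)) \<and>
        (INF k. ereal (moment (Q k) s 2 - (moment (Q k) s 1)\<^sup>2))
          \<le> (SUP k. ereal (sqrt (moment (Q k) s 4))) \<and>
        (SUP k. ereal (sqrt (moment (Q k) s 4))) < \<infinity> \<and>
        (\<lambda>k. moment (Q k) s 1) \<longlonglongrightarrow> \<mu> s \<and>
        (\<lambda>k. moment (Q k) s 2) \<longlonglongrightarrow> \<nu> s) \<and>
     c \<le> 0 \<and> (\<lambda>k. ereal (scaled_effect (Q k) (N k))) \<longlonglongrightarrow> c"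

definition lipschitz_design :: "(nat \<Rightarrow> ereal \<Rightarrow> real) \<Rightarrow> bool" where
  "lipschitz_design e \<longleftrightarrow>
     (\<exists>L>0. \<forall>s\<in>{0, 1}. L-lipschitz_on UNIV (\<lambda>x. e s (ereal x))) \<and>
     (\<forall>s\<in>{0, 1}. isCont (e s) (-\<infinity>) \<and> e s (-\<infinity>) \<in> {0, 1})"

text \<open>A step design need not be almost everywhere continuous in the score: the boundary of
  \<open>{x. g x \<le> m\<^sub>1}\<close> is the boundary of an essentially arbitrary closed set, and may have positive
  measure.\<close>

definition step_design :: "(nat \<Rightarrow> ereal \<Rightarrow> real) \<Rightarrow> bool" where
  "step_design e \<longleftrightarrow>
     (\<exists>(m\<^sub>1 :: real) (K :: nat) (g :: ereal \<Rightarrow> ereal) (a :: nat \<Rightarrow> nat \<Rightarrow> real) (C :: nat \<Rightarrow> ereal set).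
        1 \<le> K \<and>
        g \<in> {..<\<infinity>} \<rightarrow> {..<\<infinity>} \<and> continuous_on {..<\<infinity>} g \<and> g (-\<infinity>) = -\<infinity> \<and>
        (\<forall>s\<in>{0, 1}. \<forall>k\<in>{1..K}. a k s \<in> {0..1}) \<and>
        disjoint_family_on C {1..K} \<and>
        C 1 = {..ereal m\<^sub>1} \<and> (\<forall>k\<in>{2..K}. open (C k)) \<and>
        (\<Union>k\<in>{2..K}. C k) = {ereal m\<^sub>1<..<\<infinity>} \<and>
        (\<forall>s\<in>{0, 1}. \<forall>x<\<infinity>. e s x = (\<Sum>k\<in>{1..K}. a k s * of_bool (g x \<in> C k))))"

definition design_conditions :: "(nat \<Rightarrow> real) \<Rightarrow> (nat \<Rightarrow> ereal \<Rightarrow> real) \<Rightarrow> bool" where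
  "design_conditions p e \<longleftrightarrow>
     (\<exists>c\<^sub>l c\<^sub>u. 0 < c\<^sub>l \<and> c\<^sub>l < c\<^sub>u \<and> c\<^sub>u < 1 \<and> (\<forall>s\<in>{0, 1}. c\<^sub>l < p s \<and> p s < c\<^sub>u)) \<and>
     p 0 + p 1 = 1 \<and>
     (\<forall>s\<in>{0, 1}. \<forall>x<\<infinity>. e s x \<in> {0..1}) \<and>
     (\<forall>x<\<infinity>. e 0 x + e 1 x = 1) \<and>
     (lipschitz_design e \<or> step_design e)"

definition constant_regime :: "(nat \<Rightarrow> real) \<Rightarrow> bool" where
  "constant_regime l \<longleftrightarrow> (\<exists>l'. 0 < l' \<and> l' < 1 / 2 \<and> (\<forall>k. l k = l'))"

definition adaptive_regime :: "(nat \<Rightarrow> nat) \<Rightarrow> (nat \<Rightarrow> real) \<Rightarrow> bool" where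
  "adaptive_regime N l \<longleftrightarrow>
     (\<forall>k. 0 < l k \<and> l k < 1 / 2) \<and> l \<longlonglongrightarrow> 0 \<and>
     filterlim (\<lambda>k. real (N k) * l k) at_top sequentially"

section \<open>Limit laws\<close>

text \<open>The centred bivariate normal law with unit variances and correlation \<open>\<rho>\<close>, for
  \<open>\<bar>\<rho>\<bar> < 1\<close>.\<close>

definition binormal :: "real \<Rightarrow> (real \<times> real) measure" where
  "binormal \<rho> = density lborel (\<lambda>(x, y).
     ennreal (exp (- (x\<^sup>2 - 2 * \<rho> * x * y + y\<^sup>2) / (2 * (1 - \<rho>\<^sup>2))) / (2 * pi * sqrt (1 - \<rho>\<^sup>2))))"

text \<open>Below, \<open>h s\<close> or \<open>H t s\<close> stands for the limiting propensity score of arm \<open>s\<close>, and the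
  argument \<open>y\<close> of \<open>lim_S\<close> and \<open>lim_H\<close> for the value of the first-stage normal vector. The
  variance \<open>lim_V\<close> is bounded away from 0 and the correlation \<open>lim_corr\<close> lies strictly
  between -1 and 1 because the limiting outcome variances \<open>\<nu> s - (\<mu> s)\<^sup>2\<close> are positive.\<close>

definition lim_V :: "(nat \<Rightarrow> real) \<Rightarrow> (nat \<Rightarrow> real) \<Rightarrow> (nat \<Rightarrow> real) \<Rightarrow> nat \<Rightarrow> real" where
  "lim_V \<mu> \<nu> h s = \<nu> s - h s * (\<mu> s)\<^sup>2"

definition lim_corr :: "(nat \<Rightarrow> real) \<Rightarrow> (nat \<Rightarrow> real) \<Rightarrow> (nat \<Rightarrow> real) \<Rightarrow> real" where
  "lim_corr \<mu> \<nu> h = - sqrt (h 0 * h 1 / (lim_V \<mu> \<nu> h 0 * lim_V \<mu> \<nu> h 1)) * \<mu> 0 * \<mu> 1"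

definition lim_S ::
    "(nat \<Rightarrow> real) \<Rightarrow> (nat \<Rightarrow> real) \<Rightarrow> (nat \<Rightarrow> real) \<Rightarrow> (nat \<Rightarrow> real) \<Rightarrow> ereal \<Rightarrow> real \<times> real \<Rightarrow> ereal" where
  "lim_S q p \<mu> \<nu> c y =
     ereal (arm 0 y * sqrt (lim_V \<mu> \<nu> p 0 / p 0) - arm 1 y * sqrt (lim_V \<mu> \<nu> p 1 / p 1))
       + ereal (sqrt (q 1)) * c"

definition lim_H ::
    "(nat \<Rightarrow> real) \<Rightarrow> (nat \<Rightarrow> real) \<Rightarrow> (nat \<Rightarrow> ereal \<Rightarrow> real) \<Rightarrow> (nat \<Rightarrow> real) \<Rightarrow> (nat \<Rightarrow> real) \<Rightarrow> ereal
      \<Rightarrow> real \<Rightarrow> real \<times> real \<Rightarrow> nat \<Rightarrow> nat \<Rightarrow> real" where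
  "lim_H q p e \<mu> \<nu> c l_inf y t s =
     (if t = 1 then p s else clip l_inf (e s (lim_S q p \<mu> \<nu> c y)))"

text \<open>The joint law of the first- and second-stage normal vectors: the first is normal, and the
  second is conditionally normal given the first.\<close>

definition limit_law ::
    "(nat \<Rightarrow> real) \<Rightarrow> (nat \<Rightarrow> real) \<Rightarrow> (nat \<Rightarrow> ereal \<Rightarrow> real) \<Rightarrow> (nat \<Rightarrow> real) \<Rightarrow> (nat \<Rightarrow> real) \<Rightarrow> ereal
      \<Rightarrow> real \<Rightarrow> ((real \<times> real) \<times> (real \<times> real)) measure" where
  "limit_law q p e \<mu> \<nu> c l_inf =
     binormal (lim_corr \<mu> \<nu> p) \<bind>
       (\<lambda>y. distr (binormal (lim_corr \<mu> \<nu> (lim_H q p e \<mu> \<nu> c l_inf y 2))) borel (Pair y))"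

definition w_const ::
    "(nat \<Rightarrow> real) \<Rightarrow> (nat \<Rightarrow> real) \<Rightarrow> (nat \<Rightarrow> real) \<Rightarrow> (nat \<Rightarrow> nat \<Rightarrow> real) \<Rightarrow> nat \<Rightarrow> nat \<Rightarrow> real" where
  "w_const q \<mu> \<nu> H t s = sqrt (q t * lim_V \<mu> \<nu> (H t) s / H t s)"

definition w_adapt ::
    "(nat \<Rightarrow> real) \<Rightarrow> (nat \<Rightarrow> real) \<Rightarrow> (nat \<Rightarrow> real) \<Rightarrow> (nat \<Rightarrow> nat \<Rightarrow> real) \<Rightarrow> nat \<Rightarrow> nat \<Rightarrow> real" where
  "w_adapt q \<mu> \<nu> H t s =
     sqrt (q t * lim_V \<mu> \<nu> (H t) s) / (\<Sum>t'\<in>{1, 2}. q t' * sqrt (H t' s))"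

definition lim_arm :: "(nat \<Rightarrow> nat \<Rightarrow> real) \<Rightarrow> nat \<Rightarrow> (real \<times> real) \<times> (real \<times> real) \<Rightarrow> real" where
  "lim_arm w s z = (\<Sum>t\<in>{1, 2}. arm s (if t = 1 then fst z else snd z) * w t s)"

definition lim_unnormalized :: "(nat \<Rightarrow> nat \<Rightarrow> real) \<Rightarrow> (real \<times> real) \<times> (real \<times> real) \<Rightarrow> real" where
  "lim_unnormalized w z = lim_arm w 0 z - lim_arm w 1 z"

definition lim_normalized :: "(nat \<Rightarrow> nat \<Rightarrow> real) \<Rightarrow> (real \<times> real) \<times> (real \<times> real) \<Rightarrow> real" where
  "lim_normalized w z = lim_unnormalized w z / sqrt (\<Sum>s\<in>{0, 1}. \<Sum>t\<in>{1, 2}. (w t s)\<^sup>2)"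

definition converges_weakly ::
    "(nat \<Rightarrow> 'a measure) \<Rightarrow> (nat \<Rightarrow> 'a \<Rightarrow> real) \<Rightarrow> 'b measure \<Rightarrow> ('b \<Rightarrow> real) \<Rightarrow> bool" where
  "converges_weakly M U M_inf U_inf \<longleftrightarrow>
     weak_conv_m (\<lambda>k. distr (M k) borel (U k)) (distr M_inf borel U_inf)"

end

theory Submission
  imports Defs
begin

text \<open>The scaled error of \<open>WIPW\<close> in arm \<open>s\<close> is a linear combination of one standardised sum per
  stage, and in both regimes the coefficients are continuous functions of the follow-up propensity,
  which is itself a function of the pilot data. Conditionally on the pilot data, the follow-up sums
  have a characteristic function uniformly close to a normal one; the error is governed by
  \<open>N l\<^sub>N \<rightarrow> \<infinity>\<close>. It may therefore be replaced by a continuous function of the propensity, and it remains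
  to find the joint limit of the pilot sums and the propensity. If \<open>c\<close> is finite, the propensity is
  an almost everywhere continuous function of a pilot statistic whose limit law is absolutely
  continuous; if \<open>c = -\<infinity>\<close>, it has a deterministic limit. Random coefficients are frozen on a fine
  partition of their compact range, and Levy's continuity theorem gives weak convergence. The variance
  estimate is close in mean to a positive continuous function of the propensity, so studentising only
  changes the coefficients.\<close>

text \<open>With a clipping rate that may tend to 0, inverse weighted outcomes have no bounded
  variance. Multiplying them by the square root of the treatment probability \<open>h\<close> bounds
  the variance by the common moment bound \<open>K\<close> and leaves a fourth moment of order
  \<open>1 / h\<close>. For \<open>n\<close> units the normal approximation therefore costs a
  quantity that is small as soon as \<open>n * h\<close> is large, uniformly in \<open>h\<close>;
  since \<open>h\<close> is at least the clipping rate, this is what the rate condition supplies.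
  The same factor separates the two regimes: up to a common denominator, the coefficient of a
  standardised sum is the power \<open>m - 1 / 2\<close> of its propensity. For m = 1/2 the
  propensity cancels and the coefficient stays continuous at 0; for m = 0 it blows up there, but the
  clipping rate is then constant. Conditioning is replaced by iterated integration, because the
  joint law of the recorded data is an explicit mixture of product measures. The coefficients of the
  pilot sums are functions of the same pilot data, so separate limits would not be enough: sums and
  propensity have to converge jointly, although the sampling function may jump.\<close>

section \<open>Approximation of limits and elementary measurability\<close>

lemma norm_iexp_diff_le: "cmod (iexp x - iexp y) \<le> \<bar>x - y\<bar>"
proof -
  have "iexp x - iexp y = iexp y * (iexp (x - y) - 1)"
    by (simp add: algebra_simps flip: exp_add)
  moreover have "cmod (iexp (x - y) - 1) \<le> \<bar>x - y\<bar>"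
    using iexp_approx1[of "x - y" 0] by simp
  ultimately show ?thesis
    by (simp add: norm_mult)
qed

text \<open>The shape of every double limit below: the approximants may change with \<epsilon> and
  need be close only for large \<open>k\<close>. Frozen coefficients, a replaced clipping rate and a
  replaced follow-up stage can thus each be inserted and removed at the cost of an
  \<epsilon>.\<close>

lemma tendsto_by_approximation:
  fixes a :: "nat \<Rightarrow> 'a::real_normed_vector"
  assumes "\<And>\<epsilon>. 0 < \<epsilon> \<Longrightarrow> \<exists>b y. b \<longlonglongrightarrow> y \<and> (\<forall>\<^sub>F k in sequentially. norm (a k - b k) \<le> \<epsilon>) \<and> norm (x - y) \<le> \<epsilon>"
  shows "a \<longlonglongrightarrow> x"
proof (rule tendstoI)
  fix \<epsilon> :: real assume "0 < \<epsilon>"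
  then obtain b y where b: "b \<longlonglongrightarrow> y" and ab: "\<forall>\<^sub>F k in sequentially. norm (a k - b k) \<le> \<epsilon> / 4"
    and xy: "norm (x - y) \<le> \<epsilon> / 4"
    using assms[of "\<epsilon> / 4"] by auto
  have "\<forall>\<^sub>F k in sequentially. dist (b k) y < \<epsilon> / 4"
    using b \<open>0 < \<epsilon>\<close> by (intro tendstoD) auto
  with ab show "\<forall>\<^sub>F k in sequentially. dist (a k) x < \<epsilon>"
  proof eventually_elim
    case (elim k)
    have "dist (a k) x \<le> dist (a k) (b k) + dist (b k) y + dist y x"
      by metric
    also have "\<dots> < \<epsilon>"
      using elim xy \<open>0 < \<epsilon>\<close> by (simp add: dist_norm norm_minus_commute)
    finally show ?case .
  qed
qed

lemma borel_measurable_continuous_on_compose: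
  fixes \<kappa> :: "real \<Rightarrow> 'b::topological_space"
  assumes "continuous_on J \<kappa>" "h \<in> borel_measurable M" "\<And>x. x \<in> space M \<Longrightarrow> h x \<in> J"
  shows "(\<lambda>x. \<kappa> (h x)) \<in> borel_measurable M"
proof -
  have "h \<in> M \<rightarrow>\<^sub>M restrict_space borel J"
    using assms by (intro measurable_restrict_space2) auto
  then show ?thesis
    using borel_measurable_continuous_on_restrict[OF assms(1)] by (rule measurable_compose)
qed

lemma (in prob_space) integrable_of_bounded:
  fixes f :: "'a \<Rightarrow> 'b::{banach, second_countable_topology}"
  assumes "f \<in> borel_measurable M" "\<And>x. x \<in> space M \<Longrightarrow> norm (f x) \<le> B"
  shows "integrable M f"
  using assms by (intro integrable_const_bound[where B=B]) (auto intro!: AE_I2)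

lemma converges_weaklyI_char:
  assumes M: "\<And>k. prob_space (M k)" "\<And>k. U k \<in> borel_measurable (M k)"
    and M': "prob_space M'" "U' \<in> borel_measurable M'"
    and conv: "\<And>\<theta>. (\<lambda>k. CLINT x|M k. iexp (\<theta> * U k x)) \<longlonglongrightarrow> (CLINT x|M'. iexp (\<theta> * U' x))"
  shows "converges_weakly M U M' U'"
  unfolding converges_weakly_def
proof (rule levy_continuity)
  note [measurable] = M M'
  show "real_distribution (distr (M k) borel (U k))" for k
    by (rule prob_space.real_distribution_distr) (use M in auto)
  show "real_distribution (distr M' borel U')"
    by (rule prob_space.real_distribution_distr) (use M' in auto)
  show "(\<lambda>k. char (distr (M k) borel (U k)) \<theta>) \<longlonglongrightarrow> char (distr M' borel U') \<theta>" for \<theta>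
    using conv[of \<theta>] unfolding char_def by (simp add: integral_distr M M')
qed

section \<open>Weak convergence through tilted laws\<close>

text \<open>Weighting by the nonnegative function \<open>2 + cos L\<close> turns joint convergence of the
  characteristic functions of \<open>(L, S)\<close> into weak convergence of the laws of \<open>S\<close> alone, so that the
  one-dimensional continuity theorem suffices.\<close>

definition tilt_mass :: "'a measure \<Rightarrow> ('a \<Rightarrow> real) \<Rightarrow> real" where
  "tilt_mass M L = (\<integral>x. 2 + cos (L x) \<partial>M)"

definition tilt :: "'a measure \<Rightarrow> ('a \<Rightarrow> real) \<Rightarrow> ('a \<Rightarrow> real) \<Rightarrow> real measure" where
  "tilt M L S = distr (density M (\<lambda>x. ennreal ((2 + cos (L x)) / tilt_mass M L))) borel S"

context prob_space
begin

context
  fixes L S :: "'a \<Rightarrow> real"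
  assumes [measurable]: "L \<in> borel_measurable M" "S \<in> borel_measurable M"
begin

text \<open>The constant 2 instead of 1 in the weight keeps the mass away from 0, uniformly in the
  law and in \<open>L\<close>; this legitimises both the normalisation and the later division of
  limits.\<close>

lemma tilt_mass_ge_1: "1 \<le> tilt_mass M L"
proof -
  have le: "1 \<le> 2 + cos (L x)" "\<bar>2 + cos (L x)\<bar> \<le> 3" for x
    using cos_ge_minus_one[of "L x"] cos_le_one[of "L x"] by linarith+
  have "(\<integral>x. 1 \<partial>M) \<le> tilt_mass M L"
    unfolding tilt_mass_def using le
    by (intro integral_mono integrable_of_bounded[where B=3]) auto
  then show ?thesis
    by (simp add: prob_space)
qed

lemma tilt_density_nonneg: "0 \<le> (2 + cos (L x)) / tilt_mass M L"
proof -
  have "0 \<le> 2 + cos (L x)"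
    using cos_ge_minus_one[of "L x"] by linarith
  then show ?thesis
    using tilt_mass_ge_1 by simp
qed

lemma real_distribution_tilt: "real_distribution (tilt M L S)"
proof -
  have int: "integrable M (\<lambda>x. 2 + cos (L x))"
    by (rule integrable_of_bounded[where B=3]) (auto intro!: order_trans[OF abs_triangle_ineq])
  have "(\<integral>\<^sup>+x. ennreal ((2 + cos (L x)) / tilt_mass M L) \<partial>M) = ennreal (\<integral>x. (2 + cos (L x)) / tilt_mass M L \<partial>M)"
    using int tilt_density_nonneg by (intro nn_integral_eq_integral) auto
  also have "\<dots> = 1"
    using tilt_mass_ge_1 by (simp flip: tilt_mass_def)
  finally have "prob_space (density M (\<lambda>x. ennreal ((2 + cos (L x)) / tilt_mass M L)))"
    by (intro prob_spaceI) (simp add: emeasure_density cong: nn_integral_cong)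
  then show ?thesis
    unfolding tilt_def by (rule prob_space.real_distribution_distr) auto
qed

lemma integral_tilt:
  fixes g :: "real \<Rightarrow> 'd::{banach, second_countable_topology}"
  assumes [measurable]: "g \<in> borel_measurable borel"
  shows "tilt_mass M L *\<^sub>R (\<integral>x. g x \<partial>tilt M L S) = (\<integral>x. (2 + cos (L x)) *\<^sub>R g (S x) \<partial>M)"
proof -
  have "(\<integral>x. g x \<partial>tilt M L S) = (\<integral>x. ((2 + cos (L x)) / tilt_mass M L) *\<^sub>R g (S x) \<partial>M)"
    unfolding tilt_def using tilt_density_nonneg by (simp add: integral_distr integral_density)
  also have "\<dots> = (\<integral>x. inverse (tilt_mass M L) *\<^sub>R ((2 + cos (L x)) *\<^sub>R g (S x)) \<partial>M)"
    by (simp add: divide_inverse mult.commute)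
  also have "\<dots> = inverse (tilt_mass M L) *\<^sub>R (\<integral>x. (2 + cos (L x)) *\<^sub>R g (S x) \<partial>M)"
    by (rule integral_scaleR_right)
  finally have eq: "(\<integral>x. g x \<partial>tilt M L S) = inverse (tilt_mass M L) *\<^sub>R (\<integral>x. (2 + cos (L x)) *\<^sub>R g (S x) \<partial>M)" .
  have "tilt_mass M L \<noteq> 0"
    using tilt_mass_ge_1 by linarith
  then show ?thesis
    unfolding eq scaleR_scaleR by simp
qed

text \<open>The cosine is half the sum of two conjugate exponentials, so the tilted transform is a
  combination of joint transforms of \<open>(L, S)\<close> at the first arguments 0, 1 and -1, and
  inherits their convergence.\<close>

lemma char_tilt:
  "complex_of_real (tilt_mass M L) * char (tilt M L S) t = 2 * (CLINT x|M. iexp (0 * L x + t * S x))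
     + (CLINT x|M. iexp (1 * L x + t * S x)) / 2 + (CLINT x|M. iexp ((-1) * L x + t * S x)) / 2"
proof -
  have i: "integrable M (\<lambda>x. iexp (u * L x + t * S x))" for u t
    by (rule integrable_iexp) auto
  have "(2 + cos (L x)) *\<^sub>R iexp (t * S x) = 2 * iexp (0 * L x + t * S x) + iexp (1 * L x + t * S x) / 2
      + iexp ((-1) * L x + t * S x) / 2" for x
    by (simp add: scaleR_conv_of_real cos_exp_eq exp_add exp_diff exp_minus field_simps flip: cos_of_real)
  then show ?thesis
    unfolding char_def using integral_tilt[of "\<lambda>x. iexp (t * x)"] i[of 0 t] i[of 1 t] i[of "-1" t]
    by (simp add: scaleR_conv_of_real)
qed

lemma AE_tilt:
  assumes [measurable]: "Measurable.pred borel P" and "AE x in M. P (S x)"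
  shows "AE x in tilt M L S. P x"
proof -
  have "AE x in density M (\<lambda>x. ennreal ((2 + cos (L x)) / tilt_mass M L)). P (S x)"
    using assms(2) by (simp add: AE_density) (auto elim: eventually_mono)
  then show ?thesis
    unfolding tilt_def by (simp add: AE_distr_iff)
qed

end

end

text \<open>Under the tilted laws \<open>S\<close> converges weakly by the continuity theorem, and a
  bounded function may be integrated in the limit if it is continuous almost everywhere. Null sets
  for the limit of \<open>S\<close> remain null after tilting, since the tilt is a density.\<close>

lemma tilted_integral_tendsto:
  fixes f :: "real \<Rightarrow> real"
  assumes M: "\<And>k. prob_space (M k)" "\<And>k. L k \<in> borel_measurable (M k)" "\<And>k. S k \<in> borel_measurable (M k)"
    and M': "prob_space M'" "L' \<in> borel_measurable M'" "S' \<in> borel_measurable M'"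
    and conv: "\<And>u t. (\<lambda>k. CLINT x|M k. iexp (u * L k x + t * S k x)) \<longlonglongrightarrow> (CLINT x|M'. iexp (u * L' x + t * S' x))"
    and f: "f \<in> borel_measurable borel" "\<And>x. \<bar>f x\<bar> \<le> B" "AE x in M'. isCont f (S' x)"
  shows "(\<lambda>k. \<integral>x. (2 + cos (L k x)) * f (S k x) \<partial>M k) \<longlonglongrightarrow> (\<integral>x. (2 + cos (L' x)) * f (S' x) \<partial>M')"
proof -
  note [measurable] = M(2,3) M'(2,3) f(1)
  have tilt_k: "real_distribution (tilt (M k) (L k) (S k))" "1 \<le> tilt_mass (M k) (L k)" for k
    using prob_space.real_distribution_tilt[OF M] prob_space.tilt_mass_ge_1[OF M] by auto
  have tilt': "real_distribution (tilt M' L' S')" "1 \<le> tilt_mass M' L'"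
    using prob_space.real_distribution_tilt[OF M'] prob_space.tilt_mass_ge_1[OF M'] by auto
  have comb: "(\<lambda>k. complex_of_real (tilt_mass (M k) (L k)) * char (tilt (M k) (L k) (S k)) t)
      \<longlonglongrightarrow> complex_of_real (tilt_mass M' L') * char (tilt M' L' S') t" for t
    unfolding prob_space.char_tilt[OF M] prob_space.char_tilt[OF M']
    by (intro tendsto_intros conv) auto
  \<comment> \<open>At 0 every characteristic function is 1, so the masses themselves converge and
    can be divided out.\<close>
  have mass: "(\<lambda>k. complex_of_real (tilt_mass (M k) (L k))) \<longlonglongrightarrow> complex_of_real (tilt_mass M' L')"
    using comb[of 0] by (simp add: real_distribution.char_zero tilt_k tilt')
  have ne: "tilt_mass M' L' \<noteq> 0" "tilt_mass (M k) (L k) \<noteq> 0" for k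
    using tilt'(2) tilt_k(2)[of k] by linarith+
  have "(\<lambda>k. char (tilt (M k) (L k) (S k)) t) \<longlonglongrightarrow> char (tilt M' L' S') t" for t
    using tendsto_divide[OF comb[of t] mass] ne by simp
  then have weak: "weak_conv_m (\<lambda>k. tilt (M k) (L k) (S k)) (tilt M' L' S')"
    by (intro levy_continuity tilt_k tilt')
  have [measurable]: "Measurable.pred borel (isCont f)"
    using f(1) by measurable
  have "AE x in tilt M' L' S'. isCont f x"
    using f(3) by (intro prob_space.AE_tilt M') auto
  then have "emeasure (tilt M' L' S') {x. \<not> isCont f x} = 0"
    by (subst (asm) AE_iff_measurable[OF _ refl]) (auto simp: tilt_def)
  then have "(\<lambda>k. integral\<^sup>L (tilt (M k) (L k) (S k)) f) \<longlonglongrightarrow> integral\<^sup>L (tilt M' L' S') f"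
    using f by (intro weak_conv_imp_bdd_ae_continuous_conv[OF _ _ weak, where B=B] tilt_k tilt') auto
  then have "(\<lambda>k. tilt_mass (M k) (L k) *\<^sub>R integral\<^sup>L (tilt (M k) (L k) (S k)) f)
      \<longlonglongrightarrow> tilt_mass M' L' *\<^sub>R integral\<^sup>L (tilt M' L' S') f"
    using tendsto_Re[OF mass] by (intro tendsto_scaleR) simp_all
  then show ?thesis
    unfolding prob_space.integral_tilt[OF M f(1)] prob_space.integral_tilt[OF M' f(1)] by simp
qed

lemma integral_of_real_parts:
  fixes f g :: "'a \<Rightarrow> real"
  assumes "integrable M f" "integrable M g"
  shows "(CLINT x|M. of_real (f x) + \<i> * of_real (g x)) = of_real (\<integral>x. f x \<partial>M) + \<i> * of_real (\<integral>x. g x \<partial>M)"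
  using assms by (simp add: integral_of_real)

text \<open>The parts of \<open>iexp (L x)\<close> are the cosines of \<open>L x\<close> and of
  \<open>L x - pi / 2\<close>, each obtained from a tilted weight by removing its constant 2. That
  constant is itself expressed by a tilt: for \<open>L = 0\<close> the weight is 3, hence the factor
  2 / 3.\<close>

lemma (in prob_space) integral_iexp_conv_tilted:
  fixes f :: "real \<Rightarrow> real"
  assumes [measurable]: "L \<in> borel_measurable M" "S \<in> borel_measurable M" "f \<in> borel_measurable borel"
    and f: "\<And>x. \<bar>f x\<bar> \<le> B"
  shows "(CLINT x|M. iexp (L x) * f (S x)) =
    of_real ((\<integral>x. (2 + cos (L x)) * f (S x) \<partial>M) - 2 / 3 * (\<integral>x. (2 + cos 0) * f (S x) \<partial>M))
    + \<i> * of_real ((\<integral>x. (2 + cos (L x - pi / 2)) * f (S x) \<partial>M) - 2 / 3 * (\<integral>x. (2 + cos 0) * f (S x) \<partial>M))"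
proof -
  have bd: "\<bar>(2 + cos y) * f z\<bar> \<le> 3 * B" for y z
  proof -
    have "\<bar>2 + cos y\<bar> \<le> 3"
      using abs_cos_le_one[of y] by linarith
    then show ?thesis
      using f[of z] unfolding abs_mult by (intro mult_mono) auto
  qed
  have i: "integrable M (\<lambda>x. (2 + cos (g x)) * f (S x))" if [measurable]: "g \<in> borel_measurable M" for g
    by (rule integrable_of_bounded[where B="3 * B"]) (auto simp only: real_norm_def bd, measurable)
  have "(CLINT x|M. iexp (L x) * f (S x)) = (CLINT x|M.
      of_real ((2 + cos (L x)) * f (S x) - 2 / 3 * ((2 + cos 0) * f (S x)))
      + \<i> * of_real ((2 + cos (L x - pi / 2)) * f (S x) - 2 / 3 * ((2 + cos 0) * f (S x))))"
    by (intro Bochner_Integration.integral_cong refl)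
       (simp add: complex_eq_iff Re_exp Im_exp cos_diff algebra_simps)
  also have "\<dots> = of_real (\<integral>x. (2 + cos (L x)) * f (S x) - 2 / 3 * ((2 + cos 0) * f (S x)) \<partial>M)
      + \<i> * of_real (\<integral>x. (2 + cos (L x - pi / 2)) * f (S x) - 2 / 3 * ((2 + cos 0) * f (S x)) \<partial>M)"
    by (intro integral_of_real_parts Bochner_Integration.integrable_diff integrable_mult_right[OF i[of "\<lambda>_. 0"]] i) auto
  also have "(\<integral>x. (2 + cos (L x)) * f (S x) - 2 / 3 * ((2 + cos 0) * f (S x)) \<partial>M) =
     (\<integral>x. (2 + cos (L x)) * f (S x) \<partial>M) - (\<integral>x. 2 / 3 * ((2 + cos 0) * f (S x)) \<partial>M)"
    by (intro Bochner_Integration.integral_diff integrable_mult_right[OF i[of "\<lambda>_. 0"]] i) auto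
  also have "(\<integral>x. (2 + cos (L x - pi / 2)) * f (S x) - 2 / 3 * ((2 + cos 0) * f (S x)) \<partial>M) =
     (\<integral>x. (2 + cos (L x - pi / 2)) * f (S x) \<partial>M) - (\<integral>x. 2 / 3 * ((2 + cos 0) * f (S x)) \<partial>M)"
    by (intro Bochner_Integration.integral_diff integrable_mult_right[OF i[of "\<lambda>_. 0"]] i) auto
  finally show ?thesis
    by (simp only: integral_mult_right_zero)
qed

text \<open>A mapping theorem in which one component enters through an exponential and the other
  through a function with jumps. Discontinuities are tolerated on a null set of the limit of
  \<open>S\<close>, as a sampling function with steps demands.\<close>

lemma iexp_integral_tendsto:
  fixes f :: "real \<Rightarrow> real"
  assumes M: "\<And>k. prob_space (M k)" "\<And>k. L k \<in> borel_measurable (M k)" "\<And>k. S k \<in> borel_measurable (M k)"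
    and M': "prob_space M'" "L' \<in> borel_measurable M'" "S' \<in> borel_measurable M'"
    and conv: "\<And>u t. (\<lambda>k. CLINT x|M k. iexp (u * L k x + t * S k x)) \<longlonglongrightarrow> (CLINT x|M'. iexp (u * L' x + t * S' x))"
    and f: "f \<in> borel_measurable borel" "\<And>x. \<bar>f x\<bar> \<le> B" "AE x in M'. isCont f (S' x)"
  shows "(\<lambda>k. CLINT x|M k. iexp (L k x) * f (S k x)) \<longlonglongrightarrow> (CLINT x|M'. iexp (L' x) * f (S' x))"
proof -
  \<comment> \<open>Shifting \<open>L\<close> by a constant multiplies the joint transform by a
    constant, so the hypothesis on \<open>L\<close> also covers the imaginary part.\<close>
  have shift: "iexp (u * (x - pi / 2) + y) = iexp (u * x + y) * iexp (- u * pi / 2)" for u x y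
    by (simp add: algebra_simps flip: exp_add)
  have 1: "(\<lambda>k. \<integral>x. (2 + cos (L k x)) * f (S k x) \<partial>M k) \<longlonglongrightarrow> (\<integral>x. (2 + cos (L' x)) * f (S' x) \<partial>M')"
    by (rule tilted_integral_tendsto[OF M M' conv f])
  have 2: "(\<lambda>k. \<integral>x. (2 + cos 0) * f (S k x) \<partial>M k) \<longlonglongrightarrow> (\<integral>x. (2 + cos 0) * f (S' x) \<partial>M')"
    using conv[of 0] by (intro tilted_integral_tendsto[OF M(1) _ M(3) M'(1) _ M'(3) _ f]) auto
  have 3: "(\<lambda>k. \<integral>x. (2 + cos (L k x - pi / 2)) * f (S k x) \<partial>M k) \<longlonglongrightarrow> (\<integral>x. (2 + cos (L' x - pi / 2)) * f (S' x) \<partial>M')"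
  proof (rule tilted_integral_tendsto[OF M(1) _ M(3) M'(1) _ M'(3) _ f])
    show "(\<lambda>k. CLINT x|M k. iexp (u * (L k x - pi / 2) + t * S k x)) \<longlonglongrightarrow> (CLINT x|M'. iexp (u * (L' x - pi / 2) + t * S' x))" for u t
      unfolding shift integral_mult_left_zero by (intro tendsto_intros conv)
  qed (use M M' in auto)
  show ?thesis
    unfolding prob_space.integral_iexp_conv_tilted[OF M f(1,2)] prob_space.integral_iexp_conv_tilted[OF M' f(1,2)]
    by (intro tendsto_intros 1 2 3)
qed

subsection \<open>Random coefficients\<close>

text \<open>Tents of radius \<delta> over a finite net, divided by their sum. The sum is positive on
  \<open>J\<close> because every point of \<open>J\<close> is closer than \<delta> to the net;
  outside \<open>J\<close> it may vanish, and division by 0 then gives the weight 0, which respects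
  the sign and support conditions.\<close>

lemma finite_continuous_partition:
  fixes J :: "'a::metric_space set"
  assumes "compact J" "0 < \<delta>"
  obtains F and \<phi> :: "'a \<Rightarrow> 'a \<Rightarrow> real" where "finite F" "F \<subseteq> J"
    "\<And>c. c \<in> F \<Longrightarrow> continuous_on J (\<phi> c)" "\<And>c x. 0 \<le> \<phi> c x" "\<And>x. x \<in> J \<Longrightarrow> (\<Sum>c\<in>F. \<phi> c x) = 1"
    "\<And>c x. \<phi> c x \<noteq> 0 \<Longrightarrow> dist c x < \<delta>"
proof -
  obtain F where F: "finite F" "F \<subseteq> J" "J \<subseteq> (\<Union>c\<in>F. ball c \<delta>)"
    using compact_imp_seq_compact[OF assms(1)] assms(2) seq_compact_imp_totally_bounded by metis
  define \<phi> where "\<phi> c x = max 0 (\<delta> - dist c x) / (\<Sum>c\<in>F. max 0 (\<delta> - dist c x))" for c x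
  have pos: "0 < (\<Sum>c\<in>F. max 0 (\<delta> - dist c x))" if "x \<in> J" for x
  proof -
    have "x \<in> (\<Union>c\<in>F. ball c \<delta>)"
      using F(3) that by blast
    then obtain c where "c \<in> F" "dist c x < \<delta>"
      by auto
    then show ?thesis
      using F(1) by (intro sum_pos2[of _ c]) auto
  qed
  show thesis
  proof (rule that[OF F(1,2)])
    show "continuous_on J (\<phi> c)" if "c \<in> F" for c
      unfolding \<phi>_def using pos by (intro continuous_intros ballI) (metis less_irrefl)
    show "0 \<le> \<phi> c x" for c x
      unfolding \<phi>_def by (intro divide_nonneg_nonneg sum_nonneg) auto
    show "(\<Sum>c\<in>F. \<phi> c x) = 1" if "x \<in> J" for x
      unfolding \<phi>_def using pos[OF that] by (simp flip: sum_divide_distrib)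
    show "dist c x < \<delta>" if "\<phi> c x \<noteq> 0" for c x
      using that unfolding \<phi>_def by (auto simp: max_def split: if_splits)
  qed
qed

text \<open>Where \<open>\<phi> c (h x)\<close> is nonzero, the coefficients at \<open>h x\<close>
  and at the net point \<open>c\<close> differ by at most \<epsilon>. Since \<open>iexp\<close> is
  1-Lipschitz and the weights sum to 1, freezing costs at most \<open>K * \<epsilon>\<close> times
  the first absolute moments.\<close>

lemma (in prob_space) freeze_coefficients_bound:
  fixes h G\<^sub>0 G\<^sub>1 :: "'a \<Rightarrow> real" and B\<^sub>0 B\<^sub>1 \<psi> :: "real \<Rightarrow> real"
  assumes h[measurable]: "h \<in> borel_measurable M" and J: "\<And>x. x \<in> space M \<Longrightarrow> h x \<in> J"
    and G: "integrable M G\<^sub>0" "integrable M G\<^sub>1"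
    and cont: "continuous_on J B\<^sub>0" "continuous_on J B\<^sub>1" "continuous_on J \<psi>"
    and \<psi>: "\<And>x. x \<in> J \<Longrightarrow> \<bar>\<psi> x\<bar> \<le> K" "0 \<le> \<epsilon>"
    and F: "finite F" "F \<subseteq> J" "\<And>c. c \<in> F \<Longrightarrow> continuous_on J (\<phi> c)" "\<And>c x. 0 \<le> \<phi> c x"
      "\<And>x. x \<in> J \<Longrightarrow> (\<Sum>c\<in>F. \<phi> c x) = 1"
    and near: "\<And>c x. c \<in> F \<Longrightarrow> x \<in> J \<Longrightarrow> \<phi> c x \<noteq> 0 \<Longrightarrow> \<bar>B\<^sub>0 c - B\<^sub>0 x\<bar> \<le> \<epsilon> \<and> \<bar>B\<^sub>1 c - B\<^sub>1 x\<bar> \<le> \<epsilon>"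
  shows "cmod ((CLINT x|M. iexp (B\<^sub>0 (h x) * G\<^sub>0 x + B\<^sub>1 (h x) * G\<^sub>1 x) * \<psi> (h x))
       - (\<Sum>c\<in>F. CLINT x|M. iexp (B\<^sub>0 c * G\<^sub>0 x + B\<^sub>1 c * G\<^sub>1 x) * complex_of_real (\<phi> c (h x) * \<psi> (h x))))
     \<le> K * \<epsilon> * (expectation (\<lambda>x. \<bar>G\<^sub>0 x\<bar>) + expectation (\<lambda>x. \<bar>G\<^sub>1 x\<bar>))"
proof -
  note [measurable] = cont[THEN borel_measurable_continuous_on_compose, OF h J]
    F(3)[THEN borel_measurable_continuous_on_compose, OF _ h J]
    borel_measurable_integrable[OF G(1)] borel_measurable_integrable[OF G(2)]
  have K: "0 \<le> K"
    using \<psi>(1)[OF J] not_empty by (metis all_not_in_conv abs_ge_zero order_trans)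
  have \<phi>1: "\<phi> c x \<le> 1" if "c \<in> F" "x \<in> J" for c x
    using F(5)[OF that(2)] sum_mono2[of F "{c}" "\<lambda>c. \<phi> c x"] F(1,4) that by auto
  have i1: "integrable M (\<lambda>x. iexp (B\<^sub>0 (h x) * G\<^sub>0 x + B\<^sub>1 (h x) * G\<^sub>1 x) * \<psi> (h x))"
    using J by (intro integrable_of_bounded[where B=K]) (auto simp: norm_mult \<psi>)
  have i2: "integrable M (\<lambda>x. iexp (B\<^sub>0 c * G\<^sub>0 x + B\<^sub>1 c * G\<^sub>1 x) * complex_of_real (\<phi> c (h x) * \<psi> (h x)))"
    if c: "c \<in> F" for c
  proof (rule integrable_of_bounded[where B=K])
    have [measurable]: "(\<lambda>x. \<phi> c (h x)) \<in> borel_measurable M"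
      using F(3)[OF c, THEN borel_measurable_continuous_on_compose, OF h J] .
    show "(\<lambda>x. iexp (B\<^sub>0 c * G\<^sub>0 x + B\<^sub>1 c * G\<^sub>1 x) * complex_of_real (\<phi> c (h x) * \<psi> (h x))) \<in> borel_measurable M"
      by measurable
    show "cmod (iexp (B\<^sub>0 c * G\<^sub>0 x + B\<^sub>1 c * G\<^sub>1 x) * complex_of_real (\<phi> c (h x) * \<psi> (h x))) \<le> K" if "x \<in> space M" for x
      using mult_mono[OF \<phi>1[OF c J[OF that]] \<psi>(1)[OF J[OF that]]] F(4)[of c "h x"]
      by (simp add: norm_mult abs_mult)
  qed
  have pointwise: "cmod (iexp (B\<^sub>0 (h x) * G\<^sub>0 x + B\<^sub>1 (h x) * G\<^sub>1 x) * \<psi> (h x)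
       - (\<Sum>c\<in>F. iexp (B\<^sub>0 c * G\<^sub>0 x + B\<^sub>1 c * G\<^sub>1 x) * complex_of_real (\<phi> c (h x) * \<psi> (h x))))
     \<le> K * \<epsilon> * (\<bar>G\<^sub>0 x\<bar> + \<bar>G\<^sub>1 x\<bar>)" if x: "x \<in> space M" for x
  proof -
    let ?y = "h x"
    let ?e = "\<lambda>c. iexp (B\<^sub>0 c * G\<^sub>0 x + B\<^sub>1 c * G\<^sub>1 x)"
    have y: "?y \<in> J" using J x by auto
    \<comment> \<open>Inserting the partition turns both expressions into sums over the same net
      points, which can be compared term by term.\<close>
    have "?e ?y * \<psi> ?y = ?e ?y * complex_of_real ((\<Sum>c\<in>F. \<phi> c ?y) * \<psi> ?y)"
      by (simp add: F(5)[OF y])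
    also have "\<dots> = (\<Sum>c\<in>F. ?e ?y * complex_of_real (\<phi> c ?y * \<psi> ?y))"
      by (simp add: sum_distrib_left sum_distrib_right)
    finally have "cmod (?e ?y * \<psi> ?y - (\<Sum>c\<in>F. ?e c * complex_of_real (\<phi> c ?y * \<psi> ?y)))
        = cmod (\<Sum>c\<in>F. (?e ?y - ?e c) * complex_of_real (\<phi> c ?y * \<psi> ?y))"
      by (simp add: sum_subtractf algebra_simps)
    also have "\<dots> \<le> (\<Sum>c\<in>F. (\<epsilon> * (\<bar>G\<^sub>0 x\<bar> + \<bar>G\<^sub>1 x\<bar>)) * (\<phi> c ?y * K))"
    proof (rule sum_norm_le)
      fix c assume c: "c \<in> F"
      show "cmod ((?e ?y - ?e c) * complex_of_real (\<phi> c ?y * \<psi> ?y)) \<le> (\<epsilon> * (\<bar>G\<^sub>0 x\<bar> + \<bar>G\<^sub>1 x\<bar>)) * (\<phi> c ?y * K)"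
      proof (cases "\<phi> c ?y = 0")
        case False
        have "cmod (?e ?y - ?e c) \<le> \<bar>(B\<^sub>0 ?y * G\<^sub>0 x + B\<^sub>1 ?y * G\<^sub>1 x) - (B\<^sub>0 c * G\<^sub>0 x + B\<^sub>1 c * G\<^sub>1 x)\<bar>"
          by (rule norm_iexp_diff_le)
        also have "\<dots> = \<bar>(B\<^sub>0 ?y - B\<^sub>0 c) * G\<^sub>0 x + (B\<^sub>1 ?y - B\<^sub>1 c) * G\<^sub>1 x\<bar>"
          by (simp add: algebra_simps)
        also have "\<dots> \<le> \<bar>B\<^sub>0 ?y - B\<^sub>0 c\<bar> * \<bar>G\<^sub>0 x\<bar> + \<bar>B\<^sub>1 ?y - B\<^sub>1 c\<bar> * \<bar>G\<^sub>1 x\<bar>"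
          unfolding abs_mult[symmetric] by (rule abs_triangle_ineq)
        also have "\<dots> \<le> \<epsilon> * \<bar>G\<^sub>0 x\<bar> + \<epsilon> * \<bar>G\<^sub>1 x\<bar>"
          using near[OF c y False] by (intro add_mono mult_right_mono) auto
        finally have "cmod (?e ?y - ?e c) \<le> \<epsilon> * (\<bar>G\<^sub>0 x\<bar> + \<bar>G\<^sub>1 x\<bar>)"
          by (simp add: algebra_simps)
        moreover have "cmod (complex_of_real (\<phi> c ?y * \<psi> ?y)) \<le> \<phi> c ?y * K"
          using F(4) \<psi>(1)[OF y] by (simp add: norm_mult mult_left_mono)
        ultimately show ?thesis
          unfolding norm_mult[of "?e ?y - ?e c"] using \<psi>(2) by (intro mult_mono) auto
      qed simp
    qed
    also have "\<dots> = K * \<epsilon> * (\<bar>G\<^sub>0 x\<bar> + \<bar>G\<^sub>1 x\<bar>) * (\<Sum>c\<in>F. \<phi> c ?y)"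
      by (simp add: sum_distrib_left mult_ac)
    finally show ?thesis
      by (simp add: F(5)[OF y])
  qed
  have eq: "(CLINT x|M. iexp (B\<^sub>0 (h x) * G\<^sub>0 x + B\<^sub>1 (h x) * G\<^sub>1 x) * \<psi> (h x))
       - (\<Sum>c\<in>F. CLINT x|M. iexp (B\<^sub>0 c * G\<^sub>0 x + B\<^sub>1 c * G\<^sub>1 x) * complex_of_real (\<phi> c (h x) * \<psi> (h x)))
     = (CLINT x|M. iexp (B\<^sub>0 (h x) * G\<^sub>0 x + B\<^sub>1 (h x) * G\<^sub>1 x) * \<psi> (h x)
       - (\<Sum>c\<in>F. iexp (B\<^sub>0 c * G\<^sub>0 x + B\<^sub>1 c * G\<^sub>1 x) * complex_of_real (\<phi> c (h x) * \<psi> (h x))))"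
    using i1 i2 by (subst Bochner_Integration.integral_diff) (auto intro!: Bochner_Integration.integrable_sum simp: Bochner_Integration.integral_sum)
  show ?thesis
    unfolding eq
  proof (rule order_trans[OF integral_norm_bound])
    have "(\<integral>x. cmod (iexp (B\<^sub>0 (h x) * G\<^sub>0 x + B\<^sub>1 (h x) * G\<^sub>1 x) * \<psi> (h x)
       - (\<Sum>c\<in>F. iexp (B\<^sub>0 c * G\<^sub>0 x + B\<^sub>1 c * G\<^sub>1 x) * complex_of_real (\<phi> c (h x) * \<psi> (h x)))) \<partial>M)
      \<le> (\<integral>x. K * \<epsilon> * (\<bar>G\<^sub>0 x\<bar> + \<bar>G\<^sub>1 x\<bar>) \<partial>M)"
    using G i1 i2 pointwise
    by (intro integral_mono)
       (auto intro!: integrable_norm Bochner_Integration.integrable_diff Bochner_Integration.integrable_sum)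
  also have "\<dots> = K * \<epsilon> * (expectation (\<lambda>x. \<bar>G\<^sub>0 x\<bar>) + expectation (\<lambda>x. \<bar>G\<^sub>1 x\<bar>))"
    unfolding integral_mult_right_zero
    by (simp only: Bochner_Integration.integral_add[OF integrable_abs[OF G(1)] integrable_abs[OF G(2)]])
  finally show "(\<integral>x. cmod (iexp (B\<^sub>0 (h x) * G\<^sub>0 x + B\<^sub>1 (h x) * G\<^sub>1 x) * \<psi> (h x)
       - (\<Sum>c\<in>F. iexp (B\<^sub>0 c * G\<^sub>0 x + B\<^sub>1 c * G\<^sub>1 x) * complex_of_real (\<phi> c (h x) * \<psi> (h x)))) \<partial>M)
     \<le> K * \<epsilon> * (expectation (\<lambda>x. \<bar>G\<^sub>0 x\<bar>) + expectation (\<lambda>x. \<bar>G\<^sub>1 x\<bar>))" .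
  qed
qed

text \<open>Frozen terms have constant coefficients and a weight that is a continuous function of
  \<open>h k\<close>, so \<open>conv\<close> applies to each of the finitely many. Uniform
  continuity on the compact range makes the freezing error small along the sequence and in the limit
  alike.\<close>

lemma random_coefficients_tendsto:
  fixes G\<^sub>0 G\<^sub>1 h :: "nat \<Rightarrow> 'a \<Rightarrow> real" and A\<^sub>0 A\<^sub>1 H :: "'b \<Rightarrow> real"
  assumes M: "\<And>k. prob_space (M k)" "\<And>k. h k \<in> borel_measurable (M k)" "\<And>k x. x \<in> space (M k) \<Longrightarrow> h k x \<in> J"
      "\<And>k. integrable (M k) (G\<^sub>0 k)" "\<And>k. integrable (M k) (G\<^sub>1 k)"
      "\<And>k. (\<integral>x. \<bar>G\<^sub>0 k x\<bar> \<partial>M k) \<le> C" "\<And>k. (\<integral>x. \<bar>G\<^sub>1 k x\<bar> \<partial>M k) \<le> C"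
    and M': "prob_space M'" "H \<in> borel_measurable M'" "\<And>x. x \<in> space M' \<Longrightarrow> H x \<in> J"
      "integrable M' A\<^sub>0" "integrable M' A\<^sub>1"
    and J: "compact J"
    and conv: "\<And>a b \<kappa>. continuous_on J \<kappa> \<Longrightarrow>
      (\<lambda>k. CLINT x|M k. iexp (a * G\<^sub>0 k x + b * G\<^sub>1 k x) * of_real (\<kappa> (h k x)))
        \<longlonglongrightarrow> (CLINT x|M'. iexp (a * A\<^sub>0 x + b * A\<^sub>1 x) * of_real (\<kappa> (H x)))"
    and cont: "continuous_on J B\<^sub>0" "continuous_on J B\<^sub>1" "continuous_on J \<psi>"
  shows "(\<lambda>k. CLINT x|M k. iexp (B\<^sub>0 (h k x) * G\<^sub>0 k x + B\<^sub>1 (h k x) * G\<^sub>1 k x) * of_real (\<psi> (h k x)))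
    \<longlonglongrightarrow> (CLINT x|M'. iexp (B\<^sub>0 (H x) * A\<^sub>0 x + B\<^sub>1 (H x) * A\<^sub>1 x) * of_real (\<psi> (H x)))"
proof (rule tendsto_by_approximation)
  fix \<epsilon> :: real assume \<epsilon>: "0 < \<epsilon>"
  obtain K where K: "0 < K" "\<And>x. x \<in> J \<Longrightarrow> \<bar>\<psi> x\<bar> \<le> K"
    using compact_imp_bounded[OF compact_continuous_image[OF cont(3) J]]
    unfolding bounded_pos by auto
  \<comment> \<open>One constant dominates the first moments both along the sequence and in the
    limit; the summand 1 makes it positive, so that the precision \<eta> can be defined by
    division.\<close>
  define C' where "C' = 1 + 2 * \<bar>C\<bar> + (\<integral>x. \<bar>A\<^sub>0 x\<bar> \<partial>M') + (\<integral>x. \<bar>A\<^sub>1 x\<bar> \<partial>M')"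
  have C': "0 < C'"
    unfolding C'_def by (intro add_pos_nonneg) auto
  define \<eta> where "\<eta> = \<epsilon> / (K * C')"
  have \<eta>: "0 < \<eta>" "K * \<eta> * C' = \<epsilon>"
    using \<epsilon> K C' by (auto simp: \<eta>_def)
  obtain \<delta>\<^sub>0 where \<delta>\<^sub>0: "0 < \<delta>\<^sub>0" "\<And>x y. x \<in> J \<Longrightarrow> y \<in> J \<Longrightarrow> dist y x < \<delta>\<^sub>0 \<Longrightarrow> dist (B\<^sub>0 y) (B\<^sub>0 x) < \<eta>"
    using compact_uniformly_continuous[OF cont(1) J] \<eta>(1) unfolding uniformly_continuous_on_def by metis
  obtain \<delta>\<^sub>1 where \<delta>\<^sub>1: "0 < \<delta>\<^sub>1" "\<And>x y. x \<in> J \<Longrightarrow> y \<in> J \<Longrightarrow> dist y x < \<delta>\<^sub>1 \<Longrightarrow> dist (B\<^sub>1 y) (B\<^sub>1 x) < \<eta>"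
    using compact_uniformly_continuous[OF cont(2) J] \<eta>(1) unfolding uniformly_continuous_on_def by metis
  obtain F \<phi> where F: "finite F" "F \<subseteq> J" "\<And>c. c \<in> F \<Longrightarrow> continuous_on J (\<phi> c)" "\<And>c x. (0::real) \<le> \<phi> c x"
      "\<And>x. x \<in> J \<Longrightarrow> (\<Sum>c\<in>F. \<phi> c x) = 1" "\<And>c x. \<phi> c x \<noteq> 0 \<Longrightarrow> dist c x < min \<delta>\<^sub>0 \<delta>\<^sub>1"
    using finite_continuous_partition[OF J, of "min \<delta>\<^sub>0 \<delta>\<^sub>1"] \<delta>\<^sub>0(1) \<delta>\<^sub>1(1) by (metis min_less_iff_conj)
  have near: "\<bar>B\<^sub>0 c - B\<^sub>0 x\<bar> \<le> \<eta> \<and> \<bar>B\<^sub>1 c - B\<^sub>1 x\<bar> \<le> \<eta>" if "c \<in> F" "x \<in> J" "\<phi> c x \<noteq> 0" for c x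
    using \<delta>\<^sub>0(2)[of x c] \<delta>\<^sub>1(2)[of x c] F(6)[OF that(3)] F(2) that by (auto simp: dist_real_def)
  let ?b = "\<lambda>k. \<Sum>c\<in>F. CLINT x|M k. iexp (B\<^sub>0 c * G\<^sub>0 k x + B\<^sub>1 c * G\<^sub>1 k x) * of_real (\<phi> c (h k x) * \<psi> (h k x))"
  let ?y = "\<Sum>c\<in>F. CLINT x|M'. iexp (B\<^sub>0 c * A\<^sub>0 x + B\<^sub>1 c * A\<^sub>1 x) * of_real (\<phi> c (H x) * \<psi> (H x))"
  show "\<exists>b y. b \<longlonglongrightarrow> y \<and>
      (\<forall>\<^sub>F k in sequentially. cmod ((CLINT x|M k. iexp (B\<^sub>0 (h k x) * G\<^sub>0 k x + B\<^sub>1 (h k x) * G\<^sub>1 k x) * of_real (\<psi> (h k x))) - b k) \<le> \<epsilon>) \<and>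
      cmod ((CLINT x|M'. iexp (B\<^sub>0 (H x) * A\<^sub>0 x + B\<^sub>1 (H x) * A\<^sub>1 x) * of_real (\<psi> (H x))) - y) \<le> \<epsilon>"
  proof (intro exI[of _ ?b] exI[of _ ?y] conjI always_eventually allI)
    show "?b \<longlonglongrightarrow> ?y"
      using F(3) cont(3) by (intro tendsto_sum conv continuous_intros)
    show "cmod ((CLINT x|M k. iexp (B\<^sub>0 (h k x) * G\<^sub>0 k x + B\<^sub>1 (h k x) * G\<^sub>1 k x) * of_real (\<psi> (h k x))) - ?b k) \<le> \<epsilon>" for k
    proof -
      have "cmod ((CLINT x|M k. iexp (B\<^sub>0 (h k x) * G\<^sub>0 k x + B\<^sub>1 (h k x) * G\<^sub>1 k x) * of_real (\<psi> (h k x))) - ?b k)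
          \<le> K * \<eta> * ((\<integral>x. \<bar>G\<^sub>0 k x\<bar> \<partial>M k) + (\<integral>x. \<bar>G\<^sub>1 k x\<bar> \<partial>M k))"
        by (rule prob_space.freeze_coefficients_bound[OF M(1-5) cont K(2) less_imp_le[OF \<eta>(1)] F(1-5) near])
      also have "\<dots> \<le> K * \<eta> * C'"
      proof -
        have "0 \<le> (\<integral>x. \<bar>A\<^sub>0 x\<bar> \<partial>M')" "0 \<le> (\<integral>x. \<bar>A\<^sub>1 x\<bar> \<partial>M')" by auto
        then have "(\<integral>x. \<bar>G\<^sub>0 k x\<bar> \<partial>M k) + (\<integral>x. \<bar>G\<^sub>1 k x\<bar> \<partial>M k) \<le> C'"
          unfolding C'_def using M(6)[of k] M(7)[of k] by linarith
        then show ?thesis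
          using K \<eta> by (intro mult_left_mono) auto
      qed
      finally show ?thesis
        using \<eta> by simp
    qed
    have "cmod ((CLINT x|M'. iexp (B\<^sub>0 (H x) * A\<^sub>0 x + B\<^sub>1 (H x) * A\<^sub>1 x) * of_real (\<psi> (H x))) - ?y)
        \<le> K * \<eta> * ((\<integral>x. \<bar>A\<^sub>0 x\<bar> \<partial>M') + (\<integral>x. \<bar>A\<^sub>1 x\<bar> \<partial>M'))"
      by (rule prob_space.freeze_coefficients_bound[OF M' cont K(2) less_imp_le[OF \<eta>(1)] F(1-5) near])
    also have "\<dots> \<le> K * \<eta> * C'"
      unfolding C'_def using K \<eta> by (intro mult_left_mono) auto
    finally show "cmod ((CLINT x|M'. iexp (B\<^sub>0 (H x) * A\<^sub>0 x + B\<^sub>1 (H x) * A\<^sub>1 x) * of_real (\<psi> (H x))) - ?y) \<le> \<epsilon>"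
      using \<eta> by simp
  qed
qed

subsection \<open>The limit law\<close>

abbreviation normal2 :: "(real \<times> real) measure" where
  "normal2 \<equiv> std_normal_distribution \<Otimes>\<^sub>M std_normal_distribution"

text \<open>The Cholesky factor of the correlation matrix, applied to two independent standard
  normal variables.\<close>

definition correlate :: "real \<Rightarrow> real \<times> real \<Rightarrow> real \<times> real" where
  "correlate \<rho> = (\<lambda>(x, z). (x, \<rho> * x + sqrt (1 - \<rho>\<^sup>2) * z))"

lemma borel_measurable_fst_borel[measurable]: "fst \<in> borel_measurable borel"
  and borel_measurable_snd_borel[measurable]: "snd \<in> borel_measurable borel"
  by (auto intro!: borel_measurable_continuous_onI continuous_intros)

lemma measurable_correlate[measurable (raw)]:
  assumes [measurable]: "r \<in> borel_measurable M" "f \<in> borel_measurable M"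
  shows "(\<lambda>x. correlate (r x) (f x)) \<in> borel_measurable M"
  unfolding correlate_def case_prod_beta by measurable

interpretation std_normal: prob_space std_normal_distribution
  using real_dist_normal_dist by (simp add: real_distribution_def)

interpretation normal2: pair_prob_space std_normal_distribution std_normal_distribution ..

lemma sets_normal2[measurable_cong]: "sets normal2 = sets borel"
proof -
  have "sets normal2 = sets (borel \<Otimes>\<^sub>M borel)"
    by (intro sets_pair_measure_cong) auto
  then show ?thesis
    unfolding borel_prod .
qed

lemma space_normal2[simp]: "space normal2 = UNIV"
  by (simp add: space_pair_measure)

text \<open>Under y = \<rho> x + s z, with s the root of 1 - \<rho>^2, the quadratic form in the
  exponent becomes s^2 (x^2 + z^2), the exponential factorises, and the Jacobian s cancels the root
  in the normalising constant.\<close>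

lemma binormal_eq_distr:
  assumes "\<bar>\<rho>\<bar> < 1"
  shows "binormal \<rho> = distr normal2 borel (correlate \<rho>)"
proof (rule measure_eqI)
  show "sets (binormal \<rho>) = sets (distr normal2 borel (correlate \<rho>))"
    by (simp add: binormal_def)
  fix A assume "A \<in> sets (binormal \<rho>)"
  then have [measurable]: "A \<in> sets borel"
    by (simp add: binormal_def)
  define s where "s = sqrt (1 - \<rho>\<^sup>2)"
  have \<rho>: "\<rho>\<^sup>2 < 1"
    using assms by (simp add: abs_square_less_1)
  then have s: "0 < s" "s\<^sup>2 = 1 - \<rho>\<^sup>2"
    by (auto simp: s_def)
  let ?d = "\<lambda>x y. ennreal (exp (- (x\<^sup>2 - 2 * \<rho> * x * y + y\<^sup>2) / (2 * (1 - \<rho>\<^sup>2))) / (2 * pi * sqrt (1 - \<rho>\<^sup>2)))"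
  have dens: "?d x (\<rho> * x + s * z) = ennreal (std_normal_density x) * ennreal (std_normal_density z) / ennreal s" for x z
  proof -
    have e: "1 - \<rho>\<^sup>2 = s\<^sup>2" "sqrt (s\<^sup>2) = s"
      using s by (auto simp: s_def)
    have "x\<^sup>2 - 2 * \<rho> * x * (\<rho> * x + s * z) + (\<rho> * x + s * z)\<^sup>2 = (1 - \<rho>\<^sup>2) * x\<^sup>2 + s\<^sup>2 * z\<^sup>2"
      by (simp add: algebra_simps power2_eq_square)
    then have "x\<^sup>2 - 2 * \<rho> * x * (\<rho> * x + s * z) + (\<rho> * x + s * z)\<^sup>2 = s\<^sup>2 * (x\<^sup>2 + z\<^sup>2)"
      unfolding e by (simp only: distrib_left)
    then have "- (x\<^sup>2 - 2 * \<rho> * x * (\<rho> * x + s * z) + (\<rho> * x + s * z)\<^sup>2) / (2 * (1 - \<rho>\<^sup>2)) = - (s\<^sup>2 * (x\<^sup>2 + z\<^sup>2)) / (2 * s\<^sup>2)"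
      unfolding e by simp
    also have "\<dots> = - x\<^sup>2 / 2 + - z\<^sup>2 / 2"
      using s(1) by (simp add: field_simps)
    finally have "exp (- (x\<^sup>2 - 2 * \<rho> * x * (\<rho> * x + s * z) + (\<rho> * x + s * z)\<^sup>2) / (2 * (1 - \<rho>\<^sup>2))) / (2 * pi * sqrt (1 - \<rho>\<^sup>2))
        = exp (- x\<^sup>2 / 2) * exp (- z\<^sup>2 / 2) / (2 * pi * s)"
      by (simp only: exp_add e)
    also have "\<dots> = std_normal_density x * std_normal_density z / s"
      by (simp add: std_normal_density_def)
    finally show ?thesis
      using s(1) by (simp only:) (simp add: ennreal_mult divide_ennreal flip: ennreal_mult)
  qed
  have "emeasure (binormal \<rho>) A = (\<integral>\<^sup>+(x, y). ?d x y * indicator A (x, y) \<partial>(lborel \<Otimes>\<^sub>M lborel))"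
    unfolding binormal_def by (subst emeasure_density) (auto simp: lborel_prod split_beta')
  also have "\<dots> = (\<integral>\<^sup>+x. \<integral>\<^sup>+y. ?d x y * indicator A (x, y) \<partial>lborel \<partial>lborel)"
    by (subst lborel.nn_integral_fst[symmetric]) auto
  also have "\<dots> = (\<integral>\<^sup>+x. ennreal s * (\<integral>\<^sup>+z. ?d x (\<rho> * x + s * z) * indicator A (x, \<rho> * x + s * z) \<partial>lborel) \<partial>lborel)"
    using s by (intro nn_integral_cong, subst nn_integral_real_affine[where c=s and t="\<rho> * _"]) auto
  also have "\<dots> = (\<integral>\<^sup>+x. (\<integral>\<^sup>+z. ennreal (std_normal_density x) * (ennreal (std_normal_density z) * indicator A (x, \<rho> * x + s * z)) \<partial>lborel) \<partial>lborel)"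
  proof (subst nn_integral_cmult[symmetric], measurable, intro nn_integral_cong)
    fix x z
    have "ennreal s * (a / ennreal s) = a" for a
      using s(1) by (simp add: ennreal_divide_times mult_divide_eq_ennreal mult.commute ennreal_times_divide)
    then show "ennreal s * (?d x (\<rho> * x + s * z) * indicator A (x, \<rho> * x + s * z)) =
        ennreal (std_normal_density x) * (ennreal (std_normal_density z) * indicator A (x, \<rho> * x + s * z))"
      unfolding dens by (metis mult.assoc)
  qed
  also have "\<dots> = (\<integral>\<^sup>+x. \<integral>\<^sup>+z. indicator A (correlate \<rho> (x, z)) \<partial>std_normal_distribution \<partial>std_normal_distribution)"
    by (simp add: nn_integral_density nn_integral_cmult correlate_def s_def)
  also have "\<dots> = (\<integral>\<^sup>+x. indicator A (correlate \<rho> x) \<partial>normal2)"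
    by (subst std_normal.nn_integral_fst) auto
  also have "\<dots> = emeasure (distr normal2 borel (correlate \<rho>)) A"
    by (simp add: nn_integral_distr flip: nn_integral_indicator)
  finally show "emeasure (binormal \<rho>) A = emeasure (distr normal2 borel (correlate \<rho>)) A" .
qed

lemma prob_space_binormal: "\<bar>\<rho>\<bar> < 1 \<Longrightarrow> prob_space (binormal \<rho>)"
  by (auto simp: binormal_eq_distr intro!: normal2.prob_space_distr)

lemma sets_binormal[simp, measurable_cong]: "sets (binormal \<rho>) = sets borel"
  and space_binormal[simp]: "space (binormal \<rho>) = UNIV"
  by (simp_all add: binormal_def)

lemma char_std_normal: "(CLINT x|std_normal_distribution. iexp (t * x)) = of_real (exp (- t\<^sup>2 / 2))"
  using char_std_normal_distribution by (auto simp: char_def fun_eq_iff)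

text \<open>In terms of the Cholesky factor the exponent is (a + b \<rho>) x + b s z, so
  independence splits the transform and the two variances add up to a^2 + 2 \<rho> a b +
  b^2.\<close>

lemma char_binormal:
  assumes "\<bar>\<rho>\<bar> < 1"
  shows "(CLINT y|binormal \<rho>. iexp (a * fst y + b * snd y)) = of_real (exp (- (a\<^sup>2 + 2 * \<rho> * a * b + b\<^sup>2) / 2))"
proof -
  define s where "s = sqrt (1 - \<rho>\<^sup>2)"
  have s: "s\<^sup>2 = 1 - \<rho>\<^sup>2"
    using assms by (auto simp: s_def abs_square_le_1)
  have "(CLINT y|binormal \<rho>. iexp (a * fst y + b * snd y)) = (CLINT y|normal2. iexp ((a + b * \<rho>) * fst y) * iexp (b * s * snd y))"
    unfolding binormal_eq_distr[OF assms]
  proof (subst integral_distr)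
    show "correlate \<rho> \<in> normal2 \<rightarrow>\<^sub>M borel"
      using measurable_correlate[of "\<lambda>_. \<rho>" normal2 "\<lambda>x. x"] by simp
    show "(\<lambda>y. iexp (a * fst y + b * snd y)) \<in> borel_measurable borel"
      by (auto intro!: borel_measurable_continuous_onI continuous_intros)
    show "(CLINT x|normal2. iexp (a * fst (correlate \<rho> x) + b * snd (correlate \<rho> x)))
        = (CLINT y|normal2. iexp ((a + b * \<rho>) * fst y) * iexp (b * s * snd y))"
      by (intro Bochner_Integration.integral_cong refl)
         (simp add: correlate_def case_prod_beta s_def[symmetric] algebra_simps flip: exp_add)
  qed
  also have "\<dots> = (CLINT x|std_normal_distribution. CLINT z|std_normal_distribution. iexp ((a + b * \<rho>) * x) * iexp (b * s * z))"
    by (subst normal2.integral_fst'[symmetric]) (auto intro!: normal2.integrable_of_bounded[where B=1] simp: norm_mult)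
  also have "\<dots> = of_real (exp (- (a + b * \<rho>)\<^sup>2 / 2)) * of_real (exp (- (b * s)\<^sup>2 / 2))"
    by (simp only: integral_mult_right_zero integral_mult_left_zero char_std_normal)
  also have "\<dots> = of_real (exp (- (a + b * \<rho>)\<^sup>2 / 2 + - (b * s)\<^sup>2 / 2))"
    by (simp only: exp_add of_real_mult)
  also have "- (a + b * \<rho>)\<^sup>2 / 2 + - (b * s)\<^sup>2 / 2 = - (a\<^sup>2 + 2 * \<rho> * a * b + b\<^sup>2) / 2"
    unfolding power_mult_distrib s by (simp add: power2_eq_square field_simps)
  finally show ?thesis .
qed

lemma integrable_binormal:
  assumes "\<bar>\<rho>\<bar> < 1"
  shows "integrable (binormal \<rho>) (\<lambda>y. fst y)" "integrable (binormal \<rho>) (\<lambda>y. snd y)"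
proof -
  have 1: "integrable std_normal_distribution (\<lambda>x. x)"
    using integrable_std_normal_distribution_moment[of 1] by simp
  have f: "integrable normal2 (\<lambda>y. fst y)"
    by (rule normal2.Fubini_integrable) (use 1 in \<open>auto simp: std_normal.prob_space\<close>)
  have "integrable normal2 (\<lambda>y. snd y)"
    by (rule normal2.Fubini_integrable) (use 1 in auto)
  with f show "integrable (binormal \<rho>) (\<lambda>y. fst y)" "integrable (binormal \<rho>) (\<lambda>y. snd y)"
    unfolding binormal_eq_distr[OF assms] by (simp_all add: integrable_distr_eq correlate_def case_prod_beta)
qed

text \<open>Given the first coordinate, the affine form is a normal variable with nonzero slope
  \<open>b * sqrt (1 - \<rho>\<^sup>2)\<close>, so Lebesgue null sets stay null. This carries almost
  everywhere continuity of the sampling function over to the limiting pilot statistic.\<close>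

lemma AE_binormal_affine:
  assumes "\<bar>\<rho>\<bar> < 1" "b \<noteq> 0" "AE x in lborel. P x" "Measurable.pred borel P"
  shows "AE y in binormal \<rho>. P (a * fst y + b * snd y + d)"
proof -
  define s where "s = b * sqrt (1 - \<rho>\<^sup>2)"
  have \<rho>: "\<rho>\<^sup>2 < 1"
    using assms by (simp add: abs_square_less_1)
  then have s: "s \<noteq> 0"
    using assms(2) by (auto simp: s_def)
  note [measurable] = assms(4)
  have "AE z in std_normal_distribution. P (r + s * z)" for r
  proof -
    have "AE z in lborel. P (r + s * z)"
      using AE_borel_affine[OF s, of P r] assms(3,4) lborel_distr_plus by simp
    then show ?thesis
      by (auto simp: AE_density elim: eventually_mono)
  qed
  then have "AE x in std_normal_distribution. AE z in std_normal_distribution. P (((a + b * \<rho>) * x + d) + s * z)"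
    by simp
  moreover have "{y \<in> space normal2. P (((a + b * \<rho>) * fst y + d) + s * snd y)} \<in> sets normal2"
    by measurable
  ultimately have "AE y in normal2. P (((a + b * \<rho>) * fst y + d) + s * snd y)"
    using normal2.AE_pair_measure[of "\<lambda>y. P (((a + b * \<rho>) * fst y + d) + s * snd y)"] by simp
  then have "AE y in normal2. P (a * fst (correlate \<rho> y) + b * snd (correlate \<rho> y) + d)"
    by (auto simp: correlate_def s_def algebra_simps split: prod.splits)
  then show ?thesis
    unfolding binormal_eq_distr[OF assms(1)] by (subst AE_distr_iff) auto
qed

context
  fixes \<rho>\<^sub>1 :: real and \<rho>\<^sub>2 :: "real \<times> real \<Rightarrow> real"
  assumes \<rho>\<^sub>1: "\<bar>\<rho>\<^sub>1\<bar> < 1" and \<rho>\<^sub>2: "\<And>y. \<bar>\<rho>\<^sub>2 y\<bar> < 1" and [measurable]: "\<rho>\<^sub>2 \<in> borel_measurable borel"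
begin

text \<open>After writing the kernel as an image of \<open>normal2\<close>, the parameter
  \<open>y\<close> sits only in the map, and joint measurability of \<open>correlate\<close> is all
  that is left.\<close>

lemma measurable_binormal_kernel:
  "(\<lambda>y. distr (binormal (\<rho>\<^sub>2 y)) borel (Pair y)) \<in> borel \<rightarrow>\<^sub>M subprob_algebra borel"
proof -
  have "(\<lambda>y. distr normal2 borel (\<lambda>v. (y, correlate (\<rho>\<^sub>2 y) v))) \<in> borel \<rightarrow>\<^sub>M subprob_algebra borel"
  proof (rule measurable_distr2)
    show "(\<lambda>y. normal2) \<in> borel \<rightarrow>\<^sub>M subprob_algebra normal2"
      by (intro measurable_const) (auto simp: space_subprob_algebra intro: normal2.subprob_space_axioms)
  qed measurable
  then show ?thesis
    by (simp add: binormal_eq_distr \<rho>\<^sub>2 distr_distr comp_def)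
qed

text \<open>Both vectors are driven by independent noise, so the mixture is the image of one product
  measure under one measurable map; integrals against it then follow from Fubini.\<close>

lemma binormal_bind_eq_distr:
  "binormal \<rho>\<^sub>1 \<bind> (\<lambda>y. distr (binormal (\<rho>\<^sub>2 y)) borel (Pair y))
     = distr (binormal \<rho>\<^sub>1 \<Otimes>\<^sub>M normal2) borel (\<lambda>(y, v). (y, correlate (\<rho>\<^sub>2 y) v))"
    (is "?L = ?R")
proof (rule measure_eqI)
  interpret B: prob_space "binormal \<rho>\<^sub>1"
    by (rule prob_space_binormal[OF \<rho>\<^sub>1])
  interpret P: pair_prob_space "binormal \<rho>\<^sub>1" normal2 ..
  have K: "(\<lambda>y. distr (binormal (\<rho>\<^sub>2 y)) borel (Pair y)) \<in> binormal \<rho>\<^sub>1 \<rightarrow>\<^sub>M subprob_algebra borel"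
    using measurable_binormal_kernel by simp
  show sets: "sets ?L = sets ?R"
    using sets_bind[OF sets_kernel[OF K]] by simp
  fix A assume "A \<in> sets ?L"
  then have [measurable]: "A \<in> sets borel"
    by (simp add: sets)
  have "emeasure ?L A = (\<integral>\<^sup>+y. emeasure (distr (binormal (\<rho>\<^sub>2 y)) borel (Pair y)) A \<partial>binormal \<rho>\<^sub>1)"
    by (rule emeasure_bind[OF _ K]) auto
  also have "\<dots> = (\<integral>\<^sup>+y. \<integral>\<^sup>+v. indicator A (y, correlate (\<rho>\<^sub>2 y) v) \<partial>normal2 \<partial>binormal \<rho>\<^sub>1)"
    by (intro nn_integral_cong)
       (simp add: binormal_eq_distr \<rho>\<^sub>2 distr_distr comp_def nn_integral_distr flip: nn_integral_indicator)
  also have "\<dots> = (\<integral>\<^sup>+x. indicator A ((\<lambda>(y, v). (y, correlate (\<rho>\<^sub>2 y) v)) x) \<partial>(binormal \<rho>\<^sub>1 \<Otimes>\<^sub>M normal2))"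
    by (subst normal2.nn_integral_fst[symmetric]) auto
  also have "\<dots> = emeasure ?R A"
    by (simp add: nn_integral_distr flip: nn_integral_indicator)
  finally show "emeasure ?L A = emeasure ?R A" .
qed

lemma prob_space_binormal_bind: "prob_space (binormal \<rho>\<^sub>1 \<bind> (\<lambda>y. distr (binormal (\<rho>\<^sub>2 y)) borel (Pair y)))"
proof -
  interpret B: prob_space "binormal \<rho>\<^sub>1"
    by (rule prob_space_binormal[OF \<rho>\<^sub>1])
  interpret P: pair_prob_space "binormal \<rho>\<^sub>1" normal2 ..
  show ?thesis
    unfolding binormal_bind_eq_distr by (rule P.prob_space_distr) measurable
qed

lemma sets_binormal_bind: "sets (binormal \<rho>\<^sub>1 \<bind> (\<lambda>y. distr (binormal (\<rho>\<^sub>2 y)) borel (Pair y))) = sets borel"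
  unfolding binormal_bind_eq_distr by simp

lemma integral_binormal_bind:
  fixes F :: "(real \<times> real) \<times> (real \<times> real) \<Rightarrow> complex"
  assumes [measurable]: "F \<in> borel_measurable borel" and F: "\<And>x. norm (F x) \<le> B"
  shows "(\<integral>z. F z \<partial>(binormal \<rho>\<^sub>1 \<bind> (\<lambda>y. distr (binormal (\<rho>\<^sub>2 y)) borel (Pair y))))
    = (\<integral>y. \<integral>z. F (y, z) \<partial>binormal (\<rho>\<^sub>2 y) \<partial>binormal \<rho>\<^sub>1)"
proof -
  interpret B: prob_space "binormal \<rho>\<^sub>1"
    by (rule prob_space_binormal[OF \<rho>\<^sub>1])
  interpret P: pair_prob_space "binormal \<rho>\<^sub>1" normal2 ..
  have "(\<integral>z. F z \<partial>(binormal \<rho>\<^sub>1 \<bind> (\<lambda>y. distr (binormal (\<rho>\<^sub>2 y)) borel (Pair y))))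
     = (\<integral>x. F ((\<lambda>(y, v). (y, correlate (\<rho>\<^sub>2 y) v)) x) \<partial>(binormal \<rho>\<^sub>1 \<Otimes>\<^sub>M normal2))"
    unfolding binormal_bind_eq_distr by (rule integral_distr) measurable
  also have "\<dots> = (\<integral>y. \<integral>v. F (y, correlate (\<rho>\<^sub>2 y) v) \<partial>normal2 \<partial>binormal \<rho>\<^sub>1)"
  proof -
    have "integrable (binormal \<rho>\<^sub>1 \<Otimes>\<^sub>M normal2) (\<lambda>x. F ((\<lambda>(y, v). (y, correlate (\<rho>\<^sub>2 y) v)) x))"
      by (rule P.integrable_of_bounded[where B=B]) (measurable, rule F)
    from P.integral_fst'[OF this] show ?thesis
      by simp
  qed
  also have "\<dots> = (\<integral>y. \<integral>z. F (y, z) \<partial>binormal (\<rho>\<^sub>2 y) \<partial>binormal \<rho>\<^sub>1)"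
  proof (rule Bochner_Integration.integral_cong[OF refl])
    show "(\<integral>v. F (y, correlate (\<rho>\<^sub>2 y) v) \<partial>normal2) = (\<integral>z. F (y, z) \<partial>binormal (\<rho>\<^sub>2 y))" for y
      unfolding binormal_eq_distr[OF \<rho>\<^sub>2] by (rule integral_distr[symmetric]) measurable
  qed
  finally show ?thesis .
qed

end

subsection \<open>The law of one unit\<close>

definition obs_space :: "(nat \<times> real) measure" where
  "obs_space = count_space UNIV \<Otimes>\<^sub>M borel"

definition unif :: "real measure" where
  "unif = uniform_measure lborel {0..1}"

definition assign :: "real \<Rightarrow> real \<Rightarrow> real \<times> real \<Rightarrow> nat \<times> real" where
  "assign h t y = (if t \<le> h then (0, arm 0 y) else (1, arm 1 y))"

text \<open>Realising the treatment through a uniform variable makes all joint laws measurable in \<open>h\<close>.\<close>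

definition unit_law :: "(real \<times> real) measure \<Rightarrow> real \<Rightarrow> (nat \<times> real) measure" where
  "unit_law Q h = distr (unif \<Otimes>\<^sub>M Q) obs_space (\<lambda>(t, y). assign h t y)"

text \<open>A propensity is carried as a single number, the probability of arm 0. This recovers the
  pair, reading every nonzero index as arm 1.\<close>

definition aprob :: "real \<Rightarrow> nat \<Rightarrow> real" where
  "aprob h s = (if s = 0 then h else 1 - h)"

definition data_law :: "nat \<Rightarrow> (real \<times> real) measure \<Rightarrow> real \<Rightarrow> (nat \<Rightarrow> nat \<times> real) measure" where
  "data_law n Q h = (\<Pi>\<^sub>M u\<in>{1..n}. unit_law Q h)"

lemma aprob_simps[simp]: "aprob h 0 = h" "aprob h (Suc 0) = 1 - h"
  by (auto simp: aprob_def)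

lemma arm_simps[simp]: "arm 0 y = fst y" "arm (Suc 0) y = snd y"
  by (auto simp: arm_def)

lemma borel_measurable_arm[measurable]: "arm s \<in> borel_measurable borel"
  unfolding arm_def by measurable

lemma measurable_obs_fst[measurable]: "fst \<in> obs_space \<rightarrow>\<^sub>M count_space UNIV"
  and measurable_obs_snd[measurable]: "snd \<in> obs_space \<rightarrow>\<^sub>M borel"
  unfolding obs_space_def by measurable

lemma measurable_obs_Pair[measurable (raw)]:
  "f \<in> M \<rightarrow>\<^sub>M count_space UNIV \<Longrightarrow> g \<in> M \<rightarrow>\<^sub>M borel \<Longrightarrow> (\<lambda>x. (f x, g x)) \<in> M \<rightarrow>\<^sub>M obs_space"
  unfolding obs_space_def by measurable

lemma space_obs_space[simp]: "space obs_space = UNIV"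
  by (simp add: obs_space_def space_pair_measure)

lemma measurable_assign[measurable (raw)]:
  assumes [measurable]: "h \<in> borel_measurable M" "t \<in> borel_measurable M" "y \<in> borel_measurable M"
  shows "(\<lambda>x. assign (h x) (t x) (y x)) \<in> M \<rightarrow>\<^sub>M obs_space"
  unfolding assign_def by measurable

lemma sets_unif[simp, measurable_cong]: "sets unif = sets borel"
  and space_unif[simp]: "space unif = UNIV"
  by (simp_all add: unif_def)

interpretation unif: prob_space unif
  unfolding unif_def by (rule prob_space_uniform_measure) auto

lemma emeasure_unif_atMost:
  assumes "0 \<le> h" "h \<le> 1"
  shows "emeasure unif {..h} = ennreal h" "measure unif {..h} = h"
proof -
  have "{0..1} \<inter> {..h} = {0..h}"
    using assms by auto
  then show "emeasure unif {..h} = ennreal h"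
    using assms by (simp add: unif_def emeasure_uniform_measure divide_ennreal_def)
  then show "measure unif {..h} = h"
    using assms by (simp add: measure_def)
qed

lemma emeasure_unif_greaterThan:
  assumes "0 \<le> h" "h \<le> 1"
  shows "emeasure unif {h<..} = ennreal (1 - h)" "measure unif {h<..} = 1 - h"
proof -
  have "{0..1} \<inter> {h<..} = {h<..1}"
    using assms by auto
  then show "emeasure unif {h<..} = ennreal (1 - h)"
    using assms by (simp add: unif_def emeasure_uniform_measure divide_ennreal_def)
  then show "measure unif {h<..} = 1 - h"
    using assms by (simp add: measure_def)
qed

section \<open>Taylor bounds and inequalities for powers\<close>

lemma iexp_second_order: "cmod (iexp x - (1 + \<i> * x - x\<^sup>2 / 2)) \<le> \<bar>x\<bar> ^ 3 / 6"
proof -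
  have "(\<Sum>k\<le>2. (\<i> * complex_of_real x) ^ k / fact k) = 1 + \<i> * x - x\<^sup>2 / 2"
  proof -
    have "(\<Sum>k\<le>2. (\<i> * complex_of_real x) ^ k / fact k) = 1 + \<i> * x + (\<i> * x)\<^sup>2 / 2"
      by (simp add: numeral_2_eq_2)
    then show ?thesis
      by (simp add: power_mult_distrib)
  qed
  then show ?thesis
    using iexp_approx1[of x 2] by (simp add: eval_nat_numeral)
qed

text \<open>The upper bound is read off a product: (1 + x + x^2/2) (1 - x + x^2/2) = 1 + x^4/4 is at
  least 1, and the first factor is at most exp x.\<close>

lemma exp_minus_second_order:
  fixes x :: real
  assumes "0 \<le> x"
  shows "\<bar>exp (- x) - (1 - x)\<bar> \<le> x\<^sup>2 / 2"
proof -
  have "(1 + x + x\<^sup>2 / 2) * (1 - x + x\<^sup>2 / 2) = 1 + (x\<^sup>2)\<^sup>2 / 4"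
    by (simp add: field_simps power2_eq_square)
  then have "1 \<le> (1 + x + x\<^sup>2 / 2) * (1 - x + x\<^sup>2 / 2)"
    by simp
  also have "\<dots> \<le> exp x * (1 - x + x\<^sup>2 / 2)"
  proof (rule mult_right_mono[OF exp_lower_Taylor_quadratic[OF assms]])
    have "0 \<le> (1 - x)\<^sup>2 / 2 + 1 / 2"
      by simp
    also have "\<dots> = 1 - x + x\<^sup>2 / 2"
      by (simp add: power2_diff field_simps)
    finally show "0 \<le> 1 - x + x\<^sup>2 / 2" .
  qed
  finally have "exp (- x) \<le> 1 - x + x\<^sup>2 / 2"
    by (simp add: exp_minus field_simps)
  moreover have "1 - x \<le> exp (- x)"
    using exp_ge_add_one_self[of "- x"] by simp
  ultimately show ?thesis
    by simp
qed

lemma power4_sum_le: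
  fixes a b :: real
  shows "(a + b) ^ 4 \<le> 8 * (a ^ 4 + b ^ 4)"
proof -
  have "(a + b)\<^sup>2 \<le> 2 * (a\<^sup>2 + b\<^sup>2)"
    using sum_squares_bound[of a b] by (simp add: power2_sum)
  then have "((a + b)\<^sup>2)\<^sup>2 \<le> (2 * (a\<^sup>2 + b\<^sup>2))\<^sup>2"
    by (intro power_mono) auto
  also have "\<dots> \<le> 4 * (2 * ((a\<^sup>2)\<^sup>2 + (b\<^sup>2)\<^sup>2))"
    using sum_squares_bound[of "a\<^sup>2" "b\<^sup>2"] by (simp add: power2_sum power_mult_distrib)
  finally show ?thesis
    by simp
qed

text \<open>After division by x^2 and multiplication by \<epsilon> this is \<open>\<epsilon> *
  \<bar>x\<bar> \<le> \<epsilon>\<^sup>2 + x\<^sup>2\<close>, by completing the square. It lets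
  fourth moments control a cubic Taylor remainder.\<close>

lemma abs_power3_le:
  fixes x :: real
  assumes "0 < \<epsilon>"
  shows "\<bar>x\<bar> ^ 3 \<le> \<epsilon> * x\<^sup>2 + x ^ 4 / \<epsilon>"
proof -
  have "0 \<le> \<bar>x\<bar>\<^sup>2 * ((\<epsilon> / 2 - \<bar>x\<bar>)\<^sup>2 + 3 / 4 * \<epsilon>\<^sup>2)"
    by (intro mult_nonneg_nonneg add_nonneg_nonneg) auto
  also have "\<dots> = \<epsilon> * (\<epsilon> * \<bar>x\<bar>\<^sup>2) + \<bar>x\<bar> ^ 4 - \<epsilon> * \<bar>x\<bar> ^ 3"
    by (simp add: field_simps eval_nat_numeral del: abs_mult_self_eq)
  finally have "\<epsilon> * \<bar>x\<bar> ^ 3 \<le> \<epsilon> * (\<epsilon> * x\<^sup>2) + x ^ 4"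
    by simp
  then show ?thesis
    using assms by (simp add: field_simps)
qed

text \<open>When the square is expanded, a mixed term is the product of two independent centred
  factors and integrates to 0; only the diagonal survives.\<close>

lemma iid_sum_second_moment:
  fixes f :: "'a \<Rightarrow> real"
  assumes "prob_space K" "finite I" "f \<in> borel_measurable K" "integrable K f" "integrable K (\<lambda>x. (f x)\<^sup>2)" "(\<integral>x. f x \<partial>K) = 0"
  shows "integrable (\<Pi>\<^sub>M u\<in>I. K) (\<lambda>d. (\<Sum>u\<in>I. f (d u))\<^sup>2)"
    and "(\<integral>d. (\<Sum>u\<in>I. f (d u))\<^sup>2 \<partial>(\<Pi>\<^sub>M u\<in>I. K)) = card I * (\<integral>x. (f x)\<^sup>2 \<partial>K)"
proof -
  note [measurable] = assms(3)
  interpret prob_space K by fact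
  interpret P: product_sigma_finite "\<lambda>_. K" ..
  have *: "integrable (\<Pi>\<^sub>M u\<in>I. K) (\<lambda>d. f (d u) * f (d v)) \<and>
      (\<integral>d. f (d u) * f (d v) \<partial>(\<Pi>\<^sub>M u\<in>I. K)) = (if u = v then \<integral>x. (f x)\<^sup>2 \<partial>K else 0)" if uv: "u \<in> I" "v \<in> I" for u v
  proof (cases "u = v")
    case True
    have d: "distr (\<Pi>\<^sub>M u\<in>I. K) K (\<lambda>\<omega>. \<omega> u) = K"
      by (rule distr_PiM_component) (use uv assms(1) in auto)
    have m: "(\<lambda>\<omega>. \<omega> u) \<in> (\<Pi>\<^sub>M u\<in>I. K) \<rightarrow>\<^sub>M K"
      using uv by measurable
    have "integrable (distr (\<Pi>\<^sub>M u\<in>I. K) K (\<lambda>\<omega>. \<omega> u)) (\<lambda>x. (f x)\<^sup>2)"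
      unfolding d by fact
    then have "integrable (\<Pi>\<^sub>M u\<in>I. K) (\<lambda>d. (f (d u))\<^sup>2)"
      by (subst (asm) integrable_distr_eq[OF m]) auto
    moreover have "(\<integral>x. (f x)\<^sup>2 \<partial>distr (\<Pi>\<^sub>M u\<in>I. K) K (\<lambda>\<omega>. \<omega> u)) = (\<integral>d. (f (d u))\<^sup>2 \<partial>(\<Pi>\<^sub>M u\<in>I. K))"
      by (rule integral_distr[OF m]) auto
    ultimately show ?thesis
      using True d by (simp add: power2_eq_square)
  next
    case False
    \<comment> \<open>Filling the remaining coordinates with the constant 1 writes the two-point
      product as a product over all of \<open>I\<close>, the form in which product measures
      factorise.\<close>
    let ?g = "\<lambda>i x. if i \<in> {u, v} then f x else 1"
    have prod: "(\<Prod>i\<in>I. ?g i (d i)) = f (d u) * f (d v)" for d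
    proof -
      have "(\<Prod>i\<in>I. ?g i (d i)) = (\<Prod>i\<in>I \<inter> {u, v}. f (d i))"
        using assms(2) by (rule prod.inter_restrict[symmetric])
      also have "I \<inter> {u, v} = {u, v}"
        using uv by auto
      finally show ?thesis
        using False by simp
    qed
    have g: "integrable K (?g i)" for i
      using assms(4) by (cases "i \<in> {u, v}") auto
    have "integrable (\<Pi>\<^sub>M u\<in>I. K) (\<lambda>d. \<Prod>i\<in>I. ?g i (d i))"
      by (rule P.product_integrable_prod[OF assms(2)]) (rule g)
    moreover have "(\<integral>d. (\<Prod>i\<in>I. ?g i (d i)) \<partial>(\<Pi>\<^sub>M u\<in>I. K)) = (\<Prod>i\<in>I. integral\<^sup>L K (?g i))"
      by (rule P.product_integral_prod[OF assms(2)]) (rule g)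
    moreover have "(\<Prod>i\<in>I. integral\<^sup>L K (?g i)) = 0"
      using uv assms(2,6) by (intro prod_zero bexI[of _ u]) auto
    ultimately show ?thesis
      unfolding prod using False by simp
  qed
  have sq: "(\<Sum>u\<in>I. f (d u))\<^sup>2 = (\<Sum>u\<in>I. \<Sum>v\<in>I. f (d u) * f (d v))" for d
    by (simp add: power2_eq_square sum_product)
  show "integrable (\<Pi>\<^sub>M u\<in>I. K) (\<lambda>d. (\<Sum>u\<in>I. f (d u))\<^sup>2)"
    unfolding sq using * by (intro Bochner_Integration.integrable_sum) blast
  have "(\<integral>d. (\<Sum>u\<in>I. f (d u))\<^sup>2 \<partial>(\<Pi>\<^sub>M u\<in>I. K)) = (\<Sum>u\<in>I. \<Sum>v\<in>I. if u = v then \<integral>x. (f x)\<^sup>2 \<partial>K else 0)"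
    unfolding sq using * by (simp add: Bochner_Integration.integral_sum)
  then show "(\<integral>d. (\<Sum>u\<in>I. f (d u))\<^sup>2 \<partial>(\<Pi>\<^sub>M u\<in>I. K)) = card I * (\<integral>x. (f x)\<^sup>2 \<partial>K)"
    using assms(2) by simp
qed

section \<open>Integration against the law of one unit\<close>

text \<open>\<open>K\<close> is taken at least 1 so that its powers are ordered and one constant can
  absorb the lower moments as well; later it is common to the whole triangular array.\<close>

locale outcome_law = prob_space Q for Q :: "(real \<times> real) measure" +
  fixes K :: real
  assumes sets_Q[simp, measurable_cong]: "sets Q = sets borel"
    and integrable_power4: "s \<in> {0, 1} \<Longrightarrow> integrable Q (\<lambda>y. arm s y ^ 4)"
    and moment4_le: "s \<in> {0, 1} \<Longrightarrow> moment Q s 4 \<le> K" and K_ge_1: "1 \<le> K"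
begin

lemma space_Q[simp]: "space Q = UNIV"
  using sets_eq_imp_space_eq[OF sets_Q] by simp

sublocale unif_Q: pair_prob_space unif Q ..

lemma prob_space_unit_law: "prob_space (unit_law Q h)"
  unfolding unit_law_def by (rule unif_Q.prob_space_distr) measurable

lemma sets_unit_law[simp, measurable_cong]: "sets (unit_law Q h) = sets obs_space"
  and space_unit_law[simp]: "space (unit_law Q h) = UNIV"
  unfolding unit_law_def by simp_all

text \<open>Given the uniform variable the arm is fixed, and the two arms occur on sets of mass
  \<open>h\<close> and \<open>1 - h\<close>.\<close>

lemma nn_integral_unit_law:
  assumes h: "0 \<le> h" "h \<le> 1" and [measurable]: "f \<in> borel_measurable obs_space"
  shows "(\<integral>\<^sup>+x. f x \<partial>unit_law Q h) = ennreal h * (\<integral>\<^sup>+y. f (0, arm 0 y) \<partial>Q) + ennreal (1 - h) * (\<integral>\<^sup>+y. f (1, arm 1 y) \<partial>Q)"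
proof -
  have "(\<integral>\<^sup>+x. f x \<partial>unit_law Q h) = (\<integral>\<^sup>+x. f ((\<lambda>(t, y). assign h t y) x) \<partial>(unif \<Otimes>\<^sub>M Q))"
    unfolding unit_law_def by (rule nn_integral_distr) measurable
  also have "\<dots> = (\<integral>\<^sup>+t. \<integral>\<^sup>+y. f (assign h t y) \<partial>Q \<partial>unif)"
    by (subst nn_integral_fst[symmetric]) auto
  also have "\<dots> = (\<integral>\<^sup>+t. (\<integral>\<^sup>+y. f (0, arm 0 y) \<partial>Q) * indicator {..h} t + (\<integral>\<^sup>+y. f (1, arm 1 y) \<partial>Q) * indicator {h<..} t \<partial>unif)"
  proof (rule nn_integral_cong)
    show "(\<integral>\<^sup>+y. f (assign h t y) \<partial>Q) = (\<integral>\<^sup>+y. f (0, arm 0 y) \<partial>Q) * indicator {..h} t + (\<integral>\<^sup>+y. f (1, arm 1 y) \<partial>Q) * indicator {h<..} t" for t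
      by (cases "t \<le> h") (auto simp: assign_def)
  qed
  also have "\<dots> = (\<integral>\<^sup>+y. f (0, arm 0 y) \<partial>Q) * ennreal h + (\<integral>\<^sup>+y. f (1, arm 1 y) \<partial>Q) * ennreal (1 - h)"
    by (subst nn_integral_add) (auto simp: nn_integral_cmult_indicator emeasure_unif_atMost emeasure_unif_greaterThan h)
  finally show ?thesis
    by (simp add: mult.commute)
qed

lemma
  fixes f :: "nat \<times> real \<Rightarrow> 'b::{banach, second_countable_topology}"
  assumes h: "0 \<le> h" "h \<le> 1" and [measurable]: "f \<in> borel_measurable obs_space"
    and int: "integrable Q (\<lambda>y. f (0, arm 0 y))" "integrable Q (\<lambda>y. f (1, arm 1 y))"
  shows integrable_unit_law: "integrable (unit_law Q h) f"
    and integral_unit_law: "(\<integral>x. f x \<partial>unit_law Q h) = h *\<^sub>R (\<integral>y. f (0, arm 0 y) \<partial>Q) + (1 - h) *\<^sub>R (\<integral>y. f (1, arm 1 y) \<partial>Q)"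
proof -
  show i: "integrable (unit_law Q h) f"
  proof (rule integrableI_bounded)
    have "(\<integral>\<^sup>+x. norm (f x) \<partial>unit_law Q h)
        = ennreal h * (\<integral>\<^sup>+y. norm (f (0, arm 0 y)) \<partial>Q) + ennreal (1 - h) * (\<integral>\<^sup>+y. norm (f (1, arm 1 y)) \<partial>Q)"
      using h by (rule nn_integral_unit_law) measurable
    also have "\<dots> < \<infinity>"
      using int by (auto simp: integrable_iff_bounded ennreal_mult_less_top)
    finally show "(\<integral>\<^sup>+x. norm (f x) \<partial>unit_law Q h) < \<infinity>" .
  qed measurable
  have m: "(\<lambda>(t, y). assign h t y) \<in> unif \<Otimes>\<^sub>M Q \<rightarrow>\<^sub>M obs_space"
    by measurable
  have i': "integrable (unif \<Otimes>\<^sub>M Q) (\<lambda>x. f ((\<lambda>(t, y). assign h t y) x))"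
    using i unfolding unit_law_def by (rule integrable_distr[OF m])
  have "(\<integral>x. f x \<partial>unit_law Q h) = (\<integral>x. f ((\<lambda>(t, y). assign h t y) x) \<partial>(unif \<Otimes>\<^sub>M Q))"
    unfolding unit_law_def by (rule integral_distr[OF m]) measurable
  also have "\<dots> = (\<integral>t. \<integral>y. f (assign h t y) \<partial>Q \<partial>unif)"
    using unif_Q.integral_fst'[OF i'] by simp
  also have "\<dots> = (\<integral>t. indicator {..h} t *\<^sub>R (\<integral>y. f (0, arm 0 y) \<partial>Q) + indicator {h<..} t *\<^sub>R (\<integral>y. f (1, arm 1 y) \<partial>Q) \<partial>unif)"
  proof (rule Bochner_Integration.integral_cong[OF refl])
    show "(\<integral>y. f (assign h t y) \<partial>Q) = indicator {..h} t *\<^sub>R (\<integral>y. f (0, arm 0 y) \<partial>Q) + indicator {h<..} t *\<^sub>R (\<integral>y. f (1, arm 1 y) \<partial>Q)" for t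
      by (cases "t \<le> h") (auto simp: assign_def)
  qed
  also have "\<dots> = h *\<^sub>R (\<integral>y. f (0, arm 0 y) \<partial>Q) + (1 - h) *\<^sub>R (\<integral>y. f (1, arm 1 y) \<partial>Q)"
    by (subst Bochner_Integration.integral_add)
       (auto simp: emeasure_unif_atMost emeasure_unif_greaterThan h)
  finally show "(\<integral>x. f x \<partial>unit_law Q h) = h *\<^sub>R (\<integral>y. f (0, arm 0 y) \<partial>Q) + (1 - h) *\<^sub>R (\<integral>y. f (1, arm 1 y) \<partial>Q)" .
qed

lemma emeasure_unit_law:
  assumes "0 \<le> h" "h \<le> 1" "B \<in> sets obs_space"
  shows "emeasure (unit_law Q h) B = ennreal h * emeasure Q {y. (0, arm 0 y) \<in> B} + ennreal (1 - h) * emeasure Q {y. (1, arm 1 y) \<in> B}"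
proof -
  have [measurable]: "{y. (s, arm s y) \<in> B} \<in> sets borel" for s
  proof -
    have "(\<lambda>y. (s, arm s y)) -` B \<inter> space borel \<in> sets borel"
      by (rule measurable_sets[OF _ assms(3)]) measurable
    then show ?thesis
      by (simp add: vimage_def)
  qed
  have ind: "(\<integral>\<^sup>+y. indicator B (s, arm s y) \<partial>Q) = emeasure Q {y. (s, arm s y) \<in> B}" for s
  proof -
    have "(\<integral>\<^sup>+y. indicator B (s, arm s y) \<partial>Q) = (\<integral>\<^sup>+y. indicator {y. (s, arm s y) \<in> B} y \<partial>Q)"
      by (simp add: indicator_def)
    then show ?thesis
      by simp
  qed
  have "emeasure (unit_law Q h) B = (\<integral>\<^sup>+x. indicator B x \<partial>unit_law Q h)"
    using assms(3) by simp
  also have "\<dots> = ennreal h * (\<integral>\<^sup>+y. indicator B (0, arm 0 y) \<partial>Q) + ennreal (1 - h) * (\<integral>\<^sup>+y. indicator B (1, arm 1 y) \<partial>Q)"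
    using assms by (intro nn_integral_unit_law) auto
  finally show ?thesis
    unfolding ind .
qed

lemma
  fixes g :: "real \<Rightarrow> real"
  assumes h: "0 \<le> h" "h \<le> 1" and s: "s \<in> {0, 1}" and [measurable]: "g \<in> borel_measurable borel"
    and g: "integrable Q (\<lambda>y. g (arm s y))"
  shows integrable_unit_law_arm: "integrable (unit_law Q h) (\<lambda>x. if fst x = s then g (snd x) else k)"
    and integral_unit_law_arm: "(\<integral>x. (if fst x = s then g (snd x) else k) \<partial>unit_law Q h)
      = aprob h s * (\<integral>y. g (arm s y) \<partial>Q) + (1 - aprob h s) * k"
proof -
  let ?f = "\<lambda>x. if fst x = s then g (snd x) else k"
  have m: "?f \<in> borel_measurable obs_space"
    by measurable
  have i: "integrable Q (\<lambda>y. ?f (0, arm 0 y))" "integrable Q (\<lambda>y. ?f (1, arm 1 y))"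
    using g s by auto
  show "integrable (unit_law Q h) ?f"
    by (rule integrable_unit_law[OF h m i])
  show "(\<integral>x. ?f x \<partial>unit_law Q h) = aprob h s * (\<integral>y. g (arm s y) \<partial>Q) + (1 - aprob h s) * k"
    using integral_unit_law[OF h m i] s prob_space by auto
qed

end

subsection \<open>Sums of standardised units\<close>

text \<open>The prefactor is the square root of the treatment probability
  \<open>g = aprob h s\<close>. It turns the variance \<open>v s / g - (m s)\<^sup>2\<close> of the
  inverse weighted outcome into \<open>v s - g * (m s)\<^sup>2\<close>, which stays bounded as
  \<open>g\<close> tends to 0 and is the quantity \<open>lim_V\<close>.\<close>

definition score :: "real \<Rightarrow> (nat \<Rightarrow> real) \<Rightarrow> nat \<Rightarrow> nat \<times> real \<Rightarrow> real" where
  "score h m s x = sqrt (aprob h s) * (of_bool (fst x = s) * snd x / aprob h s - m s)"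

text \<open>Governs the squared weighted outcomes in the variance estimate: the square of an inverse
  weighted outcome, times the treatment probability, is this variable plus
  \<open>v s\<close>.\<close>

definition sq_score :: "real \<Rightarrow> (nat \<Rightarrow> real) \<Rightarrow> nat \<Rightarrow> nat \<times> real \<Rightarrow> real" where
  "sq_score h v s x = of_bool (fst x = s) * (snd x)\<^sup>2 / aprob h s - v s"

definition score_sum :: "nat \<Rightarrow> real \<Rightarrow> (nat \<Rightarrow> real) \<Rightarrow> nat \<Rightarrow> (nat \<Rightarrow> nat \<times> real) \<Rightarrow> real" where
  "score_sum n h m s d = (\<Sum>u\<in>{1..n}. score h m s (d u)) / sqrt n"

definition sq_score_mean :: "nat \<Rightarrow> real \<Rightarrow> (nat \<Rightarrow> real) \<Rightarrow> nat \<Rightarrow> (nat \<Rightarrow> nat \<times> real) \<Rightarrow> real" where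
  "sq_score_mean n h v s d = (\<Sum>u\<in>{1..n}. sq_score h v s (d u)) / n"

text \<open>The variance of \<open>a * score h m 0 x + b * score h m 1 x\<close>. No unit is seen in
  both arms, so the covariance of the inverse weighted outcomes is minus the product of their
  means.\<close>

definition score_var :: "(nat \<Rightarrow> real) \<Rightarrow> (nat \<Rightarrow> real) \<Rightarrow> real \<Rightarrow> real \<Rightarrow> real \<Rightarrow> real" where
  "score_var m v h a b = a\<^sup>2 * lim_V m v (aprob h) 0 + b\<^sup>2 * lim_V m v (aprob h) 1
     - 2 * a * b * sqrt (h * (1 - h)) * m 0 * m 1"

lemma measurable_score[measurable (raw)]:
  assumes [measurable]: "h \<in> borel_measurable M" "f \<in> M \<rightarrow>\<^sub>M obs_space"
  shows "(\<lambda>x. score (h x) m s (f x)) \<in> borel_measurable M"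
  unfolding score_def aprob_def by measurable

lemma measurable_sq_score[measurable (raw)]:
  assumes [measurable]: "h \<in> borel_measurable M" "f \<in> M \<rightarrow>\<^sub>M obs_space"
  shows "(\<lambda>x. sq_score (h x) v s (f x)) \<in> borel_measurable M"
  unfolding sq_score_def aprob_def by measurable

lemma measurable_score_sum[measurable (raw)]:
  assumes [measurable]: "h \<in> borel_measurable M" "f \<in> M \<rightarrow>\<^sub>M (\<Pi>\<^sub>M u\<in>{1..n}. obs_space)"
  shows "(\<lambda>x. score_sum n (h x) m s (f x)) \<in> borel_measurable M"
  unfolding score_sum_def by measurable

lemma measurable_sq_score_mean[measurable (raw)]:
  assumes [measurable]: "h \<in> borel_measurable M" "f \<in> M \<rightarrow>\<^sub>M (\<Pi>\<^sub>M u\<in>{1..n}. obs_space)"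
  shows "(\<lambda>x. sq_score_mean n (h x) v s (f x)) \<in> borel_measurable M"
  unfolding sq_score_mean_def by measurable

lemma (in prob_space) integrable_power_le_4:
  fixes z :: "'a \<Rightarrow> real"
  assumes [measurable]: "z \<in> borel_measurable M" and z: "integrable M (\<lambda>x. z x ^ 4)" and j: "j \<le> 4"
  shows "integrable M (\<lambda>x. z x ^ j)"
proof (rule Bochner_Integration.integrable_bound[of _ "\<lambda>x. 1 + z x ^ 4"])
  show "integrable M (\<lambda>x. 1 + z x ^ 4)"
    using z by auto
  have "\<bar>y\<bar> ^ j \<le> 1 + \<bar>y\<bar> ^ 4" for y :: real
  proof (cases "\<bar>y\<bar> \<le> 1")
    case True
    then have "\<bar>y\<bar> ^ j \<le> 1"
      by (intro power_le_one) auto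
    then show ?thesis
      using zero_le_power[of "\<bar>y\<bar>" 4] by linarith
  next
    case False
    then have "\<bar>y\<bar> ^ j \<le> \<bar>y\<bar> ^ 4"
      using j by (intro power_increasing) auto
    then show ?thesis
      by simp
  qed
  then show "AE x in M. norm (z x ^ j) \<le> norm (1 + z x ^ 4)"
    by (intro AE_I2) (auto simp: power_abs)
qed measurable

context outcome_law
begin

abbreviation "m \<equiv> \<lambda>s. moment Q s 1"
abbreviation "v \<equiv> \<lambda>s. moment Q s 2"

context
  fixes s :: nat
  assumes s: "s \<in> {0, 1}"
begin

lemma integrable_arm_power: "j \<le> 4 \<Longrightarrow> integrable Q (\<lambda>y. arm s y ^ j)"
  by (rule integrable_power_le_4[OF _ integrable_power4[OF s]]) auto

lemma integrable_affine_power4: "integrable Q (\<lambda>y. (a * arm s y + b) ^ 4)"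
proof (rule Bochner_Integration.integrable_bound[of _ "\<lambda>y. 8 * (a ^ 4 * arm s y ^ 4 + b ^ 4)"])
  show "integrable Q (\<lambda>y. 8 * (a ^ 4 * arm s y ^ 4 + b ^ 4))"
    using integrable_power4[OF s] by auto
  show "AE y in Q. norm ((a * arm s y + b) ^ 4) \<le> norm (8 * (a ^ 4 * arm s y ^ 4 + b ^ 4))"
    using power4_sum_le[of "a * arm s _" b] by (intro AE_I2) (auto simp: power_mult_distrib abs_of_nonneg)
qed measurable

lemma integrable_affine_power: "j \<le> 4 \<Longrightarrow> integrable Q (\<lambda>y. (a * arm s y + b) ^ j)"
  by (rule integrable_power_le_4[OF _ integrable_affine_power4]) auto

lemma integral_affine: "(\<integral>y. a * arm s y + b \<partial>Q) = a * m s + b"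
  using integrable_arm_power[of 1] prob_space by (simp add: moment_def)

lemma integral_affine_sq: "(\<integral>y. (a * arm s y + b)\<^sup>2 \<partial>Q) = a\<^sup>2 * v s + 2 * a * b * m s + b\<^sup>2"
proof -
  have "(\<integral>y. (a * arm s y + b)\<^sup>2 \<partial>Q) = (\<integral>y. a\<^sup>2 * (arm s y)\<^sup>2 + (2 * a * b * arm s y + b\<^sup>2) \<partial>Q)"
    by (simp add: power2_sum power_mult_distrib algebra_simps)
  also have "\<dots> = a\<^sup>2 * v s + (2 * a * b * m s + b\<^sup>2)"
    using integrable_arm_power[of 1] integrable_arm_power[of 2] prob_space by (simp add: moment_def)
  finally show ?thesis
    by simp
qed

lemma integral_affine_power4_le: "(\<integral>y. (a * arm s y + b) ^ 4 \<partial>Q) \<le> 8 * (a ^ 4 * K + b ^ 4)"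
proof -
  have "(\<integral>y. (a * arm s y + b) ^ 4 \<partial>Q) \<le> (\<integral>y. 8 * (a ^ 4 * arm s y ^ 4 + b ^ 4) \<partial>Q)"
    using integrable_power4[OF s] power4_sum_le[of "a * arm s _" b]
    by (intro integral_mono integrable_affine_power4) (auto simp: power_mult_distrib)
  also have "\<dots> = 8 * (a ^ 4 * moment Q s 4 + b ^ 4)"
    using integrable_power4[OF s] prob_space by (simp add: moment_def)
  also have "\<dots> \<le> 8 * (a ^ 4 * K + b ^ 4)"
    using moment4_le[OF s] by (intro mult_left_mono add_right_mono) auto
  finally show ?thesis .
qed

lemma mean_sq_le: "(m s)\<^sup>2 \<le> v s"
proof -
  have "0 \<le> (\<integral>y. (1 * arm s y + - m s)\<^sup>2 \<partial>Q)"
    by simp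
  then show ?thesis
    unfolding integral_affine_sq by (simp add: power2_eq_square)
qed

text \<open>From y^2 \<le> (1 + y^4) / 2; the normalisation 1 \<le> K absorbs the constant.\<close>

lemma second_moment_le: "v s \<le> K"
proof -
  have "v s \<le> (\<integral>y. (1 + arm s y ^ 4) / 2 \<partial>Q)"
    unfolding moment_def
  proof (intro integral_mono)
    show "(arm s y)\<^sup>2 \<le> (1 + arm s y ^ 4) / 2" for y
      using sum_squares_bound[of 1 "(arm s y)\<^sup>2"] by simp
  qed (use integrable_power4[OF s] integrable_arm_power[of 2] in auto)
  also have "\<dots> = (1 + moment Q s 4) / 2"
    using integrable_power4[OF s] prob_space by (simp add: moment_def)
  finally show ?thesis
    using moment4_le[OF s] K_ge_1 by simp
qed

lemma mean_power4_le: "(m s) ^ 4 \<le> K\<^sup>2"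
proof -
  have "((m s)\<^sup>2)\<^sup>2 \<le> K\<^sup>2"
    using mean_sq_le second_moment_le by (intro power_mono) auto
  then show ?thesis
    by simp
qed

end

context
  fixes h :: real
  assumes h: "0 < h" "h < 1"
begin

lemma aprob_bounds: "0 < aprob h s" "aprob h s < 1"
  using h by (auto simp: aprob_def)

lemma score_eq:
  "score h m s x = (if fst x = s then sqrt (aprob h s) / aprob h s * snd x + - sqrt (aprob h s) * m s
     else - sqrt (aprob h s) * m s)"
  using aprob_bounds[of s] by (simp add: score_def algebra_simps)

lemma sqrt_aprob: "aprob h s * (sqrt (aprob h s) / aprob h s) = sqrt (aprob h s)"
    "sqrt (aprob h s) * (sqrt (aprob h s) / aprob h s) = 1" "(sqrt (aprob h s))\<^sup>2 = aprob h s"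
  using aprob_bounds[of s] by (auto simp: field_simps)

lemma
  assumes s: "s \<in> {0, 1}" and j: "j \<le> 4"
  shows integrable_score_power: "integrable (unit_law Q h) (\<lambda>x. score h m s x ^ j)"
    and integral_score_power: "(\<integral>x. score h m s x ^ j \<partial>unit_law Q h) =
      aprob h s * (\<integral>y. (sqrt (aprob h s) / aprob h s * arm s y + - sqrt (aprob h s) * m s) ^ j \<partial>Q)
      + (1 - aprob h s) * (- sqrt (aprob h s) * m s) ^ j"
proof -
  have eq: "score h m s x ^ j = (if fst x = s then (sqrt (aprob h s) / aprob h s * snd x + - sqrt (aprob h s) * m s) ^ j
     else (- sqrt (aprob h s) * m s) ^ j)" for x
    unfolding score_eq by simp
  note i = integrable_affine_power[OF s j]
  show "integrable (unit_law Q h) (\<lambda>x. score h m s x ^ j)"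
    unfolding eq by (rule integrable_unit_law_arm[OF less_imp_le[OF h(1)] less_imp_le[OF h(2)] s _ i]) measurable
  show "(\<integral>x. score h m s x ^ j \<partial>unit_law Q h) =
      aprob h s * (\<integral>y. (sqrt (aprob h s) / aprob h s * arm s y + - sqrt (aprob h s) * m s) ^ j \<partial>Q)
      + (1 - aprob h s) * (- sqrt (aprob h s) * m s) ^ j"
    unfolding eq by (rule integral_unit_law_arm[OF less_imp_le[OF h(1)] less_imp_le[OF h(2)] s _ i]) measurable
qed

lemma integral_score:
  assumes s: "s \<in> {0, 1}"
  shows "(\<integral>x. score h m s x \<partial>unit_law Q h) = 0"
proof -
  define r where "r = sqrt (aprob h s)"
  have "(\<integral>x. score h m s x \<partial>unit_law Q h) = aprob h s * (r / aprob h s * m s + - r * m s) + (1 - aprob h s) * (- r * m s)"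
    using integral_score_power[OF s, of 1] by (simp only: power_one_right integral_affine[OF s] r_def)
  also have "\<dots> = (aprob h s * (r / aprob h s) - r) * m s"
    by (simp add: algebra_simps)
  also have "\<dots> = 0"
    unfolding r_def sqrt_aprob by simp
  finally show ?thesis .
qed

lemma integral_score_sq:
  assumes s: "s \<in> {0, 1}"
  shows "(\<integral>x. (score h m s x)\<^sup>2 \<partial>unit_law Q h) = lim_V m v (aprob h) s"
proof -
  define r where "r = sqrt (aprob h s)"
  define a where "a = r / aprob h s"
  have r: "aprob h s * a = r" "r * a = 1" "r\<^sup>2 = aprob h s"
    using sqrt_aprob[of s] by (simp_all add: r_def a_def)
  have "(\<integral>x. (score h m s x)\<^sup>2 \<partial>unit_law Q h) =
      aprob h s * (a\<^sup>2 * v s + 2 * a * (- r * m s) * m s + (- r * m s)\<^sup>2) + (1 - aprob h s) * (- r * m s)\<^sup>2"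
    unfolding a_def r_def by (subst integral_score_power[OF s], simp, subst integral_affine_sq[OF s], simp)
  also have "\<dots> = (aprob h s * a) * a * v s - 2 * ((aprob h s * a) * r) * (m s)\<^sup>2 + r\<^sup>2 * (m s)\<^sup>2"
    by (simp add: power2_eq_square algebra_simps)
  also have "\<dots> = (r * a) * v s - r\<^sup>2 * (m s)\<^sup>2"
    unfolding r(1) by (simp add: power2_eq_square algebra_simps)
  finally show ?thesis
    unfolding r by (simp add: lim_V_def)
qed

text \<open>On the event of probability \<open>g\<close> on which the arm is observed, the score is
  of the order of the outcome over \<open>sqrt g\<close>, so its fourth power contributes
  \<open>g / g\<^sup>2\<close>. The centring adds a bounded amount, absorbed through
  \<open>g < 1\<close>; each of the two parts is at most \<open>8 * K\<^sup>2 / g\<close>.\<close>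

lemma integral_score_power4_le:
  assumes s: "s \<in> {0, 1}"
  shows "(\<integral>x. score h m s x ^ 4 \<partial>unit_law Q h) \<le> 17 * K\<^sup>2 / aprob h s"
proof -
  define g where "g = aprob h s"
  define r where "r = sqrt g"
  have g: "0 < g" "g < 1"
    using aprob_bounds[of s] by (auto simp: g_def)
  have r4: "r ^ 4 = g\<^sup>2"
    using g by (simp add: r_def power4_eq_xxxx power2_eq_square)
  have b4: "(- r * m s) ^ 4 \<le> K\<^sup>2"
  proof -
    have "(- r * m s) ^ 4 = g\<^sup>2 * m s ^ 4"
      using r4 by (simp add: power_mult_distrib)
    also have "\<dots> \<le> 1 * K\<^sup>2"
      using g mean_power4_le[OF s] by (intro mult_mono) (auto simp: power_le_one)
    finally show ?thesis
      by simp
  qed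
  have "(\<integral>x. score h m s x ^ 4 \<partial>unit_law Q h) \<le> g * (8 * ((r / g) ^ 4 * K + (- r * m s) ^ 4)) + (1 - g) * (- r * m s) ^ 4"
    unfolding r_def g_def using aprob_bounds[of s]
    by (subst integral_score_power[OF s], simp)
       (intro add_right_mono mult_left_mono integral_affine_power4_le[OF s], simp)
  also have "\<dots> = 8 * K / g + (1 + 7 * g) * (- r * m s) ^ 4"
  proof -
    have "(r / g) ^ 4 = 1 / g\<^sup>2"
      using g unfolding power_divide r4 by (simp add: field_simps eval_nat_numeral)
    moreover have "g * (8 * (1 / g\<^sup>2 * K)) = 8 * K / g"
      using g by (simp add: power2_eq_square)
    ultimately show ?thesis
      by (simp add: algebra_simps)
  qed
  also have "\<dots> \<le> 8 * K\<^sup>2 / g + 8 * K\<^sup>2"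
  proof (intro add_mono divide_right_mono)
    show "8 * K \<le> 8 * K\<^sup>2"
      using K_ge_1 by (simp add: power2_eq_square)
    show "(1 + 7 * g) * (- r * m s) ^ 4 \<le> 8 * K\<^sup>2"
      using g b4 by (intro mult_mono) auto
  qed (use g in auto)
  also have "\<dots> \<le> 8 * K\<^sup>2 / g + 8 * K\<^sup>2 / g"
    using g by (intro add_left_mono) (simp add: field_simps mult_left_le_one_le)
  also have "\<dots> \<le> 17 * K\<^sup>2 / g"
    using g by (simp add: field_simps)
  finally show ?thesis
    by (simp add: g_def)
qed

text \<open>In either arm one of the two factors has collapsed to its centring constant, so the
  product is affine in the observed outcome and first moments determine the integral.\<close>

lemma integrable_score_mult: "integrable (unit_law Q h) (\<lambda>x. score h m 0 x * score h m 1 x)"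
  and integral_score_mult: "(\<integral>x. score h m 0 x * score h m 1 x \<partial>unit_law Q h) = - sqrt (h * (1 - h)) * m 0 * m 1"
proof -
  define r\<^sub>0 r\<^sub>1 where "r\<^sub>0 = sqrt h" and "r\<^sub>1 = sqrt (1 - h)"
  define b\<^sub>0 b\<^sub>1 where "b\<^sub>0 = - r\<^sub>0 * m 0" and "b\<^sub>1 = - r\<^sub>1 * m 1"
  have e0: "score h m 0 (0, y) * score h m 1 (0, y) = (r\<^sub>0 / h * y + b\<^sub>0) * b\<^sub>1" for y
    unfolding score_eq by (simp add: b\<^sub>0_def b\<^sub>1_def r\<^sub>0_def r\<^sub>1_def aprob_def)
  have e1: "score h m 0 (1, y) * score h m 1 (1, y) = b\<^sub>0 * (r\<^sub>1 / (1 - h) * y + b\<^sub>1)" for y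
    unfolding score_eq by (simp add: b\<^sub>0_def b\<^sub>1_def r\<^sub>0_def r\<^sub>1_def aprob_def)
  have i: "integrable Q (\<lambda>y. a * arm s y + b)" if "s \<in> {0, 1}" for a b s
    using integrable_affine_power[OF that, of 1 a b] by simp
  have ii: "integrable Q (\<lambda>y. score h m 0 (0, arm 0 y) * score h m 1 (0, arm 0 y))"
    "integrable Q (\<lambda>y. score h m 0 (1, arm 1 y) * score h m 1 (1, arm 1 y))"
    unfolding e0 e1 by (intro integrable_mult_left integrable_mult_right i; simp)+
  have h': "0 \<le> h" "h \<le> 1"
    using h by auto
  have meas: "(\<lambda>x. score h m 0 x * score h m 1 x) \<in> borel_measurable obs_space"
    by measurable
  show "integrable (unit_law Q h) (\<lambda>x. score h m 0 x * score h m 1 x)"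
    by (rule integrable_unit_law[OF h' meas ii])
  have "(\<integral>x. score h m 0 x * score h m 1 x \<partial>unit_law Q h)
      = h * ((r\<^sub>0 / h * m 0 + b\<^sub>0) * b\<^sub>1) + (1 - h) * (b\<^sub>0 * (r\<^sub>1 / (1 - h) * m 1 + b\<^sub>1))"
    unfolding integral_unit_law[OF h' meas ii] e0 e1
    by (simp only: integral_mult_left_zero integral_mult_right_zero integral_affine insertI1 insertI2 real_scaleR_def)
  also have "h * ((r\<^sub>0 / h * m 0 + b\<^sub>0) * b\<^sub>1) = (r\<^sub>0 * m 0 + h * b\<^sub>0) * b\<^sub>1"
    using h by (simp add: field_simps)
  also have "(1 - h) * (b\<^sub>0 * (r\<^sub>1 / (1 - h) * m 1 + b\<^sub>1)) = b\<^sub>0 * (r\<^sub>1 * m 1 + (1 - h) * b\<^sub>1)"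
    using h by (simp add: field_simps)
  also have "(r\<^sub>0 * m 0 + h * b\<^sub>0) * b\<^sub>1 + b\<^sub>0 * (r\<^sub>1 * m 1 + (1 - h) * b\<^sub>1) = - (r\<^sub>0 * r\<^sub>1) * m 0 * m 1"
    unfolding b\<^sub>0_def b\<^sub>1_def by (simp add: algebra_simps)
  finally show "(\<integral>x. score h m 0 x * score h m 1 x \<partial>unit_law Q h) = - sqrt (h * (1 - h)) * m 0 * m 1"
    using h by (simp add: r\<^sub>0_def r\<^sub>1_def real_sqrt_mult)
qed

text \<open>The fourth power of the outcome is divided by \<open>g\<^sup>2\<close> on an event of
  probability \<open>g\<close>, which leaves the order \<open>1 / g\<close> for the second
  moment.\<close>

lemma
  assumes s: "s \<in> {0, 1}"
  shows integrable_sq_score: "integrable (unit_law Q h) (sq_score h v s)"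
      "integrable (unit_law Q h) (\<lambda>x. (sq_score h v s x)\<^sup>2)"
    and integral_sq_score: "(\<integral>x. sq_score h v s x \<partial>unit_law Q h) = 0"
      "(\<integral>x. (sq_score h v s x)\<^sup>2 \<partial>unit_law Q h) \<le> K / aprob h s"
proof -
  define g where "g = aprob h s"
  have g: "0 < g" "g < 1"
    using aprob_bounds[of s] by (auto simp: g_def)
  have h': "0 \<le> h" "h \<le> 1"
    using h by auto
  have eq: "sq_score h v s = (\<lambda>x. if fst x = s then (snd x)\<^sup>2 / g - v s else - v s)"
    and eq2: "(\<lambda>x. (sq_score h v s x)\<^sup>2) = (\<lambda>x. if fst x = s then ((snd x)\<^sup>2 / g - v s)\<^sup>2 else (v s)\<^sup>2)"
    by (auto simp: sq_score_def g_def fun_eq_iff)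
  have sq: "((arm s y)\<^sup>2 / g - v s)\<^sup>2 = arm s y ^ 4 / g\<^sup>2 + ((- 2 * v s / g) * (arm s y)\<^sup>2 + (v s)\<^sup>2)" for y
    by (simp add: power2_diff power_divide)
  note i2 = integrable_arm_power[OF s, of 2, simplified]
  have i: "integrable Q (\<lambda>y. (arm s y)\<^sup>2 / g - v s)" "integrable Q (\<lambda>y. ((arm s y)\<^sup>2 / g - v s)\<^sup>2)"
    unfolding sq using i2 integrable_power4[OF s] by auto
  show "integrable (unit_law Q h) (sq_score h v s)"
    unfolding eq using i(1) by (intro integrable_unit_law_arm[OF h' s]) auto
  show "integrable (unit_law Q h) (\<lambda>x. (sq_score h v s x)\<^sup>2)"
    unfolding eq2 using i(2) by (intro integrable_unit_law_arm[OF h' s]) auto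
  have "(\<integral>x. sq_score h v s x \<partial>unit_law Q h) = g * (\<integral>y. (arm s y)\<^sup>2 / g - v s \<partial>Q) + (1 - g) * - v s"
    unfolding eq g_def[symmetric] using i(1) by (subst integral_unit_law_arm[OF h' s]) (auto simp: g_def)
  also have "(\<integral>y. (arm s y)\<^sup>2 / g - v s \<partial>Q) = v s / g - v s"
    using i2 prob_space by (simp add: moment_def)
  finally show "(\<integral>x. sq_score h v s x \<partial>unit_law Q h) = 0"
    using g by (simp add: field_simps)
  have "(\<integral>x. (sq_score h v s x)\<^sup>2 \<partial>unit_law Q h) = g * (\<integral>y. ((arm s y)\<^sup>2 / g - v s)\<^sup>2 \<partial>Q) + (1 - g) * (v s)\<^sup>2"
    unfolding eq2 g_def[symmetric] using i(2) by (subst integral_unit_law_arm[OF h' s]) (auto simp: g_def)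
  also have "(\<integral>y. ((arm s y)\<^sup>2 / g - v s)\<^sup>2 \<partial>Q) = moment Q s 4 / g\<^sup>2 + ((- 2 * v s / g) * v s + (v s)\<^sup>2)"
    unfolding sq using i2 integrable_power4[OF s] prob_space by (simp add: moment_def)
  also have "g * (moment Q s 4 / g\<^sup>2 + ((- 2 * v s / g) * v s + (v s)\<^sup>2)) + (1 - g) * (v s)\<^sup>2 = moment Q s 4 / g - (v s)\<^sup>2"
    using g by (simp add: field_simps power2_eq_square)
  also have "\<dots> \<le> K / g"
    using divide_right_mono[OF moment4_le[OF s], of g] g zero_le_power2[of "v s"] by linarith
  finally show "(\<integral>x. (sq_score h v s x)\<^sup>2 \<partial>unit_law Q h) \<le> K / aprob h s"
    by (simp add: g_def)
qed

text \<open>For the normalised sum the bound is free of \<open>h\<close>, as the scores are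
  standardised. For the mean of the squared terms it is of order \<open>1 / (n * g)\<close> in the
  treatment probability \<open>g\<close>, a law of large numbers that relies on the rate
  condition.\<close>

lemma
  assumes s: "s \<in> {0, 1}" and n: "0 < n"
  shows integrable_score_sum_sq: "integrable (data_law n Q h) (\<lambda>d. (score_sum n h m s d)\<^sup>2)"
    and integral_score_sum_sq: "(\<integral>d. (score_sum n h m s d)\<^sup>2 \<partial>data_law n Q h) \<le> K"
    and integrable_sq_score_mean: "integrable (data_law n Q h) (\<lambda>d. (sq_score_mean n h v s d)\<^sup>2)"
    and integral_sq_score_mean: "(\<integral>d. (sq_score_mean n h v s d)\<^sup>2 \<partial>data_law n Q h) \<le> K / (n * aprob h s)"
proof -
  have fin: "finite {1..n}" and mm: "score h m s \<in> borel_measurable (unit_law Q h)" "sq_score h v s \<in> borel_measurable (unit_law Q h)"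
    by measurable
  have i1: "integrable (unit_law Q h) (score h m s)" and i2: "integrable (unit_law Q h) (\<lambda>x. (score h m s x)\<^sup>2)"
    using integrable_score_power[OF s, of 1] integrable_score_power[OF s, of 2] by simp_all
  note 1 = iid_sum_second_moment[OF prob_space_unit_law fin mm(1) i1 i2 integral_score[OF s]]
  note 2 = iid_sum_second_moment[OF prob_space_unit_law fin mm(2) integrable_sq_score[OF s] integral_sq_score(1)[OF s]]
  show "integrable (data_law n Q h) (\<lambda>d. (score_sum n h m s d)\<^sup>2)"
    using 1(1) by (simp add: score_sum_def power_divide data_law_def)
  have "(\<integral>d. (score_sum n h m s d)\<^sup>2 \<partial>data_law n Q h) = lim_V m v (aprob h) s"
    using 1(2) n by (simp add: score_sum_def power_divide data_law_def integral_score_sq[OF s, simplified])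
  also have "\<dots> \<le> K"
    using second_moment_le[OF s] aprob_bounds[of s] by (simp add: lim_V_def) (smt (verit) mult_nonneg_nonneg zero_le_power2)
  finally show "(\<integral>d. (score_sum n h m s d)\<^sup>2 \<partial>data_law n Q h) \<le> K" .
  show "integrable (data_law n Q h) (\<lambda>d. (sq_score_mean n h v s d)\<^sup>2)"
    using 2(1) by (simp add: sq_score_mean_def power_divide data_law_def)
  have "(\<integral>d. (sq_score_mean n h v s d)\<^sup>2 \<partial>data_law n Q h) = (\<integral>x. (sq_score h v s x)\<^sup>2 \<partial>unit_law Q h) / n"
    using 2(2) n by (simp add: sq_score_mean_def power_divide data_law_def power2_eq_square)
  also have "\<dots> \<le> K / aprob h s / n"
    using integral_sq_score(2)[OF s] by (intro divide_right_mono) auto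
  finally show "(\<integral>d. (sq_score_mean n h v s d)\<^sup>2 \<partial>data_law n Q h) \<le> K / (n * aprob h s)"
    by (simp add: mult.commute)
qed

text \<open>The free parameter \<open>\<epsilon>\<close> trades the third absolute moment for the second and the fourth.\<close>

lemma char_score_sum_bound:
  assumes n: "0 < n" and \<epsilon>: "0 < \<epsilon>"
  shows "cmod ((CLINT d|data_law n Q h. iexp (a * score_sum n h m 0 d + b * score_sum n h m 1 d))
      - of_real (exp (- score_var m v h a b / 2)))
    \<le> \<epsilon> * score_var m v h a b + 136 * K\<^sup>2 * (a ^ 4 / h + b ^ 4 / (1 - h)) / (n * \<epsilon>) + (score_var m v h a b)\<^sup>2 / n"
proof -
  define L where "L x = a * score h m 0 x + b * score h m 1 x" for x
  define \<sigma>2 where "\<sigma>2 = score_var m v h a b"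
  \<comment> \<open>136 = 8 * 17: the 8 comes from splitting the fourth power of a sum, the 17 from
    the fourth moment of a score.\<close>
  define F where "F = 136 * K\<^sup>2 * (a ^ 4 / h + b ^ 4 / (1 - h))"
  interpret U: prob_space "unit_law Q h"
    by (rule prob_space_unit_law)
  have [measurable]: "L \<in> borel_measurable obs_space"
    unfolding L_def by measurable
  have i: "integrable (unit_law Q h) (\<lambda>x. score h m 0 x)" "integrable (unit_law Q h) (\<lambda>x. score h m 1 x)"
    using integrable_score_power[of 0 1] integrable_score_power[of 1 1] by simp_all
  have i2: "integrable (unit_law Q h) (\<lambda>x. (score h m 0 x)\<^sup>2)" "integrable (unit_law Q h) (\<lambda>x. (score h m 1 x)\<^sup>2)"
    using integrable_score_power[of 0 2] integrable_score_power[of 1 2] by simp_all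
  have i4: "integrable (unit_law Q h) (\<lambda>x. score h m 0 x ^ 4)" "integrable (unit_law Q h) (\<lambda>x. score h m 1 x ^ 4)"
    using integrable_score_power[of 0 4] integrable_score_power[of 1 4] by simp_all
  have L1: "integrable (unit_law Q h) L" "(\<integral>x. L x \<partial>unit_law Q h) = 0"
    unfolding L_def using i integral_score[of 0] integral_score[of 1] by auto
  have L_sq: "(L x)\<^sup>2 = a\<^sup>2 * (score h m 0 x)\<^sup>2 + b\<^sup>2 * (score h m 1 x)\<^sup>2 + 2 * a * b * (score h m 0 x * score h m 1 x)" for x
    unfolding L_def by (simp add: power2_sum power_mult_distrib mult_ac)
  have L2: "integrable (unit_law Q h) (\<lambda>x. (L x)\<^sup>2)" "(\<integral>x. (L x)\<^sup>2 \<partial>unit_law Q h) = \<sigma>2"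
  proof -
    note i12 = integrable_score_mult
    show "integrable (unit_law Q h) (\<lambda>x. (L x)\<^sup>2)"
      unfolding L_sq using i2 i12 by (intro Bochner_Integration.integrable_add integrable_mult_right)
    have "(\<integral>x. (L x)\<^sup>2 \<partial>unit_law Q h) = a\<^sup>2 * (\<integral>x. (score h m 0 x)\<^sup>2 \<partial>unit_law Q h)
        + b\<^sup>2 * (\<integral>x. (score h m 1 x)\<^sup>2 \<partial>unit_law Q h) + 2 * a * b * (\<integral>x. score h m 0 x * score h m 1 x \<partial>unit_law Q h)"
      unfolding L_sq using i2 i12 by (simp del: One_nat_def)
    also have "\<dots> = \<sigma>2"
      unfolding integral_score_mult \<sigma>2_def score_var_def
      using integral_score_sq[of 0] integral_score_sq[of 1] by simp
    finally show "(\<integral>x. (L x)\<^sup>2 \<partial>unit_law Q h) = \<sigma>2" .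
  qed
  have L4: "integrable (unit_law Q h) (\<lambda>x. L x ^ 4)" "(\<integral>x. L x ^ 4 \<partial>unit_law Q h) \<le> F"
  proof -
    have le: "L x ^ 4 \<le> 8 * (a ^ 4 * score h m 0 x ^ 4 + b ^ 4 * score h m 1 x ^ 4)" for x
      using power4_sum_le[of "a * score h m 0 x" "b * score h m 1 x"] by (simp add: L_def power_mult_distrib)
    have ir: "integrable (unit_law Q h) (\<lambda>x. 8 * (a ^ 4 * score h m 0 x ^ 4 + b ^ 4 * score h m 1 x ^ 4))"
      using i4 by (intro integrable_mult_right Bochner_Integration.integrable_add)
    show iL: "integrable (unit_law Q h) (\<lambda>x. L x ^ 4)"
      by (rule Bochner_Integration.integrable_bound[OF ir]) (use le in \<open>auto simp: abs_of_nonneg\<close>)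
    have "(\<integral>x. L x ^ 4 \<partial>unit_law Q h) \<le> (\<integral>x. 8 * (a ^ 4 * score h m 0 x ^ 4 + b ^ 4 * score h m 1 x ^ 4) \<partial>unit_law Q h)"
      using iL ir le by (intro integral_mono) auto
    also have "\<dots> = 8 * (a ^ 4 * (\<integral>x. score h m 0 x ^ 4 \<partial>unit_law Q h) + b ^ 4 * (\<integral>x. score h m 1 x ^ 4 \<partial>unit_law Q h))"
      using i4 by (simp del: One_nat_def)
    also have "\<dots> \<le> 8 * (a ^ 4 * (17 * K\<^sup>2 / h) + b ^ 4 * (17 * K\<^sup>2 / (1 - h)))"
      using integral_score_power4_le[of 0] integral_score_power4_le[of 1]
      by (intro mult_left_mono add_mono) auto
    also have "\<dots> = F"
      by (simp add: F_def algebra_simps)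
    finally show "(\<integral>x. L x ^ 4 \<partial>unit_law Q h) \<le> F" .
  qed
  have \<sigma>2: "0 \<le> \<sigma>2"
    unfolding L2(2)[symmetric] by simp
  define \<phi> where "\<phi> = (CLINT x|unit_law Q h. iexp (L x / sqrt n))"
  have n': "0 < real n" "sqrt n \<noteq> 0" "(sqrt n)\<^sup>2 = n" "sqrt n ^ 4 = real n * n"
    using n by (auto simp: power4_eq_xxxx)
  have \<phi>_le: "cmod \<phi> \<le> 1"
    unfolding \<phi>_def by (rule order_trans[OF integral_norm_bound]) (simp add: U.prob_space[simplified])
  \<comment> \<open>One unit, expanded to second order: the linear term integrates to 0 because the
    scores are centred, and the cubic remainder is split into second and fourth moments.\<close>
  have d1: "cmod (\<phi> - of_real (1 - \<sigma>2 / (2 * n))) \<le> \<epsilon> * \<sigma>2 / n + F / (\<epsilon> * n * n)"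
  proof -
    let ?y = "\<lambda>x. L x / sqrt n"
    have iexp: "integrable (unit_law Q h) (\<lambda>x. iexp (?y x))"
      by (rule U.integrable_iexp) measurable
    have ty: "integrable (unit_law Q h) (\<lambda>x. 1 + \<i> * of_real (?y x) - of_real ((?y x)\<^sup>2 / 2))"
      using L1 L2 by (intro Bochner_Integration.integrable_diff Bochner_Integration.integrable_add integrable_mult_right integrable_of_real)
        (auto simp: power_divide)
    have "of_real (1 - \<sigma>2 / (2 * n)) = (CLINT x|unit_law Q h. 1 + \<i> * of_real (?y x) - of_real ((?y x)\<^sup>2 / 2))"
    proof -
      have "(CLINT x|unit_law Q h. 1 + \<i> * of_real (?y x) - of_real ((?y x)\<^sup>2 / 2))
         = (CLINT x|unit_law Q h. of_real (1 - (?y x)\<^sup>2 / 2) + \<i> * of_real (?y x))"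
        by (rule Bochner_Integration.integral_cong) auto
      also have "\<dots> = of_real (\<integral>x. 1 - (?y x)\<^sup>2 / 2 \<partial>unit_law Q h) + \<i> * of_real (\<integral>x. ?y x \<partial>unit_law Q h)"
        using L1 L2 by (intro integral_of_real_parts Bochner_Integration.integrable_diff) (auto simp: power_divide)
      also have "(\<integral>x. 1 - (?y x)\<^sup>2 / 2 \<partial>unit_law Q h) = 1 - \<sigma>2 / (2 * n)"
        using L2 U.prob_space by (simp add: power_divide mult.commute)
      also have "(\<integral>x. ?y x \<partial>unit_law Q h) = 0"
        using L1 by simp
      finally show ?thesis
        by simp
    qed
    then have "\<phi> - of_real (1 - \<sigma>2 / (2 * n)) = (CLINT x|unit_law Q h. iexp (?y x) - (1 + \<i> * of_real (?y x) - of_real ((?y x)\<^sup>2 / 2)))"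
      unfolding \<phi>_def by (simp only: Bochner_Integration.integral_diff[OF iexp ty])
    then have "cmod (\<phi> - of_real (1 - \<sigma>2 / (2 * n))) \<le> (\<integral>x. cmod (iexp (?y x) - (1 + \<i> * of_real (?y x) - of_real ((?y x)\<^sup>2 / 2))) \<partial>unit_law Q h)"
      by (simp only: integral_norm_bound)
    also have "\<dots> \<le> (\<integral>x. \<epsilon> / n * (L x)\<^sup>2 + 1 / (\<epsilon> * n * n) * L x ^ 4 \<partial>unit_law Q h)"
    proof (rule integral_mono)
      show "integrable (unit_law Q h) (\<lambda>x. cmod (iexp (?y x) - (1 + \<i> * of_real (?y x) - of_real ((?y x)\<^sup>2 / 2))))"
        by (rule integrable_norm[OF Bochner_Integration.integrable_diff[OF iexp ty]])
      show "integrable (unit_law Q h) (\<lambda>x. \<epsilon> / n * (L x)\<^sup>2 + 1 / (\<epsilon> * n * n) * L x ^ 4)"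
        using L2 L4 by (intro Bochner_Integration.integrable_add integrable_mult_right)
      fix x
      have "cmod (iexp (?y x) - (1 + \<i> * of_real (?y x) - of_real ((?y x)\<^sup>2 / 2))) \<le> \<bar>?y x\<bar> ^ 3 / 6"
        using iexp_second_order[of "?y x"] by simp
      also have "\<dots> \<le> \<bar>?y x\<bar> ^ 3"
        by simp
      also have "\<dots> \<le> \<epsilon> * (?y x)\<^sup>2 + ?y x ^ 4 / \<epsilon>"
        by (rule abs_power3_le[OF \<epsilon>])
      also have "\<dots> = \<epsilon> / n * (L x)\<^sup>2 + 1 / (\<epsilon> * n * n) * L x ^ 4"
        by (simp add: power_divide n')
      finally show "cmod (iexp (?y x) - (1 + \<i> * of_real (?y x) - of_real ((?y x)\<^sup>2 / 2))) \<le> \<epsilon> / n * (L x)\<^sup>2 + 1 / (\<epsilon> * n * n) * L x ^ 4" .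
    qed
    also have "\<dots> = \<epsilon> / n * \<sigma>2 + 1 / (\<epsilon> * n * n) * (\<integral>x. L x ^ 4 \<partial>unit_law Q h)"
      using L2 L4 by simp
    also have "\<dots> \<le> \<epsilon> / n * \<sigma>2 + 1 / (\<epsilon> * n * n) * F"
      using L4(2) \<epsilon> by (intro add_left_mono mult_left_mono) auto
    finally show ?thesis
      by simp
  qed
  \<comment> \<open>The normal factor has the same second-order expansion, with an error of order 1
    / n^2 per unit.\<close>
  have d2: "cmod (of_real (1 - \<sigma>2 / (2 * n)) - of_real (exp (- \<sigma>2 / (2 * n)))) \<le> \<sigma>2\<^sup>2 / (n * n)"
  proof -
    have "\<bar>exp (- (\<sigma>2 / (2 * n))) - (1 - \<sigma>2 / (2 * n))\<bar> \<le> (\<sigma>2 / (2 * n))\<^sup>2 / 2"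
      by (rule exp_minus_second_order) (use \<sigma>2 in auto)
    also have "\<dots> \<le> \<sigma>2\<^sup>2 / (n * n)"
    proof -
      have divide_8_le: "x / 8 \<le> x" if "0 \<le> x" for x :: real
        using that by simp
      have "(\<sigma>2 / (2 * n))\<^sup>2 / 2 = \<sigma>2\<^sup>2 / (n * n) / 8"
        by (simp add: power2_eq_square)
      also have "\<dots> \<le> \<sigma>2\<^sup>2 / (n * n)"
        by (rule divide_8_le) simp
      finally show ?thesis .
    qed
    finally show ?thesis
      unfolding of_real_diff[symmetric] norm_of_real minus_divide_left by (subst abs_minus_commute)
  qed
  have diff: "cmod (\<phi> - of_real (exp (- \<sigma>2 / (2 * n)))) \<le> \<epsilon> * \<sigma>2 / n + F / (\<epsilon> * n * n) + \<sigma>2\<^sup>2 / (n * n)"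
    by (rule norm_diff_triangle_le[OF d1 d2])
  have power: "(CLINT d|data_law n Q h. iexp (a * score_sum n h m 0 d + b * score_sum n h m 1 d)) = \<phi> ^ n"
  proof -
    interpret P: product_sigma_finite "\<lambda>_. unit_law Q h" ..
    have e: "a * score_sum n h m 0 d + b * score_sum n h m 1 d = (\<Sum>u\<in>{1..n}. L (d u) / sqrt n)" for d
      unfolding score_sum_def L_def by (simp add: sum.distrib sum_distrib_left sum_divide_distrib add_divide_distrib)
    have "(CLINT d|data_law n Q h. iexp (a * score_sum n h m 0 d + b * score_sum n h m 1 d))
        = (CLINT d|data_law n Q h. \<Prod>u\<in>{1..n}. iexp (L (d u) / sqrt n))"
      unfolding e by (simp add: exp_sum sum_distrib_left)
    also have "\<dots> = (\<Prod>u\<in>{1..n}. CLINT x|unit_law Q h. iexp (L x / sqrt n))"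
      unfolding data_law_def by (rule P.product_integral_prod, simp, rule U.integrable_iexp) measurable
    finally show ?thesis
      by (simp add: \<phi>_def)
  qed
  have exp_power: "of_real (exp (- \<sigma>2 / 2)) = complex_of_real (exp (- \<sigma>2 / (2 * n))) ^ n"
    using n by (simp add: exp_of_nat_mult[symmetric] flip: of_real_power)
  \<comment> \<open>Both bases have modulus at most 1, so their \<open>n\<close>-th powers differ by
    at most \<open>n\<close> times the difference of the bases.\<close>
  have "cmod (\<phi> ^ n - complex_of_real (exp (- \<sigma>2 / (2 * n))) ^ n) \<le> n * cmod (\<phi> - of_real (exp (- \<sigma>2 / (2 * n))))"
    using \<phi>_le \<sigma>2 by (intro norm_power_diff) auto
  also have "\<dots> \<le> n * (\<epsilon> * \<sigma>2 / n + F / (\<epsilon> * n * n) + \<sigma>2\<^sup>2 / (n * n))"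
    using diff by (intro mult_left_mono) auto
  also have "\<dots> = \<epsilon> * \<sigma>2 + F / (n * \<epsilon>) + \<sigma>2\<^sup>2 / n"
    using n' by (simp add: field_simps)
  finally show ?thesis
    unfolding power \<sigma>2_def[symmetric] F_def[symmetric] exp_power .
qed

end

end

subsection \<open>The law of the data\<close>

text \<open>Two uniqueness steps: for fixed \<open>A\<close>, the measure of
  \<open>A \<times> C\<close> as a function of \<open>C\<close> is a finite measure on a finite
  product and is determined by boxes; the resulting equality on rectangles determines the measure on
  the pair.\<close>

lemma measure_eqI_pair_PiM:
  fixes N :: "'a measure" and L :: "'b \<Rightarrow> 'c measure"
  assumes I: "finite I" and sets: "sets P = sets (N \<Otimes>\<^sub>M Pi\<^sub>M I L)" "sets P' = sets (N \<Otimes>\<^sub>M Pi\<^sub>M I L)"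
    and fin: "finite_measure P"
    and eq: "\<And>A B. A \<in> sets N \<Longrightarrow> (\<And>i. i \<in> I \<Longrightarrow> B i \<in> sets (L i)) \<Longrightarrow> emeasure P (A \<times> Pi\<^sub>E I B) = emeasure P' (A \<times> Pi\<^sub>E I B)"
  shows "P = P'"
proof -
  \<comment> \<open>A slice is encoded as an image of a restricted measure so that it is a genuine
    measure, to which uniqueness on finite products applies.\<close>
  define slice where "slice R A = distr (density R (indicator (A \<times> space (Pi\<^sub>M I L)))) (Pi\<^sub>M I L) snd"
    for R :: "('a \<times> ('b \<Rightarrow> 'c)) measure" and A
  have slice: "emeasure (slice R A) C = emeasure R (A \<times> C)"
    if [measurable_cong]: "sets R = sets (N \<Otimes>\<^sub>M Pi\<^sub>M I L)" and [measurable]: "A \<in> sets N" "C \<in> sets (Pi\<^sub>M I L)" for R A C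
  proof -
    have sp: "space R = space N \<times> space (Pi\<^sub>M I L)"
      using sets_eq_imp_space_eq[OF that(1)] by (simp add: space_pair_measure)
    have sub: "A \<subseteq> space N" "C \<subseteq> space (Pi\<^sub>M I L)"
      using that sets.sets_into_space by blast+
    have "emeasure (slice R A) C = emeasure (density R (indicator (A \<times> space (Pi\<^sub>M I L)))) (snd -` C \<inter> space R)"
      unfolding slice_def by (subst emeasure_distr) auto
    also have "snd -` C \<inter> space R = space N \<times> C"
      using sub sp by auto
    also have "emeasure (density R (indicator (A \<times> space (Pi\<^sub>M I L)))) (space N \<times> C) =
        (\<integral>\<^sup>+x. indicator (A \<times> C) x \<partial>R)"
    proof -
      have "indicator (A \<times> space (Pi\<^sub>M I L)) x * indicator (space N \<times> C) x = (indicator (A \<times> C) x :: ennreal)" for x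
        using sub by (cases x) (auto simp: indicator_def)
      then show ?thesis
        by (subst emeasure_density) auto
    qed
    also have "\<dots> = emeasure R (A \<times> C)"
      by (rule nn_integral_indicator) measurable
    finally show ?thesis .
  qed
  have AC: "emeasure P (A \<times> C) = emeasure P' (A \<times> C)" if A: "A \<in> sets N" and C: "C \<in> sets (Pi\<^sub>M I L)" for A C
  proof -
    have "slice P A = slice P' A"
    proof (rule measure_eqI_PiM_finite[OF I])
      show "sets (slice P A) = sets (Pi\<^sub>M I L)" "sets (slice P' A) = sets (Pi\<^sub>M I L)"
        by (simp_all add: slice_def)
      show "emeasure (slice P A) (Pi\<^sub>E I B) = emeasure (slice P' A) (Pi\<^sub>E I B)" if "\<And>i. i \<in> I \<Longrightarrow> B i \<in> sets (L i)" for B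
        using eq[OF A that] that I A by (simp add: slice sets)
      show "range (\<lambda>_::nat. \<Pi>\<^sub>E i\<in>I. space (L i)) \<subseteq> prod_algebra I L"
        using I by (auto intro!: prod_algebraI_finite)
      show "(\<Union>i::nat. \<Pi>\<^sub>E i\<in>I. space (L i)) = space (Pi\<^sub>M I L)"
        by (simp add: space_PiM)
      show "emeasure (slice P A) (\<Pi>\<^sub>E i\<in>I. space (L i)) \<noteq> \<infinity>" for i :: nat
      proof -
        have "emeasure (slice P A) (space (Pi\<^sub>M I L)) \<noteq> \<infinity>"
          unfolding slice[OF sets(1) A sets.top] using finite_measure.emeasure_finite[OF fin] by simp
        then show ?thesis
          by (simp add: space_PiM)
      qed
    qed
    then show ?thesis
      using slice[OF sets(1) A C] slice[OF sets(2) A C] by simp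
  qed
  show ?thesis
  proof (rule measure_eqI_generator_eq[OF Int_stable_pair_measure_generator pair_measure_closed])
    show "sets P = sigma_sets (space N \<times> space (Pi\<^sub>M I L)) {a \<times> b | a b. a \<in> sets N \<and> b \<in> sets (Pi\<^sub>M I L)}"
      "sets P' = sigma_sets (space N \<times> space (Pi\<^sub>M I L)) {a \<times> b | a b. a \<in> sets N \<and> b \<in> sets (Pi\<^sub>M I L)}"
      using sets by (simp_all add: sets_pair_measure)
    show "range (\<lambda>_::nat. space N \<times> space (Pi\<^sub>M I L)) \<subseteq> {a \<times> b | a b. a \<in> sets N \<and> b \<in> sets (Pi\<^sub>M I L)}"
      by auto
    show "emeasure P (space N \<times> space (Pi\<^sub>M I L)) \<noteq> \<infinity>" for i :: nat
      using finite_measure.emeasure_finite[OF fin] by simp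
  qed (use AC in auto)
qed

text \<open>\<open>compose\<close> restricts the result to the index set, so that the values are
  extensional functions as the product space requires.\<close>

definition assign_all :: "nat \<Rightarrow> real \<Rightarrow> (nat \<Rightarrow> real \<times> (real \<times> real)) \<Rightarrow> (nat \<Rightarrow> nat \<times> real)" where
  "assign_all n h = compose {1..n} (\<lambda>(t, y). assign h t y)"

lemma (in outcome_law) distr_assign_all:
  "distr (\<Pi>\<^sub>M u\<in>{1..n}. unif \<Otimes>\<^sub>M Q) (\<Pi>\<^sub>M u\<in>{1..n}. obs_space) (assign_all n h) = data_law n Q h"
proof -
  have "distr (\<Pi>\<^sub>M u\<in>{1..n}. unif \<Otimes>\<^sub>M Q) (\<Pi>\<^sub>M u\<in>{1..n}. unit_law Q h) (assign_all n h) = data_law n Q h"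
    unfolding assign_all_def
  proof (subst distr_PiM_finite_prob_space')
    show "(\<Pi>\<^sub>M u\<in>{1..n}. distr (unif \<Otimes>\<^sub>M Q) (unit_law Q h) (\<lambda>(t, y). assign h t y)) = data_law n Q h"
      unfolding data_law_def by (intro PiM_cong refl) (auto simp: unit_law_def intro!: distr_cong)
  qed (auto intro: prob_space_unit_law unif_Q.prob_space_axioms)
  moreover have "distr (\<Pi>\<^sub>M u\<in>{1..n}. unif \<Otimes>\<^sub>M Q) (\<Pi>\<^sub>M u\<in>{1..n}. obs_space) (assign_all n h)
      = distr (\<Pi>\<^sub>M u\<in>{1..n}. unif \<Otimes>\<^sub>M Q) (\<Pi>\<^sub>M u\<in>{1..n}. unit_law Q h) (assign_all n h)"
    by (intro distr_cong sets_PiM_cong) auto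
  ultimately show ?thesis
    by simp
qed

lemma (in outcome_law) measurable_assign_all[measurable (raw)]:
  assumes [measurable]: "h \<in> borel_measurable N" "f \<in> N \<rightarrow>\<^sub>M (\<Pi>\<^sub>M u\<in>{1..n}. unif \<Otimes>\<^sub>M Q)"
  shows "(\<lambda>x. assign_all n (h x) (f x)) \<in> N \<rightarrow>\<^sub>M (\<Pi>\<^sub>M u\<in>{1..n}. obs_space)"
proof -
  have u: "(\<lambda>x. f x u) \<in> N \<rightarrow>\<^sub>M unif \<Otimes>\<^sub>M Q" if "u \<in> {1..n}" for u
    using that by measurable
  have "fst \<in> unif \<Otimes>\<^sub>M Q \<rightarrow>\<^sub>M borel" "snd \<in> unif \<Otimes>\<^sub>M Q \<rightarrow>\<^sub>M borel"
    using measurable_fst[of unif Q] measurable_snd[of unif Q]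
    by (simp_all add: measurable_cong_sets[OF refl sets_unif] measurable_cong_sets[OF refl sets_Q])
  then show ?thesis
    unfolding assign_all_def compose_def case_prod_beta
    by (intro measurable_restrict measurable_assign) (auto intro: measurable_compose[OF u])
qed

lemma (in outcome_law) prob_space_noise: "prob_space (\<Pi>\<^sub>M u\<in>{1..n}. unif \<Otimes>\<^sub>M Q)"
  by (intro prob_space_PiM unif_Q.prob_space_axioms)

lemma ennreal_convex_combination:
  "0 \<le> a \<Longrightarrow> 0 \<le> b \<Longrightarrow> 0 \<le> x \<Longrightarrow> 0 \<le> y \<Longrightarrow> ennreal a * ennreal x + ennreal b * ennreal y = ennreal (a * x + b * y)"
  by (simp add: ennreal_mult)

section \<open>The two-stage law as an iterated integral\<close>

text \<open>The noise of the follow-up stage is independent of the pilot data, and the propensity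
  enters only through the map. Conditioning on the pilot data is then plain iterated
  integration.\<close>

definition two_stage_law ::
    "nat \<Rightarrow> nat \<Rightarrow> (real \<times> real) measure \<Rightarrow> real \<Rightarrow> ((nat \<Rightarrow> nat \<times> real) \<Rightarrow> real) \<Rightarrow>
      ((nat \<Rightarrow> nat \<times> real) \<times> (nat \<Rightarrow> nat \<times> real)) measure" where
  "two_stage_law n\<^sub>1 n\<^sub>2 Q h \<pi> = distr (data_law n\<^sub>1 Q h \<Otimes>\<^sub>M (\<Pi>\<^sub>M u\<in>{1..n\<^sub>2}. unif \<Otimes>\<^sub>M Q))
     ((\<Pi>\<^sub>M u\<in>{1..n\<^sub>1}. obs_space) \<Otimes>\<^sub>M (\<Pi>\<^sub>M u\<in>{1..n\<^sub>2}. obs_space)) (\<lambda>(d, \<eta>). (d, assign_all n\<^sub>2 (\<pi> d) \<eta>))"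

text \<open>The pilot statistic as a function of the recorded data, which exhibits the follow-up
  propensity as a function of the pilot history.\<close>

definition pilot_diff :: "(nat \<Rightarrow> real) \<Rightarrow> nat \<Rightarrow> (nat \<Rightarrow> nat \<times> real) \<Rightarrow> real" where
  "pilot_diff p n d =
     (\<Sum>u\<in>{1..n}. of_bool (fst (d u) = 0) * snd (d u) / p 0) / sqrt (real n)
   - (\<Sum>u\<in>{1..n}. of_bool (fst (d u) = 1) * snd (d u) / p 1) / sqrt (real n)"

lemma measurable_pilot_diff[measurable]: "pilot_diff p n \<in> borel_measurable (\<Pi>\<^sub>M u\<in>{1..n}. obs_space)"
  unfolding pilot_diff_def by measurable

definition data :: "('a, 'z) trial_scheme \<Rightarrow> nat \<Rightarrow> 'a \<Rightarrow> nat \<Rightarrow> nat \<times> real" where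
  "data X t \<omega> = (\<lambda>u\<in>{1..stage_size X t}. (treatment X t u \<omega>, observed X t u \<omega>))"

lemma clip_complement: "l \<le> 1 / 2 \<Longrightarrow> 1 - clip l x = clip l (1 - x)"
  by (auto simp: clip_def min_def max_def)

lemma clip_bounds: "l \<le> 1 / 2 \<Longrightarrow> l \<le> clip l x \<and> clip l x \<le> 1 - l"
  by (auto simp: clip_def)

context outcome_law
begin

lemma sets_data_law: "sets (data_law n Q h) = sets (\<Pi>\<^sub>M u\<in>{1..n}. obs_space)"
  unfolding data_law_def by (intro sets_PiM_cong) auto

lemma prob_space_data_law: "prob_space (data_law n Q h)"
  unfolding data_law_def by (intro prob_space_PiM prob_space_unit_law)

context
  fixes n\<^sub>1 n\<^sub>2 :: nat and h :: real and \<pi> :: "(nat \<Rightarrow> nat \<times> real) \<Rightarrow> real"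
  assumes \<pi>[measurable]: "\<pi> \<in> borel_measurable (\<Pi>\<^sub>M u\<in>{1..n\<^sub>1}. obs_space)"
begin

lemma measurable_two_stage:
  "(\<lambda>(d, \<eta>). (d, assign_all n\<^sub>2 (\<pi> d) \<eta>)) \<in> data_law n\<^sub>1 Q h \<Otimes>\<^sub>M (\<Pi>\<^sub>M u\<in>{1..n\<^sub>2}. unif \<Otimes>\<^sub>M Q)
     \<rightarrow>\<^sub>M (\<Pi>\<^sub>M u\<in>{1..n\<^sub>1}. obs_space) \<Otimes>\<^sub>M (\<Pi>\<^sub>M u\<in>{1..n\<^sub>2}. obs_space)"
proof -
  note [measurable_cong] = sets_data_law
  show ?thesis
    by measurable
qed

lemma measurable_assign_all_fixed:
  "assign_all n c \<in> (\<Pi>\<^sub>M u\<in>{1..n}. unif \<Otimes>\<^sub>M Q) \<rightarrow>\<^sub>M (\<Pi>\<^sub>M u\<in>{1..n}. obs_space)"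
  using measurable_assign_all[of "\<lambda>_. c" _ "\<lambda>x. x" n] by simp

lemma pair_prob_space_two_stage: "pair_prob_space (data_law n\<^sub>1 Q h) (\<Pi>\<^sub>M u\<in>{1..n\<^sub>2}. unif \<Otimes>\<^sub>M Q)"
  by (intro pair_prob_space.intro pair_sigma_finite.intro prob_space_imp_sigma_finite prob_space_data_law prob_space_noise)

text \<open>For fixed \<open>d\<close> the map sends the noise to \<open>n\<^sub>2\<close>
  independent units with propensity \<open>\<pi> d\<close>; Fubini does the rest.\<close>

lemma nn_integral_two_stage_law:
  assumes F: "F \<in> borel_measurable ((\<Pi>\<^sub>M u\<in>{1..n\<^sub>1}. obs_space) \<Otimes>\<^sub>M (\<Pi>\<^sub>M u\<in>{1..n\<^sub>2}. obs_space))"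
  shows "(\<integral>\<^sup>+z. F z \<partial>two_stage_law n\<^sub>1 n\<^sub>2 Q h \<pi>) = (\<integral>\<^sup>+d. \<integral>\<^sup>+y. F (d, y) \<partial>data_law n\<^sub>2 Q (\<pi> d) \<partial>data_law n\<^sub>1 Q h)"
proof -
  interpret N: prob_space "\<Pi>\<^sub>M u\<in>{1..n\<^sub>2}. unif \<Otimes>\<^sub>M Q"
    by (rule prob_space_noise)
  note [measurable] = F measurable_two_stage
  have "(\<integral>\<^sup>+z. F z \<partial>two_stage_law n\<^sub>1 n\<^sub>2 Q h \<pi>)
      = (\<integral>\<^sup>+z. F ((\<lambda>(d, \<eta>). (d, assign_all n\<^sub>2 (\<pi> d) \<eta>)) z) \<partial>(data_law n\<^sub>1 Q h \<Otimes>\<^sub>M (\<Pi>\<^sub>M u\<in>{1..n\<^sub>2}. unif \<Otimes>\<^sub>M Q)))"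
    unfolding two_stage_law_def by (rule nn_integral_distr[OF measurable_two_stage]) (subst measurable_distr_eq1, rule F)
  also have "\<dots> = (\<integral>\<^sup>+d. \<integral>\<^sup>+\<eta>. F (d, assign_all n\<^sub>2 (\<pi> d) \<eta>) \<partial>(\<Pi>\<^sub>M u\<in>{1..n\<^sub>2}. unif \<Otimes>\<^sub>M Q) \<partial>data_law n\<^sub>1 Q h)"
    using N.nn_integral_fst[OF measurable_compose[OF measurable_two_stage F]] by simp
  also have "\<dots> = (\<integral>\<^sup>+d. \<integral>\<^sup>+y. F (d, y) \<partial>data_law n\<^sub>2 Q (\<pi> d) \<partial>data_law n\<^sub>1 Q h)"
  proof (rule nn_integral_cong)
    fix d assume "d \<in> space (data_law n\<^sub>1 Q h)"
    then have d: "d \<in> space (\<Pi>\<^sub>M u\<in>{1..n\<^sub>1}. obs_space)"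
      using sets_eq_imp_space_eq[OF sets_data_law] by simp
    have "(\<lambda>y. F (d, y)) \<in> borel_measurable (\<Pi>\<^sub>M u\<in>{1..n\<^sub>2}. obs_space)"
      using measurable_compose[OF measurable_Pair1'[OF d] F] by simp
    then show "(\<integral>\<^sup>+\<eta>. F (d, assign_all n\<^sub>2 (\<pi> d) \<eta>) \<partial>(\<Pi>\<^sub>M u\<in>{1..n\<^sub>2}. unif \<Otimes>\<^sub>M Q)) = (\<integral>\<^sup>+y. F (d, y) \<partial>data_law n\<^sub>2 Q (\<pi> d))"
      unfolding distr_assign_all[symmetric] by (intro nn_integral_distr[symmetric] measurable_assign_all_fixed) simp_all
  qed
  finally show ?thesis .
qed

lemma
  fixes F :: "(nat \<Rightarrow> nat \<times> real) \<times> (nat \<Rightarrow> nat \<times> real) \<Rightarrow> complex"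
  assumes F: "F \<in> borel_measurable ((\<Pi>\<^sub>M u\<in>{1..n\<^sub>1}. obs_space) \<Otimes>\<^sub>M (\<Pi>\<^sub>M u\<in>{1..n\<^sub>2}. obs_space))"
    and bd: "\<And>z. norm (F z) \<le> B"
  shows integral_two_stage_law: "(\<integral>z. F z \<partial>two_stage_law n\<^sub>1 n\<^sub>2 Q h \<pi>) = (\<integral>d. \<integral>y. F (d, y) \<partial>data_law n\<^sub>2 Q (\<pi> d) \<partial>data_law n\<^sub>1 Q h)"
    and integrable_two_stage_law: "integrable (data_law n\<^sub>1 Q h) (\<lambda>d. \<integral>y. F (d, y) \<partial>data_law n\<^sub>2 Q (\<pi> d))"
proof -
  interpret P: pair_prob_space "data_law n\<^sub>1 Q h" "\<Pi>\<^sub>M u\<in>{1..n\<^sub>2}. unif \<Otimes>\<^sub>M Q"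
    by (rule pair_prob_space_two_stage)
  have int: "integrable (data_law n\<^sub>1 Q h \<Otimes>\<^sub>M (\<Pi>\<^sub>M u\<in>{1..n\<^sub>2}. unif \<Otimes>\<^sub>M Q)) (\<lambda>z. F ((\<lambda>(d, \<eta>). (d, assign_all n\<^sub>2 (\<pi> d) \<eta>)) z))"
    by (rule P.integrable_of_bounded[where B=B, OF measurable_compose[OF measurable_two_stage F] bd])
  have inner: "(\<integral>\<eta>. F (d, assign_all n\<^sub>2 (\<pi> d) \<eta>) \<partial>(\<Pi>\<^sub>M u\<in>{1..n\<^sub>2}. unif \<Otimes>\<^sub>M Q)) = (\<integral>y. F (d, y) \<partial>data_law n\<^sub>2 Q (\<pi> d))"
    if "d \<in> space (data_law n\<^sub>1 Q h)" for d
  proof -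
    have d: "d \<in> space (\<Pi>\<^sub>M u\<in>{1..n\<^sub>1}. obs_space)"
      using that sets_eq_imp_space_eq[OF sets_data_law] by simp
    have "(\<lambda>y. F (d, y)) \<in> borel_measurable (\<Pi>\<^sub>M u\<in>{1..n\<^sub>2}. obs_space)"
      using measurable_compose[OF measurable_Pair1'[OF d] F] by simp
    then show ?thesis
      unfolding distr_assign_all[symmetric] by (intro integral_distr[symmetric] measurable_assign_all_fixed) simp_all
  qed
  have "(\<integral>z. F z \<partial>two_stage_law n\<^sub>1 n\<^sub>2 Q h \<pi>)
      = (\<integral>z. F ((\<lambda>(d, \<eta>). (d, assign_all n\<^sub>2 (\<pi> d) \<eta>)) z) \<partial>(data_law n\<^sub>1 Q h \<Otimes>\<^sub>M (\<Pi>\<^sub>M u\<in>{1..n\<^sub>2}. unif \<Otimes>\<^sub>M Q)))"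
    unfolding two_stage_law_def by (rule integral_distr[OF measurable_two_stage F])
  also have "\<dots> = (\<integral>d. \<integral>\<eta>. F (d, assign_all n\<^sub>2 (\<pi> d) \<eta>) \<partial>(\<Pi>\<^sub>M u\<in>{1..n\<^sub>2}. unif \<Otimes>\<^sub>M Q) \<partial>data_law n\<^sub>1 Q h)"
    using P.integral_fst'[OF int] by simp
  also have "\<dots> = (\<integral>d. \<integral>y. F (d, y) \<partial>data_law n\<^sub>2 Q (\<pi> d) \<partial>data_law n\<^sub>1 Q h)"
    by (rule Bochner_Integration.integral_cong[OF refl inner])
  finally show "(\<integral>z. F z \<partial>two_stage_law n\<^sub>1 n\<^sub>2 Q h \<pi>) = (\<integral>d. \<integral>y. F (d, y) \<partial>data_law n\<^sub>2 Q (\<pi> d) \<partial>data_law n\<^sub>1 Q h)" .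
  have "integrable (data_law n\<^sub>1 Q h) (\<lambda>d. \<integral>\<eta>. F (d, assign_all n\<^sub>2 (\<pi> d) \<eta>) \<partial>(\<Pi>\<^sub>M u\<in>{1..n\<^sub>2}. unif \<Otimes>\<^sub>M Q))"
    using P.integrable_fst'[OF int] by simp
  then show "integrable (data_law n\<^sub>1 Q h) (\<lambda>d. \<integral>y. F (d, y) \<partial>data_law n\<^sub>2 Q (\<pi> d))"
    using inner by (subst Bochner_Integration.integrable_cong[OF refl inner[symmetric]]) auto
qed

end

end

section \<open>Identification of the law of the recorded data\<close>

locale regular_experiment = two_stage_experiment X Q p e l
  for X :: "'a trial" and Q p e l +
  fixes K :: real
  assumes stage_pos: "t \<in> {1, 2} \<Longrightarrow> 0 < stage_size X t"
    and outcome_law_Q: "outcome_law Q K"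
    and p_pos: "0 < p 0" "0 < p 1" and p_sum: "p 0 + p 1 = 1"
    and e_measurable[measurable]: "(\<lambda>x. e 0 (ereal x)) \<in> borel_measurable borel"
    and e_sum: "x < \<infinity> \<Longrightarrow> e 0 x + e 1 x = 1"
begin

interpretation Q: outcome_law Q K by (rule outcome_law_Q)

abbreviation "n\<^sub>1 \<equiv> stage_size X 1"
abbreviation "n\<^sub>2 \<equiv> stage_size X 2"
abbreviation "D\<^sub>1 \<equiv> \<Pi>\<^sub>M u\<in>{1..n\<^sub>1}. obs_space"
abbreviation "D\<^sub>2 \<equiv> \<Pi>\<^sub>M u\<in>{1..n\<^sub>2}. obs_space"
abbreviation "M \<equiv> prob_sp X"
abbreviation "outcomes t u \<equiv> \<lambda>\<omega>. (outcome X t u 0 \<omega>, outcome X t u 1 \<omega>)"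

definition \<pi> :: "(nat \<Rightarrow> nat \<times> real) \<Rightarrow> real" where
  "\<pi> d = clip l (e 0 (ereal (pilot_diff p n\<^sub>1 d)))"

lemma clip_measurable: "clip c \<in> borel_measurable borel"
  unfolding clip_def by measurable

lemma measurable_\<pi>[measurable]: "\<pi> \<in> borel_measurable D\<^sub>1"
  unfolding \<pi>_def using clip_measurable by measurable

lemma \<pi>_bounds: "l \<le> \<pi> d" "\<pi> d \<le> 1 - l"
  unfolding \<pi>_def using clip_bounds clipping_rate by auto

lemma \<pi>_unit: "0 \<le> \<pi> d" "\<pi> d \<le> 1"
  using \<pi>_bounds[of d] clipping_rate by auto

lemma measurable_outcomes: "t \<in> {1, 2} \<Longrightarrow> u \<in> {1..stage_size X t} \<Longrightarrow> outcomes t u \<in> M \<rightarrow>\<^sub>M borel"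
  using unconfounded[of t u] by (simp add: cond_indep_var_def)

lemma observed_eq:
  assumes "t \<in> {1, 2}" "u \<in> {1..stage_size X t}" "\<omega> \<in> space M"
  shows "observed X t u \<omega> = arm (treatment X t u \<omega>) (outcomes t u \<omega>)"
  using treatment_binary[OF assms] by (auto simp: observed_def)

lemma measurable_unit:
  assumes "t \<in> {1, 2}" "u \<in> {1..stage_size X t}"
  shows "(\<lambda>\<omega>. (treatment X t u \<omega>, observed X t u \<omega>)) \<in> M \<rightarrow>\<^sub>M obs_space"
proof -
  note [measurable] = treatment_measurable[OF assms] measurable_outcomes[OF assms]
  have "(\<lambda>\<omega>. fst (outcomes t u \<omega>)) \<in> borel_measurable M" "(\<lambda>\<omega>. snd (outcomes t u \<omega>)) \<in> borel_measurable M"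
    by measurable
  then have [measurable]: "outcome X t u 0 \<in> borel_measurable M" "outcome X t u 1 \<in> borel_measurable M"
    by simp_all
  have "observed X t u \<in> borel_measurable M"
    unfolding observed_def by measurable
  then show ?thesis
    by measurable
qed

lemma measurable_data: "t \<in> {1, 2} \<Longrightarrow> data X t \<in> M \<rightarrow>\<^sub>M (\<Pi>\<^sub>M u\<in>{1..stage_size X t}. obs_space)"
  unfolding data_def by (intro measurable_restrict measurable_unit) auto

text \<open>Every pilot event is a preimage under the pilot data, which is what turns integrals over
  pilot events into integrals against the pilot law.\<close>

lemma sets_history_1: "sets (history X 1) = {data X 1 -` B \<inter> space M | B. B \<in> sets D\<^sub>1}"
proof -
  have "history X 1 = vimage_algebra (space M) (data X 1) D\<^sub>1"
    unfolding history_def data_def[abs_def] obs_space_def by simp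
  moreover have "data X 1 \<in> space M \<rightarrow> space D\<^sub>1"
    using measurable_space[OF measurable_data[of 1]] by auto
  ultimately show ?thesis
    by (simp add: sets_vimage_algebra2)
qed

lemma subalgebra_history: "t \<in> {1, 2} \<Longrightarrow> subalgebra M (history X (t - 1))"
proof -
  have "sets (history X 1) \<subseteq> sets M"
    unfolding sets_history_1 using measurable_sets[OF measurable_data[of 1]] by auto
  moreover have "subalgebra M (history X 0)"
    by (auto simp: subalgebra_def history_def sigma_sets_empty_eq)
  ultimately show "t \<in> {1, 2} \<Longrightarrow> subalgebra M (history X (t - 1))"
    by (auto simp: subalgebra_def history_def)
qed

lemma finite_measure_subalgebra_history: "t \<in> {1, 2} \<Longrightarrow> finite_measure_subalgebra M (history X (t - 1))"
  using subalgebra_history by (simp add: finite_measure_subalgebra_def finite_measure_subalgebra_axioms_def finite_measure_axioms)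

lemma cprob_measurable: "t \<in> {1, 2} \<Longrightarrow> cprob M (history X (t - 1)) E \<in> borel_measurable M"
  unfolding cprob_def by measurable

lemma integrable_indicator_event: "E \<in> sets M \<Longrightarrow> integrable M (indicat_real E)"
  by (rule integrable_real_indicator) (auto simp: emeasure_eq_measure)

lemma set_integral_cprob:
  assumes "t \<in> {1, 2}" "E \<in> sets M" "A \<in> sets (history X (t - 1))"
  shows "(\<integral>\<omega>\<in>A. cprob M (history X (t - 1)) E \<omega> \<partial>M) = prob (A \<inter> E)"
proof -
  interpret H: finite_measure_subalgebra M "history X (t - 1)"
    by (rule finite_measure_subalgebra_history[OF assms(1)])
  have A: "A \<in> sets M"
    using assms(1,3) subalgebra_history by (auto simp: subalgebra_def)
  have "(\<integral>\<omega>\<in>A. cprob M (history X (t - 1)) E \<omega> \<partial>M) = (\<integral>\<omega>\<in>A. indicator E \<omega> \<partial>M)"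
    unfolding cprob_def by (rule H.real_cond_exp_intA[symmetric, OF integrable_indicator_event[OF assms(2)] assms(3)])
  also have "\<dots> = (\<integral>\<omega>. indicator (A \<inter> E) \<omega> \<partial>M)"
    by (auto simp: set_lebesgue_integral_def indicator_def intro!: Bochner_Integration.integral_cong)
  also have "\<dots> = prob (A \<inter> E)"
    using A assms by simp
  finally show ?thesis .
qed

lemma cprob_eq_prob:
  assumes "t \<in> {1, 2}" "E \<in> sets M" "\<And>A. A \<in> sets (history X (t - 1)) \<Longrightarrow> prob (A \<inter> E) = prob A * prob E"
  shows "AE \<omega> in M. cprob M (history X (t - 1)) E \<omega> = prob E"
proof -
  interpret H: finite_measure_subalgebra M "history X (t - 1)"
    by (rule finite_measure_subalgebra_history[OF assms(1)])
  show ?thesis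
    unfolding cprob_def
  proof (rule H.real_cond_exp_charact)
    fix A assume A: "A \<in> sets (history X (t - 1))"
    then have AM: "A \<in> sets M"
      using assms(1) subalgebra_history by (auto simp: subalgebra_def)
    have "(\<integral>\<omega>\<in>A. indicator E \<omega> \<partial>M) = (\<integral>\<omega>. indicator (A \<inter> E) \<omega> \<partial>M)"
      by (auto simp: set_lebesgue_integral_def indicator_def intro!: Bochner_Integration.integral_cong)
    also have "\<dots> = prob A * prob E"
      using AM assms A by simp
    finally show "(\<integral>\<omega>\<in>A. indicator E \<omega> \<partial>M) = (\<integral>\<omega>\<in>A. prob E \<partial>M)"
      using AM by (simp add: set_lebesgue_integral_def)
  qed (use assms in \<open>auto intro: integrable_indicator_event\<close>)
qed

lemma cprob_disjoint_union:
  assumes "t \<in> {1, 2}" "E \<in> sets M" "E' \<in> sets M" "E \<inter> E' = {}"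
  shows "AE \<omega> in M. cprob M (history X (t - 1)) (E \<union> E') \<omega> = cprob M (history X (t - 1)) E \<omega> + cprob M (history X (t - 1)) E' \<omega>"
proof -
  interpret H: finite_measure_subalgebra M "history X (t - 1)"
    by (rule finite_measure_subalgebra_history[OF assms(1)])
  have "AE \<omega> in M. real_cond_exp M (history X (t - 1)) (\<lambda>\<omega>. indicat_real E \<omega> + indicat_real E' \<omega>) \<omega>
      = cprob M (history X (t - 1)) E \<omega> + cprob M (history X (t - 1)) E' \<omega>"
    unfolding cprob_def by (rule H.real_cond_exp_add[OF integrable_indicator_event[OF assms(2)] integrable_indicator_event[OF assms(3)]])
  moreover have "(\<lambda>\<omega>. indicat_real E \<omega> + indicat_real E' \<omega>) = indicator (E \<union> E')"
    using assms(4) by (auto simp: fun_eq_iff indicator_def)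
  ultimately show ?thesis
    by (simp add: cprob_def)
qed

text \<open>In the pilot stage the history is trivial; in the follow-up stage
  \<open>fresh_outcomes\<close> makes the potential outcomes independent of the history. Either way
  conditioning leaves their law \<open>Q\<close> unchanged.\<close>

lemma cprob_outcomes:
  assumes t: "t \<in> {1, 2}" and u: "u \<in> {1..stage_size X t}" and B: "B \<in> sets borel"
  shows "AE \<omega> in M. cprob M (history X (t - 1)) {\<omega> \<in> space M. outcomes t u \<omega> \<in> B} \<omega> = measure Q B"
proof -
  note [measurable] = measurable_outcomes[OF t u]
  let ?E = "{\<omega> \<in> space M. outcomes t u \<omega> \<in> B}"
  have E: "?E = outcomes t u -` B \<inter> space M"
    by auto
  have "measure Q B = prob ?E"
    unfolding E outcomes_law[OF t u, symmetric] by (rule measure_distr[OF measurable_outcomes[OF t u] B])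
  moreover have "AE \<omega> in M. cprob M (history X (t - 1)) ?E \<omega> = prob ?E"
  proof (rule cprob_eq_prob[OF t])
    show "?E \<in> sets M"
      using B by measurable
    fix A assume A: "A \<in> sets (history X (t - 1))"
    show "prob (A \<inter> ?E) = prob A * prob ?E"
    proof (cases "t = 1")
      case True
      then have "A = {} \<or> A = space M"
        using A by (auto simp: history_def sigma_sets_empty_eq)
      then show ?thesis
        by (auto simp: prob_space Int_absorb1)
    next
      case False
      then have "t = 2"
        using t by auto
      then show ?thesis
        using A u B unfolding E by (intro indep_setD[OF fresh_outcomes]) auto
    qed
  qed
  ultimately show ?thesis
    by simp
qed

text \<open>The outcome recorded in arm \<open>s\<close> is the potential outcome of that arm, so
  the event splits according to the treatment, and unconfoundedness factorises each of the two
  disjoint pieces.\<close>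

lemma cprob_unit:
  assumes t: "t \<in> {1, 2}" and u: "u \<in> {1..stage_size X t}" and B: "B \<in> sets obs_space"
  shows "AE \<omega> in M. cprob M (history X (t - 1)) {\<omega> \<in> space M. (treatment X t u \<omega>, observed X t u \<omega>) \<in> B} \<omega>
    = cprob M (history X (t - 1)) {\<omega> \<in> space M. treatment X t u \<omega> = 0} \<omega> * measure Q {y. (0, arm 0 y) \<in> B}
    + cprob M (history X (t - 1)) {\<omega> \<in> space M. treatment X t u \<omega> = 1} \<omega> * measure Q {y. (1, arm 1 y) \<in> B}"
proof -
  note [measurable] = measurable_outcomes[OF t u] treatment_measurable[OF t u]
  let ?H = "history X (t - 1)"
  let ?B = "\<lambda>s. {y. (s, arm s y) \<in> B}"
  have [measurable]: "?B s \<in> sets borel" for s :: nat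
  proof -
    have "(\<lambda>y. (s, arm s y)) -` B \<inter> space borel \<in> sets borel"
      by (rule measurable_sets[OF _ B]) measurable
    then show ?thesis
      by (simp add: vimage_def)
  qed
  let ?E = "\<lambda>s. {\<omega> \<in> space M. outcomes t u \<omega> \<in> ?B s \<and> treatment X t u \<omega> \<in> {s}}"
  have E: "?E s \<in> sets M" for s
  proof -
    have "?E s = (outcomes t u -` ?B s \<inter> space M) \<inter> (treatment X t u -` {s} \<inter> space M)"
      by auto
    then show ?thesis
      using measurable_sets[OF measurable_outcomes[OF t u], of "?B s"] measurable_sets[OF treatment_measurable[OF t u], of "{s}"]
      by auto
  qed
  have un: "{\<omega> \<in> space M. (treatment X t u \<omega>, observed X t u \<omega>) \<in> B} = ?E 0 \<union> ?E 1"
  proof (rule set_eqI)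
    fix \<omega>
    show "\<omega> \<in> {\<omega> \<in> space M. (treatment X t u \<omega>, observed X t u \<omega>) \<in> B} \<longleftrightarrow> \<omega> \<in> ?E 0 \<union> ?E 1"
    proof (cases "\<omega> \<in> space M")
      case True
      have "treatment X t u \<omega> = 0 \<or> treatment X t u \<omega> = 1"
        using treatment_binary[OF t u True] by auto
      then show ?thesis
        using True by (auto simp: observed_eq[OF t u True])
    qed simp
  qed
  have one: "AE \<omega> in M. cprob M ?H (?E s) \<omega> = cprob M ?H {\<omega> \<in> space M. treatment X t u \<omega> = s} \<omega> * measure Q (?B s)" for s
  proof -
    have "AE \<omega> in M. cprob M ?H (?E s) \<omega> = cprob M ?H {\<omega> \<in> space M. outcomes t u \<omega> \<in> ?B s} \<omega> * cprob M ?H {\<omega> \<in> space M. treatment X t u \<omega> \<in> {s}} \<omega>"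
    proof -
      have "?B s \<in> sets borel" "{s} \<in> sets (count_space UNIV)"
        by measurable
      then show ?thesis
        using unconfounded[OF t u] unfolding cond_indep_var_def by blast
    qed
    moreover have "AE \<omega> in M. cprob M ?H {\<omega> \<in> space M. outcomes t u \<omega> \<in> ?B s} \<omega> = measure Q (?B s)"
      by (rule cprob_outcomes[OF t u]) measurable
    ultimately show ?thesis
      by eventually_elim simp
  qed
  have disj: "?E 0 \<inter> ?E 1 = {}"
    by auto
  from one[of 0] one[of 1] cprob_disjoint_union[OF t E E disj] show ?thesis
    unfolding un by eventually_elim simp
qed

lemma cprob_history_0:
  assumes "E \<in> sets M"
  shows "AE \<omega> in M. cprob M (history X 0) E \<omega> = prob E"
proof -
  have "prob (A \<inter> E) = prob A * prob E" if "A \<in> sets (history X 0)" for A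
  proof -
    have "A = {} \<or> A = space M"
      using that by (auto simp: history_def sigma_sets_empty_eq)
    then show ?thesis
      using sets.sets_into_space[OF assms] by (auto simp: prob_space Int_absorb1)
  qed
  then show ?thesis
    using cprob_eq_prob[of 1 E] assms by simp
qed

lemma distr_pilot_unit:
  assumes u: "u \<in> {1..n\<^sub>1}"
  shows "distr M obs_space (\<lambda>\<omega>. (treatment X 1 u \<omega>, observed X 1 u \<omega>)) = unit_law Q (p 0)"
proof (rule measure_eqI)
  have one: "(1::nat) \<in> {1, 2}" by simp
  note [measurable] = treatment_measurable[OF one u] measurable_unit[OF one u]
  fix B assume "B \<in> sets (distr M obs_space (\<lambda>\<omega>. (treatment X 1 u \<omega>, observed X 1 u \<omega>)))"
  then have B[measurable]: "B \<in> sets obs_space"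
    by simp
  have meas: "{\<omega> \<in> space M. (treatment X 1 u \<omega>, observed X 1 u \<omega>) \<in> B} \<in> sets M" "{\<omega> \<in> space M. treatment X 1 u \<omega> = s} \<in> sets M" for s
    by measurable
  have "AE \<omega> in M. prob {\<omega> \<in> space M. (treatment X 1 u \<omega>, observed X 1 u \<omega>) \<in> B}
      = p 0 * measure Q {y. (0, arm 0 y) \<in> B} + p 1 * measure Q {y. (1, arm 1 y) \<in> B}"
    using cprob_unit[OF one u B] cprob_history_0[OF meas(1)] cprob_history_0[OF meas(2), of 0] cprob_history_0[OF meas(2), of 1]
    unfolding diff_self_eq_0
  proof eventually_elim
    case (elim \<omega>)
    then show ?case
      using pilot_prob[OF u, of 0] pilot_prob[OF u, of 1] by simp
  qed
  \<comment> \<open>Both sides are constants and the space is not null, so the almost sure identity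
    is an identity.\<close>
  then have "prob {\<omega> \<in> space M. (treatment X 1 u \<omega>, observed X 1 u \<omega>) \<in> B}
      = p 0 * measure Q {y. (0, arm 0 y) \<in> B} + p 1 * measure Q {y. (1, arm 1 y) \<in> B}"
    using not_empty by simp
  note prob_B = this
  have Q_B: "emeasure (unit_law Q (p 0)) B = ennreal (p 0 * measure Q {y. (0, arm 0 y) \<in> B} + p 1 * measure Q {y. (1, arm 1 y) \<in> B})"
  proof -
    have p1: "1 - p 0 = p 1"
      using p_sum by simp
    have "0 \<le> p 0" "p 0 \<le> 1"
      using p_pos p_sum by auto
    from Q.emeasure_unit_law[OF this B] show ?thesis
      unfolding p1 Q.emeasure_eq_measure using p_pos by (simp only: ennreal_convex_combination measure_nonneg less_imp_le)
  qed
  show "emeasure (distr M obs_space (\<lambda>\<omega>. (treatment X 1 u \<omega>, observed X 1 u \<omega>))) B = emeasure (unit_law Q (p 0)) B"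
  proof -
    have "(\<lambda>\<omega>. (treatment X 1 u \<omega>, observed X 1 u \<omega>)) -` B \<inter> space M = {\<omega> \<in> space M. (treatment X 1 u \<omega>, observed X 1 u \<omega>) \<in> B}"
      by auto
    then have "emeasure (distr M obs_space (\<lambda>\<omega>. (treatment X 1 u \<omega>, observed X 1 u \<omega>))) B
        = ennreal (prob {\<omega> \<in> space M. (treatment X 1 u \<omega>, observed X 1 u \<omega>) \<in> B})"
      by (subst emeasure_distr[OF measurable_unit[OF one u] B]) (simp only: emeasure_eq_measure)
    then show ?thesis
      unfolding prob_B Q_B .
  qed
qed (simp add: Q.sets_unit_law)

lemma distr_pilot: "distr M D\<^sub>1 (data X 1) = data_law n\<^sub>1 Q (p 0)"
proof -
  have ne: "{1..n\<^sub>1} \<noteq> {}"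
    using stage_pos[of 1] by auto
  have "distr M (\<Pi>\<^sub>M u\<in>{1..n\<^sub>1}. obs_space) (\<lambda>\<omega>. \<lambda>u\<in>{1..n\<^sub>1}. (treatment X 1 u \<omega>, observed X 1 u \<omega>))
      = (\<Pi>\<^sub>M u\<in>{1..n\<^sub>1}. distr M obs_space (\<lambda>\<omega>. (treatment X 1 u \<omega>, observed X 1 u \<omega>)))"
    using pilot_indep measurable_unit[of 1] by (subst (asm) indep_vars_iff_distr_eq_PiM'[OF ne]) (auto simp: obs_space_def)
  also have "\<dots> = data_law n\<^sub>1 Q (p 0)"
    unfolding data_law_def by (intro PiM_cong refl distr_pilot_unit)
  finally show ?thesis
    by (simp add: data_def[abs_def])
qed

lemma pilot_stat_eq: "pilot_stat p X 0 \<omega> - pilot_stat p X 1 \<omega> = pilot_diff p n\<^sub>1 (data X 1 \<omega>)"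
  by (simp add: pilot_stat_def pilot_diff_def data_def)

text \<open>The two arms exhaust the space, so the second probability is the complement of the first
  up to a null set.\<close>

lemma cprob_followup:
  assumes u: "u \<in> {1..n\<^sub>2}"
  shows "AE \<omega> in M. cprob M (history X 1) {\<omega> \<in> space M. treatment X 2 u \<omega> = 0} \<omega> = \<pi> (data X 1 \<omega>)"
    and "AE \<omega> in M. cprob M (history X 1) {\<omega> \<in> space M. treatment X 2 u \<omega> = 1} \<omega> = 1 - \<pi> (data X 1 \<omega>)"
proof -
  have two: "(2::nat) \<in> {1, 2}" by simp
  note [measurable] = treatment_measurable[OF two u]
  let ?E = "\<lambda>s. {\<omega> \<in> space M. treatment X 2 u \<omega> = s}"
  show 0: "AE \<omega> in M. cprob M (history X 1) (?E 0) \<omega> = \<pi> (data X 1 \<omega>)"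
    using followup_prob[OF u] unfolding pilot_stat_eq \<pi>_def .
  have E: "?E s \<in> sets M" for s
    by measurable
  have "?E 0 \<inter> ?E 1 = {}"
    by auto
  from cprob_disjoint_union[OF two E E this]
  have "AE \<omega> in M. cprob M (history X 1) (?E 0 \<union> ?E 1) \<omega> = cprob M (history X 1) (?E 0) \<omega> + cprob M (history X 1) (?E 1) \<omega>"
    by simp
  moreover have "?E 0 \<union> ?E 1 = space M"
    using treatment_binary[OF two u] by auto
  moreover have "AE \<omega> in M. cprob M (history X 1) (space M) \<omega> = 1"
  proof -
    have "AE \<omega> in M. cprob M (history X (2 - 1)) (space M) \<omega> = prob (space M)"
    proof (rule cprob_eq_prob[OF two])
      fix A assume "A \<in> sets (history X (2 - 1))"
      then have "A \<in> sets M"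
        using subalgebra_history[OF two] by (auto simp: subalgebra_def)
      then show "prob (A \<inter> space M) = prob A * prob (space M)"
        by (simp add: prob_space)
    qed simp
    then show ?thesis
      by (simp add: prob_space)
  qed
  ultimately have "AE \<omega> in M. cprob M (history X 1) (?E 0 \<union> ?E 1) \<omega> = cprob M (history X 1) (?E 0) \<omega> + cprob M (history X 1) (?E 1) \<omega>"
      and "AE \<omega> in M. cprob M (history X 1) (?E 0 \<union> ?E 1) \<omega> = 1"
    by (simp_all only:)
  with 0 show "AE \<omega> in M. cprob M (history X 1) (?E 1) \<omega> = 1 - \<pi> (data X 1 \<omega>)"
    by eventually_elim simp
qed

lemma measure_unit_law_\<pi>:
  assumes B: "B \<in> sets obs_space"
  shows "measure (unit_law Q (\<pi> d)) B = \<pi> d * measure Q {y. (0, arm 0 y) \<in> B} + (1 - \<pi> d) * measure Q {y. (1, arm 1 y) \<in> B}"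
proof -
  have "emeasure (unit_law Q (\<pi> d)) B = ennreal (\<pi> d * measure Q {y. (0, arm 0 y) \<in> B} + (1 - \<pi> d) * measure Q {y. (1, arm 1 y) \<in> B})"
    using Q.emeasure_unit_law[OF \<pi>_unit[of d] B] \<pi>_unit[of d]
    unfolding Q.emeasure_eq_measure by (simp only: ennreal_convex_combination measure_nonneg diff_ge_0_iff_ge)
  then show ?thesis
    using \<pi>_unit[of d] unfolding measure_def[of "unit_law Q (\<pi> d)"]
    by (simp only:) (intro enn2real_ennreal add_nonneg_nonneg mult_nonneg_nonneg; simp)
qed

lemma measurable_unit_law_prob: "B \<in> sets obs_space \<Longrightarrow> (\<lambda>d. measure (unit_law Q (\<pi> d)) B) \<in> borel_measurable D\<^sub>1"
  unfolding measure_unit_law_\<pi> by measurable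

lemma cprob_followup_unit:
  assumes u: "u \<in> {1..n\<^sub>2}" and B: "B \<in> sets obs_space"
  shows "AE \<omega> in M. cprob M (history X 1) {\<omega> \<in> space M. (treatment X 2 u \<omega>, observed X 2 u \<omega>) \<in> B} \<omega>
    = measure (unit_law Q (\<pi> (data X 1 \<omega>))) B"
proof -
  have two: "(2::nat) \<in> {1, 2}" and diff_two_one: "2 - 1 = (1::nat)" by simp_all
  have "AE \<omega> in M. cprob M (history X 1) {\<omega> \<in> space M. (treatment X 2 u \<omega>, observed X 2 u \<omega>) \<in> B} \<omega>
    = cprob M (history X 1) {\<omega> \<in> space M. treatment X 2 u \<omega> = 0} \<omega> * measure Q {y. (0, arm 0 y) \<in> B}
    + cprob M (history X 1) {\<omega> \<in> space M. treatment X 2 u \<omega> = 1} \<omega> * measure Q {y. (1, arm 1 y) \<in> B}"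
    using cprob_unit[OF two u B] unfolding diff_two_one .
  with cprob_followup[OF u] show ?thesis
    unfolding measure_unit_law_\<pi>[OF B] by eventually_elim simp
qed

text \<open>It suffices to compare products of a pilot set \<open>A\<close> with a box. There
  conditional independence turns the conditional probability into a product of unit laws at the
  propensity \<pi>, a function of the pilot data alone; integrating it over \<open>A\<close> against
  the pilot law gives the mixture.\<close>

theorem distr_data: "distr M (D\<^sub>1 \<Otimes>\<^sub>M D\<^sub>2) (\<lambda>\<omega>. (data X 1 \<omega>, data X 2 \<omega>)) = two_stage_law n\<^sub>1 n\<^sub>2 Q (p 0) \<pi>"
proof (rule measure_eqI_pair_PiM)
  have two: "(2::nat) \<in> {1, 2}" and diff_two_one: "2 - 1 = (1::nat)" by simp_all
  note [measurable] = measurable_data[of 1, simplified] measurable_data[of 2, simplified]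
  have m: "(\<lambda>\<omega>. (data X 1 \<omega>, data X 2 \<omega>)) \<in> M \<rightarrow>\<^sub>M D\<^sub>1 \<Otimes>\<^sub>M D\<^sub>2"
    using measurable_data[of 1] measurable_data[of 2] by (intro measurable_Pair) auto
  show "sets (distr M (D\<^sub>1 \<Otimes>\<^sub>M D\<^sub>2) (\<lambda>\<omega>. (data X 1 \<omega>, data X 2 \<omega>))) = sets (D\<^sub>1 \<Otimes>\<^sub>M D\<^sub>2)"
    "sets (two_stage_law n\<^sub>1 n\<^sub>2 Q (p 0) \<pi>) = sets (D\<^sub>1 \<Otimes>\<^sub>M D\<^sub>2)"
    by (simp_all add: two_stage_law_def)
  show "finite_measure (distr M (D\<^sub>1 \<Otimes>\<^sub>M D\<^sub>2) (\<lambda>\<omega>. (data X 1 \<omega>, data X 2 \<omega>)))"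
    by (rule finite_measure_distr[OF m])
  fix A B assume A: "A \<in> sets D\<^sub>1" and B: "\<And>i. i \<in> {1..n\<^sub>2} \<Longrightarrow> B i \<in> sets obs_space"
  let ?A = "data X 1 -` A \<inter> space M"
  let ?E = "{\<omega> \<in> space M. \<forall>u\<in>{1..n\<^sub>2}. (treatment X 2 u \<omega>, observed X 2 u \<omega>) \<in> B u}"
  let ?k = "\<lambda>d. \<Prod>u\<in>{1..n\<^sub>2}. measure (unit_law Q (\<pi> d)) (B u)"
  have box: "Pi\<^sub>E {1..n\<^sub>2} B \<in> sets D\<^sub>2"
    using B by (intro sets_PiM_I_finite) auto
  have E: "?E = data X 2 -` (Pi\<^sub>E {1..n\<^sub>2} B) \<inter> space M"
    by (auto simp: data_def PiE_iff)
  have EM: "?E \<in> sets M"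
    unfolding E by (rule measurable_sets[OF measurable_data[OF two] box])
  have AH: "?A \<in> sets (history X 1)"
    using sets_history_1 A by auto
  have AM: "?A \<in> sets M"
    using AH subalgebra_history[OF two] by (auto simp: subalgebra_def)
  have k_meas: "?k \<in> borel_measurable D\<^sub>1"
    using B by (intro borel_measurable_prod measurable_unit_law_prob) auto
  have AE_E: "AE \<omega> in M. cprob M (history X 1) ?E \<omega> = ?k (data X 1 \<omega>)"
  proof -
    have "AE \<omega> in M. cprob M (history X 1) ?E \<omega>
      = (\<Prod>u\<in>{1..n\<^sub>2}. cprob M (history X 1) {\<omega> \<in> space M. (treatment X 2 u \<omega>, observed X 2 u \<omega>) \<in> B u} \<omega>)"
      using followup_iid B unfolding cond_iid_def obs_space_def by blast
    moreover have "AE \<omega> in M. \<forall>u\<in>{1..n\<^sub>2}. cprob M (history X 1) {\<omega> \<in> space M. (treatment X 2 u \<omega>, observed X 2 u \<omega>) \<in> B u} \<omega>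
        = measure (unit_law Q (\<pi> (data X 1 \<omega>))) (B u)"
      using B by (intro AE_ball_countable[THEN iffD2] ballI cprob_followup_unit) (auto intro: countable_finite)
    ultimately show ?thesis
      by eventually_elim (auto intro!: prod.cong)
  qed
  have "emeasure (distr M (D\<^sub>1 \<Otimes>\<^sub>M D\<^sub>2) (\<lambda>\<omega>. (data X 1 \<omega>, data X 2 \<omega>))) (A \<times> Pi\<^sub>E {1..n\<^sub>2} B) = emeasure M (?A \<inter> ?E)"
  proof -
    have "(\<lambda>\<omega>. (data X 1 \<omega>, data X 2 \<omega>)) -` (A \<times> Pi\<^sub>E {1..n\<^sub>2} B) \<inter> space M = ?A \<inter> ?E"
      unfolding E by auto
    moreover have "A \<times> Pi\<^sub>E {1..n\<^sub>2} B \<in> sets (D\<^sub>1 \<Otimes>\<^sub>M D\<^sub>2)"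
      using A box by simp
    ultimately show ?thesis
      by (simp only: emeasure_distr[OF m])
  qed
  \<comment> \<open>The defining property of conditional probability, available since
    \<open>?A\<close> is an event of the pilot history.\<close>
  also have "\<dots> = ennreal (\<integral>\<omega>\<in>?A. cprob M (history X 1) ?E \<omega> \<partial>M)"
    using set_integral_cprob[OF two EM, unfolded diff_two_one, OF AH] by (simp only: emeasure_eq_measure)
  also have "(\<integral>\<omega>\<in>?A. cprob M (history X 1) ?E \<omega> \<partial>M) = (\<integral>\<omega>. indicator A (data X 1 \<omega>) * ?k (data X 1 \<omega>) \<partial>M)"
    unfolding set_lebesgue_integral_def
  proof (rule integral_cong_AE)
    show "(\<lambda>\<omega>. indicat_real ?A \<omega> *\<^sub>R cprob M (history X 1) ?E \<omega>) \<in> borel_measurable M"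
      using AM cprob_measurable[OF two, unfolded diff_two_one] by measurable
    show "(\<lambda>\<omega>. indicator A (data X 1 \<omega>) * ?k (data X 1 \<omega>)) \<in> borel_measurable M"
      using A measurable_compose[OF measurable_data[of 1] k_meas]
        measurable_compose[OF measurable_data[of 1] borel_measurable_indicator[OF A]] by (intro borel_measurable_times) auto
    show "AE \<omega> in M. indicat_real ?A \<omega> *\<^sub>R cprob M (history X 1) ?E \<omega> = indicator A (data X 1 \<omega>) * ?k (data X 1 \<omega>)"
      using AE_E AE_space by eventually_elim (auto simp: indicator_def)
  qed
  also have "\<dots> = (\<integral>d. indicator A d * ?k d \<partial>data_law n\<^sub>1 Q (p 0))"
    unfolding distr_pilot[symmetric] using k_meas A
    by (subst integral_distr[OF measurable_data[of 1]]) auto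
  also have "ennreal \<dots> = (\<integral>\<^sup>+d. ennreal (indicator A d * ?k d) \<partial>data_law n\<^sub>1 Q (p 0))"
  proof (rule nn_integral_eq_integral[symmetric])
    interpret L: prob_space "data_law n\<^sub>1 Q (p 0)"
      unfolding distr_pilot[symmetric] by (rule prob_space_distr) (use measurable_data[of 1] in auto)
    have [measurable_cong]: "sets (data_law n\<^sub>1 Q (p 0)) = sets D\<^sub>1"
      unfolding distr_pilot[symmetric] by simp
    show "integrable (data_law n\<^sub>1 Q (p 0)) (\<lambda>d. indicator A d * ?k d)"
    proof (rule L.integrable_of_bounded[where B=1])
      show "(\<lambda>d. indicator A d * ?k d) \<in> borel_measurable (data_law n\<^sub>1 Q (p 0))"
        using A k_meas by measurable
      show "norm (indicator A d * ?k d) \<le> 1" for d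
        using prod_le_1[of "{1..n\<^sub>2}" "\<lambda>u. measure (unit_law Q (\<pi> d)) (B u)"] prob_space.prob_le_1[OF Q.prob_space_unit_law]
        by (auto simp: indicator_def prod_nonneg)
    qed
    show "AE d in data_law n\<^sub>1 Q (p 0). 0 \<le> indicator A d * ?k d"
      by (auto intro!: AE_I2 mult_nonneg_nonneg prod_nonneg)
  qed
  also have "\<dots> = (\<integral>\<^sup>+d. \<integral>\<^sup>+y. indicator (A \<times> Pi\<^sub>E {1..n\<^sub>2} B) (d, y) \<partial>data_law n\<^sub>2 Q (\<pi> d) \<partial>data_law n\<^sub>1 Q (p 0))"
  proof (rule nn_integral_cong)
    fix d
    have fin: "product_prob_space (\<lambda>_. unit_law Q (\<pi> d))"
      by (intro product_prob_spaceI Q.prob_space_unit_law)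
    have "emeasure (data_law n\<^sub>2 Q (\<pi> d)) (Pi\<^sub>E {1..n\<^sub>2} B) = (\<Prod>u\<in>{1..n\<^sub>2}. emeasure (unit_law Q (\<pi> d)) (B u))"
      unfolding data_law_def using B
      by (intro product_sigma_finite.emeasure_PiM) (auto intro: product_prob_space.axioms(1)[OF fin] simp: Q.sets_unit_law)
    also have "\<dots> = ennreal (?k d)"
      using finite_measure.emeasure_eq_measure[OF prob_space.finite_measure[OF Q.prob_space_unit_law]]
      by (simp add: prod_ennreal)
    finally have "emeasure (data_law n\<^sub>2 Q (\<pi> d)) (Pi\<^sub>E {1..n\<^sub>2} B) = ennreal (?k d)" .
    moreover have "(\<integral>\<^sup>+y. indicator (A \<times> Pi\<^sub>E {1..n\<^sub>2} B) (d, y) \<partial>data_law n\<^sub>2 Q (\<pi> d))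
        = (\<integral>\<^sup>+y. indicator A d * indicator (Pi\<^sub>E {1..n\<^sub>2} B) y \<partial>data_law n\<^sub>2 Q (\<pi> d))"
      by (simp add: indicator_times)
    moreover have "\<dots> = indicator A d * emeasure (data_law n\<^sub>2 Q (\<pi> d)) (Pi\<^sub>E {1..n\<^sub>2} B)"
      using box by (intro nn_integral_cmult_indicator) (subst Q.sets_data_law)
    ultimately show "ennreal (indicator A d * ?k d) = (\<integral>\<^sup>+y. indicator (A \<times> Pi\<^sub>E {1..n\<^sub>2} B) (d, y) \<partial>data_law n\<^sub>2 Q (\<pi> d))"
      by (simp add: indicator_def)
  qed
  also have "\<dots> = (\<integral>\<^sup>+z. indicator (A \<times> Pi\<^sub>E {1..n\<^sub>2} B) z \<partial>two_stage_law n\<^sub>1 n\<^sub>2 Q (p 0) \<pi>)"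
    using A box by (intro Q.nn_integral_two_stage_law[symmetric]) (use measurable_\<pi> in auto)
  also have "\<dots> = emeasure (two_stage_law n\<^sub>1 n\<^sub>2 Q (p 0) \<pi>) (A \<times> Pi\<^sub>E {1..n\<^sub>2} B)"
    using A box by (intro nn_integral_indicator) (auto simp: two_stage_law_def)
  finally show "emeasure (distr M (D\<^sub>1 \<Otimes>\<^sub>M D\<^sub>2) (\<lambda>\<omega>. (data X 1 \<omega>, data X 2 \<omega>))) (A \<times> Pi\<^sub>E {1..n\<^sub>2} B)
      = emeasure (two_stage_law n\<^sub>1 n\<^sub>2 Q (p 0) \<pi>) (A \<times> Pi\<^sub>E {1..n\<^sub>2} B)" .
qed simp

end

subsection \<open>The statistics in terms of standardised sums\<close>

lemma nn_integral_bound_integrable: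
  fixes f :: "'a \<Rightarrow> real"
  assumes "f \<in> borel_measurable M" "\<And>x. 0 \<le> f x" "(\<integral>\<^sup>+x. ennreal (f x) \<partial>M) \<le> ennreal C" "0 \<le> C"
  shows "integrable M f" "(\<integral>x. f x \<partial>M) \<le> C"
proof -
  show i: "integrable M f"
    using assms by (intro integrableI_nonneg) (auto simp: le_less_trans[OF _ ennreal_less_top])
  have "ennreal (\<integral>x. f x \<partial>M) = (\<integral>\<^sup>+x. ennreal (f x) \<partial>M)"
    using i assms(2) by (intro nn_integral_eq_integral[symmetric]) auto
  with assms(3) have "ennreal (\<integral>x. f x \<partial>M) \<le> ennreal C"
    by simp
  then show "(\<integral>x. f x \<partial>M) \<le> C"
    unfolding ennreal_le_iff[OF assms(4)] .
qed

lemma score_sum_eq: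
  assumes "0 < n" "0 < aprob h s"
  shows "score_sum n h m s d = sqrt (aprob h s)
    * ((\<Sum>u\<in>{1..n}. of_bool (fst (d u) = s) * snd (d u) / aprob h s) / sqrt n - sqrt n * m s)"
proof -
  have "(\<Sum>u\<in>{1..n}. score h m s (d u))
      = sqrt (aprob h s) * ((\<Sum>u\<in>{1..n}. of_bool (fst (d u) = s) * snd (d u) / aprob h s) - n * m s)"
    unfolding score_def sum_distrib_left[symmetric] sum_subtractf by simp
  then have "score_sum n h m s d = sqrt (aprob h s)
      * ((\<Sum>u\<in>{1..n}. of_bool (fst (d u) = s) * snd (d u) / aprob h s) / sqrt n - n * m s / sqrt n)"
    unfolding score_sum_def by (simp add: diff_divide_distrib right_diff_distrib)
  also have "n * m s / sqrt n = sqrt n * m s"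
    using assms(1) real_div_sqrt[of n] by (metis of_nat_0_le_iff mult.commute times_divide_eq_left)
  finally show ?thesis .
qed

text \<open>Since \<open>v\<close> dominates the squared means, replacing it by them decreases the
  form, and what remains is the square of
  \<open>a * sqrt (1 - h) * m 0 - b * sqrt h * m 1\<close>.\<close>

lemma score_var_nonneg:
  assumes h: "0 \<le> h" "h \<le> 1" and m: "(m 0)\<^sup>2 \<le> v 0" "(m 1)\<^sup>2 \<le> v 1"
  shows "0 \<le> score_var m v h a b"
proof -
  have "(1 - h) * (m 0)\<^sup>2 \<le> lim_V m v (aprob h) 0" "h * (m 1)\<^sup>2 \<le> lim_V m v (aprob h) 1"
    using m by (simp_all add: lim_V_def algebra_simps)
  then have "a\<^sup>2 * ((1 - h) * (m 0)\<^sup>2) + b\<^sup>2 * (h * (m 1)\<^sup>2) - 2 * a * b * sqrt (h * (1 - h)) * m 0 * m 1 \<le> score_var m v h a b"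
    unfolding score_var_def by (intro diff_right_mono add_mono mult_left_mono) auto
  moreover have "a\<^sup>2 * ((1 - h) * (m 0)\<^sup>2) + b\<^sup>2 * (h * (m 1)\<^sup>2) - 2 * a * b * sqrt (h * (1 - h)) * m 0 * m 1
      = (a * sqrt (1 - h) * m 0 - b * sqrt h * m 1)\<^sup>2"
    using h by (simp add: power2_diff power_mult_distrib real_sqrt_mult mult_ac)
  ultimately show ?thesis
    by (metis order_trans zero_le_power2)
qed

context regular_experiment
begin

interpretation Q: outcome_law Q K by (rule outcome_law_Q)

text \<open>A version of the propensity of arm 0 that is computed from the data at every sample
  point. It agrees with the conditional probability \<open>prop_score\<close> only almost surely,
  but its bounds hold everywhere.\<close>

definition pscore :: "nat \<Rightarrow> 'a \<Rightarrow> real" where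
  "pscore t \<omega> = (if t = 1 then p 0 else \<pi> (data X 1 \<omega>))"

definition G :: "nat \<Rightarrow> nat \<Rightarrow> 'a \<Rightarrow> real" where
  "G t s \<omega> = score_sum (stage_size X t) (pscore t \<omega>) (\<lambda>s. moment Q s 1) s (data X t \<omega>)"

text \<open>The fluctuation of the squared weighted outcomes; in the variance estimate it is the
  term whose size depends on the smallest propensity.\<close>

definition R :: "nat \<Rightarrow> nat \<Rightarrow> 'a \<Rightarrow> real" where
  "R t s \<omega> = sq_score_mean (stage_size X t) (pscore t \<omega>) (\<lambda>s. moment Q s 2) s (data X t \<omega>)"

lemma measurable_pscore[measurable]: "pscore t \<in> borel_measurable M"
  unfolding pscore_def[abs_def] using measurable_compose[OF measurable_data[of 1] measurable_\<pi>] by (cases "t = 1") simp_all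

lemma measurable_G: "t \<in> {1, 2} \<Longrightarrow> G t s \<in> borel_measurable M"
  unfolding G_def[abs_def] by (intro measurable_score_sum measurable_pscore measurable_data)

lemma measurable_R: "t \<in> {1, 2} \<Longrightarrow> R t s \<in> borel_measurable M"
  unfolding R_def[abs_def] by (intro measurable_sq_score_mean measurable_pscore measurable_data)

lemma p0: "0 < p 0" "p 0 < 1"
  using p_pos p_sum by auto

lemma p_eq: "s \<in> {0, 1} \<Longrightarrow> p s = aprob (p 0) s"
  using p_sum by auto

lemma nn_integral_data:
  assumes "F \<in> borel_measurable (D\<^sub>1 \<Otimes>\<^sub>M D\<^sub>2)"
  shows "(\<integral>\<^sup>+\<omega>. F (data X 1 \<omega>, data X 2 \<omega>) \<partial>M) = (\<integral>\<^sup>+d. \<integral>\<^sup>+y. F (d, y) \<partial>data_law n\<^sub>2 Q (\<pi> d) \<partial>data_law n\<^sub>1 Q (p 0))"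
proof -
  have m: "(\<lambda>\<omega>. (data X 1 \<omega>, data X 2 \<omega>)) \<in> M \<rightarrow>\<^sub>M D\<^sub>1 \<Otimes>\<^sub>M D\<^sub>2"
    using measurable_data[of 1] measurable_data[of 2] by (intro measurable_Pair) auto
  have "(\<integral>\<^sup>+\<omega>. F (data X 1 \<omega>, data X 2 \<omega>) \<partial>M) = (\<integral>\<^sup>+z. F z \<partial>distr M (D\<^sub>1 \<Otimes>\<^sub>M D\<^sub>2) (\<lambda>\<omega>. (data X 1 \<omega>, data X 2 \<omega>)))"
    by (rule nn_integral_distr[OF m, symmetric]) (subst measurable_distr_eq1, rule assms)
  also have "\<dots> = (\<integral>\<^sup>+d. \<integral>\<^sup>+y. F (d, y) \<partial>data_law n\<^sub>2 Q (\<pi> d) \<partial>data_law n\<^sub>1 Q (p 0))"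
    unfolding distr_data by (rule Q.nn_integral_two_stage_law[OF measurable_\<pi> assms])
  finally show ?thesis .
qed

lemma integral_data:
  fixes F :: "(nat \<Rightarrow> nat \<times> real) \<times> (nat \<Rightarrow> nat \<times> real) \<Rightarrow> complex"
  assumes "F \<in> borel_measurable (D\<^sub>1 \<Otimes>\<^sub>M D\<^sub>2)" "\<And>z. norm (F z) \<le> B"
  shows "(\<integral>\<omega>. F (data X 1 \<omega>, data X 2 \<omega>) \<partial>M) = (\<integral>d. \<integral>y. F (d, y) \<partial>data_law n\<^sub>2 Q (\<pi> d) \<partial>data_law n\<^sub>1 Q (p 0))"
proof -
  have m: "(\<lambda>\<omega>. (data X 1 \<omega>, data X 2 \<omega>)) \<in> M \<rightarrow>\<^sub>M D\<^sub>1 \<Otimes>\<^sub>M D\<^sub>2"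
    using measurable_data[of 1] measurable_data[of 2] by (intro measurable_Pair) auto
  have "(\<integral>\<omega>. F (data X 1 \<omega>, data X 2 \<omega>) \<partial>M) = (\<integral>z. F z \<partial>distr M (D\<^sub>1 \<Otimes>\<^sub>M D\<^sub>2) (\<lambda>\<omega>. (data X 1 \<omega>, data X 2 \<omega>)))"
    by (rule integral_distr[OF m assms(1), symmetric])
  also have "\<dots> = (\<integral>d. \<integral>y. F (d, y) \<partial>data_law n\<^sub>2 Q (\<pi> d) \<partial>data_law n\<^sub>1 Q (p 0))"
    unfolding distr_data by (rule Q.integral_two_stage_law[OF measurable_\<pi> assms])
  finally show ?thesis .
qed

lemma integral_pilot:
  fixes F :: "(nat \<Rightarrow> nat \<times> real) \<Rightarrow> 'b::{banach, second_countable_topology}"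
  assumes "F \<in> borel_measurable D\<^sub>1"
  shows "(\<integral>\<omega>. F (data X 1 \<omega>) \<partial>M) = (\<integral>d. F d \<partial>data_law n\<^sub>1 Q (p 0))"
  unfolding distr_pilot[symmetric] using measurable_data[of 1] by (intro integral_distr[symmetric] assms) auto

lemma nn_integral_pilot:
  assumes "F \<in> borel_measurable D\<^sub>1"
  shows "(\<integral>\<^sup>+\<omega>. F (data X 1 \<omega>) \<partial>M) = (\<integral>\<^sup>+d. F d \<partial>data_law n\<^sub>1 Q (p 0))"
  unfolding distr_pilot[symmetric] using measurable_data[of 1] assms
  by (intro nn_integral_distr[symmetric]) (simp_all only: measurable_distr_eq1 insertI1)

context
  assumes l_pos: "0 < l"
begin

lemma pscore_pos: "0 < pscore t \<omega>" "pscore t \<omega> < 1"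
  using p0 \<pi>_bounds[of "data X 1 \<omega>"] l_pos by (auto simp: pscore_def)

lemma aprob_pscore_pos: "0 < aprob (pscore t \<omega>) s" "aprob (pscore t \<omega>) s < 1"
  using pscore_pos[of t \<omega>] by (auto simp: aprob_def)

lemma \<pi>_pos: "0 < \<pi> d" "\<pi> d < 1"
  using \<pi>_bounds[of d] l_pos by auto

text \<open>A bound that holds for each admissible fixed propensity survives integration over the
  pilot data. Working with nonnegative integrals delivers integrability at the same time.\<close>

lemma nn_integral_stage_le:
  assumes t: "t \<in> {1, 2}" and F: "\<And>n. (\<lambda>(h, d). F n h d) \<in> borel_measurable (borel \<Otimes>\<^sub>M (\<Pi>\<^sub>M u\<in>{1..n}. obs_space))"
    and le: "\<And>h. 0 < h \<Longrightarrow> h < 1 \<Longrightarrow> (t = 1 \<longrightarrow> h = p 0) \<Longrightarrow> (t = 2 \<longrightarrow> l \<le> h \<and> h \<le> 1 - l) \<Longrightarrow>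
      (\<integral>\<^sup>+d. F (stage_size X t) h d \<partial>data_law (stage_size X t) Q h) \<le> C"
  shows "(\<integral>\<^sup>+\<omega>. F (stage_size X t) (pscore t \<omega>) (data X t \<omega>) \<partial>M) \<le> C"
proof (cases "t = 1")
  case True
  have "(\<lambda>d. F n\<^sub>1 (p 0) d) \<in> borel_measurable D\<^sub>1"
    using measurable_compose[OF measurable_Pair1'[of "p 0" borel D\<^sub>1] F] by simp
  then show ?thesis
    using nn_integral_pilot[of "F n\<^sub>1 (p 0)"] le[of "p 0"] p0 True by (simp add: pscore_def)
next
  case False
  then have t2: "t = 2"
    using t by auto
  have m: "(\<lambda>z. F n\<^sub>2 (\<pi> (fst z)) (snd z)) \<in> borel_measurable (D\<^sub>1 \<Otimes>\<^sub>M D\<^sub>2)"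
  proof -
    have "(\<lambda>z. (\<pi> (fst z), snd z)) \<in> D\<^sub>1 \<Otimes>\<^sub>M D\<^sub>2 \<rightarrow>\<^sub>M borel \<Otimes>\<^sub>M D\<^sub>2"
      using measurable_compose[OF measurable_fst measurable_\<pi>] by (intro measurable_Pair measurable_snd)
    from measurable_compose[OF this F] show ?thesis
      by simp
  qed
  interpret L: prob_space "data_law n\<^sub>1 Q (p 0)"
    by (rule Q.prob_space_data_law)
  have "(\<integral>\<^sup>+\<omega>. F n\<^sub>2 (\<pi> (data X 1 \<omega>)) (data X 2 \<omega>) \<partial>M)
      = (\<integral>\<^sup>+d. \<integral>\<^sup>+y. F n\<^sub>2 (\<pi> d) y \<partial>data_law n\<^sub>2 Q (\<pi> d) \<partial>data_law n\<^sub>1 Q (p 0))"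
    using nn_integral_data[OF m] by simp
  also have "\<dots> \<le> (\<integral>\<^sup>+d. C \<partial>data_law n\<^sub>1 Q (p 0))"
    using le \<pi>_bounds \<pi>_pos t2 by (intro nn_integral_mono) auto
  also have "\<dots> = C"
    unfolding nn_integral_const L.emeasure_space_1 by simp
  finally show ?thesis
    using t2 by (simp add: pscore_def)
qed

lemma
  assumes t: "t \<in> {1, 2}" and s: "s \<in> {0, 1}"
  shows integrable_G_sq: "integrable M (\<lambda>\<omega>. (G t s \<omega>)\<^sup>2)" and integral_G_sq: "(\<integral>\<omega>. (G t s \<omega>)\<^sup>2 \<partial>M) \<le> K"
proof -
  have K: "0 \<le> K"
    using Q.K_ge_1 by simp
  have "(\<integral>\<^sup>+\<omega>. ennreal ((G t s \<omega>)\<^sup>2) \<partial>M) \<le> ennreal K"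
    unfolding G_def
  proof (rule nn_integral_stage_le[OF t])
    show "(\<lambda>(h, d). ennreal ((score_sum n h (\<lambda>s. moment Q s 1) s d)\<^sup>2)) \<in> borel_measurable (borel \<Otimes>\<^sub>M (\<Pi>\<^sub>M u\<in>{1..n}. obs_space))" for n
      by measurable
    show "(\<integral>\<^sup>+d. ennreal ((score_sum (stage_size X t) h (\<lambda>s. moment Q s 1) s d)\<^sup>2) \<partial>data_law (stage_size X t) Q h) \<le> ennreal K"
      if "0 < h" "h < 1" for h
      using Q.integrable_score_sum_sq[OF that s stage_pos[OF t]] Q.integral_score_sum_sq[OF that s stage_pos[OF t]]
      by (subst nn_integral_eq_integral) (auto intro: ennreal_leI)
  qed
  then show "integrable M (\<lambda>\<omega>. (G t s \<omega>)\<^sup>2)" "(\<integral>\<omega>. (G t s \<omega>)\<^sup>2 \<partial>M) \<le> K"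
    using measurable_G[OF t] K by (auto intro!: nn_integral_bound_integrable)
qed

lemma
  fixes \<delta> :: real
  assumes t: "t \<in> {1, 2}" and s: "s \<in> {0, 1}" and \<delta>: "0 < \<delta>" "\<delta> \<le> l" "\<delta> \<le> p 0" "\<delta> \<le> p 1"
  shows integrable_R_sq: "integrable M (\<lambda>\<omega>. (R t s \<omega>)\<^sup>2)"
    and integral_R_sq: "(\<integral>\<omega>. (R t s \<omega>)\<^sup>2 \<partial>M) \<le> K / (stage_size X t * \<delta>)"
proof -
  have n: "0 < stage_size X t"
    by (rule stage_pos[OF t])
  have C: "0 \<le> K / (stage_size X t * \<delta>)"
    using Q.K_ge_1 \<delta> by simp
  have "(\<integral>\<^sup>+\<omega>. ennreal ((R t s \<omega>)\<^sup>2) \<partial>M) \<le> ennreal (K / (stage_size X t * \<delta>))"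
    unfolding R_def
  proof (rule nn_integral_stage_le[OF t])
    show "(\<lambda>(h, d). ennreal ((sq_score_mean n h (\<lambda>s. moment Q s 2) s d)\<^sup>2)) \<in> borel_measurable (borel \<Otimes>\<^sub>M (\<Pi>\<^sub>M u\<in>{1..n}. obs_space))" for n
      by measurable
    show "(\<integral>\<^sup>+d. ennreal ((sq_score_mean (stage_size X t) h (\<lambda>s. moment Q s 2) s d)\<^sup>2) \<partial>data_law (stage_size X t) Q h) \<le> ennreal (K / (stage_size X t * \<delta>))"
      if h: "0 < h" "h < 1" and h': "t = 1 \<longrightarrow> h = p 0" "t = 2 \<longrightarrow> l \<le> h \<and> h \<le> 1 - l" for h
    proof -
      have "\<delta> \<le> aprob h s"
        using t s \<delta> h' p_sum by auto
      then have "K / (stage_size X t * aprob h s) \<le> K / (stage_size X t * \<delta>)"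
        using Q.K_ge_1 \<delta> n by (intro divide_left_mono mult_left_mono mult_pos_pos) auto
      then show ?thesis
        using Q.integrable_sq_score_mean[OF h s n] Q.integral_sq_score_mean[OF h s n]
        by (subst nn_integral_eq_integral) (auto intro!: ennreal_leI)
    qed
  qed
  then show "integrable M (\<lambda>\<omega>. (R t s \<omega>)\<^sup>2)" "(\<integral>\<omega>. (R t s \<omega>)\<^sup>2 \<partial>M) \<le> K / (stage_size X t * \<delta>)"
    using measurable_R[OF t] C by (auto intro!: nn_integral_bound_integrable)
qed

text \<open>Integrating out the follow-up stage first leaves its transform at the propensity
  \<open>\<pi> d\<close>, which is within \<delta> of \<open>\<psi> (\<pi> d)\<close>. The pilot
  factor \<open>f\<close> has modulus at most 1 and does not enlarge the error.\<close>

lemma replace_followup: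
  fixes f :: "(nat \<Rightarrow> nat \<times> real) \<Rightarrow> complex" and b\<^sub>0 b\<^sub>1 \<psi> :: "real \<Rightarrow> real"
  assumes f: "f \<in> borel_measurable D\<^sub>1" "\<And>d. cmod (f d) \<le> 1"
    and b: "(\<lambda>d. b\<^sub>0 (\<pi> d)) \<in> borel_measurable D\<^sub>1" "(\<lambda>d. b\<^sub>1 (\<pi> d)) \<in> borel_measurable D\<^sub>1"
    and \<psi>: "(\<lambda>d. \<psi> (\<pi> d)) \<in> borel_measurable D\<^sub>1" "\<And>d. \<bar>\<psi> (\<pi> d)\<bar> \<le> 1"
    and close: "\<And>h. l \<le> h \<Longrightarrow> h \<le> 1 - l \<Longrightarrow>
      cmod ((CLINT y|data_law n\<^sub>2 Q h. iexp (b\<^sub>0 h * score_sum n\<^sub>2 h (\<lambda>s. moment Q s 1) 0 y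
         + b\<^sub>1 h * score_sum n\<^sub>2 h (\<lambda>s. moment Q s 1) 1 y)) - of_real (\<psi> h)) \<le> \<delta>"
  shows "cmod ((CLINT \<omega>|M. f (data X 1 \<omega>) * iexp (b\<^sub>0 (pscore 2 \<omega>) * G 2 0 \<omega> + b\<^sub>1 (pscore 2 \<omega>) * G 2 1 \<omega>))
      - (CLINT \<omega>|M. f (data X 1 \<omega>) * of_real (\<psi> (pscore 2 \<omega>)))) \<le> \<delta>"
proof -
  note [measurable] = f(1) b \<psi>(1)
  interpret L: prob_space "data_law n\<^sub>1 Q (p 0)"
    by (rule Q.prob_space_data_law)
  have [measurable_cong]: "sets (data_law n\<^sub>1 Q (p 0)) = sets D\<^sub>1"
    by (rule Q.sets_data_law)
  let ?F = "\<lambda>(d, y). f d * iexp (b\<^sub>0 (\<pi> d) * score_sum n\<^sub>2 (\<pi> d) (\<lambda>s. moment Q s 1) 0 y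
         + b\<^sub>1 (\<pi> d) * score_sum n\<^sub>2 (\<pi> d) (\<lambda>s. moment Q s 1) 1 y)"
  let ?\<phi> = "\<lambda>d. CLINT y|data_law n\<^sub>2 Q (\<pi> d). iexp (b\<^sub>0 (\<pi> d) * score_sum n\<^sub>2 (\<pi> d) (\<lambda>s. moment Q s 1) 0 y
         + b\<^sub>1 (\<pi> d) * score_sum n\<^sub>2 (\<pi> d) (\<lambda>s. moment Q s 1) 1 y)"
  have F: "?F \<in> borel_measurable (D\<^sub>1 \<Otimes>\<^sub>M D\<^sub>2)"
    by measurable
  have bd: "cmod (?F z) \<le> 1" for z
    using f(2) by (auto simp: norm_mult split: prod.split)
  have eq1: "(CLINT \<omega>|M. f (data X 1 \<omega>) * iexp (b\<^sub>0 (pscore 2 \<omega>) * G 2 0 \<omega> + b\<^sub>1 (pscore 2 \<omega>) * G 2 1 \<omega>))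
     = (CLINT d|data_law n\<^sub>1 Q (p 0). f d * ?\<phi> d)"
    using integral_data[OF F bd] by (simp add: pscore_def G_def)
  have eq2: "(CLINT \<omega>|M. f (data X 1 \<omega>) * of_real (\<psi> (pscore 2 \<omega>))) = (CLINT d|data_law n\<^sub>1 Q (p 0). f d * of_real (\<psi> (\<pi> d)))"
  proof -
    have "(\<lambda>d. f d * of_real (\<psi> (\<pi> d))) \<in> borel_measurable D\<^sub>1"
      by measurable
    from integral_pilot[OF this] show ?thesis
      by (simp add: pscore_def)
  qed
  have i1: "integrable (data_law n\<^sub>1 Q (p 0)) (\<lambda>d. f d * ?\<phi> d)"
    using Q.integrable_two_stage_law[OF measurable_\<pi> F bd] by simp
  have i2: "integrable (data_law n\<^sub>1 Q (p 0)) (\<lambda>d. f d * of_real (\<psi> (\<pi> d)))"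
  proof (rule L.integrable_of_bounded[where B=1])
    show "(\<lambda>d. f d * of_real (\<psi> (\<pi> d))) \<in> borel_measurable (data_law n\<^sub>1 Q (p 0))"
      by measurable
    show "cmod (f d * of_real (\<psi> (\<pi> d))) \<le> 1" for d
      using f(2) \<psi>(2) by (auto simp: norm_mult intro!: mult_le_one)
  qed
  have "cmod ((CLINT d|data_law n\<^sub>1 Q (p 0). f d * ?\<phi> d) - (CLINT d|data_law n\<^sub>1 Q (p 0). f d * of_real (\<psi> (\<pi> d))))
     = cmod (CLINT d|data_law n\<^sub>1 Q (p 0). f d * ?\<phi> d - f d * of_real (\<psi> (\<pi> d)))"
    by (simp only: Bochner_Integration.integral_diff[OF i1 i2])
  also have "\<dots> \<le> (\<integral>d. cmod (f d * ?\<phi> d - f d * of_real (\<psi> (\<pi> d))) \<partial>data_law n\<^sub>1 Q (p 0))"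
    by (rule integral_norm_bound)
  also have "\<dots> \<le> (\<integral>d. \<delta> \<partial>data_law n\<^sub>1 Q (p 0))"
  proof (rule integral_mono)
    show "integrable (data_law n\<^sub>1 Q (p 0)) (\<lambda>d. cmod (f d * ?\<phi> d - f d * of_real (\<psi> (\<pi> d))))"
      by (rule integrable_norm[OF Bochner_Integration.integrable_diff[OF i1 i2]])
    fix d
    have "cmod (f d * ?\<phi> d - f d * of_real (\<psi> (\<pi> d))) = cmod (f d) * cmod (?\<phi> d - of_real (\<psi> (\<pi> d)))"
      unfolding right_diff_distrib[symmetric] norm_mult ..
    also have "\<dots> \<le> 1 * \<delta>"
      using f(2) close[OF \<pi>_bounds[of d]] by (intro mult_mono) auto
    finally show "cmod (f d * ?\<phi> d - f d * of_real (\<psi> (\<pi> d))) \<le> \<delta>"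
      by simp
  qed (rule L.integrable_const)
  also have "\<dots> = \<delta>"
    unfolding lebesgue_integral_const L.prob_space by simp
  finally show ?thesis
    unfolding eq1 eq2 .
qed

lemma AE_prop_score:
  assumes t: "t \<in> {1, 2}" and s: "s \<in> {0, 1}"
  shows "AE \<omega> in M. prop_score X t s \<omega> = aprob (pscore t \<omega>) s"
proof (cases "t = 1")
  case True
  have 1: "1 \<in> {1..n\<^sub>1}"
    using stage_pos[of 1] by auto
  have "{\<omega> \<in> space M. treatment X 1 1 \<omega> = s} \<in> sets M"
    using measurable_sets[OF treatment_measurable[of 1 1], of "{s}"] 1 by (simp add: vimage_def Int_def conj_commute)
  from cprob_history_0[OF this] show ?thesis
    unfolding pilot_prob[OF 1 s] True prop_score_def diff_self_eq_0 pscore_def using p_eq[OF s] by simp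
next
  case False
  then have t2: "t = 2"
    using t by auto
  have 1: "1 \<in> {1..n\<^sub>2}" and diff: "2 - 1 = (1::nat)"
    using stage_pos[of 2] by auto
  show ?thesis
    using s cprob_followup[OF 1] unfolding t2 prop_score_def pscore_def diff by (auto simp: aprob_def)
qed

text \<open>The weight of a stage after the common factor 1 / sqrt N has cancelled, with the
  everywhere defined propensity in place of the conditional probability.\<close>

definition share :: "real \<Rightarrow> nat \<Rightarrow> nat \<Rightarrow> 'a \<Rightarrow> real" where
  "share r t s \<omega> = stage_size X t * aprob (pscore t \<omega>) s powr r / (\<Sum>t'\<in>{1, 2}. stage_size X t' * aprob (pscore t' \<omega>) s powr r)"

text \<open>The multiplier of \<open>G\<close> in the scaled error: \<open>ipw\<close> deviates from
  the mean by \<open>G\<close> over the root in the denominator.\<close>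

definition coef :: "real \<Rightarrow> nat \<Rightarrow> nat \<Rightarrow> 'a \<Rightarrow> real" where
  "coef r t s \<omega> = sqrt (total_size X) * share r t s \<omega> / sqrt (stage_size X t * aprob (pscore t \<omega>) s)"

lemma total_pos: "0 < real (total_size X)"
  using stage_pos[of 1] by (simp add: total_size_def)

lemma share_sum: "share r 1 s \<omega> + share r 2 s \<omega> = 1"
proof -
  have "0 < real n\<^sub>1 * aprob (pscore 1 \<omega>) s powr r + real n\<^sub>2 * aprob (pscore 2 \<omega>) s powr r"
  proof -
    have "aprob (pscore t \<omega>) s \<noteq> 0" for t
      using aprob_pscore_pos(1)[of t \<omega> s] by linarith
    then show ?thesis
      using stage_pos[of 1] stage_pos[of 2] by (intro add_pos_pos mult_pos_pos) auto
  qed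
  then show ?thesis
    unfolding share_def by (simp flip: add_divide_distrib)
qed

context
  fixes \<omega> :: 'a and s :: nat
  assumes s: "s \<in> {0, 1}" and score_eq: "\<And>t. t \<in> {1, 2} \<Longrightarrow> prop_score X t s \<omega> = aprob (pscore t \<omega>) s"
begin

lemma weight_eq_share: "t \<in> {1, 2} \<Longrightarrow> weight r X t s \<omega> = share r t s \<omega>"
  using score_eq[of 1] score_eq[of 2] score_eq[of t] total_pos
  by (simp add: weight_def raw_weight_def share_def flip: add_divide_distrib)

lemma ipw_eq:
  assumes t: "t \<in> {1, 2}"
  shows "ipw X t s \<omega> = moment Q s 1 + G t s \<omega> / sqrt (stage_size X t * aprob (pscore t \<omega>) s)"
proof -
  define g where "g = aprob (pscore t \<omega>) s"
  define n where "n = stage_size X t"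
  have pos: "0 < g" "0 < n"
    using aprob_pscore_pos stage_pos[OF t] by (auto simp: g_def n_def)
  have sum: "(\<Sum>u\<in>{1..n}. of_bool (fst (data X t \<omega> u) = s) * snd (data X t \<omega> u) / g) = n * ipw X t s \<omega>"
    using pos unfolding ipw_def ipw_unit_def score_eq[OF t] g_def[symmetric] n_def[symmetric] by (simp add: data_def n_def)
  have "G t s \<omega> = sqrt g * (n * ipw X t s \<omega> / sqrt n - sqrt n * moment Q s 1)"
    using score_sum_eq[of n "pscore t \<omega>" s "\<lambda>s. moment Q s 1" "data X t \<omega>"] pos sum
    unfolding G_def g_def[symmetric] n_def[symmetric] by simp
  also have "n * ipw X t s \<omega> / sqrt n = sqrt n * ipw X t s \<omega>"
    using pos real_div_sqrt[of n] by (metis of_nat_0_le_iff mult.commute times_divide_eq_left)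
  also have "sqrt g * (sqrt n * ipw X t s \<omega> - sqrt n * moment Q s 1) = sqrt (n * g) * (ipw X t s \<omega> - moment Q s 1)"
    by (simp add: real_sqrt_mult algebra_simps)
  finally show ?thesis
    using pos unfolding g_def[symmetric] n_def[symmetric] by simp
qed

text \<open>The shares sum to 1, so the common mean can be subtracted within each stage.\<close>

lemma WIPW_eq: "sqrt (total_size X) * (WIPW r X s \<omega> - moment Q s 1) = coef r 1 s \<omega> * G 1 s \<omega> + coef r 2 s \<omega> * G 2 s \<omega>"
proof -
  have "WIPW r X s \<omega> - moment Q s 1 = share r 1 s \<omega> * ipw X 1 s \<omega> + share r 2 s \<omega> * ipw X 2 s \<omega>
      - (share r 1 s \<omega> + share r 2 s \<omega>) * moment Q s 1"
    unfolding share_sum WIPW_def using weight_eq_share[of 1 r] weight_eq_share[of 2 r] by simp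
  also have "\<dots> = share r 1 s \<omega> * (G 1 s \<omega> / sqrt (stage_size X 1 * aprob (pscore 1 \<omega>) s))
      + share r 2 s \<omega> * (G 2 s \<omega> / sqrt (stage_size X 2 * aprob (pscore 2 \<omega>) s))"
    using ipw_eq[of 1] ipw_eq[of 2] by (simp add: algebra_simps)
  finally show ?thesis
    by (simp add: coef_def algebra_simps)
qed

text \<open>Expanding the square about \<open>WIPW\<close> leaves a quadratic sum, a linear sum and
  a constant; the first is \<open>R\<close> plus a moment, the second is \<open>G\<close> plus a
  mean. The factor \<open>g / n\<close> removes every negative power of the propensity.\<close>

lemma V_hat_term_eq:
  fixes r :: real and t :: nat
  assumes t: "t \<in> {1, 2}"
  defines "g \<equiv> aprob (pscore t \<omega>) s" and "n \<equiv> stage_size X t" and "w \<equiv> WIPW r X s \<omega> - moment Q s 1"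
  shows "g / n * (\<Sum>u\<in>{1..n}. (ipw_unit X t u s \<omega> - WIPW r X s \<omega>)\<^sup>2)
    = R t s \<omega> + (moment Q s 2 - g * (moment Q s 1)\<^sup>2) - 2 * (moment Q s 1 + w) * sqrt g * G t s \<omega> / sqrt n + g * w\<^sup>2"
proof -
  have pos: "0 < g" "0 < n"
    using aprob_pscore_pos stage_pos[OF t] by (auto simp: g_def n_def)
  define W where "W = WIPW r X s \<omega>"
  define \<mu> where "\<mu> = moment Q s 1"
  have W: "W = \<mu> + w"
    by (simp add: W_def \<mu>_def w_def)
  have sq: "g / n * (\<Sum>u\<in>{1..n}. (ipw_unit X t u s \<omega>)\<^sup>2) = R t s \<omega> + moment Q s 2"
  proof -
    have "(\<Sum>u\<in>{1..n}. (ipw_unit X t u s \<omega>)\<^sup>2) = (\<Sum>u\<in>{1..n}. of_bool (fst (data X t \<omega> u) = s) * (snd (data X t \<omega> u))\<^sup>2 / g) / g"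
      unfolding ipw_unit_def score_eq[OF t] g_def[symmetric] sum_divide_distrib
      by (intro sum.cong refl) (auto simp: data_def n_def power2_eq_square)
    moreover have "R t s \<omega> = (\<Sum>u\<in>{1..n}. of_bool (fst (data X t \<omega> u) = s) * (snd (data X t \<omega> u))\<^sup>2 / g) / n - moment Q s 2"
      using pos unfolding R_def sq_score_mean_def sq_score_def g_def[symmetric] n_def[symmetric]
      by (simp add: sum_subtractf diff_divide_distrib)
    ultimately show ?thesis
      using pos by simp
  qed
  have lin: "g / n * (\<Sum>u\<in>{1..n}. ipw_unit X t u s \<omega>) = g * \<mu> + sqrt g * G t s \<omega> / sqrt n"
  proof -
    have "(\<Sum>u\<in>{1..n}. ipw_unit X t u s \<omega>) = n * ipw X t s \<omega>"
      using pos by (simp add: ipw_def n_def)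
    then have "g / n * (\<Sum>u\<in>{1..n}. ipw_unit X t u s \<omega>) = g * ipw X t s \<omega>"
      using pos by simp
    also have "\<dots> = g * \<mu> + (g / sqrt g) * G t s \<omega> / sqrt n"
      unfolding ipw_eq[OF t] g_def[symmetric] n_def[symmetric] \<mu>_def[symmetric] using pos
      by (simp add: real_sqrt_mult distrib_left)
    also have "g / sqrt g = sqrt g"
      using pos by (simp add: real_div_sqrt)
    finally show ?thesis .
  qed
  have "(\<Sum>u\<in>{1..n}. (ipw_unit X t u s \<omega> - W)\<^sup>2) = (\<Sum>u\<in>{1..n}. (ipw_unit X t u s \<omega>)\<^sup>2) - 2 * W * (\<Sum>u\<in>{1..n}. ipw_unit X t u s \<omega>) + n * W\<^sup>2"
    by (simp add: power2_diff sum.distrib sum_subtractf sum_distrib_left sum_distrib_right mult_ac)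
  then have "g / n * (\<Sum>u\<in>{1..n}. (ipw_unit X t u s \<omega> - W)\<^sup>2)
      = g / n * (\<Sum>u\<in>{1..n}. (ipw_unit X t u s \<omega>)\<^sup>2) - 2 * W * (g / n * (\<Sum>u\<in>{1..n}. ipw_unit X t u s \<omega>)) + g * W\<^sup>2"
  proof -
    have "g / n * (a - 2 * W * b + n * W\<^sup>2) = g / n * a - 2 * W * (g / n * b) + g * W\<^sup>2" for a b
      using pos by (simp add: field_simps)
    with \<open>(\<Sum>u\<in>{1..n}. (ipw_unit X t u s \<omega> - W)\<^sup>2) = _\<close> show ?thesis
      by simp
  qed
  also have "\<dots> = R t s \<omega> + (moment Q s 2 - g * \<mu>\<^sup>2) - 2 * (\<mu> + w) * sqrt g * G t s \<omega> / sqrt n + g * w\<^sup>2"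
    unfolding sq lin W by (simp add: algebra_simps power2_eq_square)
  finally show ?thesis
    unfolding W_def \<mu>_def .
qed

lemma V_hat_eq:
  "total_size X * V_hat r X s \<omega> = (\<Sum>t\<in>{1, 2}. (coef r t s \<omega>)\<^sup>2 *
     (aprob (pscore t \<omega>) s / stage_size X t * (\<Sum>u\<in>{1..stage_size X t}. (ipw_unit X t u s \<omega> - WIPW r X s \<omega>)\<^sup>2)))"
proof -
  have "total_size X * ((weight r X t s \<omega>)\<^sup>2 / (stage_size X t)\<^sup>2 * a) = (coef r t s \<omega>)\<^sup>2 * (aprob (pscore t \<omega>) s / stage_size X t * a)"
    if t: "t \<in> {1, 2}" for t a
    using stage_pos[OF t] aprob_pscore_pos[of t \<omega> s] total_pos
    unfolding coef_def weight_eq_share[OF t] by (simp add: power_mult_distrib power_divide power2_eq_square[of "real (stage_size X t)"])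
  then show ?thesis
    unfolding V_hat_def sum_distrib_left by (intro sum.cong) auto
qed

text \<open>The main terms combine to squared coefficients times variances; each further term
  carries \<open>R\<close>, a factor one over the root of a stage size, or the squared error of
  \<open>WIPW\<close>, which is of order 1 / N. The number \<eta> is a lower bound for the stage
  fractions.\<close>

lemma V_hat_bound:
  fixes r B \<eta> :: real
  assumes b: "\<And>t. t \<in> {1, 2} \<Longrightarrow> \<bar>coef r t s \<omega>\<bar> \<le> B"
    and N: "\<And>t. t \<in> {1, 2} \<Longrightarrow> \<eta> * real (total_size X) \<le> stage_size X t" "0 < \<eta>" "\<eta> \<le> 1"
  shows "\<bar>total_size X * V_hat r X s \<omega> - (\<Sum>t\<in>{1, 2}. (coef r t s \<omega>)\<^sup>2 * (moment Q s 2 - aprob (pscore t \<omega>) s * (moment Q s 1)\<^sup>2))\<bar>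
    \<le> B\<^sup>2 * (\<bar>R 1 s \<omega>\<bar> + \<bar>R 2 s \<omega>\<bar> + (4 * K + 8 * B\<^sup>2) * (1 + (G 1 s \<omega>)\<^sup>2 + (G 2 s \<omega>)\<^sup>2) / sqrt (\<eta> * total_size X))"
proof -
  define D where "D = sqrt (\<eta> * total_size X)"
  define w where "w = WIPW r X s \<omega> - moment Q s 1"
  define \<mu> where "\<mu> = moment Q s 1"
  define S where "S = (G 1 s \<omega>)\<^sup>2 + (G 2 s \<omega>)\<^sup>2"
  define V where "V t = aprob (pscore t \<omega>) s / stage_size X t * (\<Sum>u\<in>{1..stage_size X t}. (ipw_unit X t u s \<omega> - WIPW r X s \<omega>)\<^sup>2)" for t
  define V' where "V' t = moment Q s 2 - aprob (pscore t \<omega>) s * (moment Q s 1)\<^sup>2" for t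
  have D: "0 < D"
    using N total_pos by (simp add: D_def)
  have S: "0 \<le> S"
    by (simp add: S_def)
  have "1 \<le> real (total_size X)"
    using total_pos by simp
  \<comment> \<open>The squared error of \<open>WIPW\<close> has the faster rate 1 / N; this
    inequality lets it be measured on the common scale \<open>1 / D\<close>.\<close>
  have DN: "D \<le> real (total_size X)"
  proof -
    have "D \<le> sqrt (total_size X)"
      unfolding D_def using N total_pos by (intro real_sqrt_le_mono mult_left_le_one_le) auto
    also have "\<dots> \<le> sqrt ((real (total_size X))\<^sup>2)"
      using \<open>1 \<le> real (total_size X)\<close> by (intro real_sqrt_le_mono) (simp add: power2_eq_square)
    finally show ?thesis
      by simp
  qed
  have \<mu>: "\<mu>\<^sup>2 \<le> K"
    unfolding \<mu>_def using Q.mean_sq_le[OF s] Q.second_moment_le[OF s] by simp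
  have w: "w\<^sup>2 \<le> 2 * B\<^sup>2 * S / D"
  proof -
    have c: "(coef r t s \<omega> * G t s \<omega>)\<^sup>2 \<le> B\<^sup>2 * (G t s \<omega>)\<^sup>2" if "t \<in> {1, 2}" for t
      unfolding power_mult_distrib using power_mono[OF b[OF that], of 2] by (intro mult_right_mono) auto
    have "total_size X * w\<^sup>2 = (coef r 1 s \<omega> * G 1 s \<omega> + coef r 2 s \<omega> * G 2 s \<omega>)\<^sup>2"
      unfolding w_def WIPW_eq[symmetric] by (simp add: power_mult_distrib)
    also have "\<dots> \<le> 2 * ((coef r 1 s \<omega> * G 1 s \<omega>)\<^sup>2 + (coef r 2 s \<omega> * G 2 s \<omega>)\<^sup>2)"
      using sum_squares_bound[of "coef r 1 s \<omega> * G 1 s \<omega>" "coef r 2 s \<omega> * G 2 s \<omega>"] by (simp add: power2_sum)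
    also have "\<dots> \<le> 2 * (B\<^sup>2 * (G 1 s \<omega>)\<^sup>2 + B\<^sup>2 * (G 2 s \<omega>)\<^sup>2)"
      by (intro mult_left_mono add_mono c) auto
    also have "\<dots> = 2 * B\<^sup>2 * S"
      by (simp add: S_def algebra_simps)
    finally have "D * w\<^sup>2 \<le> 2 * B\<^sup>2 * S"
      using mult_right_mono[OF DN, of "w\<^sup>2"] by simp
    then show ?thesis
      using D by (simp add: field_simps)
  qed
  have bound: "\<bar>V t - V' t\<bar> \<le> \<bar>R t s \<omega>\<bar> + (K + 2 * (G t s \<omega>)\<^sup>2 + 4 * B\<^sup>2 * S) / D" if t: "t \<in> {1, 2}" for t
  proof -
    define g where "g = aprob (pscore t \<omega>) s"
    define n where "n = stage_size X t"
    define G\<^sub>t where "G\<^sub>t = G t s \<omega>"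
    have g: "0 < g" "g < 1"
      using aprob_pscore_pos by (auto simp: g_def)
    have n: "1 \<le> sqrt n"
      using stage_pos[OF t] by (simp add: n_def)
    have Dn: "D \<le> sqrt n"
      unfolding D_def n_def using N(1)[OF t] by (intro real_sqrt_le_mono)
    have "V t - V' t = R t s \<omega> - 2 * (\<mu> + w) * sqrt g * G\<^sub>t / sqrt n + g * w\<^sup>2"
      unfolding V_def V'_def V_hat_term_eq[OF t] g_def n_def G\<^sub>t_def \<mu>_def w_def by simp
    also have "\<bar>\<dots>\<bar> \<le> \<bar>R t s \<omega>\<bar> + \<bar>2 * (\<mu> + w) * sqrt g * G\<^sub>t / sqrt n\<bar> + \<bar>g * w\<^sup>2\<bar>"
      by (rule order_trans[OF abs_triangle_ineq]) (intro add_right_mono abs_triangle_ineq4)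
    also have "\<bar>g * w\<^sup>2\<bar> \<le> w\<^sup>2"
      using g by (simp add: abs_mult mult_left_le_one_le)
    also have "\<bar>2 * (\<mu> + w) * sqrt g * G\<^sub>t / sqrt n\<bar> \<le> (K + 2 * G\<^sub>t\<^sup>2) / D + w\<^sup>2"
    proof -
      have "\<bar>2 * (\<mu> + w) * sqrt g * G\<^sub>t / sqrt n\<bar> = sqrt g * \<bar>2 * \<mu> * G\<^sub>t + 2 * w * G\<^sub>t\<bar> / sqrt n"
      proof -
        have "2 * (\<mu> + w) * sqrt g * G\<^sub>t = sqrt g * (2 * \<mu> * G\<^sub>t + 2 * w * G\<^sub>t)"
          by (simp add: algebra_simps)
        then show ?thesis
          using g by (simp only: abs_divide abs_mult[of "sqrt g"]) simp
      qed
      also have "\<dots> \<le> 1 * (K + 2 * G\<^sub>t\<^sup>2 + w\<^sup>2) / sqrt n"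
      proof (intro divide_right_mono mult_mono)
        have "\<bar>2 * \<mu> * G\<^sub>t\<bar> \<le> \<mu>\<^sup>2 + G\<^sub>t\<^sup>2" "\<bar>2 * w * G\<^sub>t\<bar> \<le> w\<^sup>2 + G\<^sub>t\<^sup>2"
          using sum_squares_bound[of \<mu> G\<^sub>t] sum_squares_bound[of "- \<mu>" G\<^sub>t] sum_squares_bound[of w G\<^sub>t] sum_squares_bound[of "- w" G\<^sub>t]
          by (auto simp: abs_le_iff)
        then show "\<bar>2 * \<mu> * G\<^sub>t + 2 * w * G\<^sub>t\<bar> \<le> K + 2 * G\<^sub>t\<^sup>2 + w\<^sup>2"
          using \<mu> abs_triangle_ineq[of "2 * \<mu> * G\<^sub>t" "2 * w * G\<^sub>t"] by linarith
      qed (use g in auto)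
      also have "\<dots> = (K + 2 * G\<^sub>t\<^sup>2) / sqrt n + w\<^sup>2 / sqrt n"
        by (simp add: add_divide_distrib)
      also have "\<dots> \<le> (K + 2 * G\<^sub>t\<^sup>2) / D + w\<^sup>2"
      proof (rule add_mono)
        show "(K + 2 * G\<^sub>t\<^sup>2) / sqrt n \<le> (K + 2 * G\<^sub>t\<^sup>2) / D"
          using Dn D n Q.K_ge_1 by (intro divide_left_mono mult_pos_pos) auto
        have "w\<^sup>2 / sqrt n \<le> w\<^sup>2 / 1"
          using n by (intro divide_left_mono) auto
        then show "w\<^sup>2 / sqrt n \<le> w\<^sup>2"
          by simp
      qed
      finally show ?thesis .
    qed
    finally have "\<bar>V t - V' t\<bar> \<le> \<bar>R t s \<omega>\<bar> + ((K + 2 * G\<^sub>t\<^sup>2) / D + 2 * w\<^sup>2)"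
      by simp
    also have "\<dots> \<le> \<bar>R t s \<omega>\<bar> + ((K + 2 * G\<^sub>t\<^sup>2) / D + 2 * (2 * B\<^sup>2 * S / D))"
      using w by (intro add_left_mono mult_left_mono) auto
    finally show ?thesis
      by (simp add: G\<^sub>t_def add_divide_distrib)
  qed
  have "\<bar>total_size X * V_hat r X s \<omega> - (\<Sum>t\<in>{1, 2}. (coef r t s \<omega>)\<^sup>2 * V' t)\<bar> = \<bar>\<Sum>t\<in>{1, 2}. (coef r t s \<omega>)\<^sup>2 * (V t - V' t)\<bar>"
    unfolding V_hat_eq V_def[symmetric] sum_subtractf[symmetric] right_diff_distrib ..
  also have "\<dots> \<le> (\<Sum>t\<in>{1, 2}. B\<^sup>2 * (\<bar>R t s \<omega>\<bar> + (K + 2 * (G t s \<omega>)\<^sup>2 + 4 * B\<^sup>2 * S) / D))"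
  proof (rule order_trans[OF sum_abs], rule sum_mono)
    fix t :: nat assume t: "t \<in> {1, 2}"
    show "\<bar>(coef r t s \<omega>)\<^sup>2 * (V t - V' t)\<bar> \<le> B\<^sup>2 * (\<bar>R t s \<omega>\<bar> + (K + 2 * (G t s \<omega>)\<^sup>2 + 4 * B\<^sup>2 * S) / D)"
      unfolding abs_mult using power_mono[OF b[OF t], of 2] bound[OF t] by (intro mult_mono) auto
  qed
  also have "\<dots> = B\<^sup>2 * (\<bar>R 1 s \<omega>\<bar> + \<bar>R 2 s \<omega>\<bar> + (2 * K + 2 * S + 8 * B\<^sup>2 * S) / D)"
  proof -
    have gen: "(K + 2 * x + 4 * b * z) + (K + 2 * y + 4 * b * z) = 2 * K + 2 * (x + y) + 8 * b * z" for b x y z :: real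
      by (simp add: algebra_simps)
    have "(K + 2 * (G 1 s \<omega>)\<^sup>2 + 4 * B\<^sup>2 * S) + (K + 2 * (G 2 s \<omega>)\<^sup>2 + 4 * B\<^sup>2 * S) = 2 * K + 2 * S + 8 * B\<^sup>2 * S"
      unfolding gen S_def[symmetric] ..
    then have "(K + 2 * (G 1 s \<omega>)\<^sup>2 + 4 * B\<^sup>2 * S) / D + (K + 2 * (G 2 s \<omega>)\<^sup>2 + 4 * B\<^sup>2 * S) / D = (2 * K + 2 * S + 8 * B\<^sup>2 * S) / D"
      by (simp only: add_divide_distrib[symmetric])
    moreover have "(\<Sum>t\<in>{1::nat, 2}. B\<^sup>2 * f t) = B\<^sup>2 * (f 1 + f 2)" for f :: "nat \<Rightarrow> real"
      by (simp add: distrib_left)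
    ultimately show ?thesis
      by (simp only:) (simp only: add_ac)
  qed
  also have "\<dots> \<le> B\<^sup>2 * (\<bar>R 1 s \<omega>\<bar> + \<bar>R 2 s \<omega>\<bar> + (4 * K + 8 * B\<^sup>2) * (1 + S) / D)"
  proof (intro mult_left_mono add_left_mono divide_right_mono)
    have "1 * S \<le> K * S"
      by (rule mult_right_mono[OF Q.K_ge_1 S])
    moreover have "0 \<le> K" "0 \<le> K * S" "0 \<le> B\<^sup>2"
      using Q.K_ge_1 S by auto
    moreover have "(4 * K + 8 * B\<^sup>2) * (1 + S) = 4 * K + 4 * (K * S) + 8 * B\<^sup>2 + 8 * B\<^sup>2 * S"
      by (simp add: algebra_simps)
    ultimately show "2 * K + 2 * S + 8 * B\<^sup>2 * S \<le> (4 * K + 8 * B\<^sup>2) * (1 + S)"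
      by linarith
  qed (use D in auto)
  finally show ?thesis
    unfolding D_def S_def V'_def by (simp only: add.assoc)
qed

end

end

end

subsection \<open>The limiting normal vector\<close>

lemma lim_V_pos:
  assumes "0 \<le> h s" "h s \<le> 1" "(\<mu> s)\<^sup>2 < \<nu> s"
  shows "0 < lim_V \<mu> \<nu> h s"
proof -
  have "h s * (\<mu> s)\<^sup>2 \<le> 1 * (\<mu> s)\<^sup>2"
    using assms by (intro mult_right_mono) auto
  then show ?thesis
    using assms by (simp add: lim_V_def)
qed

text \<open>Strictness comes from \<nu> exceeding the square of \<mu>: as the two probabilities sum
  to 1, the variance \<open>lim_V\<close> of arm 0 exceeds \<open>h 1 * (\<mu> 0)\<^sup>2\<close>,
  and symmetrically for arm 1, so the squared correlation is a quotient below 1.\<close>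

lemma
  assumes h: "0 \<le> h 0" "0 \<le> h 1" "h 0 + h 1 = 1" and \<mu>: "(\<mu> 0)\<^sup>2 < \<nu> 0" "(\<mu> 1)\<^sup>2 < \<nu> 1"
  shows lim_corr_less_1: "\<bar>lim_corr \<mu> \<nu> h\<bar> < 1"
    and score_var_eq_lim_corr: "score_var \<mu> \<nu> (h 0) a b = (a * sqrt (lim_V \<mu> \<nu> h 0))\<^sup>2
      + 2 * lim_corr \<mu> \<nu> h * (a * sqrt (lim_V \<mu> \<nu> h 0)) * (b * sqrt (lim_V \<mu> \<nu> h 1)) + (b * sqrt (lim_V \<mu> \<nu> h 1))\<^sup>2"
proof -
  define V\<^sub>0 V\<^sub>1 where "V\<^sub>0 = lim_V \<mu> \<nu> h 0" and "V\<^sub>1 = lim_V \<mu> \<nu> h 1"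
  have h1: "h 1 = 1 - h 0"
    using h by simp
  have V: "0 < V\<^sub>0" "0 < V\<^sub>1"
    unfolding V\<^sub>0_def V\<^sub>1_def using h \<mu> by (auto intro!: lim_V_pos)
  have "h 1 * (\<mu> 0)\<^sup>2 < V\<^sub>0" "h 0 * (\<mu> 1)\<^sup>2 < V\<^sub>1"
    using \<mu> unfolding V\<^sub>0_def V\<^sub>1_def lim_V_def h1 by (simp_all add: algebra_simps)
  then have lt: "(h 1 * (\<mu> 0)\<^sup>2) * (h 0 * (\<mu> 1)\<^sup>2) < V\<^sub>0 * V\<^sub>1"
    using h by (intro mult_strict_mono') auto
  have "(lim_corr \<mu> \<nu> h)\<^sup>2 = h 0 * h 1 / (V\<^sub>0 * V\<^sub>1) * (\<mu> 0)\<^sup>2 * (\<mu> 1)\<^sup>2"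
    unfolding lim_corr_def V\<^sub>0_def[symmetric] V\<^sub>1_def[symmetric] using h V by (simp add: power_mult_distrib)
  also have "\<dots> = (h 1 * (\<mu> 0)\<^sup>2) * (h 0 * (\<mu> 1)\<^sup>2) / (V\<^sub>0 * V\<^sub>1)"
    by simp
  also have "\<dots> < 1"
    using lt V by (simp add: divide_less_eq)
  finally show "\<bar>lim_corr \<mu> \<nu> h\<bar> < 1"
    by (simp add: abs_square_less_1)
  have "lim_corr \<mu> \<nu> h * (sqrt V\<^sub>0 * sqrt V\<^sub>1) = - sqrt (h 0 * h 1) * \<mu> 0 * \<mu> 1"
    unfolding lim_corr_def V\<^sub>0_def[symmetric] V\<^sub>1_def[symmetric] using V by (simp add: real_sqrt_divide real_sqrt_mult)
  then have "2 * lim_corr \<mu> \<nu> h * (a * sqrt V\<^sub>0) * (b * sqrt V\<^sub>1) = - 2 * a * b * sqrt (h 0 * h 1) * \<mu> 0 * \<mu> 1"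
    by (simp add: mult_ac)
  moreover have "lim_V \<mu> \<nu> (aprob (h 0)) 0 = V\<^sub>0" "lim_V \<mu> \<nu> (aprob (h 0)) 1 = V\<^sub>1"
    by (simp_all add: lim_V_def V\<^sub>0_def V\<^sub>1_def h1[unfolded One_nat_def])
  ultimately show "score_var \<mu> \<nu> (h 0) a b = (a * sqrt (lim_V \<mu> \<nu> h 0))\<^sup>2
      + 2 * lim_corr \<mu> \<nu> h * (a * sqrt (lim_V \<mu> \<nu> h 0)) * (b * sqrt (lim_V \<mu> \<nu> h 1)) + (b * sqrt (lim_V \<mu> \<nu> h 1))\<^sup>2"
    unfolding score_var_def V\<^sub>0_def[symmetric] V\<^sub>1_def[symmetric] h1 using V by (simp add: power_mult_distrib)
qed

lemma abs_exp_minus_diff_le: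
  fixes x y :: real
  assumes "0 \<le> x" "0 \<le> y"
  shows "\<bar>exp (- x / 2) - exp (- y / 2)\<bar> \<le> \<bar>x - y\<bar>"
proof -
  have *: "exp (- x / 2) - exp (- y / 2) \<le> y - x" if "0 \<le> x" "x \<le> y" for x y :: real
  proof -
    define z where "z = (y - x) / 2"
    have z: "0 \<le> z" "y - x = 2 * z" "- y / 2 = - x / 2 + - z"
      using that by (simp_all add: z_def field_simps)
    have "exp (- x / 2) - exp (- y / 2) = exp (- x / 2) * (1 - exp (- z))"
      unfolding z(3) exp_add by (simp add: right_diff_distrib)
    also have "\<dots> \<le> 1 * (1 - exp (- z))"
      using that z by (intro mult_right_mono) auto
    also have "\<dots> \<le> y - x"
      using exp_ge_add_one_self[of "- z"] z by simp
    finally show ?thesis .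
  qed
  show ?thesis
  proof (cases "x \<le> y")
    case True
    then have "exp (- y / 2) \<le> exp (- x / 2)"
      by simp
    with * [OF assms(1) True] True show ?thesis
      by simp
  next
    case False
    then have "exp (- x / 2) \<le> exp (- y / 2)"
      by simp
    with * [OF assms(2), of x] False show ?thesis
      by simp
  qed
qed

lemma clip_diff_le: "\<bar>clip l x - clip l' x\<bar> \<le> \<bar>l - l'\<bar>"
  by (auto simp: clip_def min_def max_def)

lemma clip_isCont: "isCont (clip l) x"
  unfolding clip_def[abs_def] by (intro continuous_intros)

section \<open>Sequences of experiments and the uniform central limit theorem\<close>

text \<open>What is asked of the sampling function depends on \<open>c\<close>: almost everywhere
  continuity if \<open>c\<close> is finite, convergence at -\<infinity> otherwise. The regimes enter
  through \<open>l_inf\<close> and the divergence of sample size times clipping rate.\<close>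

locale experiment_sequence =
  fixes X :: "nat \<Rightarrow> 'a trial" and Q :: "nat \<Rightarrow> (real \<times> real) measure" and q p :: "nat \<Rightarrow> real"
    and e :: "nat \<Rightarrow> ereal \<Rightarrow> real" and l :: "nat \<Rightarrow> real" and \<mu> \<nu> :: "nat \<Rightarrow> real" and c :: ereal
    and l_inf K :: real
  assumes reg: "\<And>k. regular_experiment (X k) (Q k) p e (l k) K"
    and total_tendsto: "filterlim (\<lambda>k. real (total_size (X k))) at_top sequentially"
    and q: "t \<in> {1, 2} \<Longrightarrow> 0 < q t \<and> q t < 1"
    and ratio: "t \<in> {1, 2} \<Longrightarrow> real (stage_size (X k) t) = q t * real (total_size (X k))"
    and l: "0 < l k" "l_inf \<le> l k" "0 \<le> l_inf" "l_inf < 1 / 2" "l \<longlonglongrightarrow> l_inf"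
    and clip_rate: "filterlim (\<lambda>k. real (total_size (X k)) * l k) at_top sequentially"
    and mean_tendsto: "s \<in> {0, 1} \<Longrightarrow> (\<lambda>k. moment (Q k) s 1) \<longlonglongrightarrow> \<mu> s"
    and second_tendsto: "s \<in> {0, 1} \<Longrightarrow> (\<lambda>k. moment (Q k) s 2) \<longlonglongrightarrow> \<nu> s"
    and lim_var_pos: "s \<in> {0, 1} \<Longrightarrow> (\<mu> s)\<^sup>2 < \<nu> s"
    and effect_tendsto: "(\<lambda>k. ereal (scaled_effect (Q k) (total_size (X k)))) \<longlonglongrightarrow> c" "c \<le> 0"
    and e_bounds: "x < \<infinity> \<Longrightarrow> 0 \<le> e 0 x" "x < \<infinity> \<Longrightarrow> e 0 x \<le> 1"
    and e_AE_cont: "c \<noteq> -\<infinity> \<Longrightarrow> AE x in lborel. isCont (\<lambda>x::real. e 0 (ereal x)) x"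
    and e_at_bot: "c = -\<infinity> \<Longrightarrow> ((\<lambda>x::real. e 0 (ereal x)) \<longlongrightarrow> e 0 (-\<infinity>)) at_bot"
begin

interpretation E: regular_experiment "X k" "Q k" p e "l k" K for k
  by (rule reg)

abbreviation "N k \<equiv> real (total_size (X k))"
abbreviation "n \<equiv> \<lambda>k. stage_size (X k)"
abbreviation "m \<equiv> \<lambda>k s. moment (Q k) s 1"
abbreviation "v \<equiv> \<lambda>k s. moment (Q k) s 2"
abbreviation "P k \<equiv> prob_sp (X k)"
abbreviation "G \<equiv> \<lambda>k. regular_experiment.G (X k) (Q k) p e (l k)"
abbreviation "h \<equiv> \<lambda>k. regular_experiment.pscore (X k) p e (l k) 2"
abbreviation "J \<equiv> {l_inf..1 - l_inf}"
abbreviation "H \<equiv> \<lambda>y. lim_H q p e \<mu> \<nu> c l_inf y 2 0"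
abbreviation "\<rho> \<equiv> lim_corr \<mu> \<nu> p"
abbreviation "A \<equiv> \<lambda>s y. sqrt (lim_V \<mu> \<nu> p s) * arm s y"

lemma p_bounds: "0 < p 0" "p 0 < 1" "0 < p 1" "p 1 < 1" "p 1 = 1 - p 0"
  using E.p_pos E.p_sum by auto

lemma K_ge_1: "1 \<le> K"
  using E.outcome_law_Q[of 0] outcome_law.K_ge_1 by blast

lemma J_unit: "x \<in> J \<Longrightarrow> 0 \<le> x \<and> x \<le> 1"
  using l by auto

lemma h_bounds: "l k \<le> h k \<omega>" "h k \<omega> \<le> 1 - l k" "h k \<omega> \<in> J"
  using E.\<pi>_bounds[of k "data (X k) 1 \<omega>"] l(2)[of k] by (simp_all add: E.pscore_def)

lemma H_eq: "H y = clip l_inf (e 0 (lim_S q p \<mu> \<nu> c y))"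
  by (simp add: lim_H_def)

lemma lim_S_less: "lim_S q p \<mu> \<nu> c y < \<infinity>"
  using effect_tendsto(2) q[of 1] by (cases c) (auto simp: lim_S_def)

lemma lim_H_1: "lim_H q p e \<mu> \<nu> c l_inf y 2 1 = 1 - H y"
proof -
  have "e 1 (lim_S q p \<mu> \<nu> c y) = 1 - e 0 (lim_S q p \<mu> \<nu> c y)"
    using E.e_sum[OF lim_S_less, of y] by simp
  then show ?thesis
    using clip_complement[of l_inf] l by (simp add: lim_H_def)
qed

lemma H_in_J: "H y \<in> J"
  unfolding H_eq using clip_bounds[of l_inf] l by auto

lemma H_unit: "0 \<le> H y" "H y \<le> 1"
  using J_unit[OF H_in_J[of y]] by auto

lemma measurable_H[measurable]: "H \<in> borel_measurable borel"
proof (cases "c = -\<infinity>")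
  case True
  have "lim_S q p \<mu> \<nu> c y = -\<infinity>" for y
    using q[of 1] True by (simp add: lim_S_def)
  then show ?thesis
    unfolding H_eq by simp
next
  case False
  then obtain c' where c': "c = ereal c'"
    using effect_tendsto(2) by (cases c) auto
  have "H y = clip l_inf (e 0 (ereal (fst y * sqrt (lim_V \<mu> \<nu> p 0 / p 0) - snd y * sqrt (lim_V \<mu> \<nu> p 1 / p 1) + sqrt (q 1) * c')))" for y
    unfolding H_eq by (simp add: lim_S_def c')
  then show ?thesis
    using E.clip_measurable[of l_inf] E.e_measurable by simp
qed

lemma \<rho>_less: "\<bar>\<rho>\<bar> < 1"
  using p_bounds lim_var_pos[of 0] lim_var_pos[of 1] by (intro lim_corr_less_1) auto

lemma \<rho>2_less: "\<bar>lim_corr \<mu> \<nu> (lim_H q p e \<mu> \<nu> c l_inf y 2)\<bar> < 1"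
  using H_unit[of y] lim_H_1[of y] lim_var_pos[of 0] lim_var_pos[of 1] by (intro lim_corr_less_1) auto

lemma measurable_\<rho>2: "(\<lambda>y. lim_corr \<mu> \<nu> (lim_H q p e \<mu> \<nu> c l_inf y 2)) \<in> borel_measurable borel"
  unfolding lim_corr_def lim_V_def lim_H_1 by measurable

lemma prob_space_limit_law: "prob_space (limit_law q p e \<mu> \<nu> c l_inf)"
  unfolding limit_law_def by (rule prob_space_binormal_bind[OF \<rho>_less \<rho>2_less measurable_\<rho>2])

lemma sets_limit_law: "sets (limit_law q p e \<mu> \<nu> c l_inf) = sets borel"
  unfolding limit_law_def by (rule sets_binormal_bind[OF \<rho>_less \<rho>2_less measurable_\<rho>2])

lemma integral_limit_law:
  fixes F :: "(real \<times> real) \<times> (real \<times> real) \<Rightarrow> complex"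
  assumes "F \<in> borel_measurable borel" "\<And>x. norm (F x) \<le> B"
  shows "(\<integral>z. F z \<partial>limit_law q p e \<mu> \<nu> c l_inf)
    = (\<integral>y. \<integral>z. F (y, z) \<partial>binormal (lim_corr \<mu> \<nu> (lim_H q p e \<mu> \<nu> c l_inf y 2)) \<partial>binormal \<rho>)"
  unfolding limit_law_def by (rule integral_binormal_bind[OF \<rho>_less \<rho>2_less measurable_\<rho>2 assms])

lemma char_A: "(CLINT y|binormal \<rho>. iexp (a * A 0 y + b * A 1 y)) = of_real (exp (- score_var \<mu> \<nu> (p 0) a b / 2))"
proof -
  have "score_var \<mu> \<nu> (p 0) a b = (a * sqrt (lim_V \<mu> \<nu> p 0))\<^sup>2
      + 2 * \<rho> * (a * sqrt (lim_V \<mu> \<nu> p 0)) * (b * sqrt (lim_V \<mu> \<nu> p 1)) + (b * sqrt (lim_V \<mu> \<nu> p 1))\<^sup>2"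
    using p_bounds lim_var_pos[of 0] lim_var_pos[of 1] by (intro score_var_eq_lim_corr) auto
  then show ?thesis
    using char_binormal[OF \<rho>_less, of "a * sqrt (lim_V \<mu> \<nu> p 0)" "b * sqrt (lim_V \<mu> \<nu> p 1)"] by (simp add: mult.assoc)
qed

text \<open>The propensity of the follow-up stage is random, so the approximation has to be uniform
  in it and in the coefficients. The lower bound \<open>\<eta> k\<close> is a constant for the pilot
  stage and the clipping rate for the follow-up stage; errors of order
  \<open>1 / (N k * \<eta> k)\<close> vanish in both.\<close>

lemma clt_uniform:
  fixes \<eta> :: "nat \<Rightarrow> real" and N :: "nat \<Rightarrow> nat"
  assumes rate: "filterlim (\<lambda>k. N k * \<eta> k) at_top sequentially" and \<eta>: "\<And>k. 0 < \<eta> k" and N: "\<And>k. 0 < N k"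
    and \<epsilon>: "0 < \<epsilon>"
  shows "\<forall>\<^sub>F k in sequentially. \<forall>h a b. \<eta> k \<le> h \<longrightarrow> h \<le> 1 - \<eta> k \<longrightarrow> \<bar>a\<bar> \<le> B \<longrightarrow> \<bar>b\<bar> \<le> B \<longrightarrow>
    cmod ((CLINT d|data_law (N k) (Q k) h. iexp (a * score_sum (N k) h (m k) 0 d + b * score_sum (N k) h (m k) 1 d))
      - of_real (exp (- score_var \<mu> \<nu> h a b / 2))) \<le> \<epsilon>"
proof -
  \<comment> \<open>The distance of the moments of the array from their limits, since the laws may
    vary with the sample size.\<close>
  define D where "D k = \<bar>v k 0 - \<nu> 0\<bar> + \<bar>(m k 0)\<^sup>2 - (\<mu> 0)\<^sup>2\<bar> + \<bar>v k 1 - \<nu> 1\<bar> + \<bar>(m k 1)\<^sup>2 - (\<mu> 1)\<^sup>2\<bar>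
    + 2 * \<bar>m k 0 * m k 1 - \<mu> 0 * \<mu> 1\<bar>" for k
  have D: "D \<longlonglongrightarrow> 0"
  proof -
    have "D \<longlonglongrightarrow> \<bar>\<nu> 0 - \<nu> 0\<bar> + \<bar>(\<mu> 0)\<^sup>2 - (\<mu> 0)\<^sup>2\<bar> + \<bar>\<nu> 1 - \<nu> 1\<bar> + \<bar>(\<mu> 1)\<^sup>2 - (\<mu> 1)\<^sup>2\<bar>
        + 2 * \<bar>\<mu> 0 * \<mu> 1 - \<mu> 0 * \<mu> 1\<bar>"
      unfolding D_def using mean_tendsto second_tendsto by (intro tendsto_intros) auto
    then show ?thesis
      by simp
  qed
  \<comment> \<open>A bound for the variance of the combination: \<open>B\<^sup>2 * K\<close> from
    each arm and twice that from the covariance.\<close>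
  define S where "S = 4 * B\<^sup>2 * K"
  have S: "0 \<le> S"
    unfolding S_def using K_ge_1 by simp
  \<comment> \<open>The part of the error that does not vanish with the sample size is
    \<open>\<epsilon>' * S\<close>, so \<open>\<epsilon>'\<close> is fixed first and leaves a gap
    below \<epsilon>.\<close>
  define \<epsilon>' where "\<epsilon>' = \<epsilon> / (2 * (S + 1))"
  have \<epsilon>': "0 < \<epsilon>'" "\<epsilon>' * S < \<epsilon>"
  proof -
    show "0 < \<epsilon>'"
      using \<epsilon> S by (simp add: \<epsilon>'_def)
    then have "\<epsilon>' * S < \<epsilon>' * (2 * (S + 1))"
      using S by (intro mult_strict_left_mono) auto
    also have "\<dots> = \<epsilon>"
      using S by (simp add: \<epsilon>'_def)
    finally show "\<epsilon>' * S < \<epsilon>" .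
  qed
  have "(\<lambda>k. \<epsilon>' * S + (272 * K\<^sup>2 * B ^ 4 / \<epsilon>') / (N k * \<eta> k) + S\<^sup>2 / (N k * \<eta> k) + B\<^sup>2 * D k) \<longlonglongrightarrow> \<epsilon>' * S + 0 + 0 + B\<^sup>2 * 0"
    by (intro tendsto_intros real_tendsto_divide_at_top[OF tendsto_const rate] D)
  then have ev: "\<forall>\<^sub>F k in sequentially. \<epsilon>' * S + (272 * K\<^sup>2 * B ^ 4 / \<epsilon>') / (N k * \<eta> k) + S\<^sup>2 / (N k * \<eta> k) + B\<^sup>2 * D k < \<epsilon>"
    by (rule order_tendstoD) (use \<epsilon>' in simp)
  then show ?thesis
  proof (rule eventually_mono, intro allI impI)
    fix k h a b
    assume le: "\<epsilon>' * S + (272 * K\<^sup>2 * B ^ 4 / \<epsilon>') / (N k * \<eta> k) + S\<^sup>2 / (N k * \<eta> k) + B\<^sup>2 * D k < \<epsilon>"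
      and h: "\<eta> k \<le> h" "h \<le> 1 - \<eta> k" and ab: "\<bar>a\<bar> \<le> B" "\<bar>b\<bar> \<le> B"
    interpret Q: outcome_law "Q k" K
      by (rule E.outcome_law_Q)
    have h01: "0 < h" "h < 1"
      using h \<eta>[of k] by auto
    have \<eta>1: "\<eta> k \<le> 1"
      using h h01 by auto
    have ab2: "a\<^sup>2 \<le> B\<^sup>2" "b\<^sup>2 \<le> B\<^sup>2" "\<bar>a * b\<bar> \<le> B\<^sup>2"
      using ab power_mono[OF ab(1), of 2] power_mono[OF ab(2), of 2] mult_mono[OF ab] by (auto simp: abs_mult power2_eq_square)
    have ab4: "a ^ 4 \<le> B ^ 4" "b ^ 4 \<le> B ^ 4"
      using power_mono[OF ab(1), of 4] power_mono[OF ab(2), of 4] by (auto simp: power_abs)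
    have B0: "0 \<le> B"
      using ab by auto
    have root: "0 \<le> sqrt (h * (1 - h))" "sqrt (h * (1 - h)) \<le> 1"
      using h01 by (auto intro!: mult_le_one)
    have mom: "(m k 0)\<^sup>2 \<le> v k 0" "(m k 1)\<^sup>2 \<le> v k 1" "v k 0 \<le> K" "v k 1 \<le> K"
      using Q.mean_sq_le[of 0] Q.mean_sq_le[of 1] Q.second_moment_le[of 0] Q.second_moment_le[of 1] by auto
    have nn: "0 \<le> score_var (m k) (v k) h a b" "0 \<le> score_var \<mu> \<nu> h a b"
      using h01 mom lim_var_pos[of 0] lim_var_pos[of 1] by (auto intro!: score_var_nonneg)
    have S_le: "score_var (m k) (v k) h a b \<le> S"
    proof -
      have V: "lim_V (m k) (v k) (aprob h) 0 \<le> K" "lim_V (m k) (v k) (aprob h) 1 \<le> K"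
      proof -
        have "0 \<le> h * (m k 0)\<^sup>2" "0 \<le> (1 - h) * (m k 1)\<^sup>2"
          using h01 by auto
        with mom show "lim_V (m k) (v k) (aprob h) 0 \<le> K" "lim_V (m k) (v k) (aprob h) 1 \<le> K"
          by (simp_all add: lim_V_def)
      qed
      have "\<bar>m k 0 * m k 1\<bar> \<le> K"
        using sum_squares_bound[of "m k 0" "m k 1"] sum_squares_bound[of "- m k 0" "m k 1"] mom by (auto simp: abs_le_iff)
      then have "\<bar>a * b * (sqrt (h * (1 - h)) * (m k 0 * m k 1))\<bar> \<le> B\<^sup>2 * (1 * K)"
        unfolding abs_mult[of "a * b"] abs_mult[of "sqrt (h * (1 - h))"] using ab2 root K_ge_1 by (intro mult_mono) auto
      then have "- (2 * a * b * sqrt (h * (1 - h)) * m k 0 * m k 1) \<le> 2 * (B\<^sup>2 * K)"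
        by (simp add: abs_le_iff mult_ac)
      moreover have "a\<^sup>2 * lim_V (m k) (v k) (aprob h) 0 \<le> B\<^sup>2 * K" "b\<^sup>2 * lim_V (m k) (v k) (aprob h) 1 \<le> B\<^sup>2 * K"
        using K_ge_1 order_trans[OF mult_left_mono[OF V(1) zero_le_power2] mult_right_mono[OF ab2(1)]]
          order_trans[OF mult_left_mono[OF V(2) zero_le_power2] mult_right_mono[OF ab2(2)]] by simp_all
      ultimately show ?thesis
        unfolding score_var_def S_def by linarith
    qed
    have "cmod ((CLINT d|data_law (N k) (Q k) h. iexp (a * score_sum (N k) h (m k) 0 d + b * score_sum (N k) h (m k) 1 d))
      - of_real (exp (- score_var (m k) (v k) h a b / 2)))
      \<le> \<epsilon>' * score_var (m k) (v k) h a b + 136 * K\<^sup>2 * (a ^ 4 / h + b ^ 4 / (1 - h)) / (N k * \<epsilon>') + (score_var (m k) (v k) h a b)\<^sup>2 / N k"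
      by (rule Q.char_score_sum_bound[OF h01 N \<epsilon>'(1)])
    also have "\<dots> \<le> \<epsilon>' * S + 136 * K\<^sup>2 * (B ^ 4 / \<eta> k + B ^ 4 / \<eta> k) / (N k * \<epsilon>') + S\<^sup>2 / (N k * \<eta> k)"
    proof (intro add_mono divide_right_mono mult_left_mono)
      show "a ^ 4 / h \<le> B ^ 4 / \<eta> k" "b ^ 4 / (1 - h) \<le> B ^ 4 / \<eta> k"
        using ab4 h h01 \<eta>[of k] by (auto intro!: frac_le)
      show "(score_var (m k) (v k) h a b)\<^sup>2 / N k \<le> S\<^sup>2 / (N k * \<eta> k)"
        using S_le nn(1) N[of k] \<eta>[of k] \<eta>1 by (intro frac_le power_mono) (auto simp: mult_left_le)
    qed (use S_le \<epsilon>' N[of k] in auto)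
    also have "136 * K\<^sup>2 * (B ^ 4 / \<eta> k + B ^ 4 / \<eta> k) / (N k * \<epsilon>') = (272 * K\<^sup>2 * B ^ 4 / \<epsilon>') / (N k * \<eta> k)"
      by (simp add: mult_ac)
    finally have 1: "cmod ((CLINT d|data_law (N k) (Q k) h. iexp (a * score_sum (N k) h (m k) 0 d + b * score_sum (N k) h (m k) 1 d))
      - of_real (exp (- score_var (m k) (v k) h a b / 2))) \<le> \<epsilon>' * S + (272 * K\<^sup>2 * B ^ 4 / \<epsilon>') / (N k * \<eta> k) + S\<^sup>2 / (N k * \<eta> k)" .
    have 2: "cmod (complex_of_real (exp (- score_var (m k) (v k) h a b / 2)) - of_real (exp (- score_var \<mu> \<nu> h a b / 2))) \<le> B\<^sup>2 * D k"
    proof -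
      have eq: "score_var (m k) (v k) h a b - score_var \<mu> \<nu> h a b
          = a\<^sup>2 * ((v k 0 - \<nu> 0) - h * ((m k 0)\<^sup>2 - (\<mu> 0)\<^sup>2)) + b\<^sup>2 * ((v k 1 - \<nu> 1) - (1 - h) * ((m k 1)\<^sup>2 - (\<mu> 1)\<^sup>2))
            - (a * b) * (2 * sqrt (h * (1 - h)) * (m k 0 * m k 1 - \<mu> 0 * \<mu> 1))"
        by (simp add: score_var_def lim_V_def algebra_simps)
      have "cmod (complex_of_real (exp (- score_var (m k) (v k) h a b / 2)) - of_real (exp (- score_var \<mu> \<nu> h a b / 2)))
          \<le> \<bar>score_var (m k) (v k) h a b - score_var \<mu> \<nu> h a b\<bar>"
        unfolding of_real_diff[symmetric] norm_of_real by (rule abs_exp_minus_diff_le[OF nn])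
      also have "\<dots> \<le> B\<^sup>2 * (\<bar>v k 0 - \<nu> 0\<bar> + \<bar>(m k 0)\<^sup>2 - (\<mu> 0)\<^sup>2\<bar>) + B\<^sup>2 * (\<bar>v k 1 - \<nu> 1\<bar> + \<bar>(m k 1)\<^sup>2 - (\<mu> 1)\<^sup>2\<bar>)
          + B\<^sup>2 * (2 * \<bar>m k 0 * m k 1 - \<mu> 0 * \<mu> 1\<bar>)"
      proof -
        have x: "\<bar>x - w * y\<bar> \<le> \<bar>x\<bar> + \<bar>y\<bar>" if "0 \<le> w" "w \<le> 1" for x y w :: real
        proof -
          have "\<bar>w * y\<bar> \<le> \<bar>y\<bar>"
            using that by (simp add: abs_mult mult_left_le_one_le)
          then show ?thesis
            using abs_triangle_ineq4[of x "w * y"] by linarith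
        qed
        have 1: "\<bar>a\<^sup>2 * ((v k 0 - \<nu> 0) - h * ((m k 0)\<^sup>2 - (\<mu> 0)\<^sup>2))\<bar> \<le> B\<^sup>2 * (\<bar>v k 0 - \<nu> 0\<bar> + \<bar>(m k 0)\<^sup>2 - (\<mu> 0)\<^sup>2\<bar>)"
          unfolding abs_mult using ab2 h01 by (intro mult_mono x) auto
        have 2: "\<bar>b\<^sup>2 * ((v k 1 - \<nu> 1) - (1 - h) * ((m k 1)\<^sup>2 - (\<mu> 1)\<^sup>2))\<bar> \<le> B\<^sup>2 * (\<bar>v k 1 - \<nu> 1\<bar> + \<bar>(m k 1)\<^sup>2 - (\<mu> 1)\<^sup>2\<bar>)"
          unfolding abs_mult[of "b\<^sup>2"] using ab2 h01 by (intro mult_mono x) auto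
        have 3: "\<bar>(a * b) * (2 * sqrt (h * (1 - h)) * (m k 0 * m k 1 - \<mu> 0 * \<mu> 1))\<bar> \<le> B\<^sup>2 * (2 * \<bar>m k 0 * m k 1 - \<mu> 0 * \<mu> 1\<bar>)"
          unfolding abs_mult[of "a * b"] abs_mult[of "2 * sqrt (h * (1 - h))"] using ab2 root
          by (intro mult_mono) auto
        have tri: "\<bar>x + y - z\<bar> \<le> x' + y' + z'" if "\<bar>x\<bar> \<le> x'" "\<bar>y\<bar> \<le> y'" "\<bar>z\<bar> \<le> z'" for x y z x' y' z' :: real
          using that by linarith
        show ?thesis
          unfolding eq by (rule tri[OF 1 2 3])
      qed
      also have "\<dots> = B\<^sup>2 * D k"
        by (simp add: D_def algebra_simps)
      finally show ?thesis .
    qed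
    show "cmod ((CLINT d|data_law (N k) (Q k) h. iexp (a * score_sum (N k) h (m k) 0 d + b * score_sum (N k) h (m k) 1 d))
      - of_real (exp (- score_var \<mu> \<nu> h a b / 2))) \<le> \<epsilon>"
      using norm_diff_triangle_le[OF 1 2] le by linarith
  qed
qed

end

lemma (in prob_space) integral_unit_mult_diff_le:
  fixes w :: "'a \<Rightarrow> complex" and f g Z :: "'a \<Rightarrow> real"
  assumes [measurable]: "w \<in> borel_measurable M" "f \<in> borel_measurable M" "g \<in> borel_measurable M"
    and w: "\<And>x. cmod (w x) \<le> 1" and fg: "\<And>x. \<bar>f x\<bar> \<le> B" "\<And>x. \<bar>g x\<bar> \<le> B"
    and Z: "integrable M Z" "\<And>x. \<bar>f x - g x\<bar> \<le> Z x"
  shows "cmod ((CLINT x|M. w x * of_real (f x)) - (CLINT x|M. w x * of_real (g x))) \<le> (\<integral>x. Z x \<partial>M)"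
proof -
  have bd: "cmod (w x * of_real y) \<le> B" if "\<bar>y\<bar> \<le> B" for x y
    unfolding norm_mult norm_of_real using mult_mono[OF w that] by auto
  have i1: "integrable M (\<lambda>x. w x * of_real (f x))" and i2: "integrable M (\<lambda>x. w x * of_real (g x))"
    by (rule integrable_of_bounded[where B=B], measurable, rule bd, rule fg)+
  have "cmod ((CLINT x|M. w x * of_real (f x)) - (CLINT x|M. w x * of_real (g x))) = cmod (CLINT x|M. w x * of_real (f x) - w x * of_real (g x))"
    by (simp only: Bochner_Integration.integral_diff[OF i1 i2])
  also have "\<dots> \<le> (\<integral>x. cmod (w x * of_real (f x) - w x * of_real (g x)) \<partial>M)"
    by (rule integral_norm_bound)
  also have "\<dots> \<le> (\<integral>x. Z x \<partial>M)"
  proof (rule integral_mono[OF integrable_norm[OF Bochner_Integration.integrable_diff[OF i1 i2]] Z(1)])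
    fix x
    have "cmod (w x * of_real (f x) - w x * of_real (g x)) = cmod (w x) * \<bar>f x - g x\<bar>"
      unfolding right_diff_distrib[symmetric] of_real_diff[symmetric] norm_mult norm_of_real ..
    also have "\<dots> \<le> 1 * Z x"
      using w Z(2) by (intro mult_mono) auto
    finally show "cmod (w x * of_real (f x) - w x * of_real (g x)) \<le> Z x"
      by simp
  qed
  finally show ?thesis .
qed

section \<open>Joint limit of the pilot sums and the follow-up propensity\<close>

context experiment_sequence
begin

interpretation E: regular_experiment "X k" "Q k" p e "l k" K for k
  by (rule reg)

interpretation B: prob_space "binormal \<rho>"
  by (rule prob_space_binormal[OF \<rho>_less])

lemma n_pos: "t \<in> {1, 2} \<Longrightarrow> 0 < n k t"
  using E.stage_pos[of t k] .

lemma n_tendsto: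
  assumes t: "t \<in> {1, 2}"
  shows "filterlim (\<lambda>k. real (n k t)) at_top sequentially"
  unfolding ratio[OF t] using q[OF t] by (intro filterlim_tendsto_pos_mult_at_top[OF tendsto_const _ total_tendsto]) simp

lemma n_rate:
  assumes t: "t \<in> {1, 2}"
  shows "filterlim (\<lambda>k. real (n k t) * l k) at_top sequentially"
  unfolding ratio[OF t] mult.assoc using q[OF t]
  by (intro filterlim_tendsto_pos_mult_at_top[OF tendsto_const _ clip_rate]) simp

lemma G_integrable:
  assumes "t \<in> {1, 2}" "s \<in> {0, 1}"
  shows "integrable (P k) (G k t s)"
  by (rule E.square_integrable_imp_integrable[OF E.measurable_G[OF assms(1)] E.integrable_G_sq[OF l(1) assms]])

text \<open>Second moments at most \<open>K\<close> control the first absolute moment through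
  \<open>\<bar>x\<bar> \<le> (1 + x\<^sup>2) / 2\<close>, with 1 \<le> K absorbing the
  constant.\<close>

lemma G_abs: 
  assumes "t \<in> {1, 2}" "s \<in> {0, 1}"
  shows "(\<integral>\<omega>. \<bar>G k t s \<omega>\<bar> \<partial>P k) \<le> K"
proof -
  have "(\<integral>\<omega>. \<bar>G k t s \<omega>\<bar> \<partial>P k) \<le> (\<integral>\<omega>. (1 + (G k t s \<omega>)\<^sup>2) / 2 \<partial>P k)"
  proof (rule integral_mono)
    show "integrable (P k) (\<lambda>\<omega>. \<bar>G k t s \<omega>\<bar>)"
      using G_integrable[OF assms] by simp
    show "integrable (P k) (\<lambda>\<omega>. (1 + (G k t s \<omega>)\<^sup>2) / 2)"
      using E.integrable_G_sq[OF l(1) assms] by simp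
    show "\<bar>G k t s \<omega>\<bar> \<le> (1 + (G k t s \<omega>)\<^sup>2) / 2" for \<omega>
      using sum_squares_bound[of 1 "\<bar>G k t s \<omega>\<bar>"] by simp
  qed
  also have "\<dots> = (1 + (\<integral>\<omega>. (G k t s \<omega>)\<^sup>2 \<partial>P k)) / 2"
    using E.integrable_G_sq[OF l(1) assms] by (simp add: E.prob_space)
  also have "\<dots> \<le> K"
    using E.integral_G_sq[OF l(1) assms, of k] K_ge_1 by simp
  finally show ?thesis .
qed

lemma measurable_G: "t \<in> {1, 2} \<Longrightarrow> G k t s \<in> borel_measurable (P k)"
  by (rule E.measurable_G)

lemma pilot_clt:
  "(\<lambda>k. CLINT \<omega>|P k. iexp (a * G k 1 0 \<omega> + b * G k 1 1 \<omega>)) \<longlonglongrightarrow> (CLINT y|binormal \<rho>. iexp (a * A 0 y + b * A 1 y))"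
proof (rule tendstoI)
  fix \<epsilon> :: real assume \<epsilon>: "0 < \<epsilon>"
  \<comment> \<open>The pilot propensity is fixed, so a constant lower bound serves and the rate
    condition reduces to growth of the stage.\<close>
  define \<eta> where "\<eta> = min (p 0) (1 - p 0)"
  have \<eta>: "0 < \<eta>" "\<eta> \<le> p 0" "p 0 \<le> 1 - \<eta>"
    using p_bounds by (auto simp: \<eta>_def)
  have "filterlim (\<lambda>k. real (n k 1) * \<eta>) at_top sequentially"
    using filterlim_tendsto_pos_mult_at_top[OF tendsto_const \<eta>(1) n_tendsto[of 1]] by (simp add: mult.commute)
  from clt_uniform[OF this, of "\<epsilon> / 2" "max \<bar>a\<bar> \<bar>b\<bar>"] \<eta>(1) \<epsilon> n_pos[of 1]
  have "\<forall>\<^sub>F k in sequentially. \<forall>h a' b'. \<eta> \<le> h \<longrightarrow> h \<le> 1 - \<eta> \<longrightarrow> \<bar>a'\<bar> \<le> max \<bar>a\<bar> \<bar>b\<bar> \<longrightarrow> \<bar>b'\<bar> \<le> max \<bar>a\<bar> \<bar>b\<bar> \<longrightarrow>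
    cmod ((CLINT d|data_law (n k 1) (Q k) h. iexp (a' * score_sum (n k 1) h (m k) 0 d + b' * score_sum (n k 1) h (m k) 1 d))
      - of_real (exp (- score_var \<mu> \<nu> h a' b' / 2))) \<le> \<epsilon> / 2"
    by simp
  then show "\<forall>\<^sub>F k in sequentially. dist (CLINT \<omega>|P k. iexp (a * G k 1 0 \<omega> + b * G k 1 1 \<omega>)) (CLINT y|binormal \<rho>. iexp (a * A 0 y + b * A 1 y)) < \<epsilon>"
  proof eventually_elim
    case (elim k)
    have "(\<lambda>d. iexp (a * score_sum (n k 1) (p 0) (m k) 0 d + b * score_sum (n k 1) (p 0) (m k) 1 d)) \<in> borel_measurable (\<Pi>\<^sub>M u\<in>{1..n k 1}. obs_space)"
      by measurable
    from E.integral_pilot[OF this]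
    have "(CLINT \<omega>|P k. iexp (a * G k 1 0 \<omega> + b * G k 1 1 \<omega>))
      = (CLINT d|data_law (n k 1) (Q k) (p 0). iexp (a * score_sum (n k 1) (p 0) (m k) 0 d + b * score_sum (n k 1) (p 0) (m k) 1 d))"
      by (simp add: E.G_def E.pscore_def)
    moreover have "cmod (\<dots> - of_real (exp (- score_var \<mu> \<nu> (p 0) a b / 2))) \<le> \<epsilon> / 2"
      using elim \<eta> by simp
    ultimately show ?case
      unfolding char_A dist_norm using \<epsilon> by simp
  qed
qed

definition S :: "nat \<Rightarrow> 'a \<Rightarrow> real" where
  "S k \<omega> = pilot_diff p (n k 1) (data (X k) 1 \<omega>)"

text \<open>The drift of the pilot statistic: the root of the pilot size is
  \<open>sqrt (q 1)\<close> times the root of the total size.\<close>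

definition shift :: "nat \<Rightarrow> real" where
  "shift k = sqrt (q 1) * scaled_effect (Q k) (total_size (X k))"

lemma S_eq: "S k \<omega> = G k 1 0 \<omega> / sqrt (p 0) - G k 1 1 \<omega> / sqrt (p 1) + shift k"
proof -
  have one: "(\<Sum>u\<in>{1..n k 1}. of_bool (fst (data (X k) 1 \<omega> u) = s) * snd (data (X k) 1 \<omega> u) / p s) / sqrt (n k 1)
      = G k 1 s \<omega> / sqrt (p s) + sqrt (n k 1) * m k s" if s: "s \<in> {0, 1}" for s
  proof -
    have ps: "aprob (p 0) s = p s" "0 < p s"
      using s p_bounds by auto
    have "G k 1 s \<omega> = sqrt (p s) * ((\<Sum>u\<in>{1..n k 1}. of_bool (fst (data (X k) 1 \<omega> u) = s) * snd (data (X k) 1 \<omega> u) / p s) / sqrt (n k 1) - sqrt (n k 1) * m k s)"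
      using score_sum_eq[of "n k 1" "p 0" s "m k" "data (X k) 1 \<omega>"] ps n_pos[of 1 k] by (simp add: E.G_def E.pscore_def)
    then show ?thesis
      using ps by simp
  qed
  have "sqrt (n k 1) * (m k 0 - m k 1) = shift k"
  proof -
    have "sqrt (real (n k 1)) = sqrt (q 1) * sqrt (N k)"
      using ratio[of 1 k] by (simp only: real_sqrt_mult insertI1)
    then show ?thesis
      unfolding shift_def scaled_effect_def by (simp only: mult.assoc)
  qed
  then show ?thesis
    unfolding S_def pilot_diff_def using one[of 0] one[of 1] by (simp add: right_diff_distrib)
qed

lemma h_eq: "h k \<omega> = clip (l k) (e 0 (ereal (S k \<omega>)))"
  by (simp add: E.pscore_def E.\<pi>_def S_def)

lemma measurable_S[measurable]: "S k \<in> borel_measurable (P k)"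
  unfolding S_def[abs_def] using measurable_compose[OF E.measurable_data[of 1] measurable_pilot_diff] by simp

lemma measurable_clip_e: "(\<lambda>x. clip l_inf (e 0 (ereal x))) \<in> borel_measurable borel"
  using measurable_compose[OF E.e_measurable E.clip_measurable] .

lemma clip_in_J: "clip l_inf x \<in> J"
  using clip_bounds[of l_inf x] l by auto

lemma continuous_on_J_bounded:
  assumes "continuous_on J \<kappa>"
  obtains B where "0 < B" "\<And>x. x \<in> J \<Longrightarrow> \<bar>\<kappa> x\<bar> \<le> (B::real)"
  using compact_imp_bounded[OF compact_continuous_image[OF assms compact_Icc]] unfolding bounded_pos by auto

lemma measurable_\<kappa>_clip:
  fixes \<kappa> :: "real \<Rightarrow> real"
  assumes "continuous_on J \<kappa>"
  shows "(\<lambda>x. \<kappa> (clip l_inf (e 0 (ereal x)))) \<in> borel_measurable borel"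
  by (rule borel_measurable_continuous_on_compose[OF assms measurable_clip_e clip_in_J])

lemma shift_tendsto_ereal: "(\<lambda>k. ereal (shift k)) \<longlonglongrightarrow> ereal (sqrt (q 1)) * c"
  unfolding shift_def times_ereal.simps(1)[symmetric] using q[of 1]
  by (intro tendsto_cmult_ereal effect_tendsto) auto

text \<open>The pilot statistic is a linear combination of the pilot sums plus a convergent shift,
  so its joint transform with any other combination is again a pilot transform at altered
  coefficients. The mapping theorem then inserts the sampling function, whose discontinuities the
  limiting statistic avoids almost surely.\<close>

lemma joint_limit_finite:
  fixes \<kappa> :: "real \<Rightarrow> real"
  assumes \<kappa>: "continuous_on J \<kappa>" and c: "c = ereal c'"
  shows "(\<lambda>k. CLINT \<omega>|P k. iexp (a * G k 1 0 \<omega> + b * G k 1 1 \<omega>) * of_real (\<kappa> (clip l_inf (e 0 (ereal (S k \<omega>))))))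
    \<longlonglongrightarrow> (CLINT y|binormal \<rho>. iexp (a * A 0 y + b * A 1 y) * of_real (\<kappa> (H y)))"
proof -
  obtain B where B: "0 < B" "\<And>x. x \<in> J \<Longrightarrow> \<bar>\<kappa> x\<bar> \<le> B"
    using continuous_on_J_bounded[OF \<kappa>] by blast
  define d where "d = sqrt (q 1) * c'"
  define S' where "S' y = A 0 y / sqrt (p 0) - A 1 y / sqrt (p 1) + d" for y
  have shift: "shift \<longlonglongrightarrow> d"
    using shift_tendsto_ereal by (simp add: c d_def)
  have H: "H y = clip l_inf (e 0 (ereal (S' y)))" for y
    unfolding H_eq unfolding lim_S_def S'_def c d_def by (simp add: real_sqrt_divide mult.commute)
  have "(\<lambda>k. CLINT \<omega>|P k. iexp (a * G k 1 0 \<omega> + b * G k 1 1 \<omega>) * of_real (\<kappa> (clip l_inf (e 0 (ereal (S k \<omega>))))))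
    \<longlonglongrightarrow> (CLINT y|binormal \<rho>. iexp (a * A 0 y + b * A 1 y) * of_real (\<kappa> (clip l_inf (e 0 (ereal (S' y))))))"
  proof (rule iexp_integral_tendsto[where L="\<lambda>k \<omega>. a * G k 1 0 \<omega> + b * G k 1 1 \<omega>" and S=S and S'=S'
        and L'="\<lambda>y. a * A 0 y + b * A 1 y" and f="\<lambda>x. \<kappa> (clip l_inf (e 0 (ereal x)))" and B=B])
    show "(\<lambda>\<omega>. a * G k 1 0 \<omega> + b * G k 1 1 \<omega>) \<in> borel_measurable (P k)" for k
      using measurable_G[of 1 k] by simp
    show "(\<lambda>y. a * A 0 y + b * A 1 y) \<in> borel_measurable (binormal \<rho>)" "S' \<in> borel_measurable (binormal \<rho>)"
      unfolding S'_def[abs_def] by measurable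
    show "(\<lambda>k. CLINT \<omega>|P k. iexp (u * (a * G k 1 0 \<omega> + b * G k 1 1 \<omega>) + t * S k \<omega>))
        \<longlonglongrightarrow> (CLINT y|binormal \<rho>. iexp (u * (a * A 0 y + b * A 1 y) + t * S' y))" for u t
    proof -
      have 1: "iexp (u * (a * x + b * y) + t * (x / sqrt (p 0) - y / sqrt (p 1) + z))
        = iexp (t * z) * iexp ((u * a + t / sqrt (p 0)) * x + (u * b - t / sqrt (p 1)) * y)" for x y z
        by (simp add: algebra_simps add_divide_distrib diff_divide_distrib flip: exp_add)
      show ?thesis
        unfolding S_eq S'_def 1 integral_mult_right_zero
        by (intro tendsto_intros pilot_clt shift)
    qed
    show "AE y in binormal \<rho>. isCont (\<lambda>x. \<kappa> (clip l_inf (e 0 (ereal x)))) (S' y)"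
    proof -
      \<comment> \<open>Positive variance of arm 1 gives the affine form a nonzero coefficient on
        the second normal coordinate, hence an absolutely continuous law.\<close>
      have V1: "0 < lim_V \<mu> \<nu> p 1"
        using p_bounds lim_var_pos[of 1] by (intro lim_V_pos) auto
      have "AE y in binormal \<rho>. isCont (\<lambda>x. e 0 (ereal x)) ((sqrt (lim_V \<mu> \<nu> p 0) / sqrt (p 0)) * fst y + (- sqrt (lim_V \<mu> \<nu> p 1) / sqrt (p 1)) * snd y + d)"
        using V1 p_bounds by (intro AE_binormal_affine[OF \<rho>_less]) (auto intro!: e_AE_cont simp: c)
      then have "AE y in binormal \<rho>. isCont (\<lambda>x. e 0 (ereal x)) (S' y)"
        by (simp add: S'_def)
      then show ?thesis
      proof eventually_elim
        case (elim y)
        have "isCont (\<lambda>x. clip l_inf (e 0 (ereal x))) (S' y)"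
          by (rule isCont_o2[OF elim clip_isCont])
        \<comment> \<open>\<kappa> is continuous only on \<open>J\<close>; composing it with the
          projection onto \<open>J\<close> gives a function continuous on the whole line with the
          same values here.\<close>
        moreover have "\<kappa> (clip l_inf (e 0 (ereal x))) = \<kappa> (max l_inf (min (1 - l_inf) (clip l_inf (e 0 (ereal x)))))" for x
          using clip_in_J[of "e 0 (ereal x)"] by (simp add: max_absorb2 min_absorb2)
        moreover have "isCont (\<lambda>x. \<kappa> (max l_inf (min (1 - l_inf) x))) x" for x
        proof -
          have "continuous_on UNIV (\<lambda>x. \<kappa> (max l_inf (min (1 - l_inf) x)))"
            using l by (intro continuous_on_compose2[OF \<kappa>] continuous_intros) auto
          then show ?thesis
            by (simp add: continuous_on_eq_continuous_at)
        qed
        ultimately show ?case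
          using isCont_o2[of "S' y" "\<lambda>x. clip l_inf (e 0 (ereal x))" "\<lambda>x. \<kappa> (max l_inf (min (1 - l_inf) x))"] by simp
      qed
    qed
    show "\<bar>\<kappa> (clip l_inf (e 0 (ereal x)))\<bar> \<le> B" for x
      using B clip_in_J by blast
  qed (use measurable_\<kappa>_clip[OF \<kappa>] E.prob_space_axioms B.prob_space_axioms measurable_S in auto)
  then show ?thesis
    unfolding H .
qed

text \<open>The shift tends to -\<infinity> while the random part of the pilot statistic is bounded
  in mean, so the statistic drops below any level with probability tending to 1. The function of the
  propensity is then replaced by the constant \<open>f\<^sub>0\<close>, which factors out of the
  transform.\<close>

lemma joint_limit_infinite:
  fixes \<kappa> :: "real \<Rightarrow> real"
  assumes \<kappa>: "continuous_on J \<kappa>" and c: "c = -\<infinity>"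
  shows "(\<lambda>k. CLINT \<omega>|P k. iexp (a * G k 1 0 \<omega> + b * G k 1 1 \<omega>) * of_real (\<kappa> (clip l_inf (e 0 (ereal (S k \<omega>))))))
    \<longlonglongrightarrow> (CLINT y|binormal \<rho>. iexp (a * A 0 y + b * A 1 y) * of_real (\<kappa> (H y)))"
proof -
  obtain B where B: "0 < B" "\<And>x. x \<in> J \<Longrightarrow> \<bar>\<kappa> x\<bar> \<le> B"
    using continuous_on_J_bounded[OF \<kappa>] by blast
  define f where "f x = \<kappa> (clip l_inf (e 0 (ereal x)))" for x
  define f\<^sub>0 where "f\<^sub>0 = \<kappa> (clip l_inf (e 0 (-\<infinity>)))"
  have [measurable]: "f \<in> borel_measurable borel"
    unfolding f_def[abs_def] by (rule measurable_\<kappa>_clip[OF \<kappa>])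
  have f_bd: "\<bar>f x\<bar> \<le> B" "\<bar>f\<^sub>0\<bar> \<le> B" for x
    unfolding f_def f\<^sub>0_def using B clip_in_J by auto
  have lim_S: "lim_S q p \<mu> \<nu> c y = -\<infinity>" for y
    using q[of 1] by (simp add: lim_S_def c)
  have H: "\<kappa> (H y) = f\<^sub>0" for y
    unfolding H_eq lim_S f\<^sub>0_def ..
  have f_lim: "(f \<longlongrightarrow> f\<^sub>0) at_bot"
  proof -
    have "((\<lambda>x. clip l_inf (e 0 (ereal x))) \<longlongrightarrow> clip l_inf (e 0 (-\<infinity>))) at_bot"
      by (rule isCont_tendsto_compose[OF clip_isCont e_at_bot[OF c]])
    then show ?thesis
      unfolding f_def f\<^sub>0_def by (rule continuous_on_tendsto_compose[OF \<kappa> _ clip_in_J always_eventually]) (rule allI, rule clip_in_J)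
  qed
  have shift: "filterlim shift at_bot sequentially"
  proof -
    have "(\<lambda>k. ereal (shift k)) \<longlonglongrightarrow> -\<infinity>"
      using shift_tendsto_ereal q[of 1] by (simp add: c)
    then show ?thesis
      by (simp add: tendsto_MInfty filterlim_at_bot_dense)
  qed
  define C where "C = K / sqrt (p 0) + K / sqrt (p 1)"
  have C: "0 \<le> C"
    using p_bounds K_ge_1 by (simp add: C_def)
  define Y where "Y k \<omega> = \<bar>G k 1 0 \<omega>\<bar> / sqrt (p 0) + \<bar>G k 1 1 \<omega>\<bar> / sqrt (p 1)" for k \<omega>
  have Y_int: "integrable (P k) (Y k)" for k
    unfolding Y_def[abs_def] using G_integrable[of 1 0 k] G_integrable[of 1 1 k] by simp
  have Y_le: "(\<integral>\<omega>. Y k \<omega> \<partial>P k) \<le> C" for k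
  proof -
    have "(\<integral>\<omega>. Y k \<omega> \<partial>P k) = (\<integral>\<omega>. \<bar>G k 1 0 \<omega>\<bar> \<partial>P k) / sqrt (p 0) + (\<integral>\<omega>. \<bar>G k 1 1 \<omega>\<bar> \<partial>P k) / sqrt (p 1)"
      unfolding Y_def[abs_def] using G_integrable[of 1 0 k] G_integrable[of 1 1 k] by simp
    also have "\<dots> \<le> C"
      unfolding C_def using G_abs[of 1 0 k] G_abs[of 1 1 k] p_bounds by (intro add_mono divide_right_mono) auto
    finally show ?thesis .
  qed
  have "(\<lambda>k. CLINT \<omega>|P k. iexp (a * G k 1 0 \<omega> + b * G k 1 1 \<omega>) * of_real (f (S k \<omega>)))
    \<longlonglongrightarrow> (CLINT y|binormal \<rho>. iexp (a * A 0 y + b * A 1 y)) * of_real f\<^sub>0"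
  proof (rule tendsto_by_approximation)
    fix \<epsilon> :: real assume \<epsilon>: "0 < \<epsilon>"
    have "\<forall>\<^sub>F x in at_bot. \<bar>f x - f\<^sub>0\<bar> < \<epsilon> / 2"
      using tendstoD[OF f_lim, of "\<epsilon> / 2"] \<epsilon> by (simp add: dist_real_def)
    then obtain x\<^sub>0 where x0: "\<And>x. x \<le> x\<^sub>0 \<Longrightarrow> \<bar>f x - f\<^sub>0\<bar> < \<epsilon> / 2"
      unfolding eventually_at_bot_linorder by auto
    \<comment> \<open>Chosen so that the Markov term \<open>2 * B / T * (C + 1)\<close> is
      \<epsilon> / 2; adding 1 to \<open>C\<close> keeps \<open>T\<close> positive.\<close>
    define T where "T = 4 * B * (C + 1) / \<epsilon>"
    have T: "0 < T"
      using B C \<epsilon> by (simp add: T_def)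
    have "\<forall>\<^sub>F k in sequentially. shift k \<le> x\<^sub>0 - T"
      using shift unfolding filterlim_at_bot by simp
    then have "\<forall>\<^sub>F k in sequentially. cmod ((CLINT \<omega>|P k. iexp (a * G k 1 0 \<omega> + b * G k 1 1 \<omega>) * of_real (f (S k \<omega>)))
        - (CLINT \<omega>|P k. iexp (a * G k 1 0 \<omega> + b * G k 1 1 \<omega>)) * of_real f\<^sub>0) \<le> \<epsilon>"
    proof eventually_elim
      case (elim k)
      have meas: "(\<lambda>\<omega>. iexp (a * G k 1 0 \<omega> + b * G k 1 1 \<omega>)) \<in> borel_measurable (P k)" "(\<lambda>\<omega>. f (S k \<omega>)) \<in> borel_measurable (P k)"
        using measurable_G[of 1 k 0] measurable_G[of 1 k 1] by simp_all
      \<comment> \<open>A pointwise form of Markov's inequality: a statistic above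
        \<open>x\<^sub>0\<close> forces \<open>Y k \<omega>\<close> to be at least \<open>T\<close>,
        and then the crude bound \<open>2 * B\<close> is at most
        \<open>2 * B / T * Y k \<omega>\<close>.\<close>
      have pt: "\<bar>f (S k \<omega>) - f\<^sub>0\<bar> \<le> \<epsilon> / 2 + 2 * B / T * Y k \<omega>" for \<omega>
      proof -
        have Y0: "0 \<le> Y k \<omega>"
          unfolding Y_def using p_bounds by (intro add_nonneg_nonneg divide_nonneg_nonneg) auto
        have "G k 1 0 \<omega> / sqrt (p 0) \<le> \<bar>G k 1 0 \<omega>\<bar> / sqrt (p 0)" "- \<bar>G k 1 1 \<omega>\<bar> / sqrt (p 1) \<le> G k 1 1 \<omega> / sqrt (p 1)"
          by (rule divide_right_mono; use p_bounds in simp)+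
        then have "S k \<omega> \<le> Y k \<omega> + shift k"
          unfolding S_eq Y_def minus_divide_left[symmetric] by linarith
        show ?thesis
        proof (cases "S k \<omega> \<le> x\<^sub>0")
          case True
          then show ?thesis
          proof -
            have "0 \<le> 2 * B / T * Y k \<omega>"
              using B T Y0 by (intro mult_nonneg_nonneg divide_nonneg_nonneg) auto
            with x0[OF True] show ?thesis
              by linarith
          qed
        next
          case False
          then have "T \<le> Y k \<omega>"
            using elim \<open>S k \<omega> \<le> Y k \<omega> + shift k\<close> by linarith
          then have "2 * B * T \<le> 2 * B * Y k \<omega>"
            using B by simp
          then have "2 * B \<le> 2 * B / T * Y k \<omega>"
            using T by (simp add: field_simps)
          moreover have "\<bar>f (S k \<omega>) - f\<^sub>0\<bar> \<le> 2 * B"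
            using f_bd(1)[of "S k \<omega>"] f_bd(2) by linarith
          ultimately show ?thesis
            using \<epsilon> by linarith
        qed
      qed
      have "cmod ((CLINT \<omega>|P k. iexp (a * G k 1 0 \<omega> + b * G k 1 1 \<omega>) * of_real (f (S k \<omega>)))
        - (CLINT \<omega>|P k. iexp (a * G k 1 0 \<omega> + b * G k 1 1 \<omega>)) * of_real f\<^sub>0)
        \<le> (\<integral>\<omega>. \<epsilon> / 2 + 2 * B / T * Y k \<omega> \<partial>P k)"
        unfolding integral_mult_left_zero[symmetric] using Y_int f_bd
        by (intro E.integral_unit_mult_diff_le[OF meas _ _ _ _ _ pt, where B=B]) auto
      also have "\<dots> = \<epsilon> / 2 + 2 * B / T * (\<integral>\<omega>. Y k \<omega> \<partial>P k)"
        using Y_int by (simp add: E.prob_space)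
      also have "\<dots> \<le> \<epsilon> / 2 + 2 * B / T * (C + 1)"
        using Y_le[of k] B T by (intro add_left_mono mult_left_mono) auto
      also have "\<dots> = \<epsilon>"
      proof -
        have "2 * B * (C + 1) = T * (\<epsilon> / 2)"
          using \<epsilon> by (simp add: T_def)
        then have "2 * B / T * (C + 1) = \<epsilon> / 2"
          using T by (metis nonzero_mult_div_cancel_left less_irrefl times_divide_eq_left)
        then show ?thesis
          by simp
      qed
      finally show ?case .
    qed
    moreover have "(\<lambda>k. (CLINT \<omega>|P k. iexp (a * G k 1 0 \<omega> + b * G k 1 1 \<omega>)) * of_real f\<^sub>0) \<longlonglongrightarrow> (CLINT y|binormal \<rho>. iexp (a * A 0 y + b * A 1 y)) * of_real f\<^sub>0"
      by (rule tendsto_mult[OF pilot_clt tendsto_const])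
    ultimately show "\<exists>b' y. b' \<longlonglongrightarrow> y \<and>
        (\<forall>\<^sub>F k in sequentially. cmod ((CLINT \<omega>|P k. iexp (a * G k 1 0 \<omega> + b * G k 1 1 \<omega>) * of_real (f (S k \<omega>))) - b' k) \<le> \<epsilon>) \<and>
        cmod ((CLINT y|binormal \<rho>. iexp (a * A 0 y + b * A 1 y)) * of_real f\<^sub>0 - y) \<le> \<epsilon>"
      by - (intro exI conjI, assumption, assumption, use \<epsilon> in simp)
  qed
  moreover have "(CLINT y|binormal \<rho>. iexp (a * A 0 y + b * A 1 y) * of_real (\<kappa> (H y))) = (CLINT y|binormal \<rho>. iexp (a * A 0 y + b * A 1 y)) * of_real f\<^sub>0"
    unfolding H by (rule integral_mult_left_zero)
  ultimately show ?thesis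
    by (simp only: f_def)
qed

text \<open>Clipping at \<open>l k\<close> instead of \<open>l_inf\<close> moves the propensity by
  at most the difference of the rates, which uniform continuity of \<kappa> on \<open>J\<close>
  makes negligible.\<close>

lemma joint_limit:
  fixes \<kappa> :: "real \<Rightarrow> real"
  assumes \<kappa>: "continuous_on J \<kappa>"
  shows "(\<lambda>k. CLINT \<omega>|P k. iexp (a * G k 1 0 \<omega> + b * G k 1 1 \<omega>) * of_real (\<kappa> (h k \<omega>)))
    \<longlonglongrightarrow> (CLINT y|binormal \<rho>. iexp (a * A 0 y + b * A 1 y) * of_real (\<kappa> (H y)))"
proof (rule tendsto_by_approximation)
  fix \<epsilon> :: real assume \<epsilon>: "0 < \<epsilon>"
  obtain B where B: "0 < B" "\<And>x. x \<in> J \<Longrightarrow> \<bar>\<kappa> x\<bar> \<le> B"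
    using continuous_on_J_bounded[OF \<kappa>] by blast
  obtain \<delta> where \<delta>: "0 < \<delta>" "\<And>x y. x \<in> J \<Longrightarrow> y \<in> J \<Longrightarrow> dist y x < \<delta> \<Longrightarrow> dist (\<kappa> y) (\<kappa> x) < \<epsilon>"
    using compact_uniformly_continuous[OF \<kappa> compact_Icc] \<epsilon> unfolding uniformly_continuous_on_def by metis
  let ?g = "\<lambda>k \<omega>. \<kappa> (clip l_inf (e 0 (ereal (S k \<omega>))))"
  have "\<forall>\<^sub>F k in sequentially. dist (l k) l_inf < \<delta>"
    using l(5) \<delta>(1) by (rule tendstoD)
  then have "\<forall>\<^sub>F k in sequentially. cmod ((CLINT \<omega>|P k. iexp (a * G k 1 0 \<omega> + b * G k 1 1 \<omega>) * of_real (\<kappa> (h k \<omega>)))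
      - (CLINT \<omega>|P k. iexp (a * G k 1 0 \<omega> + b * G k 1 1 \<omega>) * of_real (?g k \<omega>))) \<le> \<epsilon>"
  proof eventually_elim
    case (elim k)
    have meas: "(\<lambda>\<omega>. iexp (a * G k 1 0 \<omega> + b * G k 1 1 \<omega>)) \<in> borel_measurable (P k)"
      using measurable_G[of 1 k 0] measurable_G[of 1 k 1] by simp
    have meas_h: "(\<lambda>\<omega>. \<kappa> (h k \<omega>)) \<in> borel_measurable (P k)"
      by (rule borel_measurable_continuous_on_compose[OF \<kappa> E.measurable_pscore h_bounds(3)])
    have meas_g: "?g k \<in> borel_measurable (P k)"
      by (rule measurable_compose[OF measurable_S measurable_\<kappa>_clip[OF \<kappa>]])
    have pt: "\<bar>\<kappa> (h k \<omega>) - ?g k \<omega>\<bar> \<le> \<epsilon>" for \<omega>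
    proof -
      have "dist (h k \<omega>) (clip l_inf (e 0 (ereal (S k \<omega>)))) < \<delta>"
        using clip_diff_le[of "l k" "e 0 (ereal (S k \<omega>))" l_inf] elim unfolding h_eq dist_real_def by linarith
      then show ?thesis
        using \<delta>(2)[OF clip_in_J h_bounds(3)] by (simp add: dist_real_def less_imp_le)
    qed
    have "cmod ((CLINT \<omega>|P k. iexp (a * G k 1 0 \<omega> + b * G k 1 1 \<omega>) * of_real (\<kappa> (h k \<omega>)))
      - (CLINT \<omega>|P k. iexp (a * G k 1 0 \<omega> + b * G k 1 1 \<omega>) * of_real (?g k \<omega>))) \<le> (\<integral>\<omega>. \<epsilon> \<partial>P k)"
      by (rule E.integral_unit_mult_diff_le[OF meas meas_h meas_g _ B(2)[OF h_bounds(3)] B(2)[OF clip_in_J] _ pt]) auto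
    then show ?case
      by (simp add: E.prob_space)
  qed
  moreover have "(\<lambda>k. CLINT \<omega>|P k. iexp (a * G k 1 0 \<omega> + b * G k 1 1 \<omega>) * of_real (?g k \<omega>))
      \<longlonglongrightarrow> (CLINT y|binormal \<rho>. iexp (a * A 0 y + b * A 1 y) * of_real (\<kappa> (H y)))"
    using effect_tendsto(2) joint_limit_finite[OF \<kappa>] joint_limit_infinite[OF \<kappa>] by (cases c) auto
  ultimately show "\<exists>b' y. b' \<longlonglongrightarrow> y \<and>
      (\<forall>\<^sub>F k in sequentially. cmod ((CLINT \<omega>|P k. iexp (a * G k 1 0 \<omega> + b * G k 1 1 \<omega>) * of_real (\<kappa> (h k \<omega>))) - b' k) \<le> \<epsilon>) \<and>
      cmod ((CLINT y|binormal \<rho>. iexp (a * A 0 y + b * A 1 y) * of_real (\<kappa> (H y))) - y) \<le> \<epsilon>"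
    using \<epsilon> by (intro exI conjI) auto
qed

end

subsection \<open>Convergence of the statistics\<close>

lemma abs_inverse_sqrt_diff_le:
  fixes x y \<epsilon> s :: real
  assumes "0 < s" "s\<^sup>2 \<le> x" "s\<^sup>2 \<le> y" "\<bar>x - y\<bar> \<le> \<epsilon>"
  shows "\<bar>1 / sqrt x - 1 / sqrt y\<bar> \<le> \<epsilon> / (2 * s ^ 3)"
proof -
  define a b where "a = sqrt x" and "b = sqrt y"
  have ab: "s \<le> a" "s \<le> b"
    unfolding a_def b_def using assms by (auto intro!: real_le_rsqrt)
  have sq: "x = a\<^sup>2" "y = b\<^sup>2"
  proof -
    have "0 \<le> x" "0 \<le> y"
      using assms(2,3) zero_le_power2[of s] by linarith+
    then show "x = a\<^sup>2" "y = b\<^sup>2"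
      unfolding a_def b_def by simp_all
  qed
  have pos: "0 < a" "0 < b"
    using ab assms(1) by auto
  have "1 / a - 1 / b = (y - x) / (a * b * (a + b))"
  proof -
    have "b\<^sup>2 - a\<^sup>2 = (b - a) * (a + b)"
      by (simp add: power2_eq_square algebra_simps)
    then have "(y - x) / (a * b * (a + b)) = (b - a) / (a * b)"
      unfolding sq using pos by simp
    also have "\<dots> = 1 / a - 1 / b"
      using pos by (simp add: diff_divide_distrib)
    finally show ?thesis ..
  qed
  then have "\<bar>1 / a - 1 / b\<bar> = \<bar>x - y\<bar> / (a * b * (a + b))"
    using pos by (simp add: abs_mult abs_minus_commute)
  also have "\<dots> \<le> \<epsilon> / (s * s * (s + s))"
    using assms ab pos by (intro frac_le mult_mono add_mono) auto
  also have "s * s * (s + s) = 2 * s ^ 3"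
    by (simp add: power3_eq_cube)
  finally show ?thesis
    by (simp add: a_def b_def)
qed

text \<open>If \<open>x\<close> is within \<epsilon> of \<open>y\<close> then it is bounded below as
  well, and the inverse root is Lipschitz there. Otherwise the trivial bound 2 is at most
  \<open>2 / \<epsilon> * \<bar>x - y\<bar>\<close>. The result is linear in the absolute values, so
  closeness in mean of the variance estimate suffices.\<close>

lemma norm_iexp_studentized_diff_le:
  fixes u x y \<epsilon> s :: real
  assumes s: "0 < s" "2 * s\<^sup>2 \<le> y" and \<epsilon>: "0 < \<epsilon>" "\<epsilon> \<le> s\<^sup>2"
  shows "cmod (iexp (u / sqrt x) - iexp (u / sqrt y)) \<le> \<epsilon> / (2 * s ^ 3) * \<bar>u\<bar> + 2 / \<epsilon> * \<bar>x - y\<bar>"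
proof (cases "\<bar>x - y\<bar> \<le> \<epsilon>")
  case True
  have "s\<^sup>2 \<le> x" "s\<^sup>2 \<le> y"
    using True s \<epsilon> zero_le_power2[of s] by linarith+
  have "cmod (iexp (u / sqrt x) - iexp (u / sqrt y)) \<le> \<bar>u / sqrt x - u / sqrt y\<bar>"
    by (rule norm_iexp_diff_le)
  also have "\<dots> = \<bar>u\<bar> * \<bar>1 / sqrt x - 1 / sqrt y\<bar>"
    unfolding abs_mult[symmetric] by (simp add: right_diff_distrib)
  also have "\<dots> \<le> \<bar>u\<bar> * (\<epsilon> / (2 * s ^ 3))"
    by (intro mult_left_mono abs_inverse_sqrt_diff_le[OF s(1) \<open>s\<^sup>2 \<le> x\<close> \<open>s\<^sup>2 \<le> y\<close> True]) simp
  also have "\<dots> \<le> \<epsilon> / (2 * s ^ 3) * \<bar>u\<bar> + 2 / \<epsilon> * \<bar>x - y\<bar>"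
    using \<epsilon> by (simp add: mult.commute)
  finally show ?thesis .
next
  case False
  have "cmod (iexp (u / sqrt x) - iexp (u / sqrt y)) \<le> 1 + 1"
    by (rule order_trans[OF norm_triangle_ineq4]) simp
  also have "\<dots> \<le> 2 / \<epsilon> * \<bar>x - y\<bar>"
    using False \<epsilon> by (simp add: field_simps)
  also have "\<dots> \<le> \<epsilon> / (2 * s ^ 3) * \<bar>u\<bar> + 2 / \<epsilon> * \<bar>x - y\<bar>"
    using \<epsilon> s by simp
  finally show ?thesis .
qed

section \<open>Measurability of the statistics\<close>

context regular_experiment
begin

lemma measurable_prop_score: "t \<in> {1, 2} \<Longrightarrow> prop_score X t s \<in> borel_measurable M"
  unfolding prop_score_def by (rule cprob_measurable)

lemma measurable_ipw_unit:
  assumes "t \<in> {1, 2}" "u \<in> {1..stage_size X t}"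
  shows "ipw_unit X t u s \<in> borel_measurable M"
proof -
  note [measurable] = measurable_prop_score[OF assms(1), of s]
  have u: "(\<lambda>\<omega>. (treatment X t u \<omega>, observed X t u \<omega>)) \<in> M \<rightarrow>\<^sub>M obs_space"
    by (rule measurable_unit[OF assms])
  have "(\<lambda>\<omega>. fst (treatment X t u \<omega>, observed X t u \<omega>)) \<in> M \<rightarrow>\<^sub>M count_space UNIV"
    "(\<lambda>\<omega>. snd (treatment X t u \<omega>, observed X t u \<omega>)) \<in> M \<rightarrow>\<^sub>M borel"
    by (rule measurable_compose[OF u measurable_obs_fst], rule measurable_compose[OF u measurable_obs_snd])
  then have [measurable]: "treatment X t u \<in> M \<rightarrow>\<^sub>M count_space UNIV" "observed X t u \<in> borel_measurable M"
    by simp_all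
  show ?thesis
    unfolding ipw_unit_def by measurable
qed

lemma measurable_weight: "t \<in> {1, 2} \<Longrightarrow> weight r X t s \<in> borel_measurable M"
proof -
  have [measurable]: "prop_score X 1 s \<in> borel_measurable M" "prop_score X 2 s \<in> borel_measurable M"
    by (rule measurable_prop_score; simp)+
  have "raw_weight r X 1 s \<in> borel_measurable M" "raw_weight r X 2 s \<in> borel_measurable M"
    unfolding raw_weight_def[abs_def] by measurable
  then have [measurable]: "raw_weight r X t s \<in> borel_measurable M" if "t \<in> {1, 2}" for t
    using that by auto
  show "t \<in> {1, 2} \<Longrightarrow> weight r X t s \<in> borel_measurable M"
    unfolding weight_def[abs_def] by measurable
qed

lemma measurable_WIPW: "WIPW r X s \<in> borel_measurable M"
proof -
  have "ipw X t s \<in> borel_measurable M" if "t \<in> {1, 2}" for t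
    unfolding ipw_def[abs_def] using measurable_ipw_unit[OF that] by (intro borel_measurable_divide borel_measurable_sum) auto
  then show ?thesis
    unfolding WIPW_def[abs_def] using measurable_weight by (intro borel_measurable_sum borel_measurable_times) auto
qed

lemma measurable_V_hat: "V_hat r X s \<in> borel_measurable M"
  unfolding V_hat_def[abs_def]
proof (rule borel_measurable_sum)
  fix t :: nat assume t: "t \<in> {1, 2}"
  note [measurable] = measurable_weight[OF t, of r s] measurable_WIPW[of r s]
  have [measurable]: "(\<lambda>\<omega>. \<Sum>u\<in>{1..stage_size X t}. (ipw_unit X t u s \<omega> - WIPW r X s \<omega>)\<^sup>2) \<in> borel_measurable M"
  proof (rule borel_measurable_sum)
    fix u assume "u \<in> {1..stage_size X t}"
    note [measurable] = measurable_ipw_unit[OF t this, of s]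
    show "(\<lambda>\<omega>. (ipw_unit X t u s \<omega> - WIPW r X s \<omega>)\<^sup>2) \<in> borel_measurable M"
      by measurable
  qed
  show "(\<lambda>\<omega>. (weight r X t s \<omega>)\<^sup>2 / (real (stage_size X t))\<^sup>2 * (\<Sum>u\<in>{1..stage_size X t}. (ipw_unit X t u s \<omega> - WIPW r X s \<omega>)\<^sup>2)) \<in> borel_measurable M"
    by measurable
qed

end

section \<open>Characteristic functions of both stages together\<close>

context experiment_sequence
begin

interpretation E: regular_experiment "X k" "Q k" p e "l k" K for k
  by (rule reg)

abbreviation "LH \<equiv> \<lambda>y. lim_H q p e \<mu> \<nu> c l_inf y 2"
abbreviation "A\<^sub>2 \<equiv> \<lambda>s y z. sqrt (lim_V \<mu> \<nu> (LH y) s) * arm s z"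

lemma measurable_fst_borel_H: "(\<lambda>z. H (fst z)) \<in> borel_measurable (borel :: ((real \<times> real) \<times> (real \<times> real)) measure)"
  using measurable_compose[OF borel_measurable_fst_borel measurable_H] .

lemma measurable_\<beta>_H:
  assumes "continuous_on J \<beta>"
  shows "(\<lambda>z. \<beta> (H (fst z)) :: real) \<in> borel_measurable (borel :: ((real \<times> real) \<times> (real \<times> real)) measure)"
  by (rule borel_measurable_continuous_on_compose[OF assms measurable_fst_borel_H H_in_J])

lemma measurable_A2: "s \<in> {0, 1} \<Longrightarrow> (\<lambda>z. A\<^sub>2 s (fst z) (snd z)) \<in> borel_measurable (borel :: ((real \<times> real) \<times> (real \<times> real)) measure)"
proof -
  note [measurable] = measurable_fst_borel_H
  have "(\<lambda>z. A\<^sub>2 0 (fst z) (snd z)) \<in> borel_measurable (borel :: ((real \<times> real) \<times> (real \<times> real)) measure)"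
    "(\<lambda>z. A\<^sub>2 1 (fst z) (snd z)) \<in> borel_measurable (borel :: ((real \<times> real) \<times> (real \<times> real)) measure)"
    unfolding lim_V_def lim_H_1 by measurable
  then show "s \<in> {0, 1} \<Longrightarrow> (\<lambda>z. A\<^sub>2 s (fst z) (snd z)) \<in> borel_measurable (borel :: ((real \<times> real) \<times> (real \<times> real)) measure)"
    by auto
qed

text \<open>What the follow-up stage leaves behind once it is integrated out: a normal transform, as
  a function of the propensity.\<close>

definition psi :: "(nat \<Rightarrow> nat \<Rightarrow> real \<Rightarrow> real) \<Rightarrow> real \<Rightarrow> real" where
  "psi \<beta> x = exp (- score_var \<mu> \<nu> x (\<beta> 2 0 x) (\<beta> 2 1 x) / 2)"

lemma psi_continuous:
  assumes "continuous_on J (\<beta> 2 0)" "continuous_on J (\<beta> 2 1)"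
  shows "continuous_on J (psi \<beta>)"
  unfolding psi_def score_var_def lim_V_def aprob_def if_True if_False using assms
  by (auto intro!: continuous_intros)

lemma psi_le: "x \<in> J \<Longrightarrow> \<bar>psi \<beta> x\<bar> \<le> 1"
proof -
  assume "x \<in> J"
  then have "0 \<le> score_var \<mu> \<nu> x (\<beta> 2 0 x) (\<beta> 2 1 x)"
    using J_unit[of x] lim_var_pos[of 0] lim_var_pos[of 1] by (intro score_var_nonneg) auto
  then show ?thesis
    by (simp add: psi_def)
qed

text \<open>Given the first normal vector, coefficients and propensity are constants, so the inner
  integral is the transform of a single binormal law.\<close>

lemma char_limit_law:
  fixes \<beta> :: "nat \<Rightarrow> nat \<Rightarrow> real \<Rightarrow> real"
  assumes \<beta>: "\<And>t s. t \<in> {1, 2} \<Longrightarrow> s \<in> {0, 1} \<Longrightarrow> continuous_on J (\<beta> t s)"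
  shows "(CLINT z|limit_law q p e \<mu> \<nu> c l_inf. iexp ((\<beta> 1 0 (H (fst z)) * A 0 (fst z) + \<beta> 1 1 (H (fst z)) * A 1 (fst z))
      + (\<beta> 2 0 (H (fst z)) * A\<^sub>2 0 (fst z) (snd z) + \<beta> 2 1 (H (fst z)) * A\<^sub>2 1 (fst z) (snd z))))
    = (CLINT y|binormal \<rho>. iexp (\<beta> 1 0 (H y) * A 0 y + \<beta> 1 1 (H y) * A 1 y) * of_real (psi \<beta> (H y)))"
proof -
  let ?F = "\<lambda>z. iexp ((\<beta> 1 0 (H (fst z)) * A 0 (fst z) + \<beta> 1 1 (H (fst z)) * A 1 (fst z))
      + (\<beta> 2 0 (H (fst z)) * A\<^sub>2 0 (fst z) (snd z) + \<beta> 2 1 (H (fst z)) * A\<^sub>2 1 (fst z) (snd z)))"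
  have "(\<lambda>z. (\<beta> 1 0 (H (fst z)) * A 0 (fst z) + \<beta> 1 1 (H (fst z)) * A 1 (fst z))
      + (\<beta> 2 0 (H (fst z)) * A\<^sub>2 0 (fst z) (snd z) + \<beta> 2 1 (H (fst z)) * A\<^sub>2 1 (fst z) (snd z)))
    \<in> borel_measurable (borel :: ((real \<times> real) \<times> (real \<times> real)) measure)"
  proof -
    have A: "(\<lambda>z. A s (fst z)) \<in> borel_measurable (borel :: ((real \<times> real) \<times> (real \<times> real)) measure)" for s
      by measurable
    have b: "(\<lambda>z. \<beta> t s (H (fst z))) \<in> borel_measurable (borel :: ((real \<times> real) \<times> (real \<times> real)) measure)"
      if "t \<in> {1, 2}" "s \<in> {0, 1}" for t s
      by (rule measurable_\<beta>_H[OF \<beta>[OF that]])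
    show ?thesis
      by (intro borel_measurable_add borel_measurable_times A b measurable_A2) auto
  qed
  then have F: "?F \<in> borel_measurable borel"
    by measurable
  have bd: "cmod (?F z) \<le> 1" for z
    by simp
  have inner: "(CLINT z|binormal (lim_corr \<mu> \<nu> (LH y)). ?F (y, z)) = iexp (\<beta> 1 0 (H y) * A 0 y + \<beta> 1 1 (H y) * A 1 y) * of_real (psi \<beta> (H y))" for y
  proof -
    have sv: "score_var \<mu> \<nu> (H y) a b = (a * sqrt (lim_V \<mu> \<nu> (LH y) 0))\<^sup>2
      + 2 * lim_corr \<mu> \<nu> (LH y) * (a * sqrt (lim_V \<mu> \<nu> (LH y) 0)) * (b * sqrt (lim_V \<mu> \<nu> (LH y) 1)) + (b * sqrt (lim_V \<mu> \<nu> (LH y) 1))\<^sup>2" for a b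
      using H_unit[of y] lim_var_pos[of 0] lim_var_pos[of 1] lim_H_1[of y] by (intro score_var_eq_lim_corr) auto
    have "(CLINT z|binormal (lim_corr \<mu> \<nu> (LH y)). ?F (y, z)) = (CLINT z|binormal (lim_corr \<mu> \<nu> (LH y)).
        iexp (\<beta> 1 0 (H y) * A 0 y + \<beta> 1 1 (H y) * A 1 y) * iexp ((\<beta> 2 0 (H y) * sqrt (lim_V \<mu> \<nu> (LH y) 0)) * fst z + (\<beta> 2 1 (H y) * sqrt (lim_V \<mu> \<nu> (LH y) 1)) * snd z))"
      by (rule Bochner_Integration.integral_cong[OF refl]) (simp add: algebra_simps flip: exp_add)
    also have "\<dots> = iexp (\<beta> 1 0 (H y) * A 0 y + \<beta> 1 1 (H y) * A 1 y) * of_real (psi \<beta> (H y))"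
      unfolding integral_mult_right_zero char_binormal[OF \<rho>2_less] psi_def sv ..
    finally show ?thesis .
  qed
  show ?thesis
    unfolding integral_limit_law[OF F bd] inner ..
qed

text \<open>The follow-up sums go first: uniformly in the propensity their transform may be replaced
  by \<open>psi \<beta>\<close>. What remains involves the pilot data only, as pilot sums with
  random coefficients times a continuous function of the propensity.\<close>

lemma char_tendsto_binormal:
  fixes \<beta> :: "nat \<Rightarrow> nat \<Rightarrow> real \<Rightarrow> real"
  assumes \<beta>: "\<And>t s. t \<in> {1, 2} \<Longrightarrow> s \<in> {0, 1} \<Longrightarrow> continuous_on J (\<beta> t s)"
  shows "(\<lambda>k. CLINT \<omega>|P k. iexp ((\<beta> 1 0 (h k \<omega>) * G k 1 0 \<omega> + \<beta> 1 1 (h k \<omega>) * G k 1 1 \<omega>)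
      + (\<beta> 2 0 (h k \<omega>) * G k 2 0 \<omega> + \<beta> 2 1 (h k \<omega>) * G k 2 1 \<omega>)))
    \<longlonglongrightarrow> (CLINT y|binormal \<rho>. iexp (\<beta> 1 0 (H y) * A 0 y + \<beta> 1 1 (H y) * A 1 y) * of_real (psi \<beta> (H y)))"
proof (rule tendsto_by_approximation)
  fix \<epsilon> :: real assume \<epsilon>: "0 < \<epsilon>"
  have \<beta>': "continuous_on J (\<beta> 1 0)" "continuous_on J (\<beta> 1 1)" "continuous_on J (\<beta> 2 0)" "continuous_on J (\<beta> 2 1)"
    by (rule \<beta>; simp)+
  note psi = psi_continuous[of \<beta>, OF \<beta>'(3,4)]
  obtain B\<^sub>0 where B0: "\<And>x. x \<in> J \<Longrightarrow> \<bar>\<beta> 2 0 x\<bar> \<le> B\<^sub>0"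
    using continuous_on_J_bounded[OF \<beta>'(3)] by blast
  obtain B\<^sub>1 where B1: "\<And>x. x \<in> J \<Longrightarrow> \<bar>\<beta> 2 1 x\<bar> \<le> B\<^sub>1"
    using continuous_on_J_bounded[OF \<beta>'(4)] by blast
  have "\<forall>\<^sub>F k in sequentially. \<forall>h a b. l k \<le> h \<longrightarrow> h \<le> 1 - l k \<longrightarrow> \<bar>a\<bar> \<le> max B\<^sub>0 B\<^sub>1 \<longrightarrow> \<bar>b\<bar> \<le> max B\<^sub>0 B\<^sub>1 \<longrightarrow>
    cmod ((CLINT d|data_law (n k 2) (Q k) h. iexp (a * score_sum (n k 2) h (m k) 0 d + b * score_sum (n k 2) h (m k) 1 d))
      - of_real (exp (- score_var \<mu> \<nu> h a b / 2))) \<le> \<epsilon>"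
    by (rule clt_uniform[OF n_rate l(1) n_pos \<epsilon>]) simp_all
  then have "\<forall>\<^sub>F k in sequentially. cmod ((CLINT \<omega>|P k. iexp ((\<beta> 1 0 (h k \<omega>) * G k 1 0 \<omega> + \<beta> 1 1 (h k \<omega>) * G k 1 1 \<omega>)
      + (\<beta> 2 0 (h k \<omega>) * G k 2 0 \<omega> + \<beta> 2 1 (h k \<omega>) * G k 2 1 \<omega>)))
    - (CLINT \<omega>|P k. iexp (\<beta> 1 0 (h k \<omega>) * G k 1 0 \<omega> + \<beta> 1 1 (h k \<omega>) * G k 1 1 \<omega>) * of_real (psi \<beta> (h k \<omega>)))) \<le> \<epsilon>"
  proof eventually_elim
    case (elim k)
    have \<pi>J: "E.\<pi> k d \<in> J" for d
      using E.\<pi>_bounds[of k d] l(2)[of k] by simp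
    have meas: "(\<lambda>d. \<kappa> (E.\<pi> k d)) \<in> borel_measurable (\<Pi>\<^sub>M u\<in>{1..n k 1}. obs_space)"
      if "continuous_on J \<kappa>" for \<kappa> :: "real \<Rightarrow> real"
      by (rule borel_measurable_continuous_on_compose[OF that E.measurable_\<pi> \<pi>J])
    \<comment> \<open>The coefficients of the pilot sums are themselves functions of the pilot data,
      so the entire first-stage factor is one function of \<open>d\<close>, of modulus 1.\<close>
    let ?f = "\<lambda>d. iexp (\<beta> 1 0 (E.\<pi> k d) * score_sum (n k 1) (p 0) (m k) 0 d + \<beta> 1 1 (E.\<pi> k d) * score_sum (n k 1) (p 0) (m k) 1 d)"
    have f: "?f \<in> borel_measurable (\<Pi>\<^sub>M u\<in>{1..n k 1}. obs_space)"
    proof -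
      note [measurable] = meas[OF \<beta>'(1)] meas[OF \<beta>'(2)]
      show ?thesis
        by measurable
    qed
    have close: "cmod ((CLINT y|data_law (n k 2) (Q k) x. iexp (\<beta> 2 0 x * score_sum (n k 2) x (m k) 0 y + \<beta> 2 1 x * score_sum (n k 2) x (m k) 1 y))
        - of_real (psi \<beta> x)) \<le> \<epsilon>" if x: "l k \<le> x" "x \<le> 1 - l k" for x
    proof -
      have "x \<in> J"
        using x l(2)[of k] by simp
      then show ?thesis
        unfolding psi_def using elim x B0[of x] B1[of x] by (simp add: le_max_iff_disj)
    qed
    have "cmod ((CLINT \<omega>|P k. ?f (data (X k) 1 \<omega>) * iexp (\<beta> 2 0 (h k \<omega>) * G k 2 0 \<omega> + \<beta> 2 1 (h k \<omega>) * G k 2 1 \<omega>))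
      - (CLINT \<omega>|P k. ?f (data (X k) 1 \<omega>) * of_real (psi \<beta> (h k \<omega>)))) \<le> \<epsilon>"
      by (rule E.replace_followup[OF l(1) f _ meas[OF \<beta>'(3)] meas[OF \<beta>'(4)] meas[OF psi] psi_le[OF \<pi>J] close]) simp_all
    moreover have f_eq: "?f (data (X k) 1 \<omega>) = iexp (\<beta> 1 0 (h k \<omega>) * G k 1 0 \<omega> + \<beta> 1 1 (h k \<omega>) * G k 1 1 \<omega>)" for \<omega>
      by (simp add: E.G_def E.pscore_def)
    moreover have "iexp (x + y) = iexp x * iexp y" for x y :: real
      by (simp add: distrib_left exp_add)
    ultimately show ?case
      by (simp only:)
  qed
  moreover have "(\<lambda>k. CLINT \<omega>|P k. iexp (\<beta> 1 0 (h k \<omega>) * G k 1 0 \<omega> + \<beta> 1 1 (h k \<omega>) * G k 1 1 \<omega>) * of_real (psi \<beta> (h k \<omega>)))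
    \<longlonglongrightarrow> (CLINT y|binormal \<rho>. iexp (\<beta> 1 0 (H y) * A 0 y + \<beta> 1 1 (H y) * A 1 y) * of_real (psi \<beta> (H y)))"
  proof (rule random_coefficients_tendsto[where G\<^sub>0="\<lambda>k. G k 1 0" and G\<^sub>1="\<lambda>k. G k 1 1" and h=h and J=J and C=K
        and B\<^sub>0="\<beta> 1 0" and B\<^sub>1="\<beta> 1 1" and \<psi>="psi \<beta>" and A\<^sub>0="A 0" and A\<^sub>1="A 1" and H=H])
    show "integrable (binormal \<rho>) (A 0)" "integrable (binormal \<rho>) (A 1)"
      using integrable_binormal[OF \<rho>_less] by simp_all
    show "H \<in> borel_measurable (binormal \<rho>)"
      using measurable_H by simp
    show "(\<lambda>k. CLINT \<omega>|P k. iexp (a * G k 1 0 \<omega> + b * G k 1 1 \<omega>) * of_real (\<kappa> (h k \<omega>)))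
      \<longlonglongrightarrow> (CLINT y|binormal \<rho>. iexp (a * A 0 y + b * A 1 y) * of_real (\<kappa> (H y)))"
      if "continuous_on J \<kappa>" for a b and \<kappa> :: "real \<Rightarrow> real"
      by (rule joint_limit[OF that])
    show "h k \<in> borel_measurable (P k)" for k
      by (rule E.measurable_pscore)
    show "prob_space (P k)" for k
      by (rule E.prob_space_axioms)
    show "h k \<omega> \<in> J" for k \<omega>
      by (rule h_bounds)
    show "H y \<in> J" for y
      by (rule H_in_J)
    show "prob_space (binormal \<rho>)"
      by (rule prob_space_binormal[OF \<rho>_less])
  qed (use \<beta>' psi G_integrable G_abs in auto)
  ultimately show "\<exists>b' y. b' \<longlonglongrightarrow> y \<and>
      (\<forall>\<^sub>F k in sequentially. cmod ((CLINT \<omega>|P k. iexp ((\<beta> 1 0 (h k \<omega>) * G k 1 0 \<omega> + \<beta> 1 1 (h k \<omega>) * G k 1 1 \<omega>)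
        + (\<beta> 2 0 (h k \<omega>) * G k 2 0 \<omega> + \<beta> 2 1 (h k \<omega>) * G k 2 1 \<omega>))) - b' k) \<le> \<epsilon>) \<and>
      cmod ((CLINT y|binormal \<rho>. iexp (\<beta> 1 0 (H y) * A 0 y + \<beta> 1 1 (H y) * A 1 y) * of_real (psi \<beta> (H y))) - y) \<le> \<epsilon>"
    by - (intro exI conjI, assumption, assumption, use \<epsilon> in simp)
qed

theorem char_tendsto:
  fixes \<beta> :: "nat \<Rightarrow> nat \<Rightarrow> real \<Rightarrow> real"
  assumes \<beta>: "\<And>t s. t \<in> {1, 2} \<Longrightarrow> s \<in> {0, 1} \<Longrightarrow> continuous_on J (\<beta> t s)"
  shows "(\<lambda>k. CLINT \<omega>|P k. iexp ((\<beta> 1 0 (h k \<omega>) * G k 1 0 \<omega> + \<beta> 1 1 (h k \<omega>) * G k 1 1 \<omega>)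
      + (\<beta> 2 0 (h k \<omega>) * G k 2 0 \<omega> + \<beta> 2 1 (h k \<omega>) * G k 2 1 \<omega>)))
    \<longlonglongrightarrow> (CLINT z|limit_law q p e \<mu> \<nu> c l_inf. iexp ((\<beta> 1 0 (H (fst z)) * A 0 (fst z) + \<beta> 1 1 (H (fst z)) * A 1 (fst z))
      + (\<beta> 2 0 (H (fst z)) * A\<^sub>2 0 (fst z) (snd z) + \<beta> 2 1 (H (fst z)) * A\<^sub>2 1 (fst z) (snd z))))"
  by (subst char_limit_law, fact \<beta>, rule char_tendsto_binormal, fact \<beta>)

end

lemma abs_le_add_square_divide:
  fixes x a :: real
  assumes "0 < a"
  shows "\<bar>x\<bar> \<le> a + x\<^sup>2 / a"
proof (cases "\<bar>x\<bar> \<le> a")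
  case True
  then show ?thesis
    using assms by (simp add: add_increasing2)
next
  case False
  then have "\<bar>x\<bar> * a \<le> \<bar>x\<bar> * \<bar>x\<bar>"
    by (intro mult_left_mono) auto
  then have "\<bar>x\<bar> \<le> x\<^sup>2 / a"
    using assms by (simp add: pos_le_divide_eq power2_eq_square)
  then show ?thesis
    using assms by simp
qed

text \<open>Integrating \<open>abs_le_add_square_divide\<close> at \<open>a = sqrt C\<close>
  balances its two summands.\<close>

lemma (in prob_space) integral_abs_le_sqrt:
  fixes f :: "'a \<Rightarrow> real"
  assumes "integrable M (\<lambda>x. (f x)\<^sup>2)" "f \<in> borel_measurable M" "(\<integral>x. (f x)\<^sup>2 \<partial>M) \<le> C" "0 < C"
  shows "(\<integral>x. \<bar>f x\<bar> \<partial>M) \<le> 2 * sqrt C"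
proof -
  have "(\<integral>x. \<bar>f x\<bar> \<partial>M) \<le> (\<integral>x. sqrt C + (f x)\<^sup>2 / sqrt C \<partial>M)"
  proof (rule integral_mono)
    show "integrable M (\<lambda>x. \<bar>f x\<bar>)"
      using square_integrable_imp_integrable[OF assms(2,1)] by simp
    show "integrable M (\<lambda>x. sqrt C + (f x)\<^sup>2 / sqrt C)"
      using assms(1) by simp
    show "\<bar>f x\<bar> \<le> sqrt C + (f x)\<^sup>2 / sqrt C" for x
      using assms(4) by (intro abs_le_add_square_divide) simp
  qed
  also have "\<dots> = sqrt C + (\<integral>x. (f x)\<^sup>2 \<partial>M) / sqrt C"
    using assms(1) by (simp add: prob_space)
  also have "\<dots> \<le> sqrt C + C / sqrt C"
    using assms(3,4) by (intro add_left_mono divide_right_mono) auto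
  also have "C / sqrt C = sqrt C"
    using assms(4) by (simp add: real_div_sqrt)
  finally show ?thesis
    by simp
qed

section \<open>Statistics whose coefficients are continuous in the propensity\<close>

context experiment_sequence
begin

lemma lim_H_pilot: "lim_H q p e \<mu> \<nu> c l_inf y 1 s = p s"
  by (simp add: lim_H_def)

lemma lim_H_eq_aprob:
  assumes "t \<in> {1, 2}" "s \<in> {0, 1}"
  shows "lim_H q p e \<mu> \<nu> c l_inf y t s = aprob (if t = 1 then p 0 else H y) s"
  using assms p_bounds(5) lim_H_1[of y] by (auto simp: lim_H_pilot[unfolded One_nat_def])

end

text \<open>The weights enter through the functions \<beta> alone: every coefficient is a continuous
  function of the follow-up propensity on the compact interval \<open>J\<close>. One strictly
  positive coefficient, that of arm 0 in the pilot stage, already makes the limiting variance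
  positive.\<close>

locale weighted_sequence = experiment_sequence X Q q p e l \<mu> \<nu> c l_inf K
  for X :: "nat \<Rightarrow> 'a trial" and Q q p e l \<mu> \<nu> c l_inf K +
  fixes r :: real and \<beta> :: "nat \<Rightarrow> nat \<Rightarrow> real \<Rightarrow> real"
  assumes coef_eq: "\<lbrakk>t \<in> {1, 2}; s \<in> {0, 1}\<rbrakk> \<Longrightarrow> regular_experiment.coef (X k) p e (l k) r t s \<omega> = \<beta> t s (h k \<omega>)"
    and \<beta>_cont: "\<lbrakk>t \<in> {1, 2}; s \<in> {0, 1}\<rbrakk> \<Longrightarrow> continuous_on J (\<beta> t s)"
    and \<beta>_pos: "x \<in> J \<Longrightarrow> 0 < \<beta> 1 0 x"
begin

interpretation E: regular_experiment "X k" "Q k" p e "l k" K for k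
  by (rule reg)

abbreviation "U \<equiv> \<lambda>k s \<omega>. sqrt (N k) * (WIPW r (X k) s \<omega> - m k s)"
abbreviation "R \<equiv> \<lambda>k. regular_experiment.R (X k) (Q k) p e (l k)"

definition "lim_w y t s = \<beta> t s (H y) * sqrt (lim_V \<mu> \<nu> (lim_H q p e \<mu> \<nu> c l_inf y t) s)"

text \<open>The value that the scaled variance estimate approaches at propensity \<open>x\<close>;
  at \<open>H y\<close> it is the squared denominator of the normalised limit.\<close>

definition "lim_sd2 x = (\<Sum>s\<in>{0, 1}. \<Sum>t\<in>{1, 2}. (\<beta> t s x)\<^sup>2 * lim_V \<mu> \<nu> (aprob (if t = 1 then p 0 else x)) s)"

lemma lim_arm_eq: "lim_arm (lim_w (fst z)) s z = \<beta> 1 s (H (fst z)) * A s (fst z) + \<beta> 2 s (H (fst z)) * A\<^sub>2 s (fst z) (snd z)"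
proof -
  have "lim_V \<mu> \<nu> (lim_H q p e \<mu> \<nu> c l_inf y 1) s = lim_V \<mu> \<nu> p s" for y
    by (simp add: lim_V_def lim_H_def)
  then show ?thesis
    by (simp add: lim_arm_def lim_w_def mult_ac)
qed

lemma lim_w_sq_sum: "(\<Sum>s\<in>{0, 1}. \<Sum>t\<in>{1, 2}. (lim_w y t s)\<^sup>2) = lim_sd2 (H y)"
  unfolding lim_sd2_def
proof (intro sum.cong refl)
  fix s t :: nat assume s: "s \<in> {0, 1}" and t: "t \<in> {1, 2}"
  note a = lim_H_eq_aprob[OF t s, of y]
  have "0 \<le> aprob (if t = 1 then p 0 else H y) s" "aprob (if t = 1 then p 0 else H y) s \<le> 1"
    using H_unit[of y] p_bounds by (auto simp: aprob_def)
  then have "0 < lim_V \<mu> \<nu> (lim_H q p e \<mu> \<nu> c l_inf y t) s"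
    using lim_var_pos[OF s] a by (intro lim_V_pos) auto
  moreover have "lim_V \<mu> \<nu> (lim_H q p e \<mu> \<nu> c l_inf y t) s = lim_V \<mu> \<nu> (aprob (if t = 1 then p 0 else H y)) s"
    unfolding lim_V_def a ..
  ultimately show "(lim_w y t s)\<^sup>2 = (\<beta> t s (H y))\<^sup>2 * lim_V \<mu> \<nu> (aprob (if t = 1 then p 0 else H y)) s"
    by (simp add: lim_w_def power_mult_distrib)
qed

lemma lim_sd2_cont: "continuous_on J lim_sd2"
proof -
  have V: "continuous_on J (\<lambda>x. lim_V \<mu> \<nu> (aprob (if t = 1 then p 0 else x)) s)" for t s
    unfolding lim_V_def aprob_def by (cases "t = 1"; cases "s = 0") (auto intro!: continuous_intros)
  then show ?thesis
    unfolding lim_sd2_def by (intro continuous_on_sum continuous_on_mult continuous_on_power \<beta>_cont V)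
qed

lemma lim_sd2_pos: "x \<in> J \<Longrightarrow> 0 < lim_sd2 x"
proof -
  assume x: "x \<in> J"
  have V: "0 < lim_V \<mu> \<nu> (aprob (if t = 1 then p 0 else x)) s" if "s \<in> {0, 1}" for t s
    using lim_var_pos[OF that] p_bounds J_unit[OF x] by (intro lim_V_pos) (auto simp: aprob_def)
  have "0 < (\<beta> 1 0 x)\<^sup>2 * lim_V \<mu> \<nu> (aprob (if (1::nat) = 1 then p 0 else x)) 0"
    using \<beta>_pos[OF x] V[of 0 1] by simp
  also have "\<dots> \<le> (\<Sum>t\<in>{1, 2}. (\<beta> t 0 x)\<^sup>2 * lim_V \<mu> \<nu> (aprob (if t = 1 then p 0 else x)) 0)"
    by (intro member_le_sum[where f="\<lambda>t. (\<beta> t 0 x)\<^sup>2 * lim_V \<mu> \<nu> (aprob (if t = 1 then p 0 else x)) 0"]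
        mult_nonneg_nonneg zero_le_power2 less_imp_le[OF V]) simp_all
  also have "\<dots> \<le> lim_sd2 x"
    unfolding lim_sd2_def
    by (intro member_le_sum[where f="\<lambda>s. \<Sum>t\<in>{1, 2}. (\<beta> t s x)\<^sup>2 * lim_V \<mu> \<nu> (aprob (if t = 1 then p 0 else x)) s"]
        sum_nonneg mult_nonneg_nonneg zero_le_power2 less_imp_le[OF V]) auto
  finally show ?thesis .
qed

text \<open>A positive continuous function on a compact interval has a positive minimum; the form
  \<open>2 * s\<^sup>2\<close> leaves room for an estimation error of
  \<open>s\<^sup>2\<close>.\<close>

lemma lim_sd2_lower:
  obtains s where "0 < s" "\<And>x. x \<in> J \<Longrightarrow> 2 * s\<^sup>2 \<le> lim_sd2 x"
proof -
  obtain x where x: "x \<in> J" "\<And>y. y \<in> J \<Longrightarrow> lim_sd2 x \<le> lim_sd2 y"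
    using continuous_attains_inf[OF compact_Icc _ lim_sd2_cont] H_in_J by blast
  show ?thesis
    using lim_sd2_pos[OF x(1)] x(2) by (intro that[of "sqrt (lim_sd2 x / 2)"]) auto
qed

lemma coef_bound:
  obtains B where "0 < B" "\<And>t s x. t \<in> {1, 2} \<Longrightarrow> s \<in> {0, 1} \<Longrightarrow> x \<in> J \<Longrightarrow> \<bar>\<beta> t s x\<bar> \<le> B"
proof -
  have \<beta>: "continuous_on J (\<beta> 1 0)" "continuous_on J (\<beta> 1 1)" "continuous_on J (\<beta> 2 0)" "continuous_on J (\<beta> 2 1)"
    by (rule \<beta>_cont; simp)+
  obtain b\<^sub>1 where 1: "0 < b\<^sub>1" "\<And>x. x \<in> J \<Longrightarrow> \<bar>\<beta> 1 0 x\<bar> \<le> b\<^sub>1"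
    using continuous_on_J_bounded[OF \<beta>(1)] by blast
  obtain b\<^sub>2 where 2: "0 < b\<^sub>2" "\<And>x. x \<in> J \<Longrightarrow> \<bar>\<beta> 1 1 x\<bar> \<le> b\<^sub>2"
    using continuous_on_J_bounded[OF \<beta>(2)] by blast
  obtain b\<^sub>3 where 3: "0 < b\<^sub>3" "\<And>x. x \<in> J \<Longrightarrow> \<bar>\<beta> 2 0 x\<bar> \<le> b\<^sub>3"
    using continuous_on_J_bounded[OF \<beta>(3)] by blast
  obtain b\<^sub>4 where 4: "0 < b\<^sub>4" "\<And>x. x \<in> J \<Longrightarrow> \<bar>\<beta> 2 1 x\<bar> \<le> b\<^sub>4"
    using continuous_on_J_bounded[OF \<beta>(4)] by blast
  show ?thesis
  proof (rule that)
    show "0 < b\<^sub>1 + b\<^sub>2 + b\<^sub>3 + b\<^sub>4"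
      using 1(1) 2(1) 3(1) 4(1) by simp
    show "\<bar>\<beta> t s x\<bar> \<le> b\<^sub>1 + b\<^sub>2 + b\<^sub>3 + b\<^sub>4" if "t \<in> {1, 2}" "s \<in> {0, 1}" "x \<in> J" for t s x
    proof -
      have "\<bar>\<beta> t s x\<bar> \<le> b\<^sub>1 \<or> \<bar>\<beta> t s x\<bar> \<le> b\<^sub>2 \<or> \<bar>\<beta> t s x\<bar> \<le> b\<^sub>3 \<or> \<bar>\<beta> t s x\<bar> \<le> b\<^sub>4"
        using 1(2)[OF that(3)] 2(2)[OF that(3)] 3(2)[OF that(3)] 4(2)[OF that(3)] that(1,2) by blast
      then show ?thesis
        using 1(1) 2(1) 3(1) 4(1) by argo
    qed
  qed
qed

lemma AE_scores: "AE \<omega> in P k. \<forall>t\<in>{1, 2}. \<forall>s\<in>{0, 1}. prop_score (X k) t s \<omega> = aprob (E.pscore k t \<omega>) s"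
  by (intro AE_finite_allI ballI E.AE_prop_score[OF l(1)]) auto

lemma AE_U: "AE \<omega> in P k. \<forall>s\<in>{0, 1}. U k s \<omega> = \<beta> 1 s (h k \<omega>) * G k 1 s \<omega> + \<beta> 2 s (h k \<omega>) * G k 2 s \<omega>"
  using AE_scores[of k]
proof eventually_elim
  case (elim \<omega>)
  show ?case
  proof
    fix s :: nat assume s: "s \<in> {0, 1}"
    have "U k s \<omega> = E.coef k r 1 s \<omega> * G k 1 s \<omega> + E.coef k r 2 s \<omega> * G k 2 s \<omega>"
      using elim s by (intro E.WIPW_eq[OF l(1) s]) auto
    then show "U k s \<omega> = \<beta> 1 s (h k \<omega>) * G k 1 s \<omega> + \<beta> 2 s (h k \<omega>) * G k 2 s \<omega>"
      unfolding coef_eq[OF insertI1 s] coef_eq[OF insertI2[OF singletonI] s] .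
  qed
qed

lemma measurable_h: "h k \<in> borel_measurable (P k)"
  by (rule E.measurable_pscore)

lemma measurable_\<beta>_h: "continuous_on J \<kappa> \<Longrightarrow> (\<lambda>\<omega>. \<kappa> (h k \<omega>) :: real) \<in> borel_measurable (P k)"
  by (rule borel_measurable_continuous_on_compose[OF _ measurable_h h_bounds(3)])

lemma measurable_U: "U k s \<in> borel_measurable (P k)"
  using E.measurable_WIPW by simp

text \<open>With arbitrary continuous multipliers \<sigma>, one statement serves a single arm, the
  difference of the arms, and the difference divided by a function of the propensity.\<close>

lemma char_U_tendsto:
  fixes \<sigma> :: "nat \<Rightarrow> real \<Rightarrow> real"
  assumes \<sigma>: "\<And>s. s \<in> {0, 1} \<Longrightarrow> continuous_on J (\<sigma> s)"
  shows "(\<lambda>k. CLINT \<omega>|P k. iexp (\<sigma> 0 (h k \<omega>) * U k 0 \<omega> + \<sigma> 1 (h k \<omega>) * U k 1 \<omega>))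
    \<longlonglongrightarrow> (CLINT z|limit_law q p e \<mu> \<nu> c l_inf. iexp (\<sigma> 0 (H (fst z)) * lim_arm (lim_w (fst z)) 0 z + \<sigma> 1 (H (fst z)) * lim_arm (lim_w (fst z)) 1 z))"
proof -
  define \<gamma> where "\<gamma> t s x = \<sigma> s x * \<beta> t s x" for t s x
  have \<gamma>: "continuous_on J (\<gamma> t s)" if "t \<in> {1, 2}" "s \<in> {0, 1}" for t s
    unfolding \<gamma>_def by (intro continuous_on_mult \<sigma> \<beta>_cont that)
  have "(CLINT \<omega>|P k. iexp ((\<gamma> 1 0 (h k \<omega>) * G k 1 0 \<omega> + \<gamma> 1 1 (h k \<omega>) * G k 1 1 \<omega>) + (\<gamma> 2 0 (h k \<omega>) * G k 2 0 \<omega> + \<gamma> 2 1 (h k \<omega>) * G k 2 1 \<omega>)))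
      = (CLINT \<omega>|P k. iexp (\<sigma> 0 (h k \<omega>) * U k 0 \<omega> + \<sigma> 1 (h k \<omega>) * U k 1 \<omega>))" for k
  proof (rule integral_cong_AE)
    have G: "G k 1 0 \<in> borel_measurable (P k)" "G k 1 1 \<in> borel_measurable (P k)" "G k 2 0 \<in> borel_measurable (P k)" "G k 2 1 \<in> borel_measurable (P k)"
      by (rule measurable_G; simp)+
    have g: "(\<lambda>\<omega>. \<gamma> 1 0 (h k \<omega>)) \<in> borel_measurable (P k)" "(\<lambda>\<omega>. \<gamma> 1 1 (h k \<omega>)) \<in> borel_measurable (P k)"
      "(\<lambda>\<omega>. \<gamma> 2 0 (h k \<omega>)) \<in> borel_measurable (P k)" "(\<lambda>\<omega>. \<gamma> 2 1 (h k \<omega>)) \<in> borel_measurable (P k)"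
      by (rule measurable_\<beta>_h[OF \<gamma>]; simp)+
    have s: "(\<lambda>\<omega>. \<sigma> 0 (h k \<omega>)) \<in> borel_measurable (P k)" "(\<lambda>\<omega>. \<sigma> 1 (h k \<omega>)) \<in> borel_measurable (P k)"
      by (rule measurable_\<beta>_h[OF \<sigma>]; simp)+
    note [measurable] = G g s measurable_U[of k]
    show "(\<lambda>\<omega>. iexp ((\<gamma> 1 0 (h k \<omega>) * G k 1 0 \<omega> + \<gamma> 1 1 (h k \<omega>) * G k 1 1 \<omega>) + (\<gamma> 2 0 (h k \<omega>) * G k 2 0 \<omega> + \<gamma> 2 1 (h k \<omega>) * G k 2 1 \<omega>))) \<in> borel_measurable (P k)"
      by measurable
    show "(\<lambda>\<omega>. iexp (\<sigma> 0 (h k \<omega>) * U k 0 \<omega> + \<sigma> 1 (h k \<omega>) * U k 1 \<omega>)) \<in> borel_measurable (P k)"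
      by measurable
    show "AE \<omega> in P k. iexp ((\<gamma> 1 0 (h k \<omega>) * G k 1 0 \<omega> + \<gamma> 1 1 (h k \<omega>) * G k 1 1 \<omega>) + (\<gamma> 2 0 (h k \<omega>) * G k 2 0 \<omega> + \<gamma> 2 1 (h k \<omega>) * G k 2 1 \<omega>))
        = iexp (\<sigma> 0 (h k \<omega>) * U k 0 \<omega> + \<sigma> 1 (h k \<omega>) * U k 1 \<omega>)"
      using AE_U[of k]
    proof eventually_elim
      case (elim \<omega>)
      have u: "U k 0 \<omega> = \<beta> 1 0 (h k \<omega>) * G k 1 0 \<omega> + \<beta> 2 0 (h k \<omega>) * G k 2 0 \<omega>"
        "U k 1 \<omega> = \<beta> 1 1 (h k \<omega>) * G k 1 1 \<omega> + \<beta> 2 1 (h k \<omega>) * G k 2 1 \<omega>"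
        by (rule bspec[OF elim]; simp)+
      show ?case
        unfolding u \<gamma>_def by (rule arg_cong[where f=iexp]) (simp only: algebra_simps)
    qed
  qed
  moreover have "\<gamma> 1 0 (H (fst z)) * A 0 (fst z) + \<gamma> 1 1 (H (fst z)) * A 1 (fst z) + (\<gamma> 2 0 (H (fst z)) * A\<^sub>2 0 (fst z) (snd z) + \<gamma> 2 1 (H (fst z)) * A\<^sub>2 1 (fst z) (snd z))
      = \<sigma> 0 (H (fst z)) * lim_arm (lim_w (fst z)) 0 z + \<sigma> 1 (H (fst z)) * lim_arm (lim_w (fst z)) 1 z" for z
    unfolding lim_arm_eq \<gamma>_def by (simp only: algebra_simps)
  ultimately show ?thesis
    using char_tendsto[of \<gamma>, OF \<gamma>] by (simp only:)
qed

lemma measurable_lim_arm: "s \<in> {0, 1} \<Longrightarrow> (\<lambda>z. lim_arm (lim_w (fst z)) s z) \<in> borel_measurable (limit_law q p e \<mu> \<nu> c l_inf)"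
proof -
  assume s: "s \<in> {0, 1}"
  have A: "(\<lambda>z. A s (fst z)) \<in> borel_measurable (borel :: ((real \<times> real) \<times> (real \<times> real)) measure)"
    by measurable
  show ?thesis
    unfolding lim_arm_eq measurable_cong_sets[OF sets_limit_law refl] using s
    by (intro borel_measurable_add borel_measurable_times A measurable_\<beta>_H measurable_A2 \<beta>_cont) auto
qed

lemma WIPW_converges_weakly:
  assumes s: "s \<in> {0, 1}"
  shows "converges_weakly P (\<lambda>k. U k s) (limit_law q p e \<mu> \<nu> c l_inf) (\<lambda>z. lim_arm (lim_w (fst z)) s z)"
proof (rule converges_weaklyI_char[OF E.prob_space_axioms measurable_U prob_space_limit_law measurable_lim_arm[OF s]])
  fix \<theta> :: real
  show "(\<lambda>k. CLINT \<omega>|P k. iexp (\<theta> * U k s \<omega>)) \<longlonglongrightarrow> (CLINT z|limit_law q p e \<mu> \<nu> c l_inf. iexp (\<theta> * lim_arm (lim_w (fst z)) s z))"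
    using s char_U_tendsto[of "\<lambda>s' _. if s' = s then \<theta> else 0"] by auto
qed

lemma T_stat_eq: "sqrt (N k) * T_stat r (X k) \<omega> - scaled_effect (Q k) (total_size (X k)) = U k 0 \<omega> - U k 1 \<omega>"
  by (simp add: T_stat_def scaled_effect_def algebra_simps)

lemma measurable_lim_unnormalized: "(\<lambda>z. lim_unnormalized (lim_w (fst z)) z) \<in> borel_measurable (limit_law q p e \<mu> \<nu> c l_inf)"
  unfolding lim_unnormalized_def by (intro borel_measurable_diff measurable_lim_arm) auto

lemma T_stat_converges_weakly:
  "converges_weakly P (\<lambda>k \<omega>. sqrt (N k) * T_stat r (X k) \<omega> - scaled_effect (Q k) (total_size (X k)))
     (limit_law q p e \<mu> \<nu> c l_inf) (\<lambda>z. lim_unnormalized (lim_w (fst z)) z)"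
  unfolding T_stat_eq
proof (rule converges_weaklyI_char[OF E.prob_space_axioms borel_measurable_diff[OF measurable_U measurable_U] prob_space_limit_law measurable_lim_unnormalized])
  fix \<theta> :: real
  show "(\<lambda>k. CLINT \<omega>|P k. iexp (\<theta> * (U k 0 \<omega> - U k 1 \<omega>))) \<longlonglongrightarrow> (CLINT z|limit_law q p e \<mu> \<nu> c l_inf. iexp (\<theta> * lim_unnormalized (lim_w (fst z)) z))"
  proof -
    have *: "\<theta> * (x - y) = \<theta> * x + - \<theta> * y" for x y
      by (simp add: right_diff_distrib)
    have "(\<lambda>k. CLINT \<omega>|P k. iexp (\<theta> * U k 0 \<omega> + - \<theta> * U k 1 \<omega>))
        \<longlonglongrightarrow> (CLINT z|limit_law q p e \<mu> \<nu> c l_inf. iexp (\<theta> * lim_arm (lim_w (fst z)) 0 z + - \<theta> * lim_arm (lim_w (fst z)) 1 z))"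
      using char_U_tendsto[of "\<lambda>s _. if s = 0 then \<theta> else - \<theta>"] by simp
    then show ?thesis
      unfolding lim_unnormalized_def * .
  qed
qed

end

section \<open>Studentised statistics\<close>

context weighted_sequence
begin

interpretation E: regular_experiment "X k" "Q k" p e "l k" K for k
  by (rule reg)

text \<open>A dominating error for the variance estimate: sampling fluctuations in the first
  summand, drift of the moments of the array in the second. It acts through its mean, which tends to
  0.\<close>

definition var_err :: "real \<Rightarrow> real \<Rightarrow> nat \<Rightarrow> nat \<Rightarrow> 'a \<Rightarrow> real" where
  "var_err B \<eta> k s \<omega> = B\<^sup>2 * (\<bar>R k 1 s \<omega>\<bar> + \<bar>R k 2 s \<omega>\<bar> + (4 * K + 8 * B\<^sup>2) * (1 + (G k 1 s \<omega>)\<^sup>2 + (G k 2 s \<omega>)\<^sup>2) / sqrt (\<eta> * N k))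
     + 2 * B\<^sup>2 * (\<bar>v k s - \<nu> s\<bar> + \<bar>(m k s)\<^sup>2 - (\<mu> s)\<^sup>2\<bar>)"

lemma V_hat_diff_le:
  assumes s: "s \<in> {0, 1}" and scores: "\<And>t. t \<in> {1, 2} \<Longrightarrow> prop_score (X k) t s \<omega> = aprob (E.pscore k t \<omega>) s"
    and B: "\<And>t x. t \<in> {1, 2} \<Longrightarrow> x \<in> J \<Longrightarrow> \<bar>\<beta> t s x\<bar> \<le> B"
    and \<eta>: "0 < \<eta>" "\<eta> \<le> q 1" "\<eta> \<le> q 2"
  shows "\<bar>N k * V_hat r (X k) s \<omega> - (\<Sum>t\<in>{1, 2}. (\<beta> t s (h k \<omega>))\<^sup>2 * lim_V \<mu> \<nu> (aprob (if t = 1 then p 0 else h k \<omega>)) s)\<bar>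
    \<le> var_err B \<eta> k s \<omega>"
proof -
  define g where "g t = aprob (E.pscore k t \<omega>) s" for t
  define b where "b t = \<beta> t s (h k \<omega>)" for t
  have b: "\<bar>b t\<bar> \<le> B" if "t \<in> {1, 2}" for t
    unfolding b_def by (rule B[OF that h_bounds(3)])
  have coef: "E.coef k r t s \<omega> = b t" if "t \<in> {1, 2}" for t
    unfolding b_def by (rule coef_eq[OF that s])
  have q1: "\<eta> \<le> 1"
    using \<eta>(2) q[of 1] by simp
  have n\<eta>: "\<eta> * N k \<le> n k t" if "t \<in> {1, 2}" for t
    unfolding ratio[OF that] using that \<eta> by (intro mult_right_mono) auto
  have "\<bar>N k * V_hat r (X k) s \<omega> - (\<Sum>t\<in>{1, 2}. (E.coef k r t s \<omega>)\<^sup>2 * (v k s - aprob (E.pscore k t \<omega>) s * (m k s)\<^sup>2))\<bar>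
    \<le> B\<^sup>2 * (\<bar>R k 1 s \<omega>\<bar> + \<bar>R k 2 s \<omega>\<bar> + (4 * K + 8 * B\<^sup>2) * (1 + (G k 1 s \<omega>)\<^sup>2 + (G k 2 s \<omega>)\<^sup>2) / sqrt (\<eta> * N k))"
    using b coef by (intro E.V_hat_bound[OF l(1) s scores _ n\<eta> \<eta>(1) q1]) auto
  moreover have "(\<Sum>t\<in>{1, 2}. (E.coef k r t s \<omega>)\<^sup>2 * (v k s - aprob (E.pscore k t \<omega>) s * (m k s)\<^sup>2))
      = (\<Sum>t\<in>{1, 2}. (b t)\<^sup>2 * (v k s - g t * (m k s)\<^sup>2))"
    using coef by (intro sum.cong) (auto simp: g_def)
  moreover have "(\<Sum>t\<in>{1, 2}. (\<beta> t s (h k \<omega>))\<^sup>2 * lim_V \<mu> \<nu> (aprob (if t = 1 then p 0 else h k \<omega>)) s)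
      = (\<Sum>t\<in>{1, 2}. (b t)\<^sup>2 * (\<nu> s - g t * (\<mu> s)\<^sup>2))"
    by (intro sum.cong) (auto simp: g_def b_def lim_V_def E.pscore_def)
  moreover have "\<bar>(\<Sum>t\<in>{1, 2}. (b t)\<^sup>2 * (v k s - g t * (m k s)\<^sup>2)) - (\<Sum>t\<in>{1, 2}. (b t)\<^sup>2 * (\<nu> s - g t * (\<mu> s)\<^sup>2))\<bar>
      \<le> 2 * B\<^sup>2 * (\<bar>v k s - \<nu> s\<bar> + \<bar>(m k s)\<^sup>2 - (\<mu> s)\<^sup>2\<bar>)"
  proof -
    have "\<bar>(b t)\<^sup>2 * (v k s - g t * (m k s)\<^sup>2) - (b t)\<^sup>2 * (\<nu> s - g t * (\<mu> s)\<^sup>2)\<bar> \<le> B\<^sup>2 * (\<bar>v k s - \<nu> s\<bar> + \<bar>(m k s)\<^sup>2 - (\<mu> s)\<^sup>2\<bar>)"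
      if "t \<in> {1, 2}" for t
    proof -
      have g: "0 < g t" "g t < 1"
        unfolding g_def by (rule E.aprob_pscore_pos[OF l(1)])+
      have "\<bar>g t * ((m k s)\<^sup>2 - (\<mu> s)\<^sup>2)\<bar> \<le> 1 * \<bar>(m k s)\<^sup>2 - (\<mu> s)\<^sup>2\<bar>"
        unfolding abs_mult using g by (intro mult_right_mono) auto
      then have "\<bar>(v k s - \<nu> s) - g t * ((m k s)\<^sup>2 - (\<mu> s)\<^sup>2)\<bar> \<le> \<bar>v k s - \<nu> s\<bar> + \<bar>(m k s)\<^sup>2 - (\<mu> s)\<^sup>2\<bar>"
        by (intro order_trans[OF abs_triangle_ineq4 add_left_mono]) simp
      moreover have "(b t)\<^sup>2 \<le> B\<^sup>2"
        using power_mono[OF b[OF that], of 2] by simp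
      ultimately have "(b t)\<^sup>2 * \<bar>(v k s - \<nu> s) - g t * ((m k s)\<^sup>2 - (\<mu> s)\<^sup>2)\<bar> \<le> B\<^sup>2 * (\<bar>v k s - \<nu> s\<bar> + \<bar>(m k s)\<^sup>2 - (\<mu> s)\<^sup>2\<bar>)"
        by (intro mult_mono) auto
      moreover have "\<bar>(b t)\<^sup>2 * (v k s - g t * (m k s)\<^sup>2) - (b t)\<^sup>2 * (\<nu> s - g t * (\<mu> s)\<^sup>2)\<bar> = (b t)\<^sup>2 * \<bar>(v k s - \<nu> s) - g t * ((m k s)\<^sup>2 - (\<mu> s)\<^sup>2)\<bar>"
        by (simp only: right_diff_distrib[symmetric] abs_mult) (simp add: algebra_simps)
      ultimately show ?thesis
        by (simp only:)
    qed
    from this[of 1] this[of 2] show ?thesis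
      by (simp only: insertI1 insertI2 singletonI simp_thms sum.insert finite.intros sum.empty) (simp add: abs_le_iff)
  qed
  ultimately show ?thesis
    unfolding var_err_def by linarith
qed

lemma
  assumes t: "t \<in> {1, 2}" and s: "s \<in> {0, 1}"
  shows integrable_abs_R: "integrable (P k) (\<lambda>\<omega>. \<bar>R k t s \<omega>\<bar>)"
    and integral_abs_R: "(\<integral>\<omega>. \<bar>R k t s \<omega>\<bar> \<partial>P k) \<le> 2 * sqrt (K / (n k t * (l k * min (p 0) (p 1))))"
proof -
  \<comment> \<open>A lower bound for all treatment probabilities; the product, rather than the
    minimum, of the two bounds makes \<open>n k t * \<delta>\<close> a fixed multiple of
    \<open>n k t * l k\<close>.\<close>
  define \<delta> where "\<delta> = l k * min (p 0) (p 1)"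
  have "\<delta> \<le> l k * 1"
    unfolding \<delta>_def using l(1)[of k] p_bounds by (intro mult_left_mono) auto
  moreover have "\<delta> \<le> 1 * min (p 0) (p 1)"
    unfolding \<delta>_def using E.clipping_rate(2)[of k] p_bounds by (intro mult_right_mono) auto
  moreover have "0 < \<delta>"
    unfolding \<delta>_def using l(1)[of k] p_bounds by simp
  ultimately have \<delta>: "0 < \<delta>" "\<delta> \<le> l k" "\<delta> \<le> p 0" "\<delta> \<le> p 1"
    by auto
  note R = E.integrable_R_sq[OF l(1) t s \<delta>] E.measurable_R[OF t] E.integral_R_sq[OF l(1) t s \<delta>]
  have "0 < K / (n k t * \<delta>)"
    using K_ge_1 n_pos[OF t] \<delta>(1) by (intro divide_pos_pos mult_pos_pos) auto
  then show "(\<integral>\<omega>. \<bar>R k t s \<omega>\<bar> \<partial>P k) \<le> 2 * sqrt (K / (n k t * (l k * min (p 0) (p 1))))"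
    unfolding \<delta>_def[symmetric] by (rule E.integral_abs_le_sqrt[OF R])
  show "integrable (P k) (\<lambda>\<omega>. \<bar>R k t s \<omega>\<bar>)"
    using E.square_integrable_imp_integrable[OF R(2,1)] by simp
qed

lemma
  assumes s: "s \<in> {0, 1}" and \<eta>: "0 < \<eta>"
  shows integrable_var_err: "integrable (P k) (var_err B \<eta> k s)"
    and integral_var_err: "(\<lambda>k. \<integral>\<omega>. var_err B \<eta> k s \<omega> \<partial>P k) \<longlonglongrightarrow> 0"
proof -
  have t12: "1 \<in> {1, 2::nat}" "2 \<in> {1, 2::nat}"
    by auto
  note i = integrable_abs_R[OF t12(1) s] integrable_abs_R[OF t12(2) s]
    E.integrable_G_sq[OF l(1) t12(1) s] E.integrable_G_sq[OF l(1) t12(2) s]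
  note e = integral_abs_R[OF t12(1) s] integral_abs_R[OF t12(2) s]
    E.integral_G_sq[OF l(1) t12(1) s] E.integral_G_sq[OF l(1) t12(2) s]
  show int: "integrable (P k) (var_err B \<eta> k s)" for k
    unfolding var_err_def[abs_def] using i[of k] by (intro Bochner_Integration.integrable_add integrable_mult_right integrable_divide) auto
  define C where "C = 4 * K + 8 * B\<^sup>2"
  define S where "S k = sqrt (\<eta> * N k)" for k
  define d where "d k = \<bar>v k s - \<nu> s\<bar> + \<bar>(m k s)\<^sup>2 - (\<mu> s)\<^sup>2\<bar>" for k
  define \<tau> where "\<tau> t k = 2 * sqrt (K / (n k t * (l k * min (p 0) (p 1))))" for t k
  have C: "0 \<le> C"
    using K_ge_1 by (simp add: C_def)
  have S0: "0 \<le> S k" for k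
    using \<eta> by (simp add: S_def)
  have le: "(\<integral>\<omega>. var_err B \<eta> k s \<omega> \<partial>P k) \<le> B\<^sup>2 * (\<tau> 1 k + \<tau> 2 k + C * (1 + K + K) / S k) + 2 * B\<^sup>2 * d k" for k
  proof -
    have "(\<integral>\<omega>. var_err B \<eta> k s \<omega> \<partial>P k) = B\<^sup>2 * ((\<integral>\<omega>. \<bar>R k 1 s \<omega>\<bar> \<partial>P k) + (\<integral>\<omega>. \<bar>R k 2 s \<omega>\<bar> \<partial>P k)
        + C * (1 + (\<integral>\<omega>. (G k 1 s \<omega>)\<^sup>2 \<partial>P k) + (\<integral>\<omega>. (G k 2 s \<omega>)\<^sup>2 \<partial>P k)) / S k) + 2 * B\<^sup>2 * d k"
      unfolding var_err_def C_def[symmetric] S_def[symmetric] d_def[symmetric] using i[of k] by (simp add: E.prob_space)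
    also have "\<dots> \<le> B\<^sup>2 * (\<tau> 1 k + \<tau> 2 k + C * (1 + K + K) / S k) + 2 * B\<^sup>2 * d k"
      unfolding \<tau>_def using C S0[of k] by (intro add_mono mult_left_mono divide_right_mono e order_refl) auto
    finally show ?thesis .
  qed
  \<comment> \<open>Here the rate condition enters: the mean error of the squared terms is of order
    one over the root of \<open>n k t * l k\<close>.\<close>
  have \<tau>: "\<tau> t \<longlonglongrightarrow> 0" if "t \<in> {1, 2}" for t
  proof -
    have "filterlim (\<lambda>k. min (p 0) (p 1) * (real (n k t) * l k)) at_top sequentially"
      using p_bounds by (intro filterlim_tendsto_pos_mult_at_top[OF tendsto_const _ n_rate[OF that]]) auto
    then have "(\<lambda>k. K / (min (p 0) (p 1) * (real (n k t) * l k))) \<longlonglongrightarrow> 0"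
      by (rule real_tendsto_divide_at_top[OF tendsto_const])
    then have "(\<lambda>k. 2 * sqrt (K / (min (p 0) (p 1) * (real (n k t) * l k)))) \<longlonglongrightarrow> 2 * sqrt 0"
      by (intro tendsto_intros)
    then show ?thesis
      by (simp add: \<tau>_def[abs_def] mult_ac)
  qed
  have "filterlim (\<lambda>k. \<eta> * N k) at_top sequentially"
    by (rule filterlim_tendsto_pos_mult_at_top[OF tendsto_const \<eta> total_tendsto])
  then have S: "filterlim S at_top sequentially"
    unfolding S_def[abs_def] by (rule filterlim_compose[OF sqrt_at_top])
  have "d \<longlonglongrightarrow> \<bar>\<nu> s - \<nu> s\<bar> + \<bar>(\<mu> s)\<^sup>2 - (\<mu> s)\<^sup>2\<bar>"
    unfolding d_def[abs_def] by (intro tendsto_intros mean_tendsto[OF s] second_tendsto[OF s])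
  then have d: "d \<longlonglongrightarrow> 0"
    by simp
  have "(\<lambda>k. B\<^sup>2 * (\<tau> 1 k + \<tau> 2 k + C * (1 + K + K) / S k) + 2 * B\<^sup>2 * d k) \<longlonglongrightarrow> B\<^sup>2 * (0 + 0 + 0) + 2 * B\<^sup>2 * 0"
    by (intro tendsto_add tendsto_mult tendsto_const \<tau> t12 d real_tendsto_divide_at_top[OF tendsto_const S])
  then have lim: "(\<lambda>k. B\<^sup>2 * (\<tau> 1 k + \<tau> 2 k + C * (1 + K + K) / S k) + 2 * B\<^sup>2 * d k) \<longlonglongrightarrow> 0"
    by simp
  have "0 \<le> var_err B \<eta> k s \<omega>" for k \<omega>
    unfolding var_err_def C_def[symmetric] S_def[symmetric] using C S0[of k]
    by (intro add_nonneg_nonneg mult_nonneg_nonneg divide_nonneg_nonneg) auto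
  then have "0 \<le> (\<integral>\<omega>. var_err B \<eta> k s \<omega> \<partial>P k)" for k
    by simp
  then show "(\<lambda>k. \<integral>\<omega>. var_err B \<eta> k s \<omega> \<partial>P k) \<longlonglongrightarrow> 0"
    using le by (intro tendsto_sandwich[OF _ _ tendsto_const lim]) auto
qed

text \<open>The centring is divided by the same random denominator as the statistic, so the scaled
  effect, which may diverge, cancels before any limit is taken.\<close>

lemma studentized_eq:
  "W_stat r (X k) \<omega> - scaled_effect (Q k) (total_size (X k)) / S_hat r (X k) \<omega>
    = (U k 0 \<omega> - U k 1 \<omega>) / sqrt (N k * V_hat r (X k) 0 \<omega> + N k * V_hat r (X k) 1 \<omega>)"
  unfolding W_stat_def diff_divide_distrib[symmetric] T_stat_eq S_hat_def ..

lemma measurable_studentized: "(\<lambda>\<omega>. (U k 0 \<omega> - U k 1 \<omega>) / sqrt (N k * V_hat r (X k) 0 \<omega> + N k * V_hat r (X k) 1 \<omega>)) \<in> borel_measurable (P k)"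
proof -
  note [measurable] = measurable_U E.measurable_V_hat
  show ?thesis
    by measurable
qed

text \<open>The numerator is bounded in mean and the variance estimate is close in mean to
  \<open>lim_sd2 (h k \<omega>)\<close>; the pointwise estimate for studentised exponentials is
  linear in both, so integrating it is enough.\<close>

lemma char_studentized_diff:
  assumes \<epsilon>: "0 < \<epsilon>"
  shows "\<forall>\<^sub>F k in sequentially.
    cmod ((CLINT \<omega>|P k. iexp (\<theta> * ((U k 0 \<omega> - U k 1 \<omega>) / sqrt (N k * V_hat r (X k) 0 \<omega> + N k * V_hat r (X k) 1 \<omega>))))
      - (CLINT \<omega>|P k. iexp (\<theta> * ((U k 0 \<omega> - U k 1 \<omega>) / sqrt (lim_sd2 (h k \<omega>)))))) \<le> \<epsilon>"
proof -
  obtain B where B: "0 < B" "\<And>t s x. t \<in> {1, 2} \<Longrightarrow> s \<in> {0, 1} \<Longrightarrow> x \<in> J \<Longrightarrow> \<bar>\<beta> t s x\<bar> \<le> B"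
    using coef_bound by blast
  obtain s where s: "0 < s" "\<And>x. x \<in> J \<Longrightarrow> 2 * s\<^sup>2 \<le> lim_sd2 x"
    using lim_sd2_lower by blast
  define \<eta> where "\<eta> = min (q 1) (q 2)"
  have \<eta>: "0 < \<eta>" "\<eta> \<le> q 1" "\<eta> \<le> q 2"
    using q[of 1] q[of 2] by (auto simp: \<eta>_def)
  \<comment> \<open>\<open>4 * K\<close> bounds the summed first moments of the four standardised
    sums.\<close>
  define C where "C = \<bar>\<theta>\<bar> * B * (4 * K) / (2 * s ^ 3)"
  have C: "0 \<le> C"
    using B(1) s(1) K_ge_1 by (simp add: C_def)
  \<comment> \<open>The first bound keeps the estimated variance above \<open>s\<^sup>2\<close> when
    it is within \<open>\<epsilon>'\<close> of its target; the second makes the contribution of the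
    numerator at most \<epsilon> / 2.\<close>
  define \<epsilon>' where "\<epsilon>' = min (s\<^sup>2) (\<epsilon> / (2 * (C + 1)))"
  have \<epsilon>': "0 < \<epsilon>'" "\<epsilon>' \<le> s\<^sup>2"
    using s(1) \<epsilon> C by (simp_all add: \<epsilon>'_def)
  have \<epsilon>C: "\<epsilon>' * C \<le> \<epsilon> / 2"
  proof -
    have "\<epsilon>' * C \<le> \<epsilon> / (2 * (C + 1)) * (C + 1)"
      using C \<epsilon> \<epsilon>' by (intro mult_mono) (auto simp: \<epsilon>'_def)
    also have "\<dots> = \<epsilon> / 2"
      using C by (simp add: field_simps)
    finally show ?thesis .
  qed
  let ?Z = "\<lambda>k \<omega>. var_err B \<eta> k 0 \<omega> + var_err B \<eta> k 1 \<omega>"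
  let ?a = "\<lambda>k \<omega>. iexp (\<theta> * ((U k 0 \<omega> - U k 1 \<omega>) / sqrt (N k * V_hat r (X k) 0 \<omega> + N k * V_hat r (X k) 1 \<omega>)))"
  let ?b = "\<lambda>k \<omega>. iexp (\<theta> * ((U k 0 \<omega> - U k 1 \<omega>) / sqrt (lim_sd2 (h k \<omega>))))"
  let ?W = "\<lambda>k \<omega>. \<epsilon>' / (2 * s ^ 3) * (\<bar>\<theta>\<bar> * (B * (\<bar>G k 1 0 \<omega>\<bar> + \<bar>G k 2 0 \<omega>\<bar> + \<bar>G k 1 1 \<omega>\<bar> + \<bar>G k 2 1 \<omega>\<bar>))) + 2 / \<epsilon>' * ?Z k \<omega>"
  have int_Z: "integrable (P k) (var_err B \<eta> k 0)" "integrable (P k) (var_err B \<eta> k 1)" for k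
    by (rule integrable_var_err[OF _ \<eta>(1)]; simp)+
  have int_G: "integrable (P k) (G k 1 0)" "integrable (P k) (G k 2 0)" "integrable (P k) (G k 1 1)" "integrable (P k) (G k 2 1)" for k
    by (rule G_integrable; simp)+
  have abs_G: "(\<integral>\<omega>. \<bar>G k 1 0 \<omega>\<bar> \<partial>P k) \<le> K" "(\<integral>\<omega>. \<bar>G k 2 0 \<omega>\<bar> \<partial>P k) \<le> K" "(\<integral>\<omega>. \<bar>G k 1 1 \<omega>\<bar> \<partial>P k) \<le> K" "(\<integral>\<omega>. \<bar>G k 2 1 \<omega>\<bar> \<partial>P k) \<le> K" for k
    by (rule G_abs; simp)+
  have int_W: "integrable (P k) (?W k)" for k
    using int_Z[of k] int_G[of k] by (intro Bochner_Integration.integrable_add integrable_mult_right integrable_abs)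
  have W_le: "(\<integral>\<omega>. ?W k \<omega> \<partial>P k) \<le> \<epsilon> / 2 + 2 / \<epsilon>' * ((\<integral>\<omega>. var_err B \<eta> k 0 \<omega> \<partial>P k) + (\<integral>\<omega>. var_err B \<eta> k 1 \<omega> \<partial>P k))" for k
  proof -
    have "(\<integral>\<omega>. ?W k \<omega> \<partial>P k) = \<epsilon>' / (2 * s ^ 3) * (\<bar>\<theta>\<bar> * (B * ((\<integral>\<omega>. \<bar>G k 1 0 \<omega>\<bar> \<partial>P k) + (\<integral>\<omega>. \<bar>G k 2 0 \<omega>\<bar> \<partial>P k) + (\<integral>\<omega>. \<bar>G k 1 1 \<omega>\<bar> \<partial>P k) + (\<integral>\<omega>. \<bar>G k 2 1 \<omega>\<bar> \<partial>P k))))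
        + 2 / \<epsilon>' * ((\<integral>\<omega>. var_err B \<eta> k 0 \<omega> \<partial>P k) + (\<integral>\<omega>. var_err B \<eta> k 1 \<omega> \<partial>P k))"
      using int_Z[of k] int_G[of k] by simp
    also have "\<dots> \<le> \<epsilon>' / (2 * s ^ 3) * (\<bar>\<theta>\<bar> * (B * (K + K + K + K)))
        + 2 / \<epsilon>' * ((\<integral>\<omega>. var_err B \<eta> k 0 \<omega> \<partial>P k) + (\<integral>\<omega>. var_err B \<eta> k 1 \<omega> \<partial>P k))"
      using \<epsilon>' s(1) B(1) by (intro add_right_mono mult_left_mono add_mono abs_G) auto
    also have "\<epsilon>' / (2 * s ^ 3) * (\<bar>\<theta>\<bar> * (B * (K + K + K + K))) = \<epsilon>' * C"
      by (simp add: C_def)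
    finally show ?thesis
      using \<epsilon>C by linarith
  qed
  have diff: "AE \<omega> in P k. cmod (?a k \<omega> - ?b k \<omega>) \<le> ?W k \<omega>" for k
    using AE_scores[of k] AE_U[of k]
  proof eventually_elim
    case (elim \<omega>)
    have V: "\<bar>N k * V_hat r (X k) s' \<omega> - (\<Sum>t\<in>{1, 2}. (\<beta> t s' (h k \<omega>))\<^sup>2 * lim_V \<mu> \<nu> (aprob (if t = 1 then p 0 else h k \<omega>)) s')\<bar> \<le> var_err B \<eta> k s' \<omega>"
      if "s' \<in> {0, 1}" for s'
      using elim(1) that by (intro V_hat_diff_le[OF that _ B(2) \<eta>]) auto
    have "lim_sd2 (h k \<omega>) = (\<Sum>t\<in>{1, 2}. (\<beta> t 0 (h k \<omega>))\<^sup>2 * lim_V \<mu> \<nu> (aprob (if t = 1 then p 0 else h k \<omega>)) 0)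
        + (\<Sum>t\<in>{1, 2}. (\<beta> t 1 (h k \<omega>))\<^sup>2 * lim_V \<mu> \<nu> (aprob (if t = 1 then p 0 else h k \<omega>)) 1)"
      unfolding lim_sd2_def by simp
    moreover have "\<bar>x + y - (a + b)\<bar> \<le> d + d'" if "\<bar>x - a\<bar> \<le> d" "\<bar>y - b\<bar> \<le> d'" for x y a b d d' :: real
      using that by linarith
    ultimately have Z: "\<bar>(N k * V_hat r (X k) 0 \<omega> + N k * V_hat r (X k) 1 \<omega>) - lim_sd2 (h k \<omega>)\<bar> \<le> ?Z k \<omega>"
      using V[OF insertI1] V[OF insertI2[OF singletonI]] by presburger
    have bG: "\<bar>\<beta> t s' (h k \<omega>) * G k t s' \<omega>\<bar> \<le> B * \<bar>G k t s' \<omega>\<bar>" if "t \<in> {1, 2}" "s' \<in> {0, 1}" for t s'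
      unfolding abs_mult by (intro mult_right_mono B(2) that h_bounds(3)) simp
    have u: "U k 0 \<omega> = \<beta> 1 0 (h k \<omega>) * G k 1 0 \<omega> + \<beta> 2 0 (h k \<omega>) * G k 2 0 \<omega>"
      "U k 1 \<omega> = \<beta> 1 1 (h k \<omega>) * G k 1 1 \<omega> + \<beta> 2 1 (h k \<omega>) * G k 2 1 \<omega>"
      by (rule bspec[OF elim(2)]; simp)+
    have tri: "\<bar>(a + b) - (a' + b')\<bar> \<le> x + y + x' + y'" if "\<bar>a\<bar> \<le> x" "\<bar>b\<bar> \<le> y" "\<bar>a'\<bar> \<le> x'" "\<bar>b'\<bar> \<le> y'"
      for a b a' b' x y x' y' :: real
      using that by linarith
    have UG: "\<bar>U k 0 \<omega> - U k 1 \<omega>\<bar> \<le> B * (\<bar>G k 1 0 \<omega>\<bar> + \<bar>G k 2 0 \<omega>\<bar> + \<bar>G k 1 1 \<omega>\<bar> + \<bar>G k 2 1 \<omega>\<bar>)"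
      unfolding u distrib_left by (rule tri; rule bG; simp)
    have "cmod (?a k \<omega> - ?b k \<omega>) \<le> \<epsilon>' / (2 * s ^ 3) * \<bar>\<theta> * (U k 0 \<omega> - U k 1 \<omega>)\<bar>
        + 2 / \<epsilon>' * \<bar>(N k * V_hat r (X k) 0 \<omega> + N k * V_hat r (X k) 1 \<omega>) - lim_sd2 (h k \<omega>)\<bar>"
      unfolding times_divide_eq_right by (rule norm_iexp_studentized_diff_le[OF s(1) s(2)[OF h_bounds(3)] \<epsilon>'])
    also have "\<dots> \<le> ?W k \<omega>"
      unfolding abs_mult[of \<theta>] using \<epsilon>' s(1) by (intro add_mono mult_left_mono UG Z) auto
    finally show ?case .
  qed
  have ma: "?a k \<in> borel_measurable (P k)" for k
  proof -
    note [measurable] = measurable_studentized[of k]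
    show ?thesis
      by measurable
  qed
  have mb: "?b k \<in> borel_measurable (P k)" for k
  proof -
    note [measurable] = measurable_U measurable_\<beta>_h[OF lim_sd2_cont]
    show ?thesis
      by measurable
  qed
  have le: "cmod ((CLINT \<omega>|P k. ?a k \<omega>) - (CLINT \<omega>|P k. ?b k \<omega>)) \<le> (\<integral>\<omega>. ?W k \<omega> \<partial>P k)" for k
  proof -
    have ia: "integrable (P k) (?a k)" and ib: "integrable (P k) (?b k)"
      by (rule E.integrable_of_bounded[where B=1], rule ma mb, simp)+
    have "cmod ((CLINT \<omega>|P k. ?a k \<omega>) - (CLINT \<omega>|P k. ?b k \<omega>)) = cmod (CLINT \<omega>|P k. ?a k \<omega> - ?b k \<omega>)"
      by (simp only: Bochner_Integration.integral_diff[OF ia ib])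
    also have "\<dots> \<le> (\<integral>\<omega>. cmod (?a k \<omega> - ?b k \<omega>) \<partial>P k)"
      by (rule integral_norm_bound)
    also have "\<dots> \<le> (\<integral>\<omega>. ?W k \<omega> \<partial>P k)"
      by (rule integral_mono_AE[OF integrable_norm[OF Bochner_Integration.integrable_diff[OF ia ib]] int_W diff])
    finally show ?thesis .
  qed
  have "(\<lambda>k. 2 / \<epsilon>' * ((\<integral>\<omega>. var_err B \<eta> k 0 \<omega> \<partial>P k) + (\<integral>\<omega>. var_err B \<eta> k 1 \<omega> \<partial>P k))) \<longlonglongrightarrow> 2 / \<epsilon>' * (0 + 0)"
    by (intro tendsto_mult tendsto_const tendsto_add integral_var_err \<eta>) auto
  then have "\<forall>\<^sub>F k in sequentially. 2 / \<epsilon>' * ((\<integral>\<omega>. var_err B \<eta> k 0 \<omega> \<partial>P k) + (\<integral>\<omega>. var_err B \<eta> k 1 \<omega> \<partial>P k)) < \<epsilon> / 2"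
    using \<epsilon> by (intro order_tendstoD(2)) auto
  then show ?thesis
  proof eventually_elim
    case (elim k)
    show ?case
      using le[of k] W_le[of k] elim by linarith
  qed
qed

lemma measurable_lim_normalized: "(\<lambda>z. lim_normalized (lim_w (fst z)) z) \<in> borel_measurable (limit_law q p e \<mu> \<nu> c l_inf)"
  unfolding lim_normalized_def lim_w_sq_sum
  using measurable_lim_unnormalized measurable_compose[OF measurable_\<beta>_H[OF lim_sd2_cont] borel_measurable_sqrt] unfolding measurable_cong_sets[OF sets_limit_law refl]
  by (rule borel_measurable_divide)

lemma W_stat_converges_weakly:
  "converges_weakly P (\<lambda>k \<omega>. W_stat r (X k) \<omega> - scaled_effect (Q k) (total_size (X k)) / S_hat r (X k) \<omega>)
     (limit_law q p e \<mu> \<nu> c l_inf) (\<lambda>z. lim_normalized (lim_w (fst z)) z)"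
  unfolding studentized_eq
proof (rule converges_weaklyI_char[OF E.prob_space_axioms measurable_studentized prob_space_limit_law measurable_lim_normalized])
  fix \<theta> :: real
  \<comment> \<open>The limiting denominator is a continuous function of the propensity, so it is
    absorbed into the multipliers of the two arms.\<close>
  define \<sigma> where "\<sigma> s x = (if s = 0 then \<theta> else - \<theta>) / sqrt (lim_sd2 x)" for s :: nat and x
  have \<sigma>: "continuous_on J (\<sigma> s)" for s
    unfolding \<sigma>_def using lim_sd2_pos by (intro continuous_intros lim_sd2_cont) fastforce
  have *: "\<theta> * ((x - y) / sqrt (lim_sd2 w)) = \<sigma> 0 w * x + \<sigma> 1 w * y" for x y w
    by (simp add: \<sigma>_def diff_divide_distrib right_diff_distrib)
  have conv: "(\<lambda>k. CLINT \<omega>|P k. iexp (\<theta> * ((U k 0 \<omega> - U k 1 \<omega>) / sqrt (lim_sd2 (h k \<omega>)))))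
      \<longlonglongrightarrow> (CLINT z|limit_law q p e \<mu> \<nu> c l_inf. iexp (\<theta> * lim_normalized (lim_w (fst z)) z))"
    unfolding lim_normalized_def lim_w_sq_sum lim_unnormalized_def * by (rule char_U_tendsto[of \<sigma>, OF \<sigma>])
  show "(\<lambda>k. CLINT \<omega>|P k. iexp (\<theta> * ((U k 0 \<omega> - U k 1 \<omega>) / sqrt (N k * V_hat r (X k) 0 \<omega> + N k * V_hat r (X k) 1 \<omega>))))
      \<longlonglongrightarrow> (CLINT z|limit_law q p e \<mu> \<nu> c l_inf. iexp (\<theta> * lim_normalized (lim_w (fst z)) z))"
    by (rule tendsto_by_approximation, intro exI conjI, rule conv, erule char_studentized_diff) simp
qed

end

context weighted_sequence
begin

text \<open>Prescribed weights are compared with \<open>lim_w\<close> at stages 1, 2 and arms 0, 1,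
  the places at which the limit variables evaluate them.\<close>

lemma statistics_converge_weakly:
  assumes w: "\<And>y t s. t \<in> {1, 2} \<Longrightarrow> s \<in> {0, 1} \<Longrightarrow> w y t s = lim_w y t s"
  shows "(\<forall>s\<in>{0, 1}. converges_weakly P (\<lambda>k \<omega>. sqrt (N k) * (WIPW r (X k) s \<omega> - m k s))
      (limit_law q p e \<mu> \<nu> c l_inf) (\<lambda>z. lim_arm (w (fst z)) s z)) \<and>
    converges_weakly P (\<lambda>k \<omega>. sqrt (N k) * T_stat r (X k) \<omega> - scaled_effect (Q k) (total_size (X k)))
      (limit_law q p e \<mu> \<nu> c l_inf) (\<lambda>z. lim_unnormalized (w (fst z)) z) \<and>
    converges_weakly P (\<lambda>k \<omega>. W_stat r (X k) \<omega> - scaled_effect (Q k) (total_size (X k)) / S_hat r (X k) \<omega>)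
      (limit_law q p e \<mu> \<nu> c l_inf) (\<lambda>z. lim_normalized (w (fst z)) z)"
proof -
  have arm: "lim_arm (w y) s z = lim_arm (lim_w y) s z" if "s \<in> {0, 1}" for y s z
    unfolding lim_arm_def using w that by (intro sum.cong) auto
  have un: "lim_unnormalized (w y) z = lim_unnormalized (lim_w y) z" for y z
    unfolding lim_unnormalized_def by (simp only: arm insertI1 insertI2 singletonI)
  have sq: "(\<Sum>s\<in>{0, 1}. \<Sum>t\<in>{1, 2}. (w y t s)\<^sup>2) = (\<Sum>s\<in>{0, 1}. \<Sum>t\<in>{1, 2}. (lim_w y t s)\<^sup>2)" for y
    using w by (intro sum.cong refl) (simp only:)
  show ?thesis
  proof (intro conjI ballI)
    show "converges_weakly P (\<lambda>k \<omega>. sqrt (N k) * (WIPW r (X k) s \<omega> - m k s))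
        (limit_law q p e \<mu> \<nu> c l_inf) (\<lambda>z. lim_arm (w (fst z)) s z)" if "s \<in> {0, 1}" for s
      unfolding arm[OF that] by (rule WIPW_converges_weakly[OF that])
  qed (unfold lim_normalized_def un sq, rule T_stat_converges_weakly, rule W_stat_converges_weakly[unfolded lim_normalized_def])
qed

end

section \<open>The two weighting regimes\<close>

context experiment_sequence
begin

interpretation E: regular_experiment "X k" "Q k" p e "l k" K for k
  by (rule reg)

lemma N_pos: "0 < N k"
  by (rule E.total_pos[OF l(1)])

lemma q_sum: "q 1 + q 2 = 1"
proof -
  have "N k = q 1 * N k + q 2 * N k" for k
  proof -
    have "N k = real (n k 1) + real (n k 2)"
      by (simp add: total_size_def)
    then show ?thesis
      using ratio[of 1 k] ratio[of 2 k] by simp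
  qed
  then have "(q 1 + q 2) * N 0 = 1 * N 0"
    by (simp add: distrib_right)
  then show ?thesis
    using N_pos[of 0] by (simp only: mult_cancel_right) simp
qed

text \<open>Exact proportionality of the stage sizes removes the sample size: the coefficient
  depends on \<open>k\<close> through the propensity alone. The power \<open>r\<close> meets the
  root that standardises the sum, so the exponent that counts is \<open>r - 1 / 2\<close>.\<close>

lemma coef_eq_ratio:
  fixes r :: real
  assumes t: "t \<in> {1, 2}"
  shows "E.coef k r t s \<omega> = sqrt (q t) * (aprob (E.pscore k t \<omega>) s powr r / sqrt (aprob (E.pscore k t \<omega>) s))
    / (q 1 * aprob (p 0) s powr r + q 2 * aprob (h k \<omega>) s powr r)"
proof -
  define g where "g t = aprob (E.pscore k t \<omega>) s" for t
  define d where "d = q 1 * g 1 powr r + q 2 * g 2 powr r"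
  have g: "0 < g t" for t
    unfolding g_def by (rule E.aprob_pscore_pos[OF l(1)])
  have d: "0 < d"
    unfolding d_def using q[of 1] q[of 2] g[of 1] g[of 2] by (intro add_pos_pos mult_pos_pos) auto
  have qt: "0 < q t"
    using q[OF t] by simp
  have "E.share k r t s \<omega> = (q t * N k * g t powr r) / (\<Sum>t'\<in>{1, 2}. q t' * N k * g t' powr r)"
  proof -
    have "(\<Sum>t'\<in>{1, 2}. n k t' * g t' powr r) = (\<Sum>t'\<in>{1, 2}. q t' * N k * g t' powr r)"
      by (rule sum.cong) (simp_all only: ratio)
    then show ?thesis
      unfolding E.share_def[OF l(1)] g_def[symmetric] ratio[OF t] by (simp only:)
  qed
  also have "(\<Sum>t'\<in>{1, 2}. q t' * N k * g t' powr r) = N k * d"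
    by (simp add: d_def algebra_simps)
  finally have share: "E.share k r t s \<omega> = q t * g t powr r / d"
    using N_pos[of k] by simp
  have "E.coef k r t s \<omega> = sqrt (N k) * (q t * g t powr r / d) / (sqrt (q t) * sqrt (N k) * sqrt (g t))"
    unfolding E.coef_def[OF l(1)] share ratio[OF t] g_def[symmetric] real_sqrt_mult ..
  also have "\<dots> = (q t / sqrt (q t)) * (g t powr r / sqrt (g t)) / d"
    using N_pos[of k] by simp
  also have "q t / sqrt (q t) = sqrt (q t)"
    using qt by (simp add: real_div_sqrt)
  also have "d = q 1 * aprob (p 0) s powr r + q 2 * aprob (h k \<omega>) s powr r"
    by (simp add: d_def g_def E.pscore_def)
  finally show ?thesis
    by (simp only: g_def)
qed

lemma aprob_cont: "continuous_on J (\<lambda>x. aprob (if t = 1 then p 0 else x) s)" for t :: nat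
  unfolding aprob_def by (cases "s = 0"; cases "t = (1::nat)") (auto intro!: continuous_intros)

lemma aprob_p_pos: "0 < aprob (p 0) s"
  using p_bounds by (simp add: aprob_def)

lemma aprob_J_nonneg: "x \<in> J \<Longrightarrow> 0 \<le> aprob x s"
  using J_unit[of x] by (simp add: aprob_def)

text \<open>At exponent 0 all powers are 1 and the shares are \<open>q 1\<close> and
  \<open>q 2\<close>, which sum to 1. Positivity of \<open>l_inf\<close> keeps the quotient by the
  propensity continuous on \<open>J\<close>.\<close>

lemma constant_weights:
  assumes "0 < l_inf"
  shows "weighted_sequence X Q q p e l \<mu> \<nu> c l_inf K 0 (\<lambda>t s x. sqrt (q t / aprob (if t = 1 then p 0 else x) s))"
proof (intro weighted_sequence.intro weighted_sequence_axioms.intro)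
  have pos: "0 < aprob (if t = 1 then p 0 else x) s" if "x \<in> J" for t s :: nat and x
    using that assms l(4) p_bounds by (simp add: aprob_def)
  show "experiment_sequence X Q q p e l \<mu> \<nu> c l_inf K"
    by (rule experiment_sequence_axioms)
  fix t s :: nat assume t: "t \<in> {1, 2}" and s: "s \<in> {0, 1}"
  show "E.coef k 0 t s \<omega> = sqrt (q t / aprob (if t = 1 then p 0 else h k \<omega>) s)" for k \<omega>
  proof -
    have g: "0 < aprob (p 0) s" "0 < aprob (h k \<omega>) s" "0 < aprob (E.pscore k t \<omega>) s"
      using aprob_p_pos E.aprob_pscore_pos[OF l(1)] by auto
    have e: "aprob (E.pscore k t \<omega>) s = aprob (if t = 1 then p 0 else h k \<omega>) s"
      using t by (auto simp: E.pscore_def)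
    show ?thesis
      using coef_eq_ratio[OF t, of k 0 s \<omega>] g q_sum unfolding e by (simp add: real_sqrt_divide)
  qed
  show "continuous_on J (\<lambda>x. sqrt (q t / aprob (if t = 1 then p 0 else x) s))"
    using pos by (intro continuous_on_real_sqrt continuous_on_divide continuous_on_const aprob_cont) (auto simp: less_imp_neq[symmetric])
next
  show "0 < sqrt (q 1 / aprob (if (1::nat) = 1 then p 0 else x) 0)" for x
    using q[of 1] aprob_p_pos[of 0] by simp
qed

lemma constant_weight_limits:
  assumes "0 < l_inf"
  shows "(\<forall>s\<in>{0, 1}. converges_weakly P (\<lambda>k \<omega>. sqrt (N k) * (WIPW 0 (X k) s \<omega> - m k s))
      (limit_law q p e \<mu> \<nu> c l_inf) (\<lambda>z. lim_arm (w_const q \<mu> \<nu> (lim_H q p e \<mu> \<nu> c l_inf (fst z))) s z)) \<and>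
    converges_weakly P (\<lambda>k \<omega>. sqrt (N k) * T_stat 0 (X k) \<omega> - scaled_effect (Q k) (total_size (X k)))
      (limit_law q p e \<mu> \<nu> c l_inf) (\<lambda>z. lim_unnormalized (w_const q \<mu> \<nu> (lim_H q p e \<mu> \<nu> c l_inf (fst z))) z) \<and>
    converges_weakly P (\<lambda>k \<omega>. W_stat 0 (X k) \<omega> - scaled_effect (Q k) (total_size (X k)) / S_hat 0 (X k) \<omega>)
      (limit_law q p e \<mu> \<nu> c l_inf) (\<lambda>z. lim_normalized (w_const q \<mu> \<nu> (lim_H q p e \<mu> \<nu> c l_inf (fst z))) z)"
proof -
  interpret W: weighted_sequence X Q q p e l \<mu> \<nu> c l_inf K 0 "\<lambda>t s x. sqrt (q t / aprob (if t = 1 then p 0 else x) s)"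
    by (rule constant_weights[OF assms])
  show ?thesis
  proof (rule W.statistics_converge_weakly)
    fix y :: "real \<times> real" and t s :: nat assume "t \<in> {1, 2}" "s \<in> {0, 1}"
    then show "w_const q \<mu> \<nu> (lim_H q p e \<mu> \<nu> c l_inf y) t s = W.lim_w y t s"
      unfolding w_const_def W.lim_w_def by (simp only: lim_H_eq_aprob real_sqrt_mult[symmetric] times_divide_eq_left)
  qed
qed

lemma adaptive_weights:
  "weighted_sequence X Q q p e l \<mu> \<nu> c l_inf K (1 / 2) (\<lambda>t s x. sqrt (q t) / (q 1 * sqrt (aprob (p 0) s) + q 2 * sqrt (aprob x s)))"
proof (intro weighted_sequence.intro weighted_sequence_axioms.intro)
  have pos: "0 < q 1 * sqrt (aprob (p 0) s) + q 2 * sqrt (aprob x s)" if "x \<in> J" for s :: nat and x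
    using q[of 1] q[of 2] aprob_p_pos[of s] aprob_J_nonneg[OF that, of s] by (intro add_pos_nonneg mult_pos_pos mult_nonneg_nonneg) auto
  show "experiment_sequence X Q q p e l \<mu> \<nu> c l_inf K"
    by (rule experiment_sequence_axioms)
  show "0 < sqrt (q 1) / (q 1 * sqrt (aprob (p 0) 0) + q 2 * sqrt (aprob x 0))" if "x \<in> J" for x
    using q[of 1] by (intro divide_pos_pos pos[OF that]) auto
  fix t s :: nat assume t: "t \<in> {1, 2}" and s: "s \<in> {0, 1}"
  show "E.coef k (1 / 2) t s \<omega> = sqrt (q t) / (q 1 * sqrt (aprob (p 0) s) + q 2 * sqrt (aprob (h k \<omega>) s))" for k \<omega>
  proof -
    have g: "0 < aprob (p 0) s" "0 < aprob (h k \<omega>) s" "0 < aprob (E.pscore k t \<omega>) s"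
      using aprob_p_pos E.aprob_pscore_pos[OF l(1)] by auto
    show ?thesis
      using coef_eq_ratio[OF t, of k "1 / 2" s \<omega>] g by (simp add: powr_half_sqrt)
  qed
  have "continuous_on J (\<lambda>x. aprob (if (2::nat) = 1 then p 0 else x) s)"
    by (rule aprob_cont)
  then have "continuous_on J (\<lambda>x. aprob x s)"
    by simp
  then show "continuous_on J (\<lambda>x. sqrt (q t) / (q 1 * sqrt (aprob (p 0) s) + q 2 * sqrt (aprob x s)))"
    using pos by (intro continuous_intros) (auto simp: less_imp_neq[symmetric])
qed

lemma adaptive_weight_limits:
  "(\<forall>s\<in>{0, 1}. converges_weakly P (\<lambda>k \<omega>. sqrt (N k) * (WIPW (1 / 2) (X k) s \<omega> - m k s))
      (limit_law q p e \<mu> \<nu> c l_inf) (\<lambda>z. lim_arm (w_adapt q \<mu> \<nu> (lim_H q p e \<mu> \<nu> c l_inf (fst z))) s z)) \<and>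
    converges_weakly P (\<lambda>k \<omega>. sqrt (N k) * T_stat (1 / 2) (X k) \<omega> - scaled_effect (Q k) (total_size (X k)))
      (limit_law q p e \<mu> \<nu> c l_inf) (\<lambda>z. lim_unnormalized (w_adapt q \<mu> \<nu> (lim_H q p e \<mu> \<nu> c l_inf (fst z))) z) \<and>
    converges_weakly P (\<lambda>k \<omega>. W_stat (1 / 2) (X k) \<omega> - scaled_effect (Q k) (total_size (X k)) / S_hat (1 / 2) (X k) \<omega>)
      (limit_law q p e \<mu> \<nu> c l_inf) (\<lambda>z. lim_normalized (w_adapt q \<mu> \<nu> (lim_H q p e \<mu> \<nu> c l_inf (fst z))) z)"
proof -
  interpret W: weighted_sequence X Q q p e l \<mu> \<nu> c l_inf K "1 / 2" "\<lambda>t s x. sqrt (q t) / (q 1 * sqrt (aprob (p 0) s) + q 2 * sqrt (aprob x s))"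
    by (rule adaptive_weights)
  show ?thesis
  proof (rule W.statistics_converge_weakly)
    fix y :: "real \<times> real" and t s :: nat assume t: "t \<in> {1, 2}" and s: "s \<in> {0, 1}"
    have "(\<Sum>t'\<in>{1, 2}. q t' * sqrt (lim_H q p e \<mu> \<nu> c l_inf y t' s))
        = (\<Sum>t'\<in>{1, 2}. q t' * sqrt (aprob (if t' = 1 then p 0 else H y) s))"
      by (rule sum.cong[OF refl]) (simp only: lim_H_eq_aprob[OF _ s])
    also have "\<dots> = q 1 * sqrt (aprob (p 0) s) + q 2 * sqrt (aprob (H y) s)"
      by simp
    finally show "w_adapt q \<mu> \<nu> (lim_H q p e \<mu> \<nu> c l_inf y) t s = W.lim_w y t s"
      unfolding w_adapt_def W.lim_w_def by (simp only: real_sqrt_mult times_divide_eq_left)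
  qed
qed

end

subsection \<open>The sampling design\<close>

lemma tendsto_ereal_at_bot: "((\<lambda>x::real. ereal x) \<longlongrightarrow> -\<infinity>) at_bot"
  unfolding ereal_tendsto_simps2(3)[of "\<lambda>x. x" at_bot, unfolded comp_def] by (rule filterlim_ident)

lemma lipschitz_design_regular:
  assumes "lipschitz_design e"
  shows "(\<lambda>x. e 0 (ereal x)) \<in> borel_measurable borel" "((\<lambda>x::real. e 0 (ereal x)) \<longlongrightarrow> e 0 (-\<infinity>)) at_bot"
proof -
  obtain L where "L-lipschitz_on UNIV (\<lambda>x. e 0 (ereal x))"
    using assms unfolding lipschitz_design_def by blast
  then show "(\<lambda>x. e 0 (ereal x)) \<in> borel_measurable borel"
    by (intro borel_measurable_continuous_onI lipschitz_on_continuous_on)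
  have "isCont (e 0) (-\<infinity>)"
    using assms unfolding lipschitz_design_def by blast
  then show "((\<lambda>x::real. e 0 (ereal x)) \<longlongrightarrow> e 0 (-\<infinity>)) at_bot"
    using tendsto_ereal_at_bot by (rule isCont_tendsto_compose)
qed

text \<open>Near -\<infinity> the values of \<open>g\<close> fall below the threshold
  \<open>m\<^sub>1\<close>, that is into \<open>C 1\<close>; the sampling function is constant there
  and equal to its value at -\<infinity>. Measurability holds because each step is a Borel set
  pulled back along a continuous map.\<close>

lemma step_design_regular:
  assumes "step_design e"
  shows "(\<lambda>x. e 0 (ereal x)) \<in> borel_measurable borel" "((\<lambda>x::real. e 0 (ereal x)) \<longlongrightarrow> e 0 (-\<infinity>)) at_bot"
proof -
  obtain m\<^sub>1 :: real and K :: nat and g :: "ereal \<Rightarrow> ereal" and a :: "nat \<Rightarrow> nat \<Rightarrow> real" and C :: "nat \<Rightarrow> ereal set"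
    where g: "continuous_on {..<\<infinity>} g" "g (-\<infinity>) = -\<infinity>"
    and C: "disjoint_family_on C {1..K}" "C 1 = {..ereal m\<^sub>1}" "\<forall>k\<in>{2..K}. open (C k)"
    and e: "\<forall>s\<in>{0, 1}. \<forall>x<\<infinity>. e s x = (\<Sum>k\<in>{1..K}. a k s * of_bool (g x \<in> C k))" and K: "1 \<le> K"
    using assms unfolding step_design_def by (elim exE conjE) (rule that; assumption)
  have e0: "e 0 x = (\<Sum>k\<in>{1..K}. a k 0 * of_bool (g x \<in> C k))" if "x < \<infinity>" for x
    using e that by blast
  have "continuous_on UNIV (\<lambda>x::real. g (ereal x))"
    by (rule continuous_on_compose2[OF g(1) continuous_on_ereal[OF continuous_on_id]]) auto
  then have gm: "(\<lambda>x::real. g (ereal x)) \<in> borel_measurable borel"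
    by (rule borel_measurable_continuous_onI)
  have "(\<lambda>x::real. a k 0 * of_bool (g (ereal x) \<in> C k)) \<in> borel_measurable borel" if "k \<in> {1..K}" for k
  proof -
    have "C k \<in> sets borel"
    proof (cases "k = 1")
      case True
      then show ?thesis
        using C(2) by simp
    next
      case False
      then show ?thesis
        using C(3) that by (intro borel_open) auto
    qed
    then have "(\<lambda>x. indicator (C k) (g (ereal x)) :: real) \<in> borel_measurable borel"
      using gm by measurable
    then show ?thesis
      by (simp add: indicator_def of_bool_def)
  qed
  then have "(\<lambda>x::real. \<Sum>k\<in>{1..K}. a k 0 * of_bool (g (ereal x) \<in> C k)) \<in> borel_measurable borel"
    by (rule borel_measurable_sum)
  then show "(\<lambda>x. e 0 (ereal x)) \<in> borel_measurable borel"
    by (simp add: e0)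
  have "((\<lambda>x::real. g (ereal x)) \<longlongrightarrow> g (-\<infinity>)) at_bot"
    by (rule continuous_on_tendsto_compose[OF g(1) tendsto_ereal_at_bot]) auto
  then have "\<forall>\<^sub>F x::real in at_bot. g (ereal x) < ereal m\<^sub>1"
    unfolding g(2) by (rule order_tendstoD) simp
  then have "\<forall>\<^sub>F x::real in at_bot. e 0 (ereal x) = e 0 (-\<infinity>)"
  proof eventually_elim
    case (elim x)
    \<comment> \<open>Disjointness: points of \<open>C 1\<close> lie in no other \<open>C k\<close>,
      so any two of them activate the same steps.\<close>
    have "y \<in> C 1 \<Longrightarrow> z \<in> C 1 \<Longrightarrow> k \<in> {1..K} \<Longrightarrow> y \<in> C k \<longleftrightarrow> z \<in> C k" for y z k
      using disjoint_family_onD[OF C(1), of 1 k] K by (cases "k = 1") auto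
    then have C: "g (ereal x) \<in> C k \<longleftrightarrow> g (-\<infinity>) \<in> C k" if "k \<in> {1..K}" for k
      using that elim g(2) C(2) by auto
    have "e 0 (ereal x) = (\<Sum>k\<in>{1..K}. a k 0 * of_bool (g (ereal x) \<in> C k))"
      by (rule e0) simp
    also have "\<dots> = (\<Sum>k\<in>{1..K}. a k 0 * of_bool (g (-\<infinity>) \<in> C k))"
      by (rule sum.cong[OF refl]) (simp only: C)
    also have "\<dots> = e 0 (-\<infinity>)"
      by (rule e0[symmetric]) simp
    finally show ?case .
  qed
  then show "((\<lambda>x::real. e 0 (ereal x)) \<longlongrightarrow> e 0 (-\<infinity>)) at_bot"
    by (rule tendsto_eventually)
qed

section \<open>From the moment conditions to a sequence of experiments\<close>

text \<open>A real number strictly between 0 and the infimum bounds the sequence from below, and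
  this nonstrict bound passes to the limit; positivity of the terms alone would not.\<close>

lemma limit_pos_of_INF_pos:
  fixes f :: "nat \<Rightarrow> real"
  assumes "0 < (INF k. ereal (f k))" "f \<longlonglongrightarrow> L"
  shows "0 < L"
proof -
  obtain a where a: "0 < ereal a" "ereal a < (INF k. ereal (f k))"
    using ereal_dense2[OF assms(1)] by auto
  have "a \<le> f k" for k
    using less_le_trans[OF a(2) INF_lower[OF UNIV_I, of "\<lambda>k. ereal (f k)" k]] by simp
  then have "a \<le> L"
    by (intro LIMSEQ_le_const[OF assms(2)]) auto
  then show ?thesis
    using a(1) by simp
qed

text \<open>The supremum is taken over square roots, so its finite value bounds the sequence by its
  square.\<close>

lemma bounded_of_SUP_sqrt:
  fixes f :: "nat \<Rightarrow> real"
  assumes "(SUP k. ereal (sqrt (f k))) < \<infinity>" "\<And>k. 0 \<le> f k"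
  obtains B where "\<And>k. f k \<le> B"
proof -
  have le: "ereal (sqrt (f k)) \<le> (SUP k. ereal (sqrt (f k)))" for k
    by (rule SUP_upper) simp
  obtain b where b: "(SUP k. ereal (sqrt (f k))) = ereal b"
    using le[of 0] assms(1) by (cases "SUP k. ereal (sqrt (f k))") auto
  have "f k \<le> b\<^sup>2" for k
    using le[of k] unfolding b by (simp add: sqrt_le_D)
  then show ?thesis
    by (rule that)
qed

lemma (in two_stage_experiment) outcome_law_of_moments:
  assumes "0 < stage_size X 1" "\<And>s. s \<in> {0, 1} \<Longrightarrow> integrable Q (\<lambda>y. arm s y ^ 4)"
    "\<And>s. s \<in> {0, 1} \<Longrightarrow> moment Q s 4 \<le> K" "1 \<le> K"
  shows "outcome_law Q K"
proof -
  have u: "1 \<in> {1..stage_size X 1}"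
    using assms(1) by auto
  have Q: "distr (prob_sp X) borel (\<lambda>\<omega>. (outcome X 1 1 0 \<omega>, outcome X 1 1 1 \<omega>)) = Q"
    using outcomes_law[OF _ u] by simp
  have "(\<lambda>\<omega>. (outcome X 1 1 0 \<omega>, outcome X 1 1 1 \<omega>)) \<in> prob_sp X \<rightarrow>\<^sub>M borel"
    using unconfounded[OF _ u] unfolding cond_indep_var_def by simp
  then have "prob_space Q"
    unfolding Q[symmetric] by (rule prob_space_distr)
  moreover have "sets Q = sets borel"
    unfolding Q[symmetric] by simp
  ultimately show ?thesis
    using assms by (intro outcome_law.intro outcome_law_axioms.intro) auto
qed

theorem theorem1:
  fixes X :: "nat \<Rightarrow> 'a trial"
    and Q :: "nat \<Rightarrow> (real \<times> real) measure"
    and q p :: "nat \<Rightarrow> real"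
    and e :: "nat \<Rightarrow> ereal \<Rightarrow> real"
    and l :: "nat \<Rightarrow> real"
    and \<mu> \<nu> :: "nat \<Rightarrow> real"
    and c :: ereal
  assumes sizes: "strict_mono (\<lambda>k. total_size (X k))" "\<And>k. 0 < total_size (X k)"
    and ratios: "\<And>t. t \<in> {1, 2} \<Longrightarrow> 0 < q t \<and> q t < 1"
      "\<And>k t. t \<in> {1, 2} \<Longrightarrow> real (stage_size (X k) t) = q t * real (total_size (X k))"
    and two_stage: "\<And>k. two_stage_experiment (X k) (Q k) p e (l k)"
    and moments: "moment_conditions (\<lambda>k. total_size (X k)) Q \<mu> \<nu> c"
    and design: "design_conditions p e"
    and ae_continuous:
      "c \<noteq> -\<infinity> \<Longrightarrow> \<forall>s\<in>{0, 1}. AE x in lborel. isCont (\<lambda>x::real. e s (ereal x)) x"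
  shows "(constant_regime l \<longrightarrow>
            (\<forall>s\<in>{0, 1}. converges_weakly (\<lambda>k. prob_sp (X k))
               (\<lambda>k \<omega>. sqrt (real (total_size (X k))) * (WIPW 0 (X k) s \<omega> - moment (Q k) s 1))
               (limit_law q p e \<mu> \<nu> c (lim l)) (\<lambda>z. lim_arm (w_const q \<mu> \<nu> (lim_H q p e \<mu> \<nu> c (lim l) (fst z))) s z)) \<and>
            converges_weakly (\<lambda>k. prob_sp (X k))
               (\<lambda>k \<omega>. sqrt (real (total_size (X k))) * T_stat 0 (X k) \<omega>
                  - scaled_effect (Q k) (total_size (X k)))
               (limit_law q p e \<mu> \<nu> c (lim l)) (\<lambda>z. lim_unnormalized (w_const q \<mu> \<nu> (lim_H q p e \<mu> \<nu> c (lim l) (fst z))) z) \<and>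
            converges_weakly (\<lambda>k. prob_sp (X k))
               (\<lambda>k \<omega>. W_stat 0 (X k) \<omega>
                  - scaled_effect (Q k) (total_size (X k)) / S_hat 0 (X k) \<omega>)
               (limit_law q p e \<mu> \<nu> c (lim l)) (\<lambda>z. lim_normalized (w_const q \<mu> \<nu> (lim_H q p e \<mu> \<nu> c (lim l) (fst z))) z))
       \<and> (adaptive_regime (\<lambda>k. total_size (X k)) l \<longrightarrow>
            (\<forall>s\<in>{0, 1}. converges_weakly (\<lambda>k. prob_sp (X k))
               (\<lambda>k \<omega>. sqrt (real (total_size (X k))) * (WIPW (1/2) (X k) s \<omega> - moment (Q k) s 1))
               (limit_law q p e \<mu> \<nu> c (lim l)) (\<lambda>z. lim_arm (w_adapt q \<mu> \<nu> (lim_H q p e \<mu> \<nu> c (lim l) (fst z))) s z)) \<and>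
            converges_weakly (\<lambda>k. prob_sp (X k))
               (\<lambda>k \<omega>. sqrt (real (total_size (X k))) * T_stat (1/2) (X k) \<omega>
                  - scaled_effect (Q k) (total_size (X k)))
               (limit_law q p e \<mu> \<nu> c (lim l)) (\<lambda>z. lim_unnormalized (w_adapt q \<mu> \<nu> (lim_H q p e \<mu> \<nu> c (lim l) (fst z))) z) \<and>
            converges_weakly (\<lambda>k. prob_sp (X k))
               (\<lambda>k \<omega>. W_stat (1/2) (X k) \<omega>
                  - scaled_effect (Q k) (total_size (X k)) / S_hat (1/2) (X k) \<omega>)
               (limit_law q p e \<mu> \<nu> c (lim l)) (\<lambda>z. lim_normalized (w_adapt q \<mu> \<nu> (lim_H q p e \<mu> \<nu> c (lim l) (fst z))) z))"
proof -
  have p: "0 < p 0" "0 < p 1" "p 0 + p 1 = 1"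
    and e_bounds: "\<And>x. x < \<infinity> \<Longrightarrow> 0 \<le> e 0 x \<and> e 0 x \<le> 1" and e_sum: "\<And>x. x < \<infinity> \<Longrightarrow> e 0 x + e 1 x = 1"
  proof -
    obtain c\<^sub>l c\<^sub>u where c: "0 < c\<^sub>l" "\<forall>s\<in>{0, 1}. c\<^sub>l < p s \<and> p s < c\<^sub>u"
      using design unfolding design_conditions_def by blast
    then show "0 < p 0" "0 < p 1"
      by (auto intro: less_trans)
    show "p 0 + p 1 = 1" "\<And>x. x < \<infinity> \<Longrightarrow> e 0 x + e 1 x = 1"
      using design unfolding design_conditions_def by blast+
    have "\<forall>s\<in>{0, 1}. \<forall>x<\<infinity>. e s x \<in> {0..1}"
      using design unfolding design_conditions_def by blast
    then show "\<And>x. x < \<infinity> \<Longrightarrow> 0 \<le> e 0 x \<and> e 0 x \<le> 1"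
      by simp
  qed
  have e: "(\<lambda>x. e 0 (ereal x)) \<in> borel_measurable borel" "((\<lambda>x::real. e 0 (ereal x)) \<longlongrightarrow> e 0 (-\<infinity>)) at_bot"
    using design lipschitz_design_regular[of e] step_design_regular[of e] unfolding design_conditions_def by blast+
  have mom: "\<And>k. integrable (Q k) (\<lambda>y. arm s y ^ 4)" "0 < (INF k. ereal (moment (Q k) s 2 - (moment (Q k) s 1)\<^sup>2))"
      "(SUP k. ereal (sqrt (moment (Q k) s 4))) < \<infinity>" "(\<lambda>k. moment (Q k) s 1) \<longlonglongrightarrow> \<mu> s" "(\<lambda>k. moment (Q k) s 2) \<longlonglongrightarrow> \<nu> s"
    if "s \<in> {0, 1}" for s
    using moments that unfolding moment_conditions_def by blast+
  have c: "c \<le> 0" "(\<lambda>k. ereal (scaled_effect (Q k) (total_size (X k)))) \<longlonglongrightarrow> c"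
    using moments unfolding moment_conditions_def by blast+
  have lim_var: "(\<mu> s)\<^sup>2 < \<nu> s" if s: "s \<in> {0, 1}" for s
    using limit_pos_of_INF_pos[OF mom(2)[OF s] tendsto_diff[OF mom(5)[OF s] tendsto_power[OF mom(4)[OF s]]]] by simp
  have "0 \<le> moment (Q k) s 4" for k s
    unfolding moment_def by (rule Bochner_Integration.integral_nonneg) simp
  note mom4_nonneg = this
  obtain B\<^sub>0 where B0: "\<And>k. moment (Q k) 0 4 \<le> B\<^sub>0"
    using bounded_of_SUP_sqrt[OF mom(3)[OF insertI1] mom4_nonneg] by blast
  obtain B\<^sub>1 where B1: "\<And>k. moment (Q k) 1 4 \<le> B\<^sub>1"
    using bounded_of_SUP_sqrt[OF mom(3)[OF insertI2[OF singletonI]] mom4_nonneg] by blast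
  \<comment> \<open>One bound for both arms and all sample sizes, raised to at least 1.\<close>
  define K where "K = max 1 (max B\<^sub>0 B\<^sub>1)"
  have mom4: "moment (Q k) s 4 \<le> K" if "s \<in> {0, 1}" for k s
    using that B0[of k] B1[of k] by (auto simp: K_def)
  have stage_pos: "0 < stage_size (X k) t" if t: "t \<in> {1, 2}" for k t
  proof -
    have "0 < real (stage_size (X k) t)"
      unfolding ratios(2)[OF t] using ratios(1)[OF t] sizes(2)[of k] by simp
    then show ?thesis
      by simp
  qed
  have reg: "regular_experiment (X k) (Q k) p e (l k) K" for k
  proof (intro regular_experiment.intro regular_experiment_axioms.intro two_stage stage_pos p e(1) e_sum)
    show "outcome_law (Q k) K"
      by (rule two_stage_experiment.outcome_law_of_moments[OF two_stage stage_pos mom(1) mom4]) (auto simp: K_def)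
  qed
  have total: "filterlim (\<lambda>k. real (total_size (X k))) at_top sequentially"
    using filterlim_compose[OF filterlim_real_sequentially filterlim_subseq[OF sizes(1)]] .
  \<comment> \<open>Stated for an arbitrary \<open>l_inf\<close>, so that each regime has only to
    supply the limit of its clipping rate and the rate condition.\<close>
  have seq: "experiment_sequence X Q q p e l \<mu> \<nu> c l_inf K"
    if "\<And>k. 0 < l k" "\<And>k. l_inf \<le> l k" "0 \<le> l_inf" "l_inf < 1 / 2" "l \<longlonglongrightarrow> l_inf"
      "filterlim (\<lambda>k. real (total_size (X k)) * l k) at_top sequentially" for l_inf
    using that ae_continuous e_bounds
    by (intro experiment_sequence.intro reg total ratios mom c lim_var e(2)) blast+
  show ?thesis
  proof ((rule conjI; rule impI), goal_cases)
    case 1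
    then obtain l' where l': "0 < l'" "l' < 1 / 2" "\<And>k. l k = l'"
      unfolding constant_regime_def by blast
    have l: "l = (\<lambda>_. l')"
      by (rule ext) (rule l'(3))
    have lim: "l \<longlonglongrightarrow> l'"
      unfolding l by (rule tendsto_const)
    \<comment> \<open>With a constant positive rate the condition is growth of the sample
      size.\<close>
    have "filterlim (\<lambda>k. real (total_size (X k)) * l k) at_top sequentially"
      unfolding l'(3) mult.commute[of _ l'] by (rule filterlim_tendsto_pos_mult_at_top[OF tendsto_const l'(1) total])
    then have "experiment_sequence X Q q p e l \<mu> \<nu> c l' K"
      using l' lim by (intro seq) auto
    from experiment_sequence.constant_weight_limits[OF this l'(1)] show ?case
      unfolding limI[OF lim] .
  next
    case 2
    then have l': "\<And>k. 0 < l k" "l \<longlonglongrightarrow> 0" "filterlim (\<lambda>k. real (total_size (X k)) * l k) at_top sequentially"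
      unfolding adaptive_regime_def by blast+
    have "experiment_sequence X Q q p e l \<mu> \<nu> c 0 K"
      using l' by (intro seq) (auto intro: less_imp_le)
    from experiment_sequence.adaptive_weight_limits[OF this] show ?case
      unfolding limI[OF l'(2)] .
  qed
qed

end
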